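(* Let $\Sigma^+$ be a topologically transitive one-sided countable Markov shift with finite Gurevich entropy, and let $\phi$ be a $\theta$-weakly H\"older continuous potential with $\sup\phi<\infty$. The following are equivalent: (1) $\phi$ is strongly positively recurrent; (2) $\phi$ satisfies the EKP inequality for all $\psi\in\mathcal H_\beta$ with $e^{-\beta}\le\theta$, i.e. $\phi$ has an equilibrium measure $\mu_\phi$ and for every $\beta>0$ with $e^{-\beta}\le\theta$ there is a constant $C$ such that for every $\psi\in\mathcal H_\beta$ and every $\mu\in\mathscr M(\Sigma^+)$, $|\int\psi d\mu-\int\psi d\mu_\phi|\le C\|\psi\|_\beta\sqrt{P_{\mu_\phi}(\phi)-P_\mu(\phi)}$; (3) $P_\infty(\phi)<P_G(\phi)$.
   Context: One-sided TMS: $\mathscr G$ countable directed graph with vertices $S$, $\Sigma^+=\{(x_0,x_1,\dots)\in S^{\mathbb N\cup\{0\}}:x_i\to x_{i+1}\}$, left shift $\sigma$, metric $d(\underline x,\underline y)=e^{-t(\underline x,\underline y)}$, $t=\min\{i:x_i\ne y_i\}$; cylinders $[a_0,\dots,a_{n-1}]$. Transitive = strongly connected graph; period $p$ = gcd of loop lengths; mixing = period 1; for period $p$, $\Sigma^+=\biguplus_{i<p}\Sigma_i^+$ (classes of states connected by paths of length divisible by $p$) with $\sigma^p|_{\Sigma_0^+}$ mixing. $\mathrm{osc}_n(\phi)=\sup\{|\phi(\underline x)-\phi(\underline y)|:x_i=y_i,i<n\}$; $\theta$-weakly H\"older: $\mathrm{osc}_n\le A\theta^n$, $n\ge2$. $\phi_n=\sum_{k<n}\phi\circ\sigma^k$.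 Mixing: $Z_n(\phi,a)=\sum_{\sigma^n\underline x=\underline x}e^{\phi_n(\underline x)}1_{[a]}(\underline x)$, $P_G(\phi)=\lim\frac1n\log Z_n(\phi,a)$; period $p$: $P_G(\phi)=\frac1pP_G(\phi_p|_{\Sigma^+_0})$ for $\sigma^p$; Gurevich entropy $P_G(0)$. $\mathscr M(\Sigma^+)$: invariant Borel probabilities; $P_\mu(\phi)=h_\mu(\sigma)+\int\phi d\mu$; equilibrium measure maximizes it. SPR (mixing, summable variations, finite pressure): with $\tau_a$ the first return time to $[a]$ and $Z_n^\ast(\phi,a)=\sum_{\sigma^n\underline x=\underline x}e^{\phi_n(\underline x)}1_{[\tau_a=n]}(\underline x)$, $\phi$ is SPR iff $\limsup\frac1n\log Z^\ast_n(\phi,a)<P_G(\phi)$ for some (every) $a$ (equivalent to the paper's discriminant definition); period $p$: iff $\phi_p|_{\Sigma_0^+}$ is SPR for $\sigma^p$. $\mathcal H_\beta$: functions with $\|\psi\|_\beta=\|\psi\|_\infty+\sup_{\underline x\neq\underline y}|\psi(\underline x)-\psi(\underline y)|e^{\beta t(\underline x,\underline y)}<\infty$. Pressure at infinity: $P_\infty(\phi)=\sup\{\limsup_n P_{\mu_n}(\phi)\}$, the supremum over all sequences $\mu_n\in\mathscr M(\Sigma^+)$ (with $P_{\mu_n}(\phi)$ well defined) such that $\mu_n[\underline a]\to0$ for every cylinder $[\underline a]$. *)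

theory Defs
  imports "HOL-Probability.Probability"
begin

text \<open>Vertices are natural numbers in a set S (so the graph is countable); E is the edge relation.
  Edges are only taken between vertices of S.\<close>

definition Edge :: "nat set \<Rightarrow> (nat \<Rightarrow> nat \<Rightarrow> bool) \<Rightarrow> nat \<Rightarrow> nat \<Rightarrow> bool" where
  "Edge S E u v \<longleftrightarrow> u \<in> S \<and> v \<in> S \<and> E u v"

definition Sigma_plus :: "nat set \<Rightarrow> (nat \<Rightarrow> nat \<Rightarrow> bool) \<Rightarrow> (nat \<Rightarrow> nat) set" where
  "Sigma_plus S E = {x. \<forall>i. x i \<in> S \<and> E (x i) (x (Suc i))}"

definition shift :: "(nat \<Rightarrow> nat) \<Rightarrow> (nat \<Rightarrow> nat)" where
  "shift x = (\<lambda>i. x (Suc i))"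

definition top_transitive :: "nat set \<Rightarrow> (nat \<Rightarrow> nat \<Rightarrow> bool) \<Rightarrow> bool" where
  "top_transitive S E \<longleftrightarrow> (\<forall>u\<in>S. \<forall>v\<in>S. \<exists>n>0. (Edge S E ^^ n) u v)"

definition period :: "nat set \<Rightarrow> (nat \<Rightarrow> nat \<Rightarrow> bool) \<Rightarrow> nat" where
  "period S E = Gcd {n. n > 0 \<and> (\<exists>v\<in>S. (Edge S E ^^ n) v v)}"

definition class0 :: "nat set \<Rightarrow> (nat \<Rightarrow> nat \<Rightarrow> bool) \<Rightarrow> nat \<Rightarrow> nat set" where
  "class0 S E a = {v \<in> S. \<exists>n. period S E dvd n \<and> (Edge S E ^^ n) a v}"

definition Sigma0 :: "nat set \<Rightarrow> (nat \<Rightarrow> nat \<Rightarrow> bool) \<Rightarrow> nat \<Rightarrow> (nat \<Rightarrow> nat) set" where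
  "Sigma0 S E a = {x \<in> Sigma_plus S E. x 0 \<in> class0 S E a}"

definition cyl :: "nat set \<Rightarrow> (nat \<Rightarrow> nat \<Rightarrow> bool) \<Rightarrow> nat list \<Rightarrow> (nat \<Rightarrow> nat) set" where
  "cyl S E w = {x \<in> Sigma_plus S E. \<forall>i < length w. x i = w ! i}"

definition tsep :: "(nat \<Rightarrow> nat) \<Rightarrow> (nat \<Rightarrow> nat) \<Rightarrow> nat" where
  "tsep x y = (LEAST i. x i \<noteq> y i)"

definition sdist :: "(nat \<Rightarrow> nat) \<Rightarrow> (nat \<Rightarrow> nat) \<Rightarrow> real" where
  "sdist x y = (if x = y then 0 else exp (- real (tsep x y)))"

definition Sigma_open :: "nat set \<Rightarrow> (nat \<Rightarrow> nat \<Rightarrow> bool) \<Rightarrow> (nat \<Rightarrow> nat) set \<Rightarrow> bool" where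
  "Sigma_open S E U \<longleftrightarrow> U \<subseteq> Sigma_plus S E \<and>
     (\<forall>x\<in>U. \<exists>r>0. \<forall>y\<in>Sigma_plus S E. sdist x y < r \<longrightarrow> y \<in> U)"

definition borel_Sigma :: "nat set \<Rightarrow> (nat \<Rightarrow> nat \<Rightarrow> bool) \<Rightarrow> (nat \<Rightarrow> nat) measure" where
  "borel_Sigma S E = sigma (Sigma_plus S E) (Collect (Sigma_open S E))"

definition inv_measures :: "nat set \<Rightarrow> (nat \<Rightarrow> nat \<Rightarrow> bool) \<Rightarrow> (nat \<Rightarrow> nat) measure set" where
  "inv_measures S E = {\<mu>. sets \<mu> = sets (borel_Sigma S E) \<and> prob_space \<mu> \<and>
      shift \<in> measurable \<mu> \<mu> \<and> distr \<mu> \<mu> shift = \<mu>}"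

definition fin_partition :: "'a measure \<Rightarrow> 'a set set \<Rightarrow> bool" where
  "fin_partition \<mu> P \<longleftrightarrow> finite P \<and> P \<subseteq> sets \<mu> \<and> disjoint P \<and> \<Union>P = space \<mu>"

definition join_part :: "(nat \<Rightarrow> nat) measure \<Rightarrow> (nat \<Rightarrow> nat) set set \<Rightarrow> nat \<Rightarrow> (nat \<Rightarrow> nat) set set" where
  "join_part \<mu> P n = {space \<mu> \<inter> (\<Inter>k<n. (shift ^^ k) -` A k) | A. \<forall>k<n. A k \<in> P}"

definition part_entropy :: "'a measure \<Rightarrow> 'a set set \<Rightarrow> real" where
  "part_entropy \<mu> Q = - (\<Sum>B\<in>Q. measure \<mu> B * ln (measure \<mu> B))"

definition ent_rel :: "(nat \<Rightarrow> nat) measure \<Rightarrow> (nat \<Rightarrow> nat) set set \<Rightarrow> real" where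
  "ent_rel \<mu> P = lim (\<lambda>n. part_entropy \<mu> (join_part \<mu> P (Suc n)) / real (Suc n))"

definition ks_entropy :: "(nat \<Rightarrow> nat) measure \<Rightarrow> ereal" where
  "ks_entropy \<mu> = (SUP P \<in> {P. fin_partition \<mu> P}. ereal (ent_rel \<mu> P))"

definition int_plus :: "'a measure \<Rightarrow> ('a \<Rightarrow> real) \<Rightarrow> ennreal" where
  "int_plus \<mu> f = (\<integral>\<^sup>+ x. ennreal (f x) \<partial>\<mu>)"

definition int_minus :: "'a measure \<Rightarrow> ('a \<Rightarrow> real) \<Rightarrow> ennreal" where
  "int_minus \<mu> f = (\<integral>\<^sup>+ x. ennreal (- f x) \<partial>\<mu>)"

definition int_ereal :: "'a measure \<Rightarrow> ('a \<Rightarrow> real) \<Rightarrow> ereal" where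
  "int_ereal \<mu> f = enn2ereal (int_plus \<mu> f) - enn2ereal (int_minus \<mu> f)"

definition pressure_defined :: "(nat \<Rightarrow> nat) measure \<Rightarrow> ((nat \<Rightarrow> nat) \<Rightarrow> real) \<Rightarrow> bool" where
  "pressure_defined \<mu> f \<longleftrightarrow> \<not> (int_plus \<mu> f = \<top> \<and> int_minus \<mu> f = \<top>) \<and>
     \<not> (ks_entropy \<mu> = \<infinity> \<and> int_ereal \<mu> f = - \<infinity>)"

definition mpress :: "(nat \<Rightarrow> nat) measure \<Rightarrow> ((nat \<Rightarrow> nat) \<Rightarrow> real) \<Rightarrow> ereal" where
  "mpress \<mu> f = ks_entropy \<mu> + int_ereal \<mu> f"

definition equilibrium :: "nat set \<Rightarrow> (nat \<Rightarrow> nat \<Rightarrow> bool) \<Rightarrow> ((nat \<Rightarrow> nat) \<Rightarrow> real) \<Rightarrow> (nat \<Rightarrow> nat) measure \<Rightarrow> bool" where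
  "equilibrium S E f \<mu> \<longleftrightarrow> \<mu> \<in> inv_measures S E \<and> pressure_defined \<mu> f \<and> \<bar>mpress \<mu> f\<bar> \<noteq> \<infinity> \<and>
     (\<forall>\<nu>\<in>inv_measures S E. pressure_defined \<nu> f \<longrightarrow> mpress \<nu> f \<le> mpress \<mu> f)"

definition birk :: "('x \<Rightarrow> 'x) \<Rightarrow> ('x \<Rightarrow> real) \<Rightarrow> nat \<Rightarrow> 'x \<Rightarrow> real" where
  "birk T f n x = (\<Sum>k<n. f ((T ^^ k) x))"

definition ln_enn :: "ennreal \<Rightarrow> ereal" where
  "ln_enn z = (if z = \<top> then \<infinity> else if z = 0 then - \<infinity> else ereal (ln (enn2real z)))"

text \<open>Partition function Z_n(f,C) of a map T on a set X, C playing the role of the cylinder [a].\<close>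
definition Zgen :: "('x \<Rightarrow> 'x) \<Rightarrow> 'x set \<Rightarrow> ('x \<Rightarrow> real) \<Rightarrow> 'x set \<Rightarrow> nat \<Rightarrow> ennreal" where
  "Zgen T X f C n = (\<integral>\<^sup>+ x. ennreal (exp (birk T f n x)) \<partial>count_space {x \<in> X. (T ^^ n) x = x \<and> x \<in> C})"

definition first_ret :: "('x \<Rightarrow> 'x) \<Rightarrow> 'x set \<Rightarrow> 'x \<Rightarrow> nat" where
  "first_ret T C x = (LEAST k. k > 0 \<and> (T ^^ k) x \<in> C)"

definition Zstar :: "('x \<Rightarrow> 'x) \<Rightarrow> 'x set \<Rightarrow> ('x \<Rightarrow> real) \<Rightarrow> 'x set \<Rightarrow> nat \<Rightarrow> ennreal" where
  "Zstar T X f C n = (\<integral>\<^sup>+ x. ennreal (exp (birk T f n x))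
      \<partial>count_space {x \<in> X. (T ^^ n) x = x \<and> x \<in> C \<and> first_ret T C x = n})"

definition Pmix :: "('x \<Rightarrow> 'x) \<Rightarrow> 'x set \<Rightarrow> ('x \<Rightarrow> real) \<Rightarrow> 'x set \<Rightarrow> ereal" where
  "Pmix T X f C = lim (\<lambda>n. ereal (1 / real (Suc n)) * ln_enn (Zgen T X f C (Suc n)))"

definition gur_pressure :: "nat set \<Rightarrow> (nat \<Rightarrow> nat \<Rightarrow> bool) \<Rightarrow> ((nat \<Rightarrow> nat) \<Rightarrow> real) \<Rightarrow> ereal" where
  "gur_pressure S E f = (let a = (SOME a. a \<in> S); p = period S E in
     ereal (1 / real p) * Pmix (shift ^^ p) (Sigma0 S E a) (birk shift f p) (cyl S E [a]))"

definition SPR :: "nat set \<Rightarrow> (nat \<Rightarrow> nat \<Rightarrow> bool) \<Rightarrow> ((nat \<Rightarrow> nat) \<Rightarrow> real) \<Rightarrow> bool" where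
  "SPR S E f \<longleftrightarrow> (let p = period S E in \<exists>a\<in>S.
     limsup (\<lambda>m. ereal (1 / real (Suc m)) *
        ln_enn (Zstar (shift ^^ p) (Sigma0 S E a) (birk shift f p) (cyl S E [a]) (Suc m)))
     < Pmix (shift ^^ p) (Sigma0 S E a) (birk shift f p) (cyl S E [a]))"

definition weakly_holder :: "nat set \<Rightarrow> (nat \<Rightarrow> nat \<Rightarrow> bool) \<Rightarrow> real \<Rightarrow> ((nat \<Rightarrow> nat) \<Rightarrow> real) \<Rightarrow> bool" where
  "weakly_holder S E \<theta> f \<longleftrightarrow> (\<exists>A. \<forall>n\<ge>2. \<forall>x\<in>Sigma_plus S E. \<forall>y\<in>Sigma_plus S E.
      (\<forall>i<n. x i = y i) \<longrightarrow> \<bar>f x - f y\<bar> \<le> A * \<theta> ^ n)"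

definition hnorm :: "nat set \<Rightarrow> (nat \<Rightarrow> nat \<Rightarrow> bool) \<Rightarrow> real \<Rightarrow> ((nat \<Rightarrow> nat) \<Rightarrow> real) \<Rightarrow> ereal" where
  "hnorm S E \<beta> \<psi> = Sup (insert 0 ((\<lambda>x. ereal \<bar>\<psi> x\<bar>) ` Sigma_plus S E)) +
     Sup (insert 0 {ereal (\<bar>\<psi> x - \<psi> y\<bar> * exp (\<beta> * real (tsep x y))) | x y.
        x \<in> Sigma_plus S E \<and> y \<in> Sigma_plus S E \<and> x \<noteq> y})"

definition H_beta :: "nat set \<Rightarrow> (nat \<Rightarrow> nat \<Rightarrow> bool) \<Rightarrow> real \<Rightarrow> ((nat \<Rightarrow> nat) \<Rightarrow> real) set" where
  "H_beta S E \<beta> = {\<psi>. hnorm S E \<beta> \<psi> < \<infinity>}"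

definition EKP :: "nat set \<Rightarrow> (nat \<Rightarrow> nat \<Rightarrow> bool) \<Rightarrow> real \<Rightarrow> ((nat \<Rightarrow> nat) \<Rightarrow> real) \<Rightarrow> bool" where
  "EKP S E \<theta> f \<longleftrightarrow> (\<exists>\<mu>f. equilibrium S E f \<mu>f \<and>
     (\<forall>\<beta>>0. exp (- \<beta>) \<le> \<theta> \<longrightarrow> (\<exists>C::real. \<forall>\<psi>\<in>H_beta S E \<beta>. \<forall>\<mu>\<in>inv_measures S E.
        pressure_defined \<mu> f \<longrightarrow> mpress \<mu> f \<noteq> - \<infinity> \<longrightarrow>
        \<bar>(\<integral>x. \<psi> x \<partial>\<mu>) - (\<integral>x. \<psi> x \<partial>\<mu>f)\<bar>
          \<le> C * real_of_ereal (hnorm S E \<beta> \<psi>) *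
             sqrt (real_of_ereal (mpress \<mu>f f) - real_of_ereal (mpress \<mu> f)))))"

definition P_inf :: "nat set \<Rightarrow> (nat \<Rightarrow> nat \<Rightarrow> bool) \<Rightarrow> ((nat \<Rightarrow> nat) \<Rightarrow> real) \<Rightarrow> ereal" where
  "P_inf S E f = (SUP \<mu>s \<in> {\<mu>s. (\<forall>n. \<mu>s n \<in> inv_measures S E \<and> pressure_defined (\<mu>s n) f) \<and>
        (\<forall>w. length w \<ge> 1 \<longrightarrow> (\<lambda>n. measure (\<mu>s n) (cyl S E w)) \<longlonglongrightarrow> 0)}.
     limsup (\<lambda>n. mpress (\<mu>s n) f))"

end

theory Submission
 imports Defs
begin

text \<open>Fix a state \<open>a\<close>. Weighting a word \<open>w\<close> of length \<open>n\<close> by \<open>exp (f\<^sub>n - q * n)\<close>, the Gurevich pressure is the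
  critical exponent \<open>q\<close> of the series over all concatenations of first-return words at \<open>a\<close>, and strong positive
  recurrence says that the series over the first-return words alone converges at some exponent strictly below it.

  (1) implies (2): periodic-orbit averages over a system of return words have a limit, as \<open>q\<close> decreases to the critical
  exponent, whose entropy is bounded below by coding with finitely many return words; since \<open>h + \<integral>f\<close> never exceeds the
  Gurevich pressure, the limit is an equilibrium measure. The return kernel contracts a Hoelder-type distance, by
  coupling, and a second-order expansion gives \<open>P(f + \<psi>) + P(f - \<psi>) \<le> 2 P(f) + C \<parallel>\<psi>\<parallel>\<^sup>2\<close>. Bounding the pressure of
  \<open>\<mu>\<close> by \<open>P(f + t\<psi>)\<close> and that of the equilibrium measure by \<open>P(f - t\<psi>)\<close> and optimising in \<open>t\<close> gives the inequality.

  (2) implies (3): test with the indicator of a cylinder charged by the equilibrium measure.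

  (3) implies (1): if \<open>f\<close> is not strongly positively recurrent, then for every finite set \<open>F\<close> of states the series over
  excursions outside \<open>F\<close> between some two states of \<open>F\<close> diverges below the pressure, for otherwise the states of \<open>F\<close>
  could be removed one at a time until a single convergent return series remains. The loop system built from finitely
  many excursions of one large length \<open>n\<close> carries an invariant measure of pressure close to \<open>P(f)\<close> that gives \<open>F\<close> mass
  \<open>O(1/n)\<close>.\<close>

section \<open>Sums over countable sets and paths\<close>

text \<open>Three obstacles shape the proof. The potential may be unbounded below, and only
  oscillations of order at least 2 are controlled; weights of words are therefore compared at a
  reference tail \<open>pt s\<close>, at the price of a factor \<open>exp kap\<close>. No
  eigenfunction of the return operator L is used: above the critical exponent \<open>h = Hs\<close>
  satisfies L h = h - 1, and inequalities L h <= h already bound growth rates. Perturbation theory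
  is done at exponent \<open>P + s\<close>, with constants independent of \<open>s\<close>. Entropy
  is defined by finite Borel partitions while the alphabet is infinite: the upper bound merges the
  states from \<open>k\<close> on, the lower bound codes finitely many return words, and both errors
  vanish in the limit. One construction of measures, the locale \<open>gibbs\<close>, serves twice:
  with all first-return words for the equilibrium measure, with finitely many long ones for the
  escape of pressure. Its hypothesis that the loop series diverges at the critical exponent is
  automatic under an exponential tail, since convergence there would persist strictly below
  (\<open>Hs_finite_imp_below\<close>).\<close>

definition nsum :: "'a set => ('a => ennreal) => ennreal" where
 "nsum A g = (\<integral>\<^sup>+x. g x \<partial>count_space A)"

lemma nsum_mono: "(!!x. x \<in> A ==> g x <= h x) ==> nsum A g <= nsum A h"
 unfolding nsum_def by (rule nn_integral_mono) simp

lemma nsum_cong: "A = B ==> (!!x. x \<in> B ==> g x = h x) ==> nsum A g = nsum B h"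
 unfolding nsum_def by (auto intro!: nn_integral_cong)

lemma nsum_indicator: "nsum A g = nsum UNIV (%x. g x * indicator A x)"
 unfolding nsum_def by (rule nn_integral_count_space_indicator) simp

abbreviation "rsum A g == nsum A (%x. ennreal (g x))"

lemma nsum_subset: "A <= B ==> nsum A g <= nsum B g"
 unfolding nsum_indicator[of A] nsum_indicator[of B]
 by (rule nsum_mono) (auto simp: indicator_def)

lemma nsum_cmult: "nsum A (%x. c * g x) = c * nsum A g"
 unfolding nsum_def by (rule nn_integral_cmult) simp

lemma nsum_multc: "nsum A (%x. g x * c) = nsum A g * c"
 unfolding nsum_def by (rule nn_integral_multc) simp

lemma nsum_add: "nsum A (%x. g x+h x) = nsum A g+nsum A h"
 unfolding nsum_def by (rule nn_integral_add) simp_all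

lemma nsum_reindex: "inj_on k A ==> nsum (k ` A) g = nsum A (%x. g (k x))"
 unfolding nsum_def by (rule nn_integral_bij_count_space[symmetric]) (simp add: bij_betw_def)

lemma nsum_reindex_bij: "bij_betw k A B ==> nsum B g = nsum A (%x. g (k x))"
 unfolding nsum_def by (rule nn_integral_bij_count_space[symmetric])

lemma nsum_finite: "finite A ==> nsum A g = sum g A"
 unfolding nsum_def by (rule nn_integral_count_space_finite)

lemma nsum_empty [simp]: "nsum {} g = 0"
 by (simp add: nsum_finite)

lemma nsum_sum_le: "finite F ==> F <= A ==> sum g F <= nsum A g"
 using nsum_subset[of F A g] by (simp add: nsum_finite)

lemma nsum_member: "x \<in> A ==> g x <= nsum A g"
 using nsum_sum_le[of "{x}" A g] by simp

lemma nsum_image_le: "nsum (k ` A) g <= nsum A (%x. g (k x))"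
proof -
 obtain C where C: "C <= A" "inj_on k C" "k ` A = k ` C"
  using subset_image_inj[of "k ` A" k A] by auto
 show ?thesis unfolding C(3) nsum_reindex[OF C(2)] by (rule nsum_subset[OF C(1)])
qed

lemma nsum_Un_disj: "A Int B = {} ==> nsum (A Un B) g = nsum A g+nsum B g"
proof -
 assume *: "A Int B = {}"
 have "nsum (A Un B) g = nsum UNIV (%x. g x * indicator A x+g x * indicator B x)"
  unfolding nsum_indicator[of "A Un B"]
  by (rule nsum_cong) (use * in "auto simp: indicator_def")
 then show ?thesis
  by (simp add: nsum_add nsum_indicator[of A] nsum_indicator[of B])
qed

lemma nsum_Un_le: "nsum (A Un B) g <= nsum A g+nsum B g"
proof -
 have "nsum (A Un B) g = nsum A g+nsum (B - A) g"
  using nsum_Un_disj[of A "B - A" g] by (simp add: Un_Diff_cancel)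
 also have "... <= nsum A g+nsum B g"
  by (intro add_left_mono nsum_subset) auto
 finally show ?thesis .
qed

lemma nsum_Sigma: "nsum (Sigma A B) g = nsum A (%x. nsum (B x) (%y. g (x, y)))"
proof -
 have "nsum (Sigma A B) g = nsum UNIV (%(x,y). g (x,y) * indicator (Sigma A B) (x,y))"
  unfolding nsum_indicator[of "Sigma A B"] by (rule nsum_cong) auto
 also have "... = nsum UNIV (%x. nsum UNIV (%y. g (x,y) * indicator (Sigma A B) (x,y)))"
  unfolding nsum_def by (simp add: nn_integral_fst_count_space[symmetric])
 also have "... = nsum UNIV (%x. nsum (B x) (%y. g (x, y)) * indicator A x)"
  unfolding nsum_indicator[of "B _"] nsum_multc[symmetric]
  by (intro nsum_cong) (auto simp: indicator_def)
 finally show ?thesis by (simp add: nsum_indicator[of A])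
qed

lemma nsum_Times: "nsum (A \<times> B) g = nsum A (%x. nsum B (%y. g (x, y)))"
 by (rule nsum_Sigma)

lemma nsum_swap: "nsum A (%x. nsum B (%y. g x y)) = nsum B (%y. nsum A (%x. g x y))"
proof -
 have "nsum A (%x. nsum B (%y. g x y)) = nsum (A \<times> B) (%(x,y). g x y)"
  by (simp add: nsum_Times)
 also have "... = nsum (B \<times> A) (%(y,x). g x y)"
  by (subst nsum_reindex_bij[of "%(x,y). (y,x)" "B \<times> A" "A \<times> B"])
   (auto intro!: bij_betwI[where g="%(x,y). (y,x)"] nsum_cong)
 finally show ?thesis by (simp add: nsum_Times)
qed

lemma nsum_levels: "nsum A g = nsum UNIV (%n::nat. nsum {x\<in>A. len x = n} g)"
proof -
 have "bij_betw snd (SIGMA n:UNIV. {x\<in>A. len x = n}) A"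
  by (intro bij_betwI[where g="%x. (len x, x)"]) auto
 from nsum_reindex_bij[OF this, of g] show ?thesis by (simp add: nsum_Sigma)
qed

lemma nsum_nat: "nsum UNIV g = (\<Sum>n::nat. g n)"
 unfolding nsum_def by (rule nn_integral_count_space_nat)

text \<open>The index type is countable, so the sum is a series along the enumeration and some
  partial sum already exceeds \<open>c\<close>.\<close>

lemma nsum_approx:
 fixes g :: "'a::countable => ennreal"
 assumes "c < nsum A g" obtains F where "finite F" "F <= A" "c < sum g F"
proof -
 let ?h = "%n. g (from_nat n) * indicator (to_nat ` A) n"
 have "nsum A g = nsum (to_nat ` A) (%n. g (from_nat n))"
  by (subst nsum_reindex) auto
 also have "... = (\<Sum>n. ?h n)"
  by (subst nsum_indicator) (rule nsum_nat)
 also have "... = (SUP n. \<Sum>i<n. ?h i)" by (rule suminf_eq_SUP)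
 finally obtain n where n: "c < (\<Sum>i<n. ?h i)" using assms by (auto simp: less_SUP_iff)
 let ?F = "from_nat ` ({..<n} Int to_nat ` A) :: 'a set"
 have "(\<Sum>i<n. ?h i) = (SUM i:{..<n} Int to_nat ` A. g (from_nat i))"
  unfolding sum.inter_restrict[OF finite_lessThan] by (intro sum.cong) (auto simp: indicator_def)
 also have "... = sum g ?F"
  by (subst sum.reindex) (auto simp: inj_on_def)
 finally show thesis using n by (intro that[of ?F]) auto
qed

section \<open>Words, concatenation and paths\<close>

definition cat :: "nat list => (nat => nat) => nat => nat" where
 "cat w x i = (if i < length w then w ! i else x (i - length w))"

lemma cat_Nil [simp]: "cat [] x = x"
 by (rule ext) (simp add: cat_def)

lemma cat_append: "cat (u@v) x = cat u (cat v x)"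
 by (rule ext) (auto simp: cat_def nth_append)

lemma shift_pow: "(shift^^n) x = (%i. x (i+n))"
 by (induction n arbitrary: x) (auto simp: shift_def)

lemma shift_cat [simp]: "(shift^^length w) (cat w x) = x"
 by (rule ext) (simp add: shift_pow cat_def)

lemma cat_prefix: "map x [0..<n] = w ==> cat w ((shift^^n) x) = x"
 by (rule ext) (auto simp: cat_def shift_pow)

lemma cat_map_prefix [simp]: "cat (map x [0..<n]) ((shift^^n) x) = x"
 by (rule cat_prefix) simp

lemma birk_0 [simp]: "birk T f 0 x = 0"
 by (simp add: birk_def)

lemma birk_plus: "birk T f (m+n) x = birk T f m x+birk T f n ((T^^m) x)"
proof -
 have "(\<Sum>k<m+n. f ((T^^k) x)) = (\<Sum>k<m. f ((T^^k) x))+(\<Sum>k<n. f ((T^^(k+m)) x))"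
  by (induction n) (auto simp: add.commute add.left_commute)
 then show ?thesis by (simp add: birk_def funpow_add)
qed

lemma birk_add_fun: "birk T (%x. f x+g x) n x = birk T f n x+birk T g n x"
 by (simp add: birk_def sum.distrib)

lemma birk_const [simp]: "birk T (%x. q) n x = q * real n"
 by (simp add: birk_def)

text \<open>The potential sees the whole future, so the weight of a word depends on its continuation
  \<open>x\<close>; multiplicativity therefore takes the cocycle form of
  \<open>wt_append\<close>.\<close>

definition wt :: "((nat => nat) => real) => nat list => (nat => nat) => real" where
 "wt f w x = exp (birk shift f (length w) (cat w x))"

lemma wt_pos [simp]: "0 < wt f w x" by (simp add: wt_def)
lemma wt_nonneg [simp]: "0 <= wt f w x" by (simp add: wt_def)
lemma wt_Nil [simp]: "wt f [] x = 1" by (simp add: wt_def)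

lemma wt_append: "wt f (u@v) x = wt f u (cat v x) * wt f v x"
 by (simp add: wt_def cat_append birk_plus exp_add)

lemma Sigma_plus_shift: "x \<in> Sigma_plus S E ==> (shift^^n) x \<in> Sigma_plus S E"
 by (auto simp: Sigma_plus_def shift_pow)

lemma shift_in [simp]: "x \<in> Sigma_plus S E ==> shift x \<in> Sigma_plus S E"
 using Sigma_plus_shift[of x S E 1] by simp

lemma cyl1_iff: "x \<in> cyl S E [s] \<longleftrightarrow> x \<in> Sigma_plus S E & x 0 = s"
 by (auto simp: cyl_def)

lemma cyl_subset: "cyl S E w <= Sigma_plus S E"
 by (auto simp: cyl_def)

text \<open>A path word omits its final vertex \<open>t\<close>, so that paths compose by concatenation.\<close>

definition Pth :: "nat set => (nat => nat => bool) => nat => nat => nat list set" where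
 "Pth S E s t = {w. ALL y:cyl S E [t]. cat w y \<in> cyl S E [s]}"

lemma PthD: "w \<in> Pth S E s t ==> y \<in> cyl S E [t] ==> cat w y \<in> cyl S E [s]"
 by (auto simp: Pth_def)

lemma Pth_Nil: "[] \<in> Pth S E s s"
 by (auto simp: Pth_def)

lemma Pth_append: "u \<in> Pth S E s r ==> v \<in> Pth S E r t ==> u@v \<in> Pth S E s t"
 by (auto simp: Pth_def cat_append)

lemma Pth_sub:
 assumes "x \<in> Sigma_plus S E" "i <= n"
 shows "map x [i..<n] \<in> Pth S E (x i) (x n)"
 unfolding Pth_def
proof (intro CollectI ballI)
 fix y assume y: "y \<in> cyl S E [x n]"
 have len: "length (map x [i..<n]) = n - i" by simp
 show "cat (map x [i..<n]) y \<in> cyl S E [x i]"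
  unfolding cyl1_iff
 proof
  show "cat (map x [i..<n]) y 0 = x i"
   using assms y by (auto simp: cat_def cyl1_iff)
  show "cat (map x [i..<n]) y \<in> Sigma_plus S E"
   unfolding Sigma_plus_def
  proof (intro CollectI allI)
   fix j
   consider "Suc j < n - i" | "Suc j = n - i" | "j >= n - i" by linarith
   then show "cat (map x [i..<n]) y j \<in> S & E (cat (map x [i..<n]) y j) (cat (map x [i..<n]) y (Suc j))"
   proof cases
    case 1 then show ?thesis using assms by (auto simp: cat_def Sigma_plus_def)
   next
    case 2
    then have "n = Suc (i+j)" using assms by linarith
    then have "x n = x (Suc (i+j))" by simp
    with 2 show ?thesis using assms y by (auto simp: cat_def Sigma_plus_def cyl1_iff)
   next
    case 3 then show ?thesis using assms y by (auto simp: cat_def Sigma_plus_def cyl1_iff Suc_diff_le)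
   qed
  qed
 qed
qed

lemma Pth_prefix: "x \<in> Sigma_plus S E ==> map x [0..<n] \<in> Pth S E (x 0) (x n)"
 by (rule Pth_sub) auto

locale tms =
 fixes S :: "nat set" and E :: "nat => nat => bool"
 assumes S_ne: "S ~= {}" and trans: "top_transitive S E"
begin

abbreviation "Cy == cyl S E"
abbreviation "Sg == Sigma_plus S E"
abbreviation "Ph == Pth S E"
abbreviation "IM == inv_measures S E"

lemma next_ex: "u \<in> S ==> EX v. Edge S E u v"
proof -
 assume "u \<in> S"
 then obtain n where "n > 0" "(Edge S E^^n) u u" using trans by (auto simp: top_transitive_def)
 then obtain g where "g 0 = u" "ALL i<n. Edge S E (g i) (g (Suc i))" by (auto simp: relpowp_fun_conv)
 with \<open>n > 0\<close> show ?thesis by metis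
qed

lemma cyl_ne: assumes "s \<in> S" shows "EX x. x \<in> Cy [s]"
proof -
 define x where "x = rec_nat s (%_ u. SOME v. Edge S E u v)"
 have x0: "x 0 = s" and xS: "x (Suc n) = (SOME v. Edge S E (x n) v)" for n by (simp_all add: x_def)
 have in_S: "x n \<in> S" for n
 proof (induction n)
  case (Suc n) then show ?case using someI_ex[OF next_ex[OF Suc]] by (simp add: xS Edge_def)
 qed (simp add: x0 assms)
 have "E (x n) (x (Suc n))" for n
  using someI_ex[OF next_ex[OF in_S[of n]]] unfolding xS[symmetric] by (simp add: Edge_def)
 with in_S x0 show ?thesis by (auto simp: cyl1_iff Sigma_plus_def intro!: exI[of _ x])
qed

text \<open>A reference continuation for each state. By bounded distortion another choice changes
  weights by at most a factor \<open>exp kap\<close>.\<close>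

definition pt :: "nat => nat => nat" where "pt s = (SOME x. x \<in> Cy [s])"

lemma pt [simp]: "s \<in> S ==> pt s \<in> Cy [s]"
 unfolding pt_def by (rule someI_ex[OF cyl_ne])

lemma Pth_ex: assumes "s \<in> S" "t \<in> S" "(Edge S E^^n) s t" shows "EX w:Ph s t. length w = n"
proof -
 obtain g where g: "g 0 = s" "g n = t" "ALL i<n. Edge S E (g i) (g (Suc i))"
  using assms by (auto simp: relpowp_fun_conv)
 define x where "x i = (if i < n then g i else pt t (i - n))" for i
 have p: "pt t \<in> Sg" "pt t 0 = t" using pt[OF assms(2)] by (auto simp: cyl1_iff)
 have "x i \<in> S & E (x i) (x (Suc i))" for i
 proof -
  consider "Suc i < n" | "Suc i = n" | "i >= n" by linarith
  then show ?thesis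
  proof cases
   case 1 then show ?thesis using g by (auto simp: x_def Edge_def)
  next
   case 2 then show ?thesis using g p by (auto simp: x_def Edge_def)
  next
   case 3 then show ?thesis using p by (auto simp: x_def Sigma_plus_def Suc_diff_le)
  qed
 qed
 then have "x \<in> Sg" by (auto simp: Sigma_plus_def)
 from Pth_prefix[OF this, of n] show ?thesis using g p by (auto simp: x_def split: if_splits intro!: bexI)
qed

lemma Pth_ne: assumes "s \<in> S" "t \<in> S" obtains w where "w \<in> Ph s t" "w ~= []"
proof -
 obtain n where "n > 0" "(Edge S E^^n) s t" using assms trans by (auto simp: top_transitive_def)
 with Pth_ex[OF assms] that show thesis by force
qed

lemma Pth_hd: assumes "w \<in> Ph s t" "t \<in> S" shows "if w = [] then s = t else w ! 0 = s"
 using PthD[OF assms(1) pt[OF assms(2)]] pt[OF assms(2)] by (auto simp: cyl1_iff cat_def)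

text \<open>Since a word omits its last vertex, the state at the cut is the first letter of
  \<open>v\<close>, or \<open>t\<close> when \<open>v\<close> is empty.\<close>

lemma Pth_split:
 assumes "u@v \<in> Ph s t" "t \<in> S" "r = (if v = [] then t else v ! 0)"
 shows "u \<in> Ph s r" "v \<in> Ph r t"
proof -
 have r0: "cat v y 0 = r" if "y \<in> Cy [t]" for y
  using that assms(3) by (auto simp: cat_def cyl1_iff)
 show v: "v \<in> Ph r t"
  unfolding Pth_def
 proof (intro CollectI ballI)
  fix y assume y: "y \<in> Cy [t]"
  have "cat (u@v) y \<in> Sg" using PthD[OF assms(1) y] by (simp add: cyl1_iff)
  from Sigma_plus_shift[OF this, of "length u"] show "cat v y \<in> Cy [r]"
   by (simp add: cat_append cyl1_iff r0[OF y])
 qed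
 let ?x = "cat (u@v) (pt t)"
 have x: "?x \<in> Cy [s]" by (rule PthD[OF assms(1) pt[OF assms(2)]])
 have "map ?x [0..<length u] \<in> Ph (?x 0) (?x (length u))"
  by (rule Pth_prefix) (use x in "simp add: cyl1_iff")
 moreover have "map ?x [0..<length u] = u" by (rule nth_equalityI) (auto simp: cat_def nth_append)
 moreover have "?x (length u) = r" using r0[OF pt[OF assms(2)]] by (simp add: cat_append) (simp add: cat_def)
 ultimately show "u \<in> Ph s r" using x by (simp add: cyl1_iff)
qed

lemma Pth_Edge: assumes "w \<in> Ph s t" "t \<in> S" shows "(Edge S E^^length w) s t"
 unfolding relpowp_fun_conv
proof (intro exI[of _ "cat w (pt t)"] conjI allI impI)
 show "cat w (pt t) 0 = s" using PthD[OF assms(1) pt[OF assms(2)]] by (simp add: cyl1_iff)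
 show "cat w (pt t) (length w) = t" using pt[OF assms(2)] by (simp add: cat_def cyl1_iff)
 fix i show "Edge S E (cat w (pt t) i) (cat w (pt t) (Suc i))"
  using PthD[OF assms(1) pt[OF assms(2)]] by (simp add: cyl1_iff Sigma_plus_def Edge_def)
qed

end

section \<open>Bounded distortion for weakly Hoelder potentials\<close>

locale pot = tms +
 fixes f :: "(nat => nat) => real" and A \<theta> B :: real
 assumes \<theta>: "0 < \<theta>" "\<theta> < 1"
  and A: "0 <= A"
  and osc: "!!n x y. n >= 2 ==> x \<in> Sigma_plus S E ==> y \<in> Sigma_plus S E ==>
    (ALL i<n. x i = y i) ==> \<bar>f x - f y\<bar> <= A*\<theta>^n"
  and f_le: "!!x. x \<in> Sigma_plus S E ==> f x <= B"
begin

text \<open>\<open>kap * \<theta>^m\<close> is the sum of the oscillation bounds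
  \<open>A * \<theta>^j\<close> over all j > m.\<close>

definition kap :: real where "kap = A*\<theta>/(1 - \<theta>)"

lemma kap_nonneg: "0 <= kap" using A \<theta> by (simp add: kap_def)

text \<open>The k-th shifts agree on \<open>n - k + m\<close> coordinates. With m >= 1 this number
  is at least 2, the range in which the oscillation is controlled, and the bounds form a geometric
  series.\<close>

lemma birk_dist:
 assumes x: "x \<in> Sg" and y: "y \<in> Sg" and m: "m >= 1"
  and eq: "!!i. i < n+m ==> x i = y i"
 shows "\<bar>birk shift f n x - birk shift f n y\<bar> <= kap*\<theta>^m"
proof -
 have "\<bar>birk shift f n x - birk shift f n y\<bar> <= (\<Sum>k<n. \<bar>f ((shift^^k) x) - f ((shift^^k) y)\<bar>)"
  unfolding birk_def sum_subtractf[symmetric] by (rule sum_abs)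
 also have "... <= (\<Sum>k<n. A*\<theta>^(n - k+m))"
  by (intro sum_mono osc Sigma_plus_shift x y) (use m in "auto simp: shift_pow intro!: eq")
 also have "... = (\<Sum>k<n. A*\<theta>^(Suc k+m))"
  unfolding sum.nat_diff_reindex[symmetric, of "%k. A*\<theta>^(Suc k+m)"]
  by (rule sum.cong[OF refl]) (metis Suc_diff_Suc lessThan_iff)
 also have "... = A*\<theta>^Suc m*(\<Sum>k<n. \<theta>^k)"
  by (simp add: sum_distrib_left power_add ac_simps)
 also have "(\<Sum>k<n. \<theta>^k) = (1 - \<theta>^n)/(1 - \<theta>)"
  using \<theta> by (simp add: sum_gp_strict)
 also have "A*\<theta>^Suc m*((1 - \<theta>^n)/(1 - \<theta>)) <= A*\<theta>^Suc m*(1/(1 - \<theta>))"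
  using \<theta> A by (intro mult_left_mono divide_right_mono) auto
 also have "... = kap*\<theta>^m" by (simp add: kap_def)
 finally show ?thesis .
qed

lemma birk_cat_dist:
 assumes w: "w \<in> Ph s t" and xy: "x \<in> Cy [t]" "y \<in> Cy [t]" and m: "m >= 1"
  and eq: "!!i. i < m ==> x i = y i"
 shows "\<bar>birk shift f (length w) (cat w x) - birk shift f (length w) (cat w y)\<bar> <= kap*\<theta>^m"
 by (rule birk_dist) (use PthD[OF w] xy m in "auto simp: cyl1_iff cat_def intro!: eq")

lemma wt_dist_m:
 assumes "w \<in> Ph s t" "x \<in> Cy [t]" "y \<in> Cy [t]" "m >= 1"
  and "!!i. i < m ==> x i = y i"
 shows "wt f w x <= exp (kap*\<theta>^m) * wt f w y"
 using birk_cat_dist[OF assms] unfolding wt_def exp_add[symmetric] by simp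

lemma kap_pow: "kap*\<theta>^m <= kap"
 using kap_nonneg \<theta> by (simp add: mult_left_le power_le_one)

lemma wt_dist:
 assumes "w \<in> Ph s t" "x \<in> Cy [t]" "y \<in> Cy [t]"
 shows "wt f w x <= exp kap * wt f w y"
proof -
 \<comment> \<open>Both tails begin with \<open>t\<close>, so one common coordinate is always
   available.\<close>
 have "wt f w x <= exp (kap*\<theta>^1) * wt f w y"
  by (rule wt_dist_m[OF assms]) (use assms in "auto simp: cyl1_iff")
 also have "... <= exp kap * wt f w y"
  using kap_pow[of 1] by (intro mult_right_mono) auto
 finally show ?thesis .
qed

lemma birk_le: "x \<in> Sg ==> birk shift f n x <= B * real n"
 unfolding birk_def using sum_bounded_above[of "{..<n}" "%k. f ((shift^^k) x)" B]
 by (simp add: f_le Sigma_plus_shift mult.commute)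

end

section \<open>First-return words and the loop series\<close>

definition FR :: "nat set => (nat => nat => bool) => nat => nat list set" where
 "FR S E a = {w \<in> Pth S E a a. w ~= [] & (ALL i. 0 < i & i < length w --> w ! i ~= a)}"

definition Star :: "nat list set => nat list set" where
 "Star W = concat ` lists W"

lemma Star_Nil [simp]: "[] \<in> Star W"
 unfolding Star_def by (rule image_eqI[of _ _ "[]"]) auto

lemma Star_snoc: "u \<in> Star W ==> w \<in> W ==> u@w \<in> Star W"
 unfolding Star_def by (clarify, rule_tac x="x@[w]" in image_eqI) auto

lemma Star_Cons: "w \<in> W ==> u \<in> Star W ==> w@u \<in> Star W"
 unfolding Star_def by (clarify, rule_tac x="w # x" in image_eqI) auto

lemma Star_induct [consumes 1, case_names Nil Cons]:
 assumes "u \<in> Star W" "Q []" "!!w u. w \<in> W ==> u \<in> Star W ==> Q u ==> Q (w@u)"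
 shows "Q u"
proof -
 obtain ws where "ws \<in> lists W" "u = concat ws" using assms(1) by (auto simp: Star_def)
 then show ?thesis
  by (induction ws arbitrary: u) (auto intro!: assms(2,3) simp: Star_def)
qed

lemma Star_append: "u \<in> Star W ==> v \<in> Star W ==> u@v \<in> Star W"
 by (induction rule: Star_induct) (auto intro: Star_Cons)

lemma Star_first: "v \<in> Star W ==> v = [] | (EX w:W. EX u:Star W. v = w@u)"
 by (induction rule: Star_induct) auto

lemma Star_last: "v \<in> Star W ==> v = [] | (EX u:Star W. EX w:W. v = u@w)"
proof (induction rule: Star_induct)
 case (Cons w u)
 then show ?case
  by (metis Star_Cons Star_Nil append.assoc append_Nil append_Nil2)
qed simp

lemma Star_mono: "W <= V ==> Star W <= Star V"
 unfolding Star_def by (intro image_mono lists_mono)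

lemma Star_Pth: "W <= Pth S E a a ==> u \<in> Star W ==> u \<in> Pth S E a a"
proof -
 assume W: "W <= Pth S E a a" and "u \<in> Star W"
 from this(2) show ?thesis
  by (induction rule: Star_induct) (use W in "auto intro: Pth_Nil Pth_append")
qed

lemma FR_Pth: "w \<in> FR S E a ==> w \<in> Pth S E a a" by (simp add: FR_def)
lemma FR_ne: "w \<in> FR S E a ==> w ~= []" by (simp add: FR_def)

context tms
begin

abbreviation "Fr == FR S E"

lemma Star_FR_Pth: "W <= Fr a ==> u \<in> Star W ==> u \<in> Ph a a"
 by (rule Star_Pth[of W]) (auto simp: FR_def)

lemma FR_hd: "a \<in> S ==> w \<in> Fr a ==> w ! 0 = a"
 using Pth_hd[of w a a] by (auto simp: FR_def)

lemma Pth_hd': "a \<in> S ==> w \<in> Ph s a ==> w ~= [] ==> w ! 0 = s"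
 using Pth_hd[of w s a] by auto

text \<open>If one of two first-return suffixes were longer, it would contain the initial letter
  \<open>a\<close> of the shorter one in its interior.\<close>

lemma FR_suffix_unique:
 assumes "a \<in> S" "w \<in> Fr a" "w' \<in> Fr a" "u@w = u'@w'"
 shows "u = u' & w = w'"
proof -
 have *: "\<not> length w < length w'" if t: "w \<in> Fr a" "w' \<in> Fr a" "u@w = u'@w'" for u u' w w'
 proof
  assume l: "length w < length w'"
  obtain z where "u = u'@z & z@w = w' | u@z = u' & w = z@w'"
   using append_eq_append_conv2[of u w u' w'] t(3) by blast
  with l have z: "w' = z@w" "z ~= []" by auto
  then have "w' ! length z = a" using FR_hd[OF assms(1) t(1)] FR_ne[OF t(1)] by (simp add: nth_append)
  moreover have "0 < length z" "length z < length w'" using z FR_ne[OF t(1)] by auto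
  ultimately show False using t(2) by (auto simp: FR_def)
 qed
 have "length w = length w'" using *[OF assms(2,3,4)] *[OF assms(3,2) assms(4)[symmetric]] by simp
 with assms(4) show ?thesis by simp
qed

text \<open>Here the remainder must be a path at \<open>a\<close>: the return that ends a word is
  visible only as the first letter of what follows.\<close>

lemma FR_prefix_unique:
 assumes "a \<in> S" "w \<in> Fr a" "w' \<in> Fr a" "u \<in> Ph a a" "u' \<in> Ph a a" "w@u = w'@u'"
 shows "w = w' & u = u'"
proof -
 have *: "\<not> length w < length w'"
  if t: "w \<in> Fr a" "w' \<in> Fr a" "u \<in> Ph a a" "w@u = w'@u'" for u u' w w'
 proof
  assume l: "length w < length w'"
  obtain z where "w = w'@z & z@u = u' | w@z = w' & u = z@u'"
   using append_eq_append_conv2[of w u w' u'] t(4) by blast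
  with l have z: "w' = w@z" "u = z@u'" "z ~= []" by auto
  then have "z ! 0 = a" using Pth_hd'[OF assms(1) t(3)] by (simp add: nth_append)
  then have "w' ! length w = a" using z by (simp add: nth_append)
  moreover have "0 < length w" "length w < length w'" using z FR_ne[OF t(1)] by auto
  ultimately show False using t(2) by (auto simp: FR_def)
 qed
 have "length w = length w'" using *[OF assms(2,3,4,6)] *[OF assms(3,2,5) assms(6)[symmetric]] by simp
 with assms(6) show ?thesis by simp
qed

text \<open>Cutting a loop at its last visit to \<open>a\<close> splits off one first-return word;
  induction handles the rest.\<close>

lemma Pth_Star_FR:
 assumes a: "a \<in> S" and "u \<in> Ph a a" shows "u \<in> Star (Fr a)"
 using assms(2)
proof (induction "length u" arbitrary: u rule: less_induct)
 case less
 show ?case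
 proof (cases "u = []")
  case False
  let ?J = "{j. j < length u & u ! j = a}"
  have "0 \<in> ?J" using False Pth_hd'[OF a less.prems] by simp
  define j where "j = Max ?J"
  have j: "j \<in> ?J" unfolding j_def by (rule Max_in) (use \<open>0 \<in> ?J\<close> in auto)
  have mx: "i <= j" if "i \<in> ?J" for i unfolding j_def by (rule Max_ge) (use that in auto)
  let ?v = "take j u" and ?w = "drop j u"
  have uvw: "?v@?w = u" by simp
  have "?w ~= []" "?w ! 0 = a" using j by auto
  then have P: "?v \<in> Ph a a" "?w \<in> Ph a a"
   using Pth_split[of ?v ?w a a a] less.prems a by auto
  have "?w \<in> Fr a"
   unfolding FR_def
  proof (intro CollectI conjI P allI impI)
   show "?w ~= []" by fact
   fix i assume "0 < i & i < length ?w"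
   then show "?w ! i ~= a" using mx[of "j+i"] j by (auto simp: less_diff_conv add.commute)
  qed
  moreover have "?v \<in> Star (Fr a)" by (rule less.hyps) (use j P in auto)
  ultimately show ?thesis using Star_snoc[of ?v _ ?w] uvw by metis
 qed simp
qed

lemma Star_FR: "a \<in> S ==> Star (Fr a) = Ph a a"
 using Pth_Star_FR Star_FR_Pth[of "Fr a"] by blast

lemma Star_snoc_bij:
 assumes "a \<in> S" "W <= Fr a"
 shows "bij_betw (%(w, u). u@w) (W \<times> Star W) (Star W - {[]})"
 unfolding bij_betw_def
proof
 show "inj_on (%(w, u). u@w) (W \<times> Star W)"
 proof (rule inj_onI, clarify)
  fix w u w' u' assume "w \<in> W" "w' \<in> W" "u@w = u'@w'"
  then show "w = w' & u = u'" using FR_suffix_unique[OF assms(1), of w w' u u'] assms(2) by auto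
 qed
 show "(%(w, u). u@w) ` (W \<times> Star W) = Star W - {[]}"
 proof (intro equalityI subsetI)
  fix v assume "v \<in> Star W - {[]}"
  with Star_last[of v W] show "v \<in> (%(w, u). u@w) ` (W \<times> Star W)" by force
 qed (use assms FR_ne[of _ S E a] in "auto intro: Star_snoc")
qed

text \<open>Used together with \<open>Star_snoc_bij\<close>: factoring the same loops at the front
  and at the back is what makes the orbit measures \<open>Mq\<close> shift invariant.\<close>

lemma Star_Cons_bij:
 assumes "a \<in> S" "W <= Fr a"
 shows "bij_betw (%(w, u). w@u) (W \<times> Star W) (Star W - {[]})"
 unfolding bij_betw_def
proof
 show "inj_on (%(w, u). w@u) (W \<times> Star W)"
 proof (rule inj_onI, clarify)
  fix w u w' u' assume "w \<in> W" "w' \<in> W" "u \<in> Star W" "u' \<in> Star W" "w@u = w'@u'"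
  then show "w = w' & u = u'"
   using FR_prefix_unique[OF assms(1), of w w' u u'] Star_FR_Pth[OF assms(2)] assms(2) by auto
 qed
 show "(%(w, u). w@u) ` (W \<times> Star W) = Star W - {[]}"
 proof (intro equalityI subsetI)
  fix v assume "v \<in> Star W - {[]}"
  with Star_first[of v W] show "v \<in> (%(w, u). w@u) ` (W \<times> Star W)" by force
 qed (use assms FR_ne[of _ S E a] in "auto intro: Star_Cons")
qed

lemma FR_exists: assumes "a \<in> S" shows "Fr a ~= {}"
proof -
 obtain w where "w \<in> Ph a a" "w ~= []" using Pth_ne[OF assms assms] .
 with Pth_Star_FR[OF assms, of w] Star_first[of w] show ?thesis by auto
qed

end

section \<open>Loop series and supersolutions of the return operator\<close>

definition wq :: "((nat => nat) => real) => real => nat list => (nat => nat) => real" where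
 "wq f q w x = wt f w x*exp (- q * real (length w))"

lemma wq_pos [simp]: "0 < wq f q w x" by (simp add: wq_def)
lemma wq_nonneg [simp]: "0 <= wq f q w x" by (simp add: wq_def)
lemma wq_Nil [simp]: "wq f q [] x = 1" by (simp add: wq_def)

lemma wq_append: "wq f q (u@v) x = wq f q u (cat v x) * wq f q v x"
 by (simp add: wq_def wt_append algebra_simps exp_add[symmetric])

lemma wq_change: "wq f q' w x = wq f q w x*exp ((q - q') * real (length w))"
 by (simp add: wq_def algebra_simps exp_add[symmetric])

lemma wq_antimono: "q <= q' ==> wq f q' w x <= wq f q w x"
 by (simp add: wq_def mult_right_mono)

lemma wt_wq: "wt f w x = wq f q w x*exp (q * real (length w))"
 by (simp add: wq_def algebra_simps exp_add[symmetric])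

text \<open>The transfer operator of the map induced on the cylinder of \<open>a\<close>; its
  inverse branches prepend a return word.\<close>

definition Lop where
 "Lop f W q h x = nsum W (%w. ennreal (wq f q w x) * h (cat w x))"

text \<open>By unique factorisation into return words this is the Neumann series of
  \<open>Lop\<close> applied to the constant 1.\<close>

definition Hs where
 "Hs f W q x = rsum (Star W) (%w. wq f q w x)"

definition growth where
 "growth f W x q \<longleftrightarrow> (EX C. ALL n. rsum {w\<in>Star W. length w = n} (%w. wt f w x) <= ennreal (C*exp (q * real n)))"

lemma Hs_ge_1: "1 <= Hs f W q x"
 using nsum_member[of "[]" "Star W" "%w. ennreal (wq f q w x)"] by (simp add: Hs_def)

lemma growth_mono: "growth f W x q ==> q <= q' ==> growth f W x q'"
proof -
 assume "growth f W x q" "q <= q'"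
 then obtain C where C: "rsum {w\<in>Star W. length w = n} (%w. wt f w x) <= ennreal (C*exp (q * real n))" for n
  by (auto simp: growth_def)
 have "ennreal (C*exp (q * real n)) <= ennreal (\<bar>C\<bar>*exp (q' * real n))" for n
  by (intro ennreal_leI mult_mono) (use \<open>q <= q'\<close> in "auto simp: mult_right_mono")
 with C show ?thesis unfolding growth_def by (meson order_trans)
qed

lemma Hs_imp_growth: assumes "Hs f W q x < \<infinity>" shows "growth f W x q"
 unfolding growth_def
proof (intro exI[of _ "enn2real (Hs f W q x)"] allI)
 fix n
 have "rsum {w\<in>Star W. length w = n} (%w. wt f w x)
   = rsum {w\<in>Star W. length w = n} (%w. wq f q w x)*ennreal (exp (q * real n))"
  unfolding nsum_multc[symmetric] by (rule nsum_cong) (auto simp: wt_wq[of _ _ _ q] ennreal_mult)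
 also have "... <= Hs f W q x*ennreal (exp (q * real n))"
  unfolding Hs_def by (intro mult_right_mono nsum_subset) auto
 also have "... = ennreal (enn2real (Hs f W q x)*exp (q * real n))"
  using assms by (simp add: ennreal_mult less_top)
 finally show "rsum {w\<in>Star W. length w = n} (%w. wt f w x) <= ..." .
qed

lemma exp_levels_finite:
 assumes "!!n. g n <= ennreal (C*exp (- d * real n))" "d > 0"
 shows "nsum UNIV g < (\<infinity>::ennreal)"
proof -
 have sm: "summable (%n. \<bar>C\<bar>*exp (- d)^n)"
  using assms(2) by (intro summable_mult summable_geometric) simp
 have "nsum UNIV g <= rsum UNIV (%n. \<bar>C\<bar>*exp (- d)^n)"
 proof (rule nsum_mono)
  fix n have "g n <= ennreal (C*exp (- d * real n))" by (rule assms)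
  also have "... <= ennreal (\<bar>C\<bar>*exp (- d * real n))" by (intro ennreal_leI mult_right_mono) auto
  also have "exp (- d * real n) = exp (- d)^n" by (simp add: exp_of_nat_mult[symmetric] mult.commute)
  finally show "g n <= ennreal (\<bar>C\<bar>*exp (- d)^n)" .
 qed
 also have "... = ennreal (\<Sum>n. \<bar>C\<bar>*exp (- d)^n)"
  unfolding nsum_nat by (rule suminf_ennreal2) (use sm in auto)
 finally show ?thesis by (auto simp: less_top intro: le_less_trans)
qed

lemma growth_imp_Hs: assumes "growth f W x q" "q < q'" shows "Hs f W q' x < \<infinity>"
proof -
 obtain C where C: "rsum {w\<in>Star W. length w = n} (%w. wt f w x) <= ennreal (C*exp (q * real n))" for n
  using assms by (auto simp: growth_def)
 have "rsum {w\<in>Star W. length w = n} (%w. wq f q' w x) <= ennreal (C*exp (- (q' - q) * real n))" for n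
 proof -
  have "rsum {w\<in>Star W. length w = n} (%w. wq f q' w x)
   = rsum {w\<in>Star W. length w = n} (%w. wt f w x)*ennreal (exp (- q' * real n))"
   unfolding nsum_multc[symmetric] by (rule nsum_cong) (auto simp: wq_def ennreal_mult)
  also have "... <= ennreal (C*exp (q * real n))*ennreal (exp (- q' * real n))"
   by (intro mult_right_mono C) auto
  also have "... = ennreal (C*exp (- (q' - q) * real n))"
   by (subst ennreal_mult''[symmetric]) (auto simp: mult.assoc exp_add[symmetric] algebra_simps)
  finally show ?thesis .
 qed
 then show ?thesis
  unfolding Hs_def by (subst nsum_levels[of _ _ length]) (rule exp_levels_finite[of _ C "q' - q"], use assms in auto)
qed

context tms
begin

text \<open>Resolvent identity: the empty word gives the 1, every other loop is split at its last
  return word, the one adjacent to \<open>x\<close>.\<close>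

lemma Hs_eq:
 assumes "a \<in> S" "W <= Fr a"
 shows "Hs f W q x = 1+Lop f W q (Hs f W q) x"
proof -
 have "Star W = {[]} Un (Star W - {[]})" by auto
 then have "Hs f W q x = rsum ({[]} Un (Star W - {[]})) (%w. wq f q w x)"
  by (simp add: Hs_def)
 also have "... = 1+rsum (Star W - {[]}) (%w. wq f q w x)"
  by (subst nsum_Un_disj) (auto simp: nsum_finite)
 also have "rsum (Star W - {[]}) (%w. wq f q w x)
   = nsum (W \<times> Star W) (%(w, u). ennreal (wq f q w x)*ennreal (wq f q u (cat w x)))"
  by (subst nsum_reindex_bij[OF Star_snoc_bij[OF assms]])
   (auto intro!: nsum_cong simp: wq_append ennreal_mult mult.commute)
 also have "... = Lop f W q (Hs f W q) x"
  by (simp add: nsum_Times nsum_cmult Lop_def Hs_def)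
 finally show ?thesis .
qed

text \<open>A supermartingale argument: splitting off the last return word leaves a shorter total
  length, where the bound by \<open>h\<close> holds inductively, and one application of the operator
  does not increase \<open>h\<close>.\<close>

lemma supersolution:
 assumes a: "a \<in> S" and W: "W <= Fr a"
  and h: "!!x. x \<in> Cy [a] ==> Lop f W q h x <= h x"
 shows "x \<in> Cy [a] ==>
  nsum {u\<in>Star W. length u = n} (%u. ennreal (wq f q u x) * h (cat u x)) <= h x"
proof (induction n arbitrary: x rule: less_induct)
 case (less n)
 show ?case
 proof (cases "n = 0")
  case True
  then have "{u\<in>Star W. length u = n} = {[]}" by auto
  then show ?thesis by (simp add: nsum_finite)
 next
  case False
  let ?D = "SIGMA w:{w\<in>W. length w <= n}. {u\<in>Star W. length u = n - length w}"
  have "inj_on (%(w, u). u@w) ?D"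
   using Star_snoc_bij[OF a W] by (auto simp: bij_betw_def intro: inj_on_subset)
  moreover have "(%(w, u). u@w) ` ?D = {u\<in>Star W. length u = n}"
  proof (intro equalityI subsetI)
   fix v assume v: "v \<in> {u\<in>Star W. length u = n}"
   with False Star_last[of v W] obtain u w where "u \<in> Star W" "w \<in> W" "v = u@w" by auto
   with v show "v \<in> (%(w, u). u@w) ` ?D" by (intro image_eqI[of _ _ "(w, u)"]) auto
  qed (auto intro: Star_snoc)
  ultimately have "bij_betw (%(w, u). u@w) ?D {u\<in>Star W. length u = n}" by (simp add: bij_betw_def)
  then have "nsum {u\<in>Star W. length u = n} (%u. ennreal (wq f q u x) * h (cat u x))
   = nsum ?D (%(w, u). ennreal (wq f q w x)*(ennreal (wq f q u (cat w x)) * h (cat u (cat w x))))"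
   by (subst nsum_reindex_bij, assumption)
    (auto intro!: nsum_cong simp: wq_append ennreal_mult ac_simps cat_append)
  also have "... = nsum {w\<in>W. length w <= n} (%w. ennreal (wq f q w x) *
    nsum {u\<in>Star W. length u = n - length w} (%u. ennreal (wq f q u (cat w x)) * h (cat u (cat w x))))"
   by (simp add: nsum_Sigma nsum_cmult)
  also have "... <= nsum {w\<in>W. length w <= n} (%w. ennreal (wq f q w x) * h (cat w x))"
  proof (rule nsum_mono, rule mult_left_mono)
   fix w assume w: "w \<in> {w\<in>W. length w <= n}"
   then have wF: "w \<in> Fr a" using W by auto
   then have "n - length w < n" using FR_ne[OF wF] False by (cases w) auto
   moreover have "cat w x \<in> Cy [a]" using PthD[OF FR_Pth[OF wF] less.prems] .
   ultimately show "nsum {u\<in>Star W. length u = n - length w} (%u. ennreal (wq f q u (cat w x)) * h (cat u (cat w x))) <= h (cat w x)"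
    by (rule less.IH)
  qed simp
  also have "... <= Lop f W q h x" unfolding Lop_def by (rule nsum_subset) auto
  also have "... <= h x" by (rule h[OF less.prems])
  finally show ?thesis .
 qed
qed

text \<open>The lower bound \<open>c\<close> removes \<open>h\<close> from the weighted sums, so a
  positive supersolution certifies a growth rate without any spectral theory.\<close>

lemma supersolution_growth:
 assumes a: "a \<in> S" and W: "W <= Fr a" and x: "x \<in> Cy [a]"
  and h: "!!x. x \<in> Cy [a] ==> Lop f W q (%x. ennreal (h x)) x <= ennreal (h x)"
  and c: "0 < c" "!!x. x \<in> Cy [a] ==> c <= h x"
 shows "growth f W x q"
 unfolding growth_def
proof (intro exI[of _ "h x/c"] allI)
 fix n
 let ?N = "{w\<in>Star W. length w = n}"
 have "rsum ?N (%w. wt f w x) = nsum ?N (%w. ennreal (wq f q w x)*ennreal c)*ennreal (exp (q * real n)/c)"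
  unfolding nsum_multc[symmetric]
  by (rule nsum_cong) (use c in "auto simp: wt_wq[of _ _ _ q] ennreal_mult[symmetric]")
 also have "... <= ennreal (h x)*ennreal (exp (q * real n)/c)"
 proof (rule mult_right_mono)
  have "nsum ?N (%w. ennreal (wq f q w x)*ennreal c) <= nsum ?N (%w. ennreal (wq f q w x)*ennreal (h (cat w x)))"
   using PthD[OF Star_FR_Pth[OF W] x] by (intro nsum_mono mult_left_mono ennreal_leI c) auto
  also have "... <= ennreal (h x)" by (rule supersolution[OF a W h x]) auto
  finally show "nsum ?N (%w. ennreal (wq f q w x)*ennreal c) <= ennreal (h x)" .
 qed simp
 also have "... = ennreal (h x/c*exp (q * real n))"
  using c by (subst ennreal_mult''[symmetric]) auto
 finally show "rsum ?N (%w. wt f w x) <= ..." .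
qed

end

context pot
begin

lemma wq_dist_m:
 assumes "w \<in> Ph s t" "x \<in> Cy [t]" "y \<in> Cy [t]" "m >= 1"
  and "!!i. i < m ==> x i = y i"
 shows "wq f q w x <= exp (kap*\<theta>^m) * wq f q w y"
 using wt_dist_m[OF assms] by (simp add: wq_def)

lemma wq_dist:
 assumes "w \<in> Ph s t" "x \<in> Cy [t]" "y \<in> Cy [t]"
 shows "wq f q w x <= exp kap * wq f q w y"
 using wt_dist[OF assms] by (simp add: wq_def)

lemma nsum_wq_dist:
 assumes "V <= Ph s t" "x \<in> Cy [t]" "y \<in> Cy [t]"
 shows "rsum V (%w. wq f q w x) <= ennreal (exp kap) * rsum V (%w. wq f q w y)"
 unfolding nsum_cmult[symmetric]
 by (rule nsum_mono) (use assms in "auto simp: ennreal_mult[symmetric] intro!: ennreal_leI wq_dist")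

lemma Hs_dist_m:
 assumes "W <= Fr a" "x \<in> Cy [a]" "y \<in> Cy [a]" "m >= 1" "!!i. i < m ==> x i = y i"
 shows "Hs f W q x <= ennreal (exp (kap*\<theta>^m)) * Hs f W q y"
 unfolding Hs_def nsum_cmult[symmetric]
 by (rule nsum_mono)
  (use assms Star_FR_Pth[OF assms(1)] in "auto simp: ennreal_mult[symmetric] intro!: ennreal_leI wq_dist_m")

lemma Hs_dist:
 assumes "W <= Fr a" "x \<in> Cy [a]" "y \<in> Cy [a]"
 shows "Hs f W q x <= ennreal (exp kap) * Hs f W q y"
 unfolding Hs_def by (rule nsum_wq_dist) (use assms Star_FR_Pth in auto)

lemma Hs_finite_indep:
 assumes "W <= Fr a" "x \<in> Cy [a]" "y \<in> Cy [a]" "Hs f W q y < \<infinity>"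
 shows "Hs f W q x < \<infinity>"
 using Hs_dist[OF assms(1-3), of q] assms(4) by (auto intro: le_less_trans simp: ennreal_mult_less_top)

text \<open>Lowering the exponent by \<open>dlt\<close> costs little by convexity,
  \<open>exp (dlt * l) - 1 \<le> (dlt / eps) * exp (eps * l)\<close>, and the exponential tail bounds the right-hand side.\<close>

lemma gap_imp_Hs_below:
 assumes a: "a \<in> S" and W: "W <= Fr a"
  and eps: "eps > 0" and tail: "rsum W (%w. wq f (P - eps) w (pt a)) < \<infinity>"
  and c: "c > 0"
  and hq: "!!q. P < q ==> q < P+1 ==> EX h. (ALL x:Cy [a]. 0 < h x &
    Lop f W q (%x. ennreal (h x)) x+ennreal (c * h x) <= ennreal (h x)) &
    (ALL x:Cy [a]. ALL y:Cy [a]. h x <= exp k * h y)"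
 shows "EX q<P. Hs f W q (pt a) < \<infinity>"
proof -
 define T where "T = enn2real (rsum W (%w. wq f (P - eps) w (pt a)))"
 have T: "rsum W (%w. wq f (P - eps) w (pt a)) = ennreal T" "T >= 0"
  using tail by (auto simp: T_def less_top)
 \<comment> \<open>The bound by \<open>eps\<close> permits the convexity inequality, the bound by 1
   keeps \<open>q\<close> below \<open>P + 1\<close>, and the last term makes the error at most the
   deficit \<open>c * h\<close>.\<close>
 define dlt where "dlt = min (min eps 1) (c*eps/(exp (kap+k)*(T+1)))"
 have dlt: "0 < dlt" "dlt <= eps" "dlt <= 1" "dlt <= c*eps/(exp (kap+k)*(T+1))"
  using eps c T by (auto simp: dlt_def add_nonneg_pos)
 have "dlt*(exp (kap+k)*(T+1)) <= c*eps"
  using dlt(4) T by (simp add: pos_le_divide_eq add_nonneg_pos)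
 moreover have "dlt*(exp (kap+k) * T) <= dlt*(exp (kap+k)*(T+1))"
  using dlt by (intro mult_left_mono) auto
 ultimately have dltc: "dlt/eps*(exp (kap+k) * T) <= c"
  using eps by (simp add: field_simps)
 \<comment> \<open>Starting half a step above \<open>P\<close> and lowering by \<open>dlt\<close>
   lands half a step below \<open>P\<close>.\<close>
 define q where "q = P+dlt/2"
 have q: "P < q" "q < P+1" using dlt by (auto simp: q_def)
 obtain h where h: "!!x. x \<in> Cy [a] ==> 0 < h x"
   "!!x. x \<in> Cy [a] ==> Lop f W q (%x. ennreal (h x)) x+ennreal (c * h x) <= ennreal (h x)"
   "!!x y. x \<in> Cy [a] ==> y \<in> Cy [a] ==> h x <= exp k * h y"
  using hq[OF q] by blast
 have *: "wq f (q - dlt) w x <= wq f q w x+dlt/eps * wq f (P - eps) w x" for w x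
 proof -
  let ?l = "real (length w)"
  have cv: "exp (dlt*?l) <= 1+dlt/eps*exp (eps*?l)"
  proof -
   from convex_onD[OF exp_convex, of "dlt/eps" 0 "eps*?l"] dlt eps
   have "exp (dlt*?l) <= (1 - dlt/eps)+dlt/eps*exp (eps*?l)" by simp
   with dlt eps show ?thesis by (smt (verit) divide_nonneg_pos)
  qed
  have "wq f (q - dlt) w x = wq f q w x*exp (dlt*?l)" by (subst wq_change[of _ _ _ _ q]) simp
  also have "... <= wq f q w x*(1+dlt/eps*exp (eps*?l))" by (intro mult_left_mono cv) auto
  also have "... = wq f q w x+dlt/eps*(wq f q w x*exp (eps*?l))" by (simp add: algebra_simps)
  also have "wq f q w x*exp (eps*?l) = wq f (q - eps) w x" by (subst (2) wq_change[of _ _ _ _ q]) simp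
  also have "wq f q w x+dlt/eps * wq f (q - eps) w x <= wq f q w x+dlt/eps * wq f (P - eps) w x"
   using dlt eps q by (intro add_left_mono mult_left_mono wq_antimono) auto
  finally show ?thesis .
 qed
 have sup: "Lop f W (q - dlt) (%x. ennreal (h x)) x <= ennreal (h x)" if x: "x \<in> Cy [a]" for x
 proof -
  have "Lop f W (q - dlt) (%x. ennreal (h x)) x <= nsum W (%w. ennreal (wq f q w x)*ennreal (h (cat w x))
    + ennreal (dlt/eps*exp (kap+k) * h x)*ennreal (wq f (P - eps) w (pt a)))"
   unfolding Lop_def
  proof (rule nsum_mono)
   fix w assume w: "w \<in> W"
   then have wP: "w \<in> Ph a a" using W FR_Pth by auto
   have cx: "cat w x \<in> Cy [a]" by (rule PthD[OF wP x])
   have "wq f (q - dlt) w x * h (cat w x) <= (wq f q w x+dlt/eps * wq f (P - eps) w x) * h (cat w x)"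
    using h(1)[OF cx] by (intro mult_right_mono *) auto
   also have "... = wq f q w x * h (cat w x)+dlt/eps*(wq f (P - eps) w x * h (cat w x))"
    by (simp add: algebra_simps)
   also have "... <= wq f q w x * h (cat w x)+dlt/eps*((exp kap * wq f (P - eps) w (pt a))*(exp k * h x))"
    using dlt eps h(1)[OF cx] a
    by (intro add_left_mono mult_left_mono mult_mono wq_dist[OF wP x] h(3) x cx) auto
   also have "... = wq f q w x * h (cat w x)+(dlt/eps*exp (kap+k) * h x) * wq f (P - eps) w (pt a)"
    by (simp add: exp_add)
   finally show "ennreal (wq f (q - dlt) w x)*ennreal (h (cat w x)) <= ennreal (wq f q w x)*ennreal (h (cat w x))
    + ennreal (dlt/eps*exp (kap+k) * h x)*ennreal (wq f (P - eps) w (pt a))"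
    using dlt eps h(1)[OF cx] h(1)[OF x]
    by (simp add: ennreal_mult[symmetric] ennreal_plus[symmetric] del: ennreal_plus)
  qed
  also have "... = Lop f W q (%x. ennreal (h x)) x+ennreal (dlt/eps*exp (kap+k) * h x)*ennreal T"
   by (simp add: nsum_add nsum_cmult Lop_def T)
  also have "... = Lop f W q (%x. ennreal (h x)) x+ennreal ((dlt/eps*(exp (kap+k) * T)) * h x)"
   using T by (subst ennreal_mult''[symmetric]) (auto simp: ac_simps)
  also have "... <= Lop f W q (%x. ennreal (h x)) x+ennreal (c * h x)"
   using h(1)[OF x] dltc by (intro add_left_mono ennreal_leI mult_right_mono) auto
  also have "... <= ennreal (h x)" by (rule h(2)[OF x])
  finally show ?thesis .
 qed
 have lower: "h (pt a)/exp k <= h x" if "x \<in> Cy [a]" for x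
  using h(3)[OF pt[OF a] that] by (simp add: field_simps)
 have "growth f W (pt a) (q - dlt)"
  by (rule supersolution_growth[OF a W pt[OF a] sup, of "h (pt a)/exp k"]) (use h(1) a lower in auto)
 then have "Hs f W (P - dlt/4) (pt a) < \<infinity>"
  by (rule growth_imp_Hs) (use dlt in "simp add: q_def")
 then show ?thesis using dlt by (intro exI[of _ "P - dlt/4"]) auto
qed

end

section \<open>Gurevich pressure as a critical exponent\<close>

text \<open>The least positive difference \<open>g\<close> of two elements divides every element,
  for otherwise a remainder modulo \<open>g\<close> would be a smaller difference; hence it is the
  gcd. Two elements differing by \<open>g\<close> then generate all large multiples of it.\<close>

lemma additive_nat_set_eventually:
 fixes D :: "nat set"
 assumes z: "0 \<in> D" and add: "!!m n. m \<in> D ==> n \<in> D ==> m+n \<in> D" and d: "d \<in> D" "d > 0"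
 shows "EX n0. ALL n>=n0. n * Gcd D \<in> D"
proof -
 have mult: "m * n \<in> D" if "n \<in> D" for m n by (induction m) (use z add that in auto)
 define I where "I = {k. k > 0 & (EX i:D. EX j:D. i = j+k)}"
 have "d \<in> I" using d z by (auto simp: I_def)
 define g where "g = (LEAST k. k \<in> I)"
 have gI: "g \<in> I" and g_le: "!!k. k \<in> I ==> g <= k"
  using \<open>d \<in> I\<close> by (auto simp: g_def intro: LeastI Least_le)
 obtain i j where ij: "i \<in> D" "j \<in> D" "i = j+g" and g0: "g > 0" using gI by (auto simp: I_def)
 have "g dvd n" if n: "n \<in> D" for n
 proof (rule ccontr)
  assume "\<not> g dvd n"
  then have r: "0 < n mod g" "n mod g < g" using g0 by (auto simp: dvd_eq_mod_eq_0)
  let ?q = "n div g"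
  have "n+?q * j = ?q * i+n mod g"
   unfolding ij(3) by (simp add: algebra_simps)
  then have "n mod g \<in> I" using r add[OF n mult[OF ij(2)]] mult[OF ij(1)] by (auto simp: I_def)
  with g_le[of "n mod g"] r show False by simp
 qed
 then have "g dvd Gcd D" by (rule Gcd_greatest)
 moreover have "Gcd D dvd g" using Gcd_dvd[OF ij(1)] Gcd_dvd[OF ij(2)] ij(3) by (simp add: dvd_add_right_iff)
 ultimately have g: "Gcd D = g" by (simp add: dvd_antisym)
 obtain j' where j': "j = g * j'" using \<open>!!n. n \<in> D ==> g dvd n\<close>[OF ij(2)] by (auto elim: dvdE)
 show ?thesis
 \<comment> \<open>From j' squared on, the quotient by j' exceeds the remainder \<open>r\<close>, so
   \<open>r\<close> of the copies of \<open>j\<close> can be traded for copies of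
   \<open>i = j + g\<close>.\<close>
 proof (intro exI[of _ "j' * j'"] allI impI)
  fix n assume n: "n >= j' * j'"
  show "n * Gcd D \<in> D"
  proof (cases "j' = 0")
   case True then show ?thesis using ij j' g mult[OF ij(1)] by simp
  next
   case False
   let ?k = "n div j'" and ?r = "n mod j'"
   have "?r < j'" using False by simp
   moreover have "j' <= ?k" using n False by (simp add: less_eq_div_iff_mult_less_eq)
   ultimately obtain e where e: "?k = e+?r" by (metis le_add_diff_inverse2 less_imp_le_nat order_trans)
   have "n * g = (?k * j'+?r) * g" by simp
   also have "... = e * j+?r * i" unfolding e ij(3) j' by (simp add: algebra_simps)
   finally have "n * g = e * j+?r * i" .
   then show ?thesis using g add mult ij by simp
  qed
 qed
qed

lemma Least_eq_iff: "Q (n::nat) ==> (LEAST k. Q k) = n \<longleftrightarrow> (ALL k<n. ~ Q k)"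
proof -
 assume q: "Q n"
 have 1: "(LEAST k. Q k) = n" if "ALL k<n. ~ Q k"
  by (rule Least_equality[of Q, OF q]) (use that in "meson not_le")
 have 2: "\<not> Q k" if "(LEAST k. Q k) = n" "k < n" for k
  using not_less_Least[of k Q] that by blast
 show ?thesis using 1 2 by blast
qed

section \<open>Periodic points and the period of the graph\<close>

definition cyc :: "nat list => nat => nat" where "cyc w i = w ! (i mod length w)"

lemma cat_cyc: "w ~= [] ==> cat w (cyc w) = cyc w"
 by (rule ext) (auto simp: cat_def cyc_def le_mod_geq)

lemma shift_cyc: "(shift^^length w) (cyc w) = cyc w"
 by (rule ext) (auto simp: shift_pow cyc_def)

lemma cyc_prefix: "map (cyc w) [0..<length w] = w"
 by (rule nth_equalityI) (auto simp: cyc_def)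

lemma cyc_eqI: assumes "(shift^^n) x = x" "n > 0" shows "cyc (map x [0..<n]) = x"
proof
 fix i
 have per: "x (j+k * n) = x j" for j k
 proof (induction k)
  case (Suc k)
  have "x (j+k * n+n) = x (j+k * n)" using fun_cong[OF assms(1), of "j+k * n"] by (simp add: shift_pow)
  then show ?case using Suc by (simp add: ac_simps)
 qed simp
 show "cyc (map x [0..<n]) i = x i" using per[of "i mod n" "i div n"] assms(2) by (simp add: cyc_def)
qed

lemma birk_shift_pow: "birk (shift^^p) (birk shift f p) n x = birk shift f (p * n) x"
proof (induction n)
 case (Suc n)
 have "birk (shift^^p) (birk shift f p) (n+1) x = birk shift f (p * n) x+birk shift f p ((shift^^(p * n)) x)"
  unfolding birk_plus using Suc by (simp add: birk_def[of "shift^^p"] funpow_mult)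
 also have "... = birk shift f (p * n+p) x" by (simp add: birk_plus)
 finally show ?case by (simp add: algebra_simps)
qed simp

context tms
begin

text \<open>The period is defined through loops at all vertices. Loops at \<open>a\<close> alone
  give the same gcd, because a loop at \<open>v\<close> can be inserted into a round trip from
  \<open>a\<close> through \<open>v\<close>. The lengths form an additive set, which yields all
  large multiples.\<close>

lemma loop_lengths:
 assumes "a \<in> S"
 shows "period S E > 0" "!!w. w \<in> Ph a a ==> period S E dvd length w"
  "EX n0. ALL n>=n0. EX w:Ph a a. length w = period S E * n"
proof -
 let ?Q = "{n. n > 0 & (EX v:S. (Edge S E^^n) v v)}"
 let ?D = "length ` Ph a a"
 have pD: "period S E dvd n" if "n \<in> ?D" for n
 proof (cases "n = 0")
  case False
  then have "n \<in> ?Q" using that Pth_Edge[OF _ assms] assms by auto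
  then show ?thesis unfolding period_def by (rule Gcd_dvd)
 qed simp
 then show "!!w. w \<in> Ph a a ==> period S E dvd length w" by auto
 obtain w0 where w0: "w0 \<in> Ph a a" "w0 ~= []" using Pth_ne[OF assms assms] .
 then have d: "length w0 \<in> ?D" "length w0 > 0" by auto
 then show "period S E > 0" using pD[OF d(1)] by (auto intro: Nat.gr0I)
 have "Gcd ?D dvd n" if nQ: "n \<in> ?Q" for n
 proof -
  obtain v where v: "v \<in> S" "(Edge S E^^n) v v" using nQ by auto
  obtain w where w: "w \<in> Ph v v" "length w = n" using Pth_ex[OF v(1) v(1) v(2)] by auto
  obtain u where u: "u \<in> Ph a v" using Pth_ne[OF assms v(1)] by auto
  obtain u' where u': "u' \<in> Ph v a" using Pth_ne[OF v(1) assms] by auto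
  have "length (u@u') \<in> ?D" "length (u@w@u') \<in> ?D"
   using Pth_append[OF u u'] Pth_append[OF u Pth_append[OF w(1) u']] by (blast intro: imageI)+
  then have 1: "Gcd ?D dvd length u+length u'" and 2: "Gcd ?D dvd n+(length u+length u')"
   using w(2) by (auto dest!: Gcd_dvd[of _ ?D] simp: ac_simps)
  show ?thesis using 2 unfolding dvd_add_left_iff[OF 1] .
 qed
 then have "Gcd ?D dvd period S E" unfolding period_def by (rule Gcd_greatest)
 moreover have "period S E dvd Gcd ?D" using pD by (rule Gcd_greatest)
 ultimately have eq: "Gcd ?D = period S E" by (rule dvd_antisym)
 have "EX n0. ALL n>=n0. n * Gcd ?D \<in> ?D"
 proof (rule additive_nat_set_eventually[OF _ _ d])
  show "0 \<in> ?D" using Pth_Nil[of S E a] by force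
  fix m n assume "m \<in> ?D" "n \<in> ?D"
  then obtain u v where "u \<in> Ph a a" "v \<in> Ph a a" "m = length u" "n = length v" by auto
  then show "m+n \<in> ?D" using Pth_append[of u S E a a v a] by (intro image_eqI[of _ _ "u@v"]) auto
 qed
 then obtain n0 where "!!n. n >= n0 ==> n * period S E \<in> ?D" unfolding eq by auto
 then show "EX n0. ALL n>=n0. EX w:Ph a a. length w = period S E * n"
  by (intro exI[of _ n0]) (force simp: mult.commute)
qed

lemma cyc_in: assumes "a \<in> S" "w \<in> Ph a a" "w ~= []" shows "cyc w \<in> Cy [a]"
proof -
 let ?x = "cat w (pt a)"
 have x: "?x \<in> Sg" and p0: "pt a 0 = a"
  using PthD[OF assms(2) pt[OF assms(1)]] pt[OF assms(1)] by (auto simp: cyl1_iff)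
 have w0: "w ! 0 = a" using Pth_hd'[OF assms(1,2,3)] .
 have "cyc w i \<in> S & E (cyc w i) (cyc w (Suc i))" for i
 proof -
  let ?j = "i mod length w"
  have j: "?j < length w" using assms by simp
  have e: "?x ?j \<in> S" "E (?x ?j) (?x (Suc ?j))" using x by (auto simp: Sigma_plus_def)
  have "?x (Suc ?j) = cyc w (Suc i)"
   using j w0 p0 by (auto simp: cat_def cyc_def mod_Suc)
  with e j show ?thesis by (simp add: cat_def cyc_def)
 qed
 then show ?thesis using w0 by (auto simp: cyl1_iff Sigma_plus_def cyc_def)
qed

lemma periodic_points:
 assumes a: "a \<in> S" and n: "n > 0"
 shows "bij_betw cyc {w\<in>Ph a a. length w = n} {x \<in> Sigma0 S E a. (shift^^n) x = x & x \<in> Cy [a]}"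
proof (rule bij_betwI[where g="%x. map x [0..<n]"])
 have "a \<in> class0 S E a" using a by (auto simp: class0_def intro!: exI[of _ 0])
 then have C: "x \<in> Sigma0 S E a" if "x \<in> Cy [a]" for x using that by (auto simp: Sigma0_def cyl1_iff)
 show "cyc \<in> {w \<in> Ph a a. length w = n} \<rightarrow> {x \<in> Sigma0 S E a. (shift^^n) x = x & x \<in> Cy [a]}"
  using shift_cyc cyc_in[OF a] n C by fastforce
 show "(%x. map x [0..<n]) \<in> {x \<in> Sigma0 S E a. (shift^^n) x = x & x \<in> Cy [a]} \<rightarrow> {w \<in> Ph a a. length w = n}"
 proof (rule funcsetI, clarify)
  fix x assume x: "(shift^^n) x = x" "x \<in> Cy [a]"
  then have "x n = a" using fun_cong[OF x(1)[unfolded shift_pow], of 0] by (simp add: cyl1_iff)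
  then show "map x [0..<n] \<in> Ph a a & length (map x [0..<n]) = n"
   using Pth_prefix[of x S E n] x by (auto simp: cyl1_iff)
 qed
qed (auto simp: cyc_prefix n cyc_eqI)

lemma loop_visit_dvd:
 assumes "a \<in> S" "w \<in> Ph a a" "i < length w" "w ! i = a" shows "period S E dvd i"
proof -
 have "take i w \<in> Ph a a"
  using Pth_split(1)[of "take i w" "drop i w" a a a] assms by auto
 from loop_lengths(2)[OF assms(1) this] assms(3) show ?thesis by simp
qed

text \<open>All visits of a loop to \<open>a\<close> occur at multiples of the period, so the first
  return of the p-th power of the shift after \<open>n\<close> steps is an ordinary first return
  after \<open>p * n\<close> letters.\<close>

lemma first_return_points:
 fixes n :: nat
 assumes a: "a \<in> S" and n: "n > 0"
 defines "p == period S E"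
 shows "bij_betw cyc {w\<in>Fr a. length w = p * n}
  {x \<in> Sigma0 S E a. ((shift^^p)^^n) x = x & x \<in> Cy [a] & first_ret (shift^^p) (Cy [a]) x = n}"
proof -
 have p: "p > 0" using loop_lengths(1)[OF a] by (simp add: p_def)
 have pn: "p * n > 0" using p n by simp
 have ret: "first_ret (shift^^p) (Cy [a]) (cyc w) = n \<longleftrightarrow> w \<in> Fr a"
  if w: "w \<in> Ph a a" "length w = p * n" for w
 proof -
  let ?P = "%k. k > 0 & ((shift^^p)^^k) (cyc w) \<in> Cy [a]"
  have cw: "cyc w \<in> Cy [a]" using cyc_in[OF a w(1)] w(2) pn by force
  have P: "?P k \<longleftrightarrow> k > 0 & cyc w (p * k) = a" for k
   using Sigma_plus_shift[of "cyc w" S E "p * k"] cw by (auto simp: funpow_mult cyl1_iff shift_pow)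
  have Pn: "?P n" unfolding P using n w(2) cw by (auto simp: cyc_def cyl1_iff)
  have "(LEAST k. ?P k) = n \<longleftrightarrow> (ALL k<n. ~ ?P k)"
   by (rule Least_eq_iff) (rule Pn)
  also have "... \<longleftrightarrow> (ALL k<n. k > 0 --> w ! (p * k) ~= a)"
   unfolding P using w(2) p by (auto simp: cyc_def)
  also have "... \<longleftrightarrow> (ALL i. 0 < i & i < length w --> w ! i ~= a)"
  proof (safe)
   fix i assume H: "ALL k<n. 0 < k --> w ! (p * k) ~= w ! i" "0 < i" "i < length w" "a = w ! i"
   have "p dvd i" using loop_visit_dvd[OF a w(1) H(3)] H(4) by (simp add: p_def)
   then obtain k where "i = p * k" by (auto elim: dvdE)
   with H w(2) p show False by auto
  next
   fix k assume H: "ALL i. 0 < i & i < length w --> w ! i ~= w ! (p * k)" "k < n" "0 < k" "a = w ! (p * k)"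
   from H(1)[rule_format, of "p * k"] H w(2) p show False by auto
  qed
  also have "... \<longleftrightarrow> w \<in> Fr a" using w pn by (auto simp: FR_def)
  finally show ?thesis unfolding first_ret_def .
 qed
 let ?B = "{x \<in> Sigma0 S E a. (shift^^(p * n)) x = x & x \<in> Cy [a]}"
 have b: "bij_betw cyc {w\<in>Ph a a. length w = p * n} ?B" by (rule periodic_points[OF a pn])
 have "bij_betw cyc {w\<in>Fr a. length w = p * n} (cyc ` {w\<in>Fr a. length w = p * n})"
  by (rule bij_betw_subset[OF b]) (auto simp: FR_def)
 also have "cyc ` {w\<in>Fr a. length w = p * n} = {x\<in>?B. first_ret (shift^^p) (Cy [a]) x = n}"
 proof (intro equalityI subsetI)
  fix x assume x: "x \<in> {x\<in>?B. first_ret (shift^^p) (Cy [a]) x = n}"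
  then obtain w where "w \<in> Ph a a" "length w = p * n" "x = cyc w" using b by (auto simp: bij_betw_def)
  with ret x show "x \<in> cyc ` {w\<in>Fr a. length w = p * n}" by auto
 next
  fix x assume "x \<in> cyc ` {w\<in>Fr a. length w = p * n}"
  then obtain w where w: "w \<in> Fr a" "length w = p * n" "x = cyc w" by auto
  then have "w \<in> Ph a a" by (simp add: FR_def)
  moreover have "x \<in> ?B" using b w \<open>w \<in> Ph a a\<close> unfolding bij_betw_def by blast
  ultimately show "x \<in> {x\<in>?B. first_ret (shift^^p) (Cy [a]) x = n}" using ret[of w] w by auto
 qed
 finally show ?thesis unfolding funpow_mult by (simp add: conj_assoc)
qed

end

lemma ln_enn_ge: "0 < r ==> ennreal r <= z ==> ereal (ln r) <= ln_enn z"
 by (cases z) (auto simp: ln_enn_def)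

lemma ln_enn_le: "0 < r ==> z <= ennreal r ==> ln_enn z <= ereal (ln r)"
 by (cases z) (auto simp: ln_enn_def top_unique)

context pot
begin

lemma growth_FR_iff:
 assumes "a \<in> S"
 shows "growth f (Fr a) x q \<longleftrightarrow>
  (EX C. ALL n. rsum {w\<in>Ph a a. length w = n} (%w. wt f w x) <= ennreal (C*exp (q * real n)))"
 by (simp add: growth_def Star_FR[OF assms])

lemma wt_dist_nsum:
 assumes "V <= Ph s t" "!!w. w \<in> V ==> x w \<in> Cy [t]" "!!w. w \<in> V ==> y w \<in> Cy [t]"
 shows "rsum V (%w. wt f w (x w)) <= ennreal (exp kap) * rsum V (%w. wt f w (y w))"
 unfolding nsum_cmult[symmetric]
 by (rule nsum_mono) (use assms in "auto simp: ennreal_mult[symmetric] intro!: ennreal_leI wt_dist")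

text \<open>Fixed connecting words close a path from \<open>s\<close> to \<open>t\<close> into a
  loop at \<open>a\<close>. They cost a constant factor \<open>D\<close> and a fixed extra length
  \<open>k\<close>.\<close>

lemma path_growth:
 assumes a: "a \<in> S" and g: "growth f (Fr a) (pt a) q" and s: "s \<in> S" and t: "t \<in> S"
 shows "EX C. ALL n. rsum {w\<in>Ph s t. length w = n} (%w. wt f w (pt t)) <= ennreal (C*exp (q * real n))"
proof -
 obtain C where C: "!!n. rsum {w\<in>Ph a a. length w = n} (%w. wt f w (pt a)) <= ennreal (C*exp (q * real n))"
  using g growth_FR_iff[OF a] by auto
 obtain \<alpha> where \<alpha>: "\<alpha> \<in> Ph a s" using Pth_ne[OF a s] by auto
 obtain \<beta> where \<beta>: "\<beta> \<in> Ph t a" using Pth_ne[OF t a] by auto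
 define k where "k = length \<alpha>+length \<beta>"
 define D where "D = exp kap/wt f \<alpha> (pt s)*(exp kap/wt f \<beta> (pt a))"
 have D: "D > 0" by (simp add: D_def)
 have cb: "cat \<beta> (pt a) \<in> Cy [t]" by (rule PthD[OF \<beta> pt[OF a]])
 have w: "wt f w (pt t) <= D * wt f (\<alpha>@w@\<beta>) (pt a)" if "w \<in> Ph s t" for w
 proof -
  have "wt f w (pt t) <= exp kap * wt f w (cat \<beta> (pt a))"
   by (rule wt_dist[OF that pt[OF t] cb])
  moreover have "wt f \<alpha> (pt s) <= exp kap * wt f \<alpha> (cat (w@\<beta>) (pt a))"
   by (rule wt_dist[OF \<alpha> pt[OF s]]) (rule PthD[OF Pth_append[OF that \<beta>] pt[OF a]])
  ultimately have "wt f w (pt t) * wt f \<alpha> (pt s) <=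
    (exp kap * wt f w (cat \<beta> (pt a)))*(exp kap * wt f \<alpha> (cat (w@\<beta>) (pt a)))"
   by (intro mult_mono) auto
  also have "... = exp kap*exp kap/wt f \<beta> (pt a) * wt f (\<alpha>@w@\<beta>) (pt a)"
   by (simp add: wt_append less_imp_neq[OF wt_pos, symmetric] field_simps)
  finally show ?thesis unfolding D_def by (simp add: field_simps)
 qed
 show ?thesis
 proof (intro exI[of _ "D*(C*exp (q * real k))"] allI)
  fix n
  let ?V = "{w\<in>Ph s t. length w = n}"
  have "rsum ?V (%w. wt f w (pt t)) <= nsum ?V (%w. ennreal D*ennreal (wt f (\<alpha>@w@\<beta>) (pt a)))"
   using D by (intro nsum_mono) (auto simp: ennreal_mult[symmetric] intro!: ennreal_leI w)
  also have "... = ennreal D * rsum ((%w. \<alpha>@w@\<beta>) ` ?V) (%w. wt f w (pt a))"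
   unfolding nsum_cmult by (subst nsum_reindex) (auto simp: inj_on_def)
  also have "... <= ennreal D * rsum {w\<in>Ph a a. length w = n+k} (%w. wt f w (pt a))"
   using Pth_append[OF \<alpha> Pth_append[OF _ \<beta>]] by (intro mult_left_mono nsum_subset) (auto simp: k_def)
  also have "... <= ennreal D*ennreal (C*exp (q * real (n+k)))"
   by (intro mult_left_mono C) simp
  also have "... = ennreal (D*(C*exp (q * real k))*exp (q * real n))"
   using D by (subst ennreal_mult'[symmetric]) (auto simp: algebra_simps exp_add)
  finally show "rsum ?V (%w. wt f w (pt t)) <= ..." .
 qed
qed

lemma growth_indep:
 assumes "a \<in> S" "b \<in> S" "growth f (Fr a) (pt a) q" shows "growth f (Fr b) (pt b) q"
 using path_growth[OF assms(1,3,2,2)] growth_FR_iff[OF assms(2)] by auto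

definition gr :: "real => bool" where "gr q \<longleftrightarrow> (EX a:S. growth f (Fr a) (pt a) q)"
definition crit :: real where "crit = Inf {q. gr q}"

lemma gr_iff: "a \<in> S ==> gr q \<longleftrightarrow> growth f (Fr a) (pt a) q"
 unfolding gr_def using growth_indep[of _ a q] by blast

abbreviation zl where "zl a n == rsum {w\<in>Ph a a. length w = n} (%w. wt f w (pt a))"

text \<open>At fixed lengths concatenation of loops is injective, and changing the tail of the first
  loop costs \<open>exp kap\<close>.\<close>

lemma zl_supermult:
 assumes a: "a \<in> S" shows "zl a m * zl a n <= ennreal (exp kap) * zl a (m+n)"
proof -
 let ?L = "%n. {w\<in>Ph a a. length w = n}"
 have "zl a m * zl a n = nsum (?L m \<times> ?L n) (%(u, v). ennreal (wt f u (pt a))*ennreal (wt f v (pt a)))"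
  by (simp add: nsum_Times nsum_cmult nsum_multc)
 also have "... <= nsum (?L m \<times> ?L n) (%(u, v). ennreal (exp kap)*ennreal (wt f (u@v) (pt a)))"
 proof (rule nsum_mono, clarify)
  fix u v assume u: "u \<in> Ph a a" and v: "v \<in> Ph a a"
  have "wt f u (pt a) <= exp kap * wt f u (cat v (pt a))"
   by (rule wt_dist[OF u pt[OF a] PthD[OF v pt[OF a]]])
  then have "wt f u (pt a) * wt f v (pt a) <= exp kap * wt f (u@v) (pt a)"
   by (simp add: wt_append mult.assoc[symmetric])
  then show "ennreal (wt f u (pt a))*ennreal (wt f v (pt a)) <= ennreal (exp kap)*ennreal (wt f (u@v) (pt a))"
   by (simp add: ennreal_mult[symmetric])
 qed
 also have "... = ennreal (exp kap) * nsum (?L m \<times> ?L n) (%(u, v). ennreal (wt f (u@v) (pt a)))"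
  by (simp add: nsum_cmult[symmetric] case_prod_unfold)
 also have "nsum (?L m \<times> ?L n) (%(u, v). ennreal (wt f (u@v) (pt a)))
   = rsum ((%(u,v). u@v) ` (?L m \<times> ?L n)) (%w. wt f w (pt a))"
  by (subst nsum_reindex) (auto simp: inj_on_def case_prod_unfold)
 also have "... <= zl a (m+n)"
  by (rule nsum_subset) (auto intro: Pth_append)
 finally show ?thesis by (simp add: mult_left_mono)
qed

text \<open>One level exceeding the exponential by the factor \<open>exp kap\<close> reproduces
  itself under concatenation, since the surplus pays for the distortion. Levels between its
  multiples are reached by attaching loops from a complete set of residues.\<close>

lemma not_gr_lower:
 assumes a: "a \<in> S" and ng: "\<not> gr q'"
 shows "EX c>0. EX n1. ALL n>=n1. ennreal (c*exp (q' * real (period S E * n))) <= zl a (period S E * n)"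
proof -
 define p where "p = period S E"
 define K where "K = exp kap"
 have K: "K >= 1" using kap_nonneg by (simp add: K_def)
 have p: "p > 0" unfolding p_def by (rule loop_lengths(1)[OF a])
 \<comment> \<open>The failure of the growth bound is applied with the constant \<open>K\<close>
   itself, which gives exactly the surplus required.\<close>
 obtain m where "\<not> zl a m <= ennreal (K*exp (q' * real m))"
  using ng unfolding gr_iff[OF a] growth_FR_iff[OF a] by auto
 then have m: "ennreal (K*exp (q' * real m)) <= zl a m" "zl a m > ennreal (K*exp (q' * real m))" by auto
 have "zl a 0 = 1"
 proof -
  have "{w\<in>Ph a a. length w = 0} = {[]}" by (auto intro: Pth_Nil)
  then show ?thesis by (simp add: nsum_finite)
 qed
 then have m0: "m > 0" using m(2) ennreal_leI[OF K] by (intro Nat.gr0I) (auto simp: not_le[symmetric])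
 have "zl a m ~= 0" using m(2) by (metis not_less_zero)
 then have "{w\<in>Ph a a. length w = m} ~= {}" by (metis nsum_empty)
 then obtain m' where m': "m = p * m'" using loop_lengths(2)[OF a] by (auto simp: p_def elim: dvdE)
 have m'0: "m' > 0" using m' m0 by simp
 have pw: "ennreal (K*exp (q' * real (Suc j * m))) <= zl a (Suc j * m)" for j
 proof (induction j)
  case (Suc j)
  have "ennreal K*ennreal (K*exp (q' * real (Suc (Suc j) * m)))
   = ennreal (K*exp (q' * real (Suc j * m)))*ennreal (K*exp (q' * real m))"
   using K by (simp add: ennreal_mult[symmetric] algebra_simps exp_add[symmetric])
  also have "... <= zl a (Suc j * m) * zl a m" by (intro mult_mono Suc m(1)) auto
  also have "... <= ennreal K * zl a (Suc j * m+m)" unfolding K_def by (rule zl_supermult[OF a])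
  finally have "ennreal K*ennreal (K*exp (q' * real (Suc (Suc j) * m))) <= ennreal K * zl a (Suc (Suc j) * m)"
   by (simp add: ac_simps)
  then show ?case using K by (subst (asm) ennreal_mult_le_mult_iff) auto
 qed (use m in simp)
 obtain n0 where n0: "!!n. n >= n0 ==> EX w:Ph a a. length w = p * n"
  using loop_lengths(3)[OF a] unfolding p_def by blast
 then obtain lw where lw: "!!n. n >= n0 ==> lw n \<in> Ph a a & length (lw n) = p * n" by metis
 \<comment> \<open>The worst of the finitely many residue loops; they start at \<open>n0\<close>,
   from where loops of every admissible length exist.\<close>
 define c where "c = Min ((%r. wt f (lw r) (pt a)*exp (- q' * real (p * r))) ` {n0..<n0+m'})"
 have fin: "finite ((%r. wt f (lw r) (pt a)*exp (- q' * real (p * r))) ` {n0..<n0+m'})"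
  "(%r. wt f (lw r) (pt a)*exp (- q' * real (p * r))) ` {n0..<n0+m'} ~= {}" using m'0 by auto
 have c0: "c > 0" unfolding c_def using fin by (subst Min_gr_iff) auto
 have low: "ennreal (c*exp (q' * real (p * n))) <= zl a (p * n)" if n: "n >= n0+m'" for n
 proof -
  define r where "r = n0+(n - n0) mod m'"
  define j where "j = (n - n0) div m'"
  have r: "r \<in> {n0..<n0+m'}" using m'0 by (auto simp: r_def)
  have "j >= 1" using n m'0 by (auto simp: j_def less_eq_div_iff_mult_less_eq)
  then obtain i where i: "j = Suc i" by (cases j) auto
  have nr: "n = j * m'+r" using n by (simp add: r_def j_def)
  have pn: "p * n = j * m+p * r" unfolding nr m' by (simp add: algebra_simps)
  have cr: "c <= wt f (lw r) (pt a)*exp (- q' * real (p * r))" unfolding c_def by (rule Min_le) (use fin r in auto)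
  then have "c*exp (q' * real (p * r)) <= (wt f (lw r) (pt a)*exp (- q' * real (p * r)))*exp (q' * real (p * r))"
   by (intro mult_right_mono) auto
  also have "... = wt f (lw r) (pt a)" by (simp add: exp_minus)
  finally have "ennreal (c*exp (q' * real (p * r))) <= ennreal (wt f (lw r) (pt a))" by (rule ennreal_leI)
  also have "... <= zl a (p * r)" using lw[of r] r by (intro nsum_member) auto
  finally have z: "ennreal (c*exp (q' * real (p * r))) <= zl a (p * r)" .
  have "ennreal K*ennreal (c*exp (q' * real (p * n)))
    = ennreal (K*exp (q' * real (j * m)))*ennreal (c*exp (q' * real (p * r)))"
   using K c0 unfolding pn by (simp add: ennreal_mult[symmetric] algebra_simps exp_add[symmetric])
  also have "... <= zl a (j * m) * zl a (p * r)" using pw[of i] z i by (intro mult_mono) auto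
  also have "... <= ennreal K * zl a (p * n)" unfolding K_def pn by (rule zl_supermult[OF a])
  finally show ?thesis using K by (subst (asm) ennreal_mult_le_mult_iff) auto
 qed
 show ?thesis using c0 low unfolding p_def by blast
qed

text \<open>Repeating one loop gives a definite growth rate, with a loss \<open>kap\<close> per
  repetition. This makes \<open>crit\<close> a genuine infimum once some exponent is
  admissible.\<close>

lemma gr_bdd_below: "bdd_below {q. gr q}"
proof -
 obtain a where a: "a \<in> S" using S_ne by auto
 obtain w where w: "w \<in> Ph a a" "w ~= []" using Pth_ne[OF a a] .
 let ?l = "real (length w)"
 have l: "?l > 0" using w by simp
 define L where "L = ln (wt f w (pt a)) - kap"
 have pw: "ennreal (exp (real j * L)) <= zl a (j * length w)" for j
 proof (induction j)
  case 0
  then show ?case using nsum_member[of "[]" "{w\<in>Ph a a. length w = 0}" "%w. ennreal (wt f w (pt a))"]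
   by (simp add: Pth_Nil)
 next
  case (Suc j)
  have "ennreal (exp kap)*ennreal (exp (real (Suc j) * L)) = ennreal (exp (real j * L))*ennreal (wt f w (pt a))"
   by (simp add: ennreal_mult[symmetric] L_def algebra_simps exp_add exp_diff)
  also have "... <= zl a (j * length w) * zl a (length w)"
   using w by (intro mult_mono Suc nsum_member) auto
  also have "... <= ennreal (exp kap) * zl a (j * length w+length w)" by (rule zl_supermult[OF a])
  finally show ?case by (subst (asm) ennreal_mult_le_mult_iff) (auto simp: add.commute)
 qed
 have "L/?l <= q" if "gr q" for q
 proof (rule ccontr)
  assume "\<not> L/?l <= q"
  then have d: "L - q*?l > 0" using l by (simp add: field_simps)
  obtain C where C: "!!n. zl a n <= ennreal (C*exp (q * real n))"
   using \<open>gr q\<close> unfolding gr_iff[OF a] growth_FR_iff[OF a] by auto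
  have le: "exp (real j*(L - q*?l)) <= C" for j
  proof -
   have "ennreal (exp (real j * L)) <= ennreal (C*exp (q * real (j * length w)))" using pw[of j] C order_trans by blast
   then have "exp (real j * L) <= C*exp (q * real (j * length w))"
    by (subst (asm) ennreal_le_iff2) (auto simp: not_le[symmetric])
   then have "exp (real j * L)*exp (- (q * real (j * length w))) <= C"
    by (simp add: exp_minus field_simps)
   then show ?thesis by (simp add: exp_add[symmetric] algebra_simps)
  qed
  obtain j :: nat where "C < real j*(L - q*?l)" using reals_Archimedean3[OF d] by auto
  with le[of j] exp_ge_add_one_self[of "real j*(L - q*?l)"] show False by simp
 qed
 then show ?thesis by (intro bdd_belowI[of _ "L/?l"]) auto
qed

lemma crit_le: "gr q ==> crit <= q"
 unfolding crit_def by (rule cInf_lower) (auto intro: gr_bdd_below)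

lemma gr_mono: "gr q ==> q <= q' ==> gr q'"
 unfolding gr_def using growth_mono by blast

lemma gr_above_crit: assumes "gr q0" "crit < q" shows "gr q"
proof -
 obtain q' where "gr q'" "q' < q" using cInf_lessD[of "{q. gr q}" q] assms unfolding crit_def by auto
 then show ?thesis using gr_mono by force
qed

definition Zg where "Zg a n = Zgen (shift^^period S E) (Sigma0 S E a) (birk shift f (period S E)) (Cy [a]) n"

lemma Zgen_eq:
 assumes a: "a \<in> S" and n: "n > 0"
 shows "Zg a n = rsum {w\<in>Ph a a. length w = period S E * n} (%w. wt f w (cyc w))"
proof -
 have pn: "period S E * n > 0" using loop_lengths(1)[OF a] n by simp
 have "Zg a n = nsum {x \<in> Sigma0 S E a. (shift^^(period S E * n)) x = x & x \<in> Cy [a]}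
   (%x. ennreal (exp (birk shift f (period S E * n) x)))"
  unfolding Zg_def Zgen_def nsum_def funpow_mult birk_shift_pow ..
 also have "... = rsum {w\<in>Ph a a. length w = period S E * n} (%w. exp (birk shift f (period S E * n) (cyc w)))"
  by (rule nsum_reindex_bij[OF periodic_points[OF a pn]])
 also have "... = rsum {w\<in>Ph a a. length w = period S E * n} (%w. wt f w (cyc w))"
 proof (rule nsum_cong[OF refl])
  fix w assume "w \<in> {w\<in>Ph a a. length w = period S E * n}"
  then have "w ~= []" "length w = period S E * n" using pn by auto
  then show "ennreal (exp (birk shift f (period S E * n) (cyc w))) = ennreal (wt f w (cyc w))"
   by (simp add: wt_def cat_cyc)
 qed
 finally show ?thesis .
qed

text \<open>The partition function evaluates each loop at its own periodic point, \<open>zl\<close>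
  at the common tail \<open>pt a\<close>; distortion makes the two comparable.\<close>

lemma Zg_bounds:
 assumes a: "a \<in> S" and n: "n > 0"
 shows "Zg a n <= ennreal (exp kap) * zl a (period S E * n)" "zl a (period S E * n) <= ennreal (exp kap) * Zg a n"
proof -
 let ?V = "{w\<in>Ph a a. length w = period S E * n}"
 have c: "cyc w \<in> Cy [a]" if "w \<in> ?V" for w
  using that cyc_in[OF a, of w] loop_lengths(1)[OF a] n by (cases "w = []") auto
 show "Zg a n <= ennreal (exp kap) * zl a (period S E * n)" unfolding Zgen_eq[OF a n]
  by (rule wt_dist_nsum) (use c a in auto)
 show "zl a (period S E * n) <= ennreal (exp kap) * Zg a n" unfolding Zgen_eq[OF a n]
  by (rule wt_dist_nsum) (use c a in auto)
qed

lemma ln_scaled_ge: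
 assumes z: "ennreal (c*exp (r * real (Suc n))) <= z" and c: "c > 0"
 shows "ereal (ln c/real (Suc n)+r) <= ereal (1/real (Suc n)) * ln_enn z"
proof -
 have "ereal (ln (c*exp (r * real (Suc n)))) <= ln_enn z" by (rule ln_enn_ge[OF _ z]) (use c in auto)
 then have "ereal (1/real (Suc n))*ereal (ln (c*exp (r * real (Suc n)))) <= ereal (1/real (Suc n)) * ln_enn z"
  by (intro ereal_mult_left_mono) auto
 moreover have "1/real (Suc n) * ln (c*exp (r * real (Suc n))) = ln c/real (Suc n)+r"
  using c by (simp add: ln_mult field_simps)
 ultimately show ?thesis by simp
qed

lemma ln_scaled_le:
 assumes z: "z <= ennreal (c*exp (r * real (Suc n)))" and c: "c > 0"
 shows "ereal (1/real (Suc n)) * ln_enn z <= ereal (ln c/real (Suc n)+r)"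
proof -
 have "ln_enn z <= ereal (ln (c*exp (r * real (Suc n))))" by (rule ln_enn_le[OF _ z]) (use c in auto)
 then have "ereal (1/real (Suc n)) * ln_enn z <= ereal (1/real (Suc n))*ereal (ln (c*exp (r * real (Suc n))))"
  by (intro ereal_mult_left_mono) auto
 moreover have "1/real (Suc n) * ln (c*exp (r * real (Suc n))) = ln c/real (Suc n)+r"
  using c by (simp add: ln_mult field_simps)
 ultimately show ?thesis by simp
qed

lemma const_over_Suc: "(%n. C/real (Suc n)+r) \<longlonglongrightarrow> (r::real)"
 using tendsto_add[OF tendsto_mult_right_zero[OF LIMSEQ_inverse_real_of_nat, of C] tendsto_const[of r]]
 by (simp add: divide_inverse)

lemma Pmix_lower:
 assumes a: "a \<in> S" and "\<not> gr q'" "q < q'"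
 shows "\<forall>\<^sub>F n in sequentially. ereal (real (period S E) * q) < ereal (1/real (Suc n)) * ln_enn (Zg a (Suc n))"
proof -
 let ?p = "period S E"
 have p: "?p > 0" by (rule loop_lengths(1)[OF a])
 obtain c n1 where c: "c > 0" "!!n. n >= n1 ==> ennreal (c*exp (q' * real (?p * n))) <= zl a (?p * n)"
  using not_gr_lower[OF a assms(2)] by blast
 let ?c = "c*exp (- kap)"
 have low: "ereal (ln ?c/real (Suc n)+?p * q') <= ereal (1/real (Suc n)) * ln_enn (Zg a (Suc n))" if "n >= n1" for n
 proof (rule ln_scaled_ge)
  have "ennreal (exp kap)*ennreal (?c*exp (?p * q' * real (Suc n))) = ennreal (c*exp (q' * real (?p * Suc n)))"
   using c by (simp add: ennreal_mult[symmetric] exp_minus algebra_simps)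
  also have "... <= zl a (?p * Suc n)" by (rule c(2)) (use that in simp)
  also have "... <= ennreal (exp kap) * Zg a (Suc n)" by (rule Zg_bounds(2)[OF a]) simp
  finally show "ennreal (?c*exp (?p * q' * real (Suc n))) <= Zg a (Suc n)"
   by (subst (asm) ennreal_mult_le_mult_iff) auto
 qed (use c in simp)
 have "?p * q < ?p * q'" using p assms(3) by simp
 then have "\<forall>\<^sub>F n in sequentially. ?p * q < ln ?c/real (Suc n)+?p * q'"
  using order_tendstoD(1)[OF const_over_Suc] by blast
 with eventually_ge_at_top[of n1] show ?thesis
 proof eventually_elim
  case (elim n)
  then show ?case using low[of n] by (meson less_le_trans less_ereal.simps(1))
 qed
qed

lemma Pmix_upper:
 assumes a: "a \<in> S" and "gr q'" "q' < q"
 shows "\<forall>\<^sub>F n in sequentially. ereal (1/real (Suc n)) * ln_enn (Zg a (Suc n)) < ereal (real (period S E) * q)"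
proof -
 let ?p = "period S E"
 have p: "?p > 0" by (rule loop_lengths(1)[OF a])
 obtain C where C: "!!n. zl a n <= ennreal (C*exp (q' * real n))"
  using assms(2) unfolding gr_iff[OF a] growth_FR_iff[OF a] by auto
 let ?c = "(\<bar>C\<bar>+1)*exp kap"
 have up: "ereal (1/real (Suc n)) * ln_enn (Zg a (Suc n)) <= ereal (ln ?c/real (Suc n)+?p * q')" for n
 proof (rule ln_scaled_le)
  have "Zg a (Suc n) <= ennreal (exp kap) * zl a (?p * Suc n)" by (rule Zg_bounds(1)[OF a]) simp
  also have "... <= ennreal (exp kap)*ennreal (C*exp (q' * real (?p * Suc n)))" by (intro mult_left_mono C) simp
  also have "... = ennreal (exp kap*(C*exp (q' * real (?p * Suc n))))" by (subst ennreal_mult') auto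
  also have "... <= ennreal (?c*exp (?p * q' * real (Suc n)))"
   by (intro ennreal_leI) (auto simp: algebra_simps intro!: mult_right_mono add_increasing)
  finally show "Zg a (Suc n) <= ennreal (?c*exp (?p * q' * real (Suc n)))" .
 qed simp
 have "?p * q' < ?p * q" using p assms(3) by simp
 then have "\<forall>\<^sub>F n in sequentially. ln ?c/real (Suc n)+?p * q' < ?p * q"
  using order_tendstoD(2)[OF const_over_Suc] by blast
 then show ?thesis
 proof eventually_elim
  case (elim n)
  then show ?case using up[of n] by (meson le_less_trans less_ereal.simps(1))
 qed
qed

lemma Pmix_infinite:
 assumes a: "a \<in> S" and "!!q. ~ gr q"
 shows "Pmix (shift^^period S E) (Sigma0 S E a) (birk shift f (period S E)) (Cy [a]) = \<infinity>"
proof -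
 let ?p = "period S E"
 have p: "?p > 0" by (rule loop_lengths(1)[OF a])
 have "(%n. ereal (1/real (Suc n)) * ln_enn (Zg a (Suc n))) \<longlonglongrightarrow> \<infinity>"
  unfolding tendsto_PInfty
 proof
  fix r :: real
  have "\<forall>\<^sub>F n in sequentially. ereal (real ?p*(r/?p)) < ereal (1/real (Suc n)) * ln_enn (Zg a (Suc n))"
   by (rule Pmix_lower[OF a assms(2)[of "r/?p+1"]]) simp
  then show "\<forall>\<^sub>F n in sequentially. ereal r < ereal (1/real (Suc n)) * ln_enn (Zg a (Suc n))" using p by simp
 qed
 then show ?thesis unfolding Pmix_def Zg_def by (rule limI)
qed

text \<open>\<open>Pmix\<close> is given by \<open>lim\<close>, so convergence has to be shown:
  every exponent below \<open>crit\<close> fails to be a growth rate and gives a lower bound at all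
  large times, every exponent above gives an upper bound.\<close>

lemma Pmix_finite:
 assumes a: "a \<in> S" and g: "gr q0"
 shows "Pmix (shift^^period S E) (Sigma0 S E a) (birk shift f (period S E)) (Cy [a]) = ereal (period S E * crit)"
proof -
 let ?p = "period S E"
 have p: "?p > 0" by (rule loop_lengths(1)[OF a])
 have "(%n. ereal (1/real (Suc n)) * ln_enn (Zg a (Suc n))) \<longlonglongrightarrow> ereal (?p * crit)"
 proof (rule order_tendstoI)
  fix r assume rlt: "r < ereal (?p * crit)"
  obtain r' where r': "r < ereal r'" "r' < ?p * crit" using ereal_dense2[OF rlt] by auto
  define q where "q = r'/?p"
  have q: "q < crit" "?p * q = r'" using r' p by (auto simp: q_def field_simps)
  have "\<not> gr ((q+crit)/2)" using crit_le[of "(q+crit)/2"] q by auto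
  from Pmix_lower[OF a this, of q] q
  have "\<forall>\<^sub>F n in sequentially. ereal r' < ereal (1/real (Suc n)) * ln_enn (Zg a (Suc n))" by simp
  then show "\<forall>\<^sub>F n in sequentially. r < ereal (1/real (Suc n)) * ln_enn (Zg a (Suc n))"
   by eventually_elim (use r' in "auto intro: less_trans")
 next
  fix r assume rlt: "ereal (?p * crit) < r"
  obtain r' where r': "ereal r' < r" "?p * crit < r'" using ereal_dense2[OF rlt] by auto
  define q where "q = r'/?p"
  have q: "crit < q" "?p * q = r'" using r' p by (auto simp: q_def field_simps)
  have "gr ((q+crit)/2)" using gr_above_crit[OF g, of "(q+crit)/2"] q by auto
  from Pmix_upper[OF a this, of q] q
  have "\<forall>\<^sub>F n in sequentially. ereal (1/real (Suc n)) * ln_enn (Zg a (Suc n)) < ereal r'" by simp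
  then show "\<forall>\<^sub>F n in sequentially. ereal (1/real (Suc n)) * ln_enn (Zg a (Suc n)) < r"
   by eventually_elim (use r' in "auto intro: less_trans")
 qed
 then show ?thesis unfolding Pmix_def Zg_def by (rule limI)
qed

lemma gur_pressure_eq: assumes "gr q0" shows "gur_pressure S E f = ereal crit"
proof -
 define a where "a = (SOME a. a \<in> S)"
 have a: "a \<in> S" unfolding a_def using S_ne by (simp add: some_in_eq)
 then show ?thesis
  unfolding gur_pressure_def Let_def a_def[symmetric] Pmix_finite[OF a assms]
  using loop_lengths(1)[OF a] by simp
qed

lemma gur_pressure_finite_imp: assumes "gur_pressure S E f < \<infinity>" shows "EX q. gr q"
proof (rule ccontr)
 assume n: "\<not> (EX q. gr q)"
 define a where "a = (SOME a. a \<in> S)"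
 have a: "a \<in> S" unfolding a_def using S_ne by (simp add: some_in_eq)
 then have "gur_pressure S E f = \<infinity>"
  unfolding gur_pressure_def Let_def a_def[symmetric] using Pmix_infinite[OF a] n
  using loop_lengths(1)[OF a] by simp
 with assms show False by simp
qed

definition Zs where "Zs a n = Zstar (shift^^period S E) (Sigma0 S E a) (birk shift f (period S E)) (Cy [a]) n"

lemma Zstar_eq:
 assumes a: "a \<in> S" and n: "n > 0"
 shows "Zs a n = rsum {w\<in>Fr a. length w = period S E * n} (%w. wt f w (cyc w))"
proof -
 have pn: "period S E * n > 0" using loop_lengths(1)[OF a] n by simp
 have "Zs a n = rsum {w\<in>Fr a. length w = period S E * n} (%w. exp (birk shift f (period S E * n) (cyc w)))"
  unfolding Zs_def Zstar_def birk_shift_pow nsum_def[symmetric]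
  by (rule nsum_reindex_bij[OF first_return_points[OF a n]])
 also have "... = rsum {w\<in>Fr a. length w = period S E * n} (%w. wt f w (cyc w))"
 proof (rule nsum_cong[OF refl])
  fix w assume "w \<in> {w\<in>Fr a. length w = period S E * n}"
  then have "w ~= []" "length w = period S E * n" using pn by auto
  then show "ennreal (exp (birk shift f (period S E * n) (cyc w))) = ennreal (wt f w (cyc w))"
   by (simp add: wt_def cat_cyc)
 qed
 finally show ?thesis .
qed

lemma Zs_bounds:
 assumes a: "a \<in> S" and n: "n > 0"
 defines "fr == rsum {w\<in>Fr a. length w = period S E * n} (%w. wt f w (pt a))"
 shows "Zs a n <= ennreal (exp kap) * fr" "fr <= ennreal (exp kap) * Zs a n"
proof -
 let ?V = "{w\<in>Fr a. length w = period S E * n}"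
 have c: "cyc w \<in> Cy [a]" if "w \<in> ?V" for w
  using that cyc_in[OF a, of w] by (auto simp: FR_def)
 show "Zs a n <= ennreal (exp kap) * fr" unfolding Zstar_eq[OF a n] fr_def
  by (rule wt_dist_nsum[of _ a a]) (use c a in "auto simp: FR_def")
 show "fr <= ennreal (exp kap) * Zs a n" unfolding Zstar_eq[OF a n] fr_def
  by (rule wt_dist_nsum[of _ a a]) (use c a in "auto simp: FR_def")
qed

text \<open>A root test for the series of first-return words. Lengths that are not multiples of the
  period contribute nothing, and each single level is finite because some growth exponent
  exists.\<close>

lemma SPR_iff:
 assumes g: "gr q0"
 shows "SPR S E f \<longleftrightarrow> (EX a:S. EX q<crit. rsum (Fr a) (%w. wq f q w (pt a)) < \<infinity>)"
proof -
 let ?p = "period S E"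
 have "(limsup (%m. ereal (1/real (Suc m)) * ln_enn (Zs a (Suc m))) < ereal (?p * crit)) \<longleftrightarrow>
  (EX q<crit. rsum (Fr a) (%w. wq f q w (pt a)) < \<infinity>)" if a: "a \<in> S" for a
 proof
  have p: "?p > 0" by (rule loop_lengths(1)[OF a])
  let ?s = "%m. ereal (1/real (Suc m)) * ln_enn (Zs a (Suc m))"
  {
   assume rlt: "limsup ?s < ereal (?p * crit)"
   obtain r where r: "limsup ?s < ereal r" "r < ?p * crit" using ereal_dense2[OF rlt] by auto
   from Limsup_lessD[OF r(1)] obtain M where M: "!!m. m >= M ==> ?s m < ereal r"
    by (auto simp: eventually_sequentially)
   \<comment> \<open>Half of the gap between the return rate and \<open>crit\<close> is kept as the
     decay rate \<open>d\<close> of the levels; the other half keeps \<open>q\<close> below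
     \<open>crit\<close>.\<close>
   define q where "q = (r/?p+crit)/2"
   have rq: "r/?p < crit" using r p by (simp add: field_simps)
   have q: "q < crit" "r < ?p * q" using rq p by (auto simp: q_def field_simps)
   define d where "d = q - r/?p"
   have d: "d > 0" using rq by (simp add: d_def q_def field_simps)
   define lev where "lev N = rsum {w\<in>Fr a. length w = N} (%w. wq f q w (pt a))" for N
   have lev: "lev N = rsum {w\<in>Fr a. length w = N} (%w. wt f w (pt a))*ennreal (exp (- q * real N))" for N
    unfolding lev_def nsum_multc[symmetric] by (rule nsum_cong) (auto simp: wq_def ennreal_mult)
   have fin: "lev N < \<infinity>" for N
   proof -
    obtain C where C: "!!n. zl a n <= ennreal (C*exp (q0 * real n))"
     using g unfolding gr_iff[OF a] growth_FR_iff[OF a] by auto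
    have "rsum {w\<in>Fr a. length w = N} (%w. wt f w (pt a)) <= zl a N"
     by (rule nsum_subset) (auto simp: FR_def)
    also note C[of N]
    finally have "rsum {w\<in>Fr a. length w = N} (%w. wt f w (pt a)) < \<top>"
     by (rule le_less_trans) simp
    then show ?thesis unfolding lev by (simp add: ennreal_mult_less_top)
   qed
   have big: "lev N <= ennreal (exp kap*exp (- d * real N))" if N: "N >= ?p*(M+1)" for N
   proof (cases "{w\<in>Fr a. length w = N} = {}")
    case True then show ?thesis by (simp only: lev_def nsum_empty zero_le)
   next
    case False
    then obtain w where w: "w \<in> Fr a" "length w = N" by auto
    then have "?p dvd N" using loop_lengths(2)[OF a FR_Pth[OF w(1)]] by simp
    then obtain n where n: "N = ?p * n" by (rule dvdE)
    then have nM: "n >= M+1" using N p mult_le_cancel1[of ?p "M+1" n] by (simp only: n)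
    then obtain m where m: "n = Suc m" "m >= M" by (cases n) auto
    have "Zs a n <= ennreal (exp (r * real n))"
    proof (rule ccontr)
     assume "\<not> Zs a n <= ennreal (exp (r * real n))"
     then have "ennreal (1*exp (r * real (Suc m))) <= Zs a n" using m by simp
     from ln_scaled_ge[OF this] m M[OF m(2)] show False by simp
    qed
    have "lev N <= (ennreal (exp kap) * Zs a n)*ennreal (exp (- q * real N))"
     unfolding lev n by (intro mult_right_mono Zs_bounds(2)[OF a]) (use m in auto)
    also have "... <= (ennreal (exp kap)*ennreal (exp (r * real n)))*ennreal (exp (- q * real N))"
     by (intro mult_right_mono mult_left_mono) (use \<open>Zs a n <= _\<close> in auto)
    also have "... = ennreal (exp kap*exp (- d * real N))"
     using p by (simp add: ennreal_mult[symmetric] exp_add[symmetric] n d_def field_simps)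
    finally show ?thesis .
   qed
   \<comment> \<open>The finitely many levels before the asymptotic bound sets in are absorbed into
     the constant.\<close>
   define C where "C = exp kap+(\<Sum>N<?p*(M+1). enn2real (lev N)*exp (d * real N))"
   have "lev N <= ennreal (C*exp (- d * real N))" for N
   proof (cases "N < ?p*(M+1)")
    case False
    then have "lev N <= ennreal (exp kap*exp (- d * real N))" by (intro big) auto
    also have "... <= ennreal (C*exp (- d * real N))"
     unfolding C_def by (intro ennreal_leI mult_right_mono) (auto intro!: sum_nonneg)
    finally show ?thesis .
   next
    case True
    have "enn2real (lev N)*exp (d * real N) <= (\<Sum>N<?p*(M+1). enn2real (lev N)*exp (d * real N))"
     using True by (intro member_le_sum) auto
    then have "enn2real (lev N)*exp (d * real N) <= C" by (simp add: C_def add_increasing)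
    then have "enn2real (lev N) <= C*exp (- d * real N)" by (simp add: exp_minus field_simps)
    then show ?thesis using fin[of N] by (metis ennreal_enn2real ennreal_leI infinity_ennreal_def)
   qed
   then have "rsum (Fr a) (%w. wq f q w (pt a)) < \<infinity>"
    by (subst nsum_levels[of _ _ length], fold lev_def) (rule exp_levels_finite[of _ C d], use d in auto)
   then show "EX q<crit. rsum (Fr a) (%w. wq f q w (pt a)) < \<infinity>" using q by auto
  }
  {
   assume "EX q<crit. rsum (Fr a) (%w. wq f q w (pt a)) < \<infinity>"
   then obtain q where q: "q < crit" "rsum (Fr a) (%w. wq f q w (pt a)) < \<infinity>" by auto
   define T where "T = enn2real (rsum (Fr a) (%w. wq f q w (pt a)))"
   have T: "rsum (Fr a) (%w. wq f q w (pt a)) = ennreal T" "T >= 0" using q by (auto simp: T_def)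
   have up: "?s m <= ereal (ln (exp kap*(T+1))/real (Suc m)+?p * q)" for m
   proof (rule ln_scaled_le)
    let ?N = "?p * Suc m"
    have "rsum {w\<in>Fr a. length w = ?N} (%w. wt f w (pt a))
     = rsum {w\<in>Fr a. length w = ?N} (%w. wq f q w (pt a))*ennreal (exp (q * real ?N))"
     unfolding nsum_multc[symmetric] by (rule nsum_cong) (auto simp: wt_wq[of _ _ _ q] ennreal_mult)
    also have "... <= ennreal T*ennreal (exp (q * real ?N))"
     unfolding T(1)[symmetric] by (intro mult_right_mono nsum_subset) auto
    finally have 1: "rsum {w\<in>Fr a. length w = ?N} (%w. wt f w (pt a)) <= ennreal T*ennreal (exp (q * real ?N))" .
    have "Zs a (Suc m) <= ennreal (exp kap)*(ennreal T*ennreal (exp (q * real ?N)))"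
     by (rule order_trans[OF Zs_bounds(1)[OF a] mult_left_mono[OF 1]]) auto
    also have "... = ennreal (exp kap * T*exp (?p * q * real (Suc m)))"
     using T by (simp add: ennreal_mult[symmetric] algebra_simps)
    also have "... <= ennreal (exp kap*(T+1)*exp (?p * q * real (Suc m)))"
     by (intro ennreal_leI mult_right_mono mult_left_mono) auto
    finally show "Zs a (Suc m) <= ..." .
   qed (use T in "auto intro: add_nonneg_pos")
   define r where "r = ?p*((q+crit)/2)"
   have r: "?p * q < r" "r < ?p * crit" using q p by (auto simp: r_def)
   have "\<forall>\<^sub>F m in sequentially. ln (exp kap*(T+1))/real (Suc m)+?p * q < r"
    using order_tendstoD(2)[OF const_over_Suc r(1)] by blast
   then have "\<forall>\<^sub>F m in sequentially. ?s m <= ereal r"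
   proof eventually_elim
    case (elim m)
    then show ?case using up[of m] by (meson order_trans ereal_less_eq(3) less_imp_le)
   qed
   then have "limsup ?s <= ereal r" by (rule Limsup_bounded)
   with r show "limsup ?s < ereal (?p * crit)" by (meson le_less_trans less_ereal.simps(1))
  }
 qed
 then show ?thesis
  unfolding SPR_def Let_def using Pmix_finite[OF _ g] by (auto simp: Zs_def)
qed

end

section \<open>Entropy of finitely valued random variables\<close>

definition \<eta> :: "real => real" where "\<eta> p = - p * ln p"

text \<open>Partitions are handled as finitely valued random variables: joins become pairs, and
  refinement becomes functional dependence.\<close>

definition frv :: "'a measure => ('a => 'b) => bool" where
 "frv M X \<longleftrightarrow> finite (X ` space M) & (ALL v. X -` {v} Int space M \<in> sets M)"

definition pr :: "'a measure => ('a => 'b) => 'b => real" where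
 "pr M X v = measure M (X -` {v} Int space M)"

definition Hent :: "'a measure => ('a => 'b) => real" where
 "Hent M X = (SUM v:X ` space M. \<eta> (pr M X v))"

lemma \<eta>_0 [simp]: "\<eta> 0 = 0" by (simp add: \<eta>_def)

lemma \<eta>_nonneg: "0 <= p ==> p <= 1 ==> 0 <= \<eta> p"
 by (cases "p = 0") (auto simp: \<eta>_def mult_nonneg_nonpos)

lemma pr_nonneg [simp]: "0 <= pr M X v" by (simp add: pr_def)

lemma pr_notin: "v ~: X ` space M ==> pr M X v = 0"
proof -
 assume "v ~: X ` space M"
 then have "X -` {v} Int space M = {}" by auto
 then show ?thesis unfolding pr_def by simp
qed

lemma Hent_superset: "finite R ==> X ` space M <= R ==> Hent M X = (SUM v:R. \<eta> (pr M X v))"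
 unfolding Hent_def by (rule sum.mono_neutral_left) (auto simp: pr_notin)

lemma frv_vimage: assumes "frv M X" shows "X -` G Int space M \<in> sets M"
proof -
 have "X -` G Int space M = (\<Union>v\<in>G Int X ` space M. X -` {v} Int space M)" by auto
 also have "... \<in> sets M" using assms by (intro sets.finite_UN) (auto simp: frv_def)
 finally show ?thesis .
qed

lemma frv_comp: assumes "frv M X" shows "frv M (%x. g (X x))"
 unfolding frv_def
proof (intro conjI allI)
 show "finite ((%x. g (X x)) ` space M)" using assms by (auto simp: frv_def image_image[symmetric, of g X])
 fix v show "(%x. g (X x)) -` {v} Int space M \<in> sets M"
  using frv_vimage[OF assms, of "{u. g u = v}"] by (simp add: vimage_def)
qed

lemma frv_pair: assumes "frv M X" "frv M Y" shows "frv M (%x. (X x, Y x))"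
 unfolding frv_def
proof (intro conjI allI)
 have "(%x. (X x, Y x)) ` space M <= X ` space M \<times> Y ` space M" by auto
 then show "finite ((%x. (X x, Y x)) ` space M)"
  by (rule finite_subset) (use assms in "auto simp: frv_def")
 fix v
 have "(%x. (X x, Y x)) -` {v} Int space M = (X -` {fst v} Int space M) Int (Y -` {snd v} Int space M)" by auto
 then show "(%x. (X x, Y x)) -` {v} Int space M \<in> sets M" using assms by (auto simp: frv_def)
qed

lemma frv_cong: "(!!x. x \<in> space M ==> X x = Y x) ==> frv M X \<longleftrightarrow> frv M Y"
proof -
 assume *: "!!x. x \<in> space M ==> X x = Y x"
 then have "X ` space M = Y ` space M" "!!v. X -` {v} Int space M = Y -` {v} Int space M" by force+
 then show ?thesis by (simp add: frv_def)
qed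

lemma frv_indicator: "B \<in> sets M ==> frv M (%x. x \<in> B)"
 unfolding frv_def
proof (intro conjI allI)
 fix v assume B: "B \<in> sets M"
 have "(%x. x \<in> B) -` {v} Int space M = (if v then B Int space M else space M - B)" by auto
 then show "(%x. x \<in> B) -` {v} Int space M \<in> sets M" using B by auto
qed (rule finite_subset[of _ UNIV], auto)

context prob_space
begin

lemma pr_le_1: "pr M X v <= 1" by (simp add: pr_def)

lemma Hent_nonneg: "0 <= Hent M X"
 unfolding Hent_def by (intro sum_nonneg \<eta>_nonneg pr_le_1) simp

lemma pr_marginal:
 assumes "frv M X" "frv M Y" "finite R" "X ` space M <= R"
 shows "(SUM v:R. pr M (%x. (X x, Y x)) (v, w)) = pr M Y w"
proof -
 have "pr M Y w = measure M (\<Union>v\<in>R. (%x. (X x, Y x)) -` {(v, w)} Int space M)"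
  unfolding pr_def by (rule arg_cong[where f="measure M"]) (use assms(4) in auto)
 also have "... = (SUM v:R. pr M (%x. (X x, Y x)) (v, w))"
  unfolding pr_def using frv_vimage[OF frv_pair[OF assms(1,2)]] assms(3)
  by (intro finite_measure_finite_Union) (auto simp: disjoint_family_on_def)
 finally show ?thesis by simp
qed

lemma pr_mono: "frv M X ==> (!!x. x \<in> space M ==> Y x = w ==> X x = v) ==> pr M Y w <= pr M X v"
 unfolding pr_def by (rule finite_measure_mono) (auto simp: frv_vimage)

text \<open>\<open>X\<close> factors through \<open>Y\<close> by the map \<open>g\<close>. Each
  fibre of \<open>X\<close> is a union of fibres of \<open>Y\<close>, and monotonicity of the
  logarithm compares the terms.\<close>

lemma Hent_dep:
 assumes Y: "frv M Y" and dep: "!!x y. x \<in> space M ==> y \<in> space M ==> Y x = Y y ==> X x = X y"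
 shows "frv M X" "Hent M X <= Hent M Y"
proof -
 define g where "g v = X (SOME x. x \<in> space M & Y x = v)" for v
 have g: "X x = g (Y x)" if "x \<in> space M" for x
 proof -
  have "(SOME z. z \<in> space M & Y z = Y x) \<in> space M & Y (SOME z. z \<in> space M & Y z = Y x) = Y x"
   by (rule someI[of _ x]) (use that in auto)
  then show ?thesis unfolding g_def using dep[of "SOME z. z \<in> space M & Y z = Y x" x] that by auto
 qed
 show X: "frv M X" using frv_comp[OF Y, of g] frv_cong[of M X "%x. g (Y x)"] g by auto
 have finX: "finite (X ` space M)" and finY: "finite (Y ` space M)" using X Y by (auto simp: frv_def)
 have prX: "pr M X u = (SUM v:{v\<in>Y ` space M. g v = u}. pr M Y v)" for u
 proof -
  have "pr M X u = measure M (\<Union>v\<in>{v\<in>Y ` space M. g v = u}. Y -` {v} Int space M)"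
   unfolding pr_def by (rule arg_cong[where f="measure M"]) (use g in auto)
  also have "... = (SUM v:{v\<in>Y ` space M. g v = u}. pr M Y v)"
   unfolding pr_def using frv_vimage[OF Y] finY
   by (intro finite_measure_finite_Union) (auto simp: disjoint_family_on_def)
  finally show ?thesis .
 qed
 have "Hent M X = (SUM u:X ` space M. SUM v:{v\<in>Y ` space M. g v = u}. - pr M Y v * ln (pr M X u))"
  unfolding Hent_def \<eta>_def by (intro sum.cong refl) (subst prX, simp add: sum_distrib_right sum_negf)
 also have "... <= (SUM u:X ` space M. SUM v:{v\<in>Y ` space M. g v = u}. \<eta> (pr M Y v))"
 proof (intro sum_mono)
  fix u v assume v: "v \<in> {v\<in>Y ` space M. g v = u}"
  show "- pr M Y v * ln (pr M X u) <= \<eta> (pr M Y v)"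
  proof (cases "pr M Y v = 0")
   case False
   then have p: "pr M Y v > 0" using pr_nonneg[of M Y v] by linarith
   have "pr M Y v <= pr M X u" by (rule pr_mono[OF X]) (use v g in auto)
   then have "ln (pr M Y v) <= ln (pr M X u)" using p by simp
   then show ?thesis using p by (simp add: \<eta>_def)
  qed simp
 qed
 also have "... = (SUM v:Y ` space M. \<eta> (pr M Y v))"
  by (rule sum.group) (use finX finY g in auto)
 finally show "Hent M X <= Hent M Y" by (simp add: Hent_def)
qed

lemma Hent_eq:
 assumes Y: "frv M Y" and dep: "!!x y. x \<in> space M ==> y \<in> space M ==> Y x = Y y \<longleftrightarrow> X x = X y"
 shows "Hent M X = Hent M Y"
proof (rule antisym)
 show "Hent M X <= Hent M Y" by (rule Hent_dep(2)[OF Y]) (use dep in auto)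
 have "frv M X" by (rule Hent_dep(1)[OF Y]) (use dep in auto)
 then show "Hent M Y <= Hent M X" by (rule Hent_dep(2)) (use dep in auto)
qed

end

text \<open>Nonnegativity of conditional mutual information, obtained from
  \<open>ln t <= t - 1\<close> at \<open>t = pxz * pyz / (p * pz)\<close>.\<close>

lemma strong_subadd_sum:
 fixes p :: "'x => 'y => 'z => real"
 assumes fin: "finite A" "finite B" "finite C" and p: "!!x y z. 0 <= p x y z"
 defines "pxz == %x z. SUM y:B. p x y z" and "pyz == %y z. SUM x:A. p x y z"
  and "pz == %z. SUM x:A. SUM y:B. p x y z"
 shows "(SUM x:A. SUM y:B. SUM z:C. \<eta> (p x y z))+(SUM z:C. \<eta> (pz z))
  <= (SUM x:A. SUM z:C. \<eta> (pxz x z))+(SUM y:B. SUM z:C. \<eta> (pyz y z))"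
proof -
 have pz_alt: "pz z = (SUM y:B. pyz y z)" "pz z = (SUM x:A. pxz x z)" for z
  unfolding pz_def pxz_def pyz_def by (rule sum.swap) simp
 have nn: "0 <= pxz x z" "0 <= pyz y z" "0 <= pz z" for x y z
  unfolding pz_def pxz_def pyz_def by (intro sum_nonneg p)+
 have trm: "p x y z*(ln (p x y z)+ln (pz z) - ln (pxz x z) - ln (pyz y z)) >= p x y z - pxz x z * pyz y z/pz z"
  if xyz: "x \<in> A" "y \<in> B" for x y z
 proof (cases "p x y z = 0")
  case True then show ?thesis using nn by simp
 next
  case False
  then have p0: "p x y z > 0" using p[of x y z] by simp
  have "p x y z <= pxz x z" unfolding pxz_def by (rule member_le_sum) (use xyz fin p in auto)
  then have 1: "pxz x z > 0" using p0 by simp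
  have "p x y z <= pyz y z" unfolding pyz_def by (rule member_le_sum[of x A "%x. p x y z"]) (use xyz fin p in auto)
  then have 2: "pyz y z > 0" using p0 by simp
  have "pxz x z <= pz z" unfolding pz_alt(2) by (rule member_le_sum[of x A "%x. pxz x z"]) (use xyz fin nn in auto)
  then have 3: "pz z > 0" using 1 by simp
  let ?t = "pxz x z * pyz y z/(p x y z * pz z)"
  have t: "?t > 0" using p0 1 2 3 by simp
  have "ln ?t <= ?t - 1" by (rule ln_le_minus_one[OF t])
  moreover have "ln ?t = ln (pxz x z)+ln (pyz y z) - ln (p x y z) - ln (pz z)"
   using p0 1 2 3 by (simp add: ln_div ln_mult)
  ultimately have "1 - ?t <= ln (p x y z)+ln (pz z) - ln (pxz x z) - ln (pyz y z)" by simp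
  then have "p x y z*(1 - ?t) <= p x y z*(ln (p x y z)+ln (pz z) - ln (pxz x z) - ln (pyz y z))"
   using p0 by simp
  then show ?thesis using p0 by (simp add: algebra_simps)
 qed
 \<comment> \<open>The joint weights and their conditionally independent version have equal total
   mass, so the termwise lower bounds add up to zero.\<close>
 have "0 = (SUM z:C. pz z) - (SUM z:C. (SUM x:A. pxz x z)*(SUM y:B. pyz y z)/pz z)"
  unfolding pz_alt[symmetric] by simp
 also have "... = (SUM z:C. SUM x:A. SUM y:B. p x y z - pxz x z * pyz y z/pz z)"
  unfolding sum_subtractf by (simp add: pz_def sum_product sum_divide_distrib)
 also have "... <= (SUM z:C. SUM x:A. SUM y:B. p x y z*(ln (p x y z)+ln (pz z) - ln (pxz x z) - ln (pyz y z)))"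
  by (intro sum_mono trm)
 also have "... = (SUM z:C. (SUM x:A. SUM y:B. p x y z * ln (p x y z))+pz z * ln (pz z)
   - (SUM x:A. pxz x z * ln (pxz x z)) - (SUM y:B. pyz y z * ln (pyz y z)))"
 proof (rule sum.cong[OF refl])
  fix z
  have a: "(SUM x:A. SUM y:B. p x y z * ln (pz z)) = pz z * ln (pz z)"
   by (simp add: pz_def sum_distrib_right)
  have b: "(SUM x:A. SUM y:B. p x y z * ln (pxz x z)) = (SUM x:A. pxz x z * ln (pxz x z))"
   by (simp add: pxz_def sum_distrib_right)
  have c: "(SUM x:A. SUM y:B. p x y z * ln (pyz y z)) = (SUM y:B. pyz y z * ln (pyz y z))"
   by (subst sum.swap) (simp add: pyz_def sum_distrib_right)
  show "(SUM x:A. SUM y:B. p x y z*(ln (p x y z)+ln (pz z) - ln (pxz x z) - ln (pyz y z))) =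
   (SUM x:A. SUM y:B. p x y z * ln (p x y z))+pz z * ln (pz z)
   - (SUM x:A. pxz x z * ln (pxz x z)) - (SUM y:B. pyz y z * ln (pyz y z))"
   unfolding a[symmetric] b[symmetric] c[symmetric] by (simp add: algebra_simps sum.distrib sum_subtractf)
 qed
 also have "... = - (SUM z:C. SUM x:A. SUM y:B. \<eta> (p x y z)) - (SUM z:C. \<eta> (pz z))
   + (SUM z:C. SUM x:A. \<eta> (pxz x z))+(SUM z:C. SUM y:B. \<eta> (pyz y z))"
  by (simp add: \<eta>_def sum.distrib sum_subtractf sum_negf)
 also have "(SUM z:C. SUM x:A. SUM y:B. \<eta> (p x y z)) = (SUM x:A. SUM y:B. SUM z:C. \<eta> (p x y z))"
  by (subst sum.swap) (intro sum.cong refl sum.swap)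
 also have "(SUM z:C. SUM x:A. \<eta> (pxz x z)) = (SUM x:A. SUM z:C. \<eta> (pxz x z))" by (rule sum.swap)
 also have "(SUM z:C. SUM y:B. \<eta> (pyz y z)) = (SUM y:B. SUM z:C. \<eta> (pyz y z))" by (rule sum.swap)
 finally show ?thesis by simp
qed

context prob_space
begin

lemma Hent_strong_subadd:
 assumes X: "frv M X" and Y: "frv M Y" and Z: "frv M Z"
 shows "Hent M (%x. (X x, Y x, Z x))+Hent M Z <= Hent M (%x. (X x, Z x))+Hent M (%x. (Y x, Z x))"
proof -
 let ?A = "X ` space M" and ?B = "Y ` space M" and ?C = "Z ` space M"
 have fin: "finite ?A" "finite ?B" "finite ?C" using X Y Z by (auto simp: frv_def)
 define p where "p x y z = pr M (%t. (X t, Y t, Z t)) (x, y, z)" for x y z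
 have XYZ: "frv M (%x. (X x, Y x, Z x))" by (intro frv_pair X Y Z)
 have yz: "(SUM x:?A. p x y z) = pr M (%t. (Y t, Z t)) (y, z)" for y z
  unfolding p_def by (rule pr_marginal[OF X frv_pair[OF Y Z] fin(1)]) simp
 have xz: "(SUM y:?B. p x y z) = pr M (%t. (X t, Z t)) (x, z)" for x z
 proof -
  have "p x y z = pr M (%t. (Y t, X t, Z t)) (y, x, z)" for y
   unfolding p_def pr_def by (rule arg_cong[where f="measure M"]) auto
  then show ?thesis using pr_marginal[OF Y frv_pair[OF X Z] fin(2), of "(x, z)"] by simp
 qed
 have z: "(SUM x:?A. SUM y:?B. p x y z) = pr M Z z" for z
  unfolding xz by (rule pr_marginal[OF X Z fin(1)]) simp
 have H3: "Hent M (%x. (X x, Y x, Z x)) = (SUM x:?A. SUM y:?B. SUM z:?C. \<eta> (p x y z))"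
  by (subst Hent_superset[of "?A \<times> ?B \<times> ?C"]) (use fin in "auto simp: p_def sum.cartesian_product")
 have Hxz: "Hent M (%x. (X x, Z x)) = (SUM x:?A. SUM z:?C. \<eta> (SUM y:?B. p x y z))"
  by (subst Hent_superset[of "?A \<times> ?C"]) (use fin in "auto simp: xz sum.cartesian_product")
 have Hyz: "Hent M (%x. (Y x, Z x)) = (SUM y:?B. SUM z:?C. \<eta> (SUM x:?A. p x y z))"
  by (subst Hent_superset[of "?B \<times> ?C"]) (use fin in "auto simp: yz sum.cartesian_product")
 have Hz: "Hent M Z = (SUM z:?C. \<eta> (SUM x:?A. SUM y:?B. p x y z))"
  by (simp add: Hent_def z)
 show ?thesis unfolding H3 Hxz Hyz Hz
  by (rule strong_subadd_sum) (use fin in "auto simp: p_def")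
qed

lemma Hent_const: "Hent M (%_. c) = 0"
proof -
 have "(%_. c) -` {c} Int space M = space M" by auto
 then have "pr M (%_. c) c = 1" unfolding pr_def by (simp add: prob_space)
 then show ?thesis using not_empty by (simp add: Hent_def image_constant_conv \<eta>_def)
qed

lemma frv_const: "frv M (%_. c)"
 by (rule frv_comp[OF frv_indicator[OF sets.top], where g="%_. c"])

lemma Hent_subadd:
 assumes X: "frv M X" and Y: "frv M Y"
 shows "Hent M (%x. (X x, Y x)) <= Hent M X+Hent M Y"
proof -
 have "Hent M (%x. (X x, Y x)) = Hent M (%x. (X x, Y x, ()))"
  by (rule Hent_eq) (auto intro!: frv_pair X Y frv_const)
 moreover have "Hent M (%x. (X x, ())) = Hent M X" by (rule Hent_eq[OF X]) auto
 moreover have "Hent M (%x. (Y x, ())) = Hent M Y" by (rule Hent_eq[OF Y]) auto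
 ultimately show ?thesis using Hent_strong_subadd[OF X Y frv_const[of "()"]] Hent_const[of "()"] by simp
qed

lemma Hent_cond_subadd:
 assumes A: "frv M A" and B: "frv M B" and C: "frv M C" and D: "frv M D"
 shows "Hent M (%x. ((A x, B x), (C x, D x))) - Hent M (%x. (C x, D x))
  <= (Hent M (%x. (A x, C x)) - Hent M C)+(Hent M (%x. (B x, D x)) - Hent M D)"
proof -
 have CD: "frv M (%x. (C x, D x))" by (rule frv_pair[OF C D])
 have e1: "Hent M (%x. ((A x, B x), (C x, D x))) = Hent M (%x. (A x, B x, (C x, D x)))"
  by (rule Hent_eq) (auto intro!: frv_pair A B C D)
 have e2: "Hent M (%x. (A x, D x, C x)) = Hent M (%x. (A x, (C x, D x)))"
  by (rule Hent_eq) (auto intro!: frv_pair A B C D)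
 have e3: "Hent M (%x. (D x, C x)) = Hent M (%x. (C x, D x))"
  by (rule Hent_eq) (auto intro!: frv_pair A B C D)
 show ?thesis
  using Hent_strong_subadd[OF A B CD] Hent_strong_subadd[OF A D C] Hent_strong_subadd[OF B C D] e1 e2 e3 by simp
qed

lemma Hent_indicator_le:
 assumes "B \<in> sets M" shows "Hent M (%x. x \<in> B) = \<eta> (measure M B)+\<eta> (1 - measure M B)"
proof -
 have T: "(%x. x \<in> B) -` {True} Int space M = B" using sets.sets_into_space[OF assms] by auto
 have F: "(%x. x \<in> B) -` {False} Int space M = space M - B" by auto
 show ?thesis
  by (subst Hent_superset[of UNIV]) (auto simp: UNIV_bool pr_def T F prob_compl[OF assms])
qed

end

text \<open>The inequality \<open>- ln t <= 1/t - 1\<close> is applied at \<open>t = sqrt p\<close>,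
  which leaves a square root after multiplication by \<open>p\<close>.\<close>

lemma \<eta>_small:
 assumes "0 <= p" "p <= 1" shows "\<eta> p+\<eta> (1 - p) <= 3 * sqrt p"
proof -
 have neg_ln: "- ln t <= 1/t - 1" if "t > 0" for t :: real
  using ln_le_minus_one[of "1/t"] that by (simp add: ln_div)
 have 1: "\<eta> p <= 2 * sqrt p"
 proof (cases "p = 0")
  case False
  then have s: "sqrt p > 0" "p = sqrt p * sqrt p" using assms by auto
  have "- ln p = 2*(- ln (sqrt p))" using False assms by (simp add: ln_sqrt)
  also have "... <= 2*(1/sqrt p - 1)" by (intro mult_left_mono neg_ln s) auto
  finally have "p*(- ln p) <= p*(2*(1/sqrt p))" using assms by (intro mult_left_mono) auto
  also have "... = 2 * sqrt p" using s by (metis (no_types, opaque_lifting) less_irrefl mult.assoc mult.commute mult.right_neutral nonzero_mult_div_cancel_left times_divide_eq_right)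
  finally show ?thesis by (simp add: \<eta>_def)
 qed simp
 have 2: "\<eta> (1 - p) <= p"
 proof (cases "p = 1")
  case False
  then have "(1 - p)*(- ln (1 - p)) <= (1 - p)*(1/(1 - p) - 1)"
   using assms by (intro mult_left_mono neg_ln) auto
  also have "... = p" using False by (simp add: field_simps)
  finally show ?thesis by (simp add: \<eta>_def algebra_simps)
 qed simp
 have "p <= sqrt p"
  using assms by (metis mult_left_le real_sqrt_ge_0_iff real_sqrt_le_1_iff real_sqrt_mult_self abs_of_nonneg)
 with 1 2 show ?thesis by simp
qed

text \<open>Fekete's lemma. It is required because \<open>ent_rel\<close> is defined by
  \<open>lim\<close>, which carries information only for convergent sequences.\<close>

lemma fekete_convergent:
 fixes a :: "nat => real"
 assumes sub: "!!m n. a (m+n) <= a m+a n" and nn: "!!n. 0 <= a n"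
 shows "convergent (%n. a (Suc n)/real (Suc n))"
proof -
 define l where "l = (INF n. a (Suc n)/real (Suc n))"
 have bdd: "bdd_below (range (%n. a (Suc n)/real (Suc n)))"
  by (rule bdd_belowI[of _ 0]) (auto intro!: divide_nonneg_nonneg nn)
 have l: "l <= a (Suc n)/real (Suc n)" for n unfolding l_def by (rule cINF_lower[OF bdd]) simp
 have mult: "a (k * m) <= real k * a m" if "k > 0" for k m using that
 proof (induction k)
  case (Suc k)
  show ?case
  proof (cases "k = 0")
   case False
   then have "a (m+k * m) <= a m+real k * a m" using sub[of m "k * m"] Suc by auto
   then show ?thesis by (simp add: algebra_simps)
  qed simp
 qed simp
 have "(%n. a (Suc n)/real (Suc n)) \<longlonglongrightarrow> l"
 proof (rule order_tendstoI)
  fix r assume "r < l" then show "\<forall>\<^sub>F n in sequentially. r < a (Suc n)/real (Suc n)"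
   using l by (intro always_eventually allI) (rule less_le_trans)
 next
  fix r assume "l < r"
  then obtain i where i: "a (Suc i)/real (Suc i) < r"
   using cINF_less_iff[OF _ bdd, of r] unfolding l_def by auto
  define m where "m = Suc i"
  have m: "m > 0" "a m/real m < r" using i by (auto simp: m_def)
  define K where "K = (\<Sum>j<m. a j)+a m"
  have K: "a j <= K" if "j < m" for j
   unfolding K_def using member_le_sum[of j "{..<m}" a] nn that by (simp add: add_increasing2)
  have K0: "K >= 0" unfolding K_def by (intro add_nonneg_nonneg sum_nonneg nn)
  have le: "a n/real n <= a m/real m+K/real n" if "n > 0" for n
  proof -
   have "a n <= real (n div m) * a m+K"
   proof (cases "n div m = 0")
    case True
    then have "n < m" using m by (simp add: div_eq_0_iff)
    then show ?thesis using K True by simp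
   next
    case False
    have "a (n div m * m+n mod m) <= a (n div m * m)+a (n mod m)" by (rule sub)
    also have "... <= real (n div m) * a m+K" using False m by (intro add_mono mult K) auto
    finally show ?thesis by simp
   qed
   also have "real (n div m) * a m <= (real n/real m) * a m"
    using m by (intro mult_right_mono nn) (metis of_nat_div_le_of_nat)
   finally show ?thesis using that by (simp add: field_simps)
  qed
  have "(%n. K/real (Suc n)+a m/real m) \<longlonglongrightarrow> a m/real m"
   using tendsto_add[OF tendsto_mult_right_zero[OF LIMSEQ_inverse_real_of_nat, of K] tendsto_const[of "a m/real m"]]
   by (simp add: divide_inverse)
  from order_tendstoD(2)[OF this m(2)]
  show "\<forall>\<^sub>F n in sequentially. a (Suc n)/real (Suc n) < r"
  proof eventually_elim
   case (elim n) then show ?case using le[of "Suc n"] by simp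
  qed
 qed
 then show ?thesis by (auto simp: convergent_def)
qed

section \<open>Cylinders, the Borel structure and invariant measures\<close>

lemma open_eq_cylinders:
 assumes "Sigma_open S E U" shows "U = (\<Union>w\<in>{w. cyl S E w <= U}. cyl S E w)"
proof (intro equalityI subsetI)
 fix x assume x: "x \<in> U"
 then obtain r where r: "r > 0" "!!y. y \<in> Sigma_plus S E ==> sdist x y < r ==> y \<in> U" and xS: "x \<in> Sigma_plus S E"
  using assms unfolding Sigma_open_def by blast
 obtain n where n: "exp (- real n) < r"
 proof -
  obtain n where "real n > - ln r" using reals_Archimedean2 by blast
  then have "exp (- real n) < exp (ln r)" by (subst exp_less_cancel_iff) simp
  with r that show thesis by simp
 qed
 let ?w = "map x [0..<n]"
 have "cyl S E ?w <= U"
 proof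
  fix y assume y: "y \<in> cyl S E ?w"
  have "sdist x y < r"
  proof (cases "x = y")
   case False
   then have "EX i. x i ~= y i" by auto
   then have "x (tsep x y) ~= y (tsep x y)" unfolding tsep_def by (rule LeastI_ex)
   then have "n <= tsep x y" using y by (auto simp: cyl_def not_less[symmetric])
   then have "exp (- real (tsep x y)) <= exp (- real n)" by simp
   with n have "exp (- real (tsep x y)) < r" by linarith
   with False show ?thesis by (simp add: sdist_def)
  qed (use r in "simp add: sdist_def")
  with r y show "y \<in> U" by (auto simp: cyl_def)
 qed
 moreover have "x \<in> cyl S E ?w" using xS by (auto simp: cyl_def)
 ultimately show "x \<in> (\<Union>w\<in>{w. cyl S E w <= U}. cyl S E w)" by blast
qed auto

lemma open_cyl: "Sigma_open S E (cyl S E w)"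
 unfolding Sigma_open_def
proof (intro conjI ballI cyl_subset)
 fix x assume x: "x \<in> cyl S E w"
 show "EX r>0. ALL y:Sigma_plus S E. sdist x y < r --> y \<in> cyl S E w"
 proof (intro exI[of _ "exp (- real (length w))"] conjI ballI impI)
  fix y assume y: "y \<in> Sigma_plus S E" "sdist x y < exp (- real (length w))"
  show "y \<in> cyl S E w"
  proof (cases "x = y")
   case False
   then have "length w < tsep x y" using y by (simp add: sdist_def)
   then have "x i = y i" if "i < length w" for i
    using that not_less_Least[of i "%i. x i ~= y i"] unfolding tsep_def by auto
   then show ?thesis using x y by (auto simp: cyl_def)
  qed (use x in simp)
 qed simp
qed

lemma sets_borel_Sigma: "sets (borel_Sigma S E) = sigma_sets (Sigma_plus S E) (range (cyl S E))"
proof -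
 have sub: "Collect (Sigma_open S E) <= Pow (Sigma_plus S E)" by (auto simp: Sigma_open_def)
 have "sigma_sets (Sigma_plus S E) (Collect (Sigma_open S E)) = sigma_sets (Sigma_plus S E) (range (cyl S E))"
 proof (rule sigma_sets_eqI)
  fix U assume "U \<in> Collect (Sigma_open S E)"
  then have "U = (\<Union>w\<in>{w. cyl S E w <= U}. cyl S E w)" using open_eq_cylinders by simp
  also have "... \<in> sigma_sets (Sigma_plus S E) (range (cyl S E))"
   by (intro sigma_sets_UNION countableI_type countable_image) (auto intro: sigma_sets.Basic)
  finally show "U \<in> sigma_sets (Sigma_plus S E) (range (cyl S E))" .
 qed (auto intro: sigma_sets.Basic open_cyl)
 then show ?thesis unfolding borel_Sigma_def by (simp add: sets_measure_of[OF sub])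
qed

lemma space_borel_Sigma: "space (borel_Sigma S E) = Sigma_plus S E"
 unfolding borel_Sigma_def by (rule space_measure_of) (auto simp: Sigma_open_def)

lemma cyl_sets: "cyl S E w \<in> sets (borel_Sigma S E)"
 unfolding sets_borel_Sigma by (rule sigma_sets.Basic) simp

lemma cyl_Nil: "cyl S E [] = Sigma_plus S E" by (auto simp: cyl_def)

lemma cyl_Int: "cyl S E u Int cyl S E v \<in> insert {} (range (cyl S E))"
proof -
 have *: "cyl S E u Int cyl S E v \<in> insert {} (range (cyl S E))" if l: "length u <= length v" for u v
 proof (cases "ALL i<length u. u ! i = v ! i")
  case True
  then have "cyl S E u Int cyl S E v = cyl S E v" using l by (auto simp: cyl_def)
  then show ?thesis by simp
 next
  case False
  then have "cyl S E u Int cyl S E v = {}" using l by (auto simp: cyl_def)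
  then show ?thesis by simp
 qed
 show ?thesis using *[of u v] *[of v u] by (cases "length u <= length v") (auto simp: Int_commute)
qed

lemma cylinder_measure_eqI:
 assumes M: "sets M = sets (borel_Sigma S E)" "finite_measure M" and N: "sets N = sets (borel_Sigma S E)"
  and eq: "!!w. emeasure M (cyl S E w) = emeasure N (cyl S E w)"
 shows "M = N"
proof -
 let ?G = "insert {} (range (cyl S E))"
 have sg: "sets (borel_Sigma S E) = sigma_sets (Sigma_plus S E) ?G"
  unfolding sets_borel_Sigma
  by (rule sigma_sets_eqI) (auto intro: sigma_sets.Basic sigma_sets.Empty)
 interpret finite_measure M by fact
 show ?thesis
 proof (rule measure_eqI_generator_eq[of ?G "Sigma_plus S E" M N "%_. Sigma_plus S E"])
  show "Int_stable ?G" unfolding Int_stable_def using cyl_Int by fastforce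
  show "range (%_::nat. Sigma_plus S E) <= ?G" using cyl_Nil[of S E] by auto
  show "?G <= Pow (Sigma_plus S E)" using cyl_subset by blast
 qed (use M N sg eq in auto)
qed

locale inv_meas = tms +
 fixes \<mu> :: "(nat => nat) measure"
 assumes inv: "\<mu> \<in> inv_measures S E"
begin

lemma sets_mu: "sets \<mu> = sets (borel_Sigma S E)" using inv by (simp add: inv_measures_def)

lemma space_mu: "space \<mu> = Sg"
 using sets_eq_imp_space_eq[OF sets_mu] by (simp add: space_borel_Sigma)

sublocale prob_space \<mu> using inv by (simp add: inv_measures_def)

lemma shift_meas: "shift \<in> measurable \<mu> \<mu>" and distr_shift: "distr \<mu> \<mu> shift = \<mu>"
 using inv by (auto simp: inv_measures_def)

lemma shift_pow_meas [measurable]: "(shift^^k) \<in> measurable \<mu> \<mu>"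
 by (induction k) (auto intro: measurable_comp[OF _ shift_meas, unfolded comp_def] simp: comp_def)

lemma distr_shift_pow: "distr \<mu> \<mu> (shift^^k) = \<mu>"
proof (induction k)
 case (Suc k)
 have "distr \<mu> \<mu> (shift^^Suc k) = distr (distr \<mu> \<mu> (shift^^k)) \<mu> shift"
  by (subst distr_distr) (use shift_meas in "auto simp: comp_def")
 then show ?case unfolding Suc distr_shift .
qed (simp add: distr_id2[of \<mu> \<mu>, unfolded id_def] id_def)

lemma measure_shift_pow: "A \<in> sets \<mu> ==> measure \<mu> ((shift^^k) -` A Int space \<mu>) = measure \<mu> A"
 using measure_distr[OF shift_pow_meas, of A k] distr_shift_pow[of k] by simp

lemma integral_shift_pow:
 fixes g :: "(nat => nat) => real"
 assumes "g \<in> borel_measurable \<mu>" shows "(\<integral>x. g ((shift^^k) x) \<partial>\<mu>) = (\<integral>x. g x \<partial>\<mu>)"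
 using integral_distr[OF shift_pow_meas[of k], of g] assms distr_shift_pow[of k] by simp

lemma integrable_shift_pow:
 fixes g :: "(nat => nat) => real"
 assumes "integrable \<mu> g" shows "integrable \<mu> (%x. g ((shift^^k) x))"
 using integrable_distr[OF shift_pow_meas[of k], of g] assms distr_shift_pow[of k] by simp

lemma shift_space: "x \<in> space \<mu> ==> (shift^^k) x \<in> space \<mu>"
 by (simp add: space_mu Sigma_plus_shift)

lemma frv_shift: assumes "frv \<mu> X" shows "frv \<mu> (%x. X ((shift^^k) x))"
 unfolding frv_def
proof (intro conjI allI)
 show "finite ((%x. X ((shift^^k) x)) ` space \<mu>)"
  by (rule finite_subset[of _ "X ` space \<mu>"]) (use assms shift_space in "auto simp: frv_def")
 fix v
 have "(%x. X ((shift^^k) x)) -` {v} Int space \<mu> = (shift^^k) -` (X -` {v} Int space \<mu>) Int space \<mu>"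
  using shift_space by auto
 also have "... \<in> sets \<mu>" by (rule measurable_sets[OF shift_pow_meas]) (use assms in "auto simp: frv_def")
 finally show "(%x. X ((shift^^k) x)) -` {v} Int space \<mu> \<in> sets \<mu>" .
qed

lemma pr_shift: assumes "frv \<mu> X" shows "pr \<mu> (%x. X ((shift^^k) x)) v = pr \<mu> X v"
proof -
 have "(%x. X ((shift^^k) x)) -` {v} Int space \<mu> = (shift^^k) -` (X -` {v} Int space \<mu>) Int space \<mu>"
  using shift_space by auto
 then show ?thesis unfolding pr_def using measure_shift_pow[of "X -` {v} Int space \<mu>" k] assms by (simp add: frv_def)
qed

lemma Hent_shift: assumes "frv \<mu> X" shows "Hent \<mu> (%x. X ((shift^^k) x)) = Hent \<mu> X"
 by (subst Hent_superset[of "X ` space \<mu>"])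
  (use assms shift_space in "auto simp: frv_def Hent_def pr_shift[OF assms]")

definition nm :: "((nat => nat) => 'b) => nat => (nat => nat) => 'b list" where
 "nm X n x = map (%i. X ((shift^^i) x)) [0..<n]"

lemma nm_eq_iff: "nm X n x = nm Y n y \<longleftrightarrow> (ALL i<n. X ((shift^^i) x) = Y ((shift^^i) y))"
 by (auto simp: nm_def)

lemma nm_Suc: "nm X (Suc n) x = nm X n x@[X ((shift^^n) x)]" by (simp add: nm_def)

lemma frv_nm: assumes "frv \<mu> X" shows "frv \<mu> (nm X n)"
proof (induction n)
 case 0 then show ?case using frv_const[of "[]"] by (simp add: nm_def[abs_def])
next
 case (Suc n)
 from frv_comp[OF frv_pair[OF Suc frv_shift[OF assms, of n]], of "%(u, v). u@[v]"]
 show ?case by (simp add: nm_Suc[abs_def])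
qed

lemma Hent_nm_subadd:
 assumes "frv \<mu> X" shows "Hent \<mu> (nm X (m+n)) <= Hent \<mu> (nm X m)+Hent \<mu> (nm X n)"
proof -
 have "Hent \<mu> (nm X (m+n)) <= Hent \<mu> (%x. (nm X m x, nm X n ((shift^^m) x)))"
 proof (rule Hent_dep(2)[OF frv_pair[OF frv_nm[OF assms] frv_shift[OF frv_nm[OF assms]]]])
  fix x y assume H: "(nm X m x, nm X n ((shift^^m) x)) = (nm X m y, nm X n ((shift^^m) y))"
  show "nm X (m+n) x = nm X (m+n) y"
   unfolding nm_eq_iff
  proof (intro allI impI)
   fix i assume i: "i < m+n"
   show "X ((shift^^i) x) = X ((shift^^i) y)"
   proof (cases "i < m")
    case True then show ?thesis using H by (simp add: nm_eq_iff)
   next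
    case False
    then have "X ((shift^^(i - m)) ((shift^^m) x)) = X ((shift^^(i - m)) ((shift^^m) y))"
     using H i by (simp add: nm_eq_iff)
    then show ?thesis using False by (simp add: shift_pow)
   qed
  qed
 qed
 also have "... <= Hent \<mu> (nm X m)+Hent \<mu> (%x. nm X n ((shift^^m) x))"
  by (intro Hent_subadd frv_nm frv_shift assms)
 also have "Hent \<mu> (%x. nm X n ((shift^^m) x)) = Hent \<mu> (nm X n)" by (intro Hent_shift frv_nm assms)
 finally show ?thesis .
qed

lemma Hent_nm_convergent: "frv \<mu> X ==> convergent (%n. Hent \<mu> (nm X (Suc n))/real (Suc n))"
 by (rule fekete_convergent) (auto intro: Hent_nm_subadd Hent_nonneg)

text \<open>Finite-time form of h(X) <= h(Y) + H(X | Y); each further time step adds at most one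
  conditional entropy by \<open>Hent_cond_subadd\<close> and invariance.\<close>

lemma Hent_nm_cond:
 assumes X: "frv \<mu> X" and Y: "frv \<mu> Y"
 shows "Hent \<mu> (nm X n) <= Hent \<mu> (nm Y n)+real n*(Hent \<mu> (%x. (X x, Y x)) - Hent \<mu> Y)"
proof -
 have fX: "frv \<mu> (nm X n)" "frv \<mu> (%x. X ((shift^^n) x))" for n by (intro frv_nm frv_shift X)+
 have fY: "frv \<mu> (nm Y n)" "frv \<mu> (%x. Y ((shift^^n) x))" for n by (intro frv_nm frv_shift Y)+
 have "Hent \<mu> (%x. (nm X n x, nm Y n x)) - Hent \<mu> (nm Y n) <= real n*(Hent \<mu> (%x. (X x, Y x)) - Hent \<mu> Y)"
 proof (induction n)
  case 0
  have "Hent \<mu> (%x. (nm X 0 x, nm Y 0 x)) = 0" using Hent_const[of "([], [])"] by (simp add: nm_def)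
  moreover have "Hent \<mu> (nm Y 0) = 0" using Hent_const[of "[]"] by (simp add: nm_def[abs_def])
  ultimately show ?case by simp
 next
  case (Suc n)
  let ?A = "nm X n" and ?B = "%x. X ((shift^^n) x)" and ?C = "nm Y n" and ?D = "%x. Y ((shift^^n) x)"
  have "Hent \<mu> (%x. (nm X (Suc n) x, nm Y (Suc n) x)) = Hent \<mu> (%x. ((?A x, ?B x), (?C x, ?D x)))"
   by (rule Hent_eq) (auto intro!: frv_pair fX fY simp: nm_Suc)
  moreover have "Hent \<mu> (nm Y (Suc n)) = Hent \<mu> (%x. (?C x, ?D x))"
   by (rule Hent_eq) (auto intro!: frv_pair fX fY simp: nm_Suc)
  moreover have "Hent \<mu> (%x. (?B x, ?D x)) = Hent \<mu> (%x. (X x, Y x))"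
   by (rule Hent_shift[OF frv_pair[OF X Y]])
  moreover have "Hent \<mu> ?D = Hent \<mu> Y" by (rule Hent_shift[OF Y])
  ultimately show ?case using Hent_cond_subadd[OF fX(1) fX(2) fY(1) fY(2), of n n n n] Suc
   by (simp add: algebra_simps)
 qed
 moreover have "Hent \<mu> (nm X n) <= Hent \<mu> (%x. (nm X n x, nm Y n x))"
  by (rule Hent_dep(2)) (auto intro!: frv_pair fX fY)
 ultimately show ?thesis by simp
qed

definition lab :: "(nat => nat) set set => (nat => nat) => (nat => nat) set" where
 "lab P x = (THE B. B \<in> P & x \<in> B)"

lemma lab:
 assumes P: "fin_partition \<mu> P" and x: "x \<in> space \<mu>"
 shows "lab P x \<in> P" "x \<in> lab P x" "!!B. B \<in> P ==> x \<in> B \<longleftrightarrow> B = lab P x"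
proof -
 have "\<exists>!B. B \<in> P & x \<in> B" using P x by (auto simp: fin_partition_def disjoint_def)
 from theI'[OF this] show *: "lab P x \<in> P" "x \<in> lab P x" by (auto simp: lab_def)
 then show "!!B. B \<in> P ==> x \<in> B \<longleftrightarrow> B = lab P x" using P by (auto simp: fin_partition_def disjoint_def)
qed

lemma frv_lab: assumes P: "fin_partition \<mu> P" shows "frv \<mu> (lab P)"
 unfolding frv_def
proof (intro conjI allI)
 show "finite (lab P ` space \<mu>)"
  by (rule finite_subset[of _ P]) (use lab(1)[OF P] P in "auto simp: fin_partition_def")
 fix B
 show "lab P -` {B} Int space \<mu> \<in> sets \<mu>"
 proof (cases "B \<in> P")
  case True
  then have "lab P -` {B} Int space \<mu> = B"
   using lab(3)[OF P _ True] sets.sets_into_space[of B \<mu>] P by (auto simp: fin_partition_def)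
  then show ?thesis using True P by (auto simp: fin_partition_def)
 next
  case False
  then have "lab P -` {B} Int space \<mu> = {}" using lab(1)[OF P] by auto
  then show ?thesis by simp
 qed
qed

text \<open>\<open>join_part\<close> is a set of sets: coinciding intersections are counted once,
  and the empty one, if it occurs, contributes \<open>\<eta> 0 = 0\<close>.\<close>

lemma part_entropy_join:
 assumes P: "fin_partition \<mu> P"
 shows "part_entropy \<mu> (join_part \<mu> P n) = Hent \<mu> (nm (lab P) n)"
proof -
 let ?X = "nm (lab P) n"
 let ?fib = "%v. ?X -` {v} Int space \<mu>"
 let ?J = "join_part \<mu> P n"
 have fin: "finite (?X ` space \<mu>)" using frv_nm[OF frv_lab[OF P]] by (simp add: frv_def)
 have eqs: "x \<in> space \<mu> Int (\<Inter>k<n. (shift^^k) -` A k) \<longleftrightarrow> x \<in> space \<mu> & ?X x = map A [0..<n]"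
  if A: "ALL k<n. A k \<in> P" for A x
  using lab(3)[OF P shift_space, of x] A by (auto simp: nm_def)
 have img: "?J - {{}} = ?fib ` (?X ` space \<mu>)"
 proof (intro equalityI subsetI)
  fix B assume "B \<in> ?J - {{}}"
  then obtain A where A: "ALL k<n. A k \<in> P" "B = space \<mu> Int (\<Inter>k<n. (shift^^k) -` A k)" "B ~= {}"
   by (auto simp: join_part_def)
  have B: "B = ?fib (map A [0..<n])"
  proof (rule set_eqI)
   fix x show "x \<in> B \<longleftrightarrow> x \<in> ?fib (map A [0..<n])" unfolding A(2) eqs[OF A(1)] by auto
  qed
  with A(3) obtain x where "x \<in> space \<mu>" "?X x = map A [0..<n]" by auto
  then show "B \<in> ?fib ` (?X ` space \<mu>)" using B by force
 next
  fix B assume "B \<in> ?fib ` (?X ` space \<mu>)"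
  then obtain x where x: "x \<in> space \<mu>" "B = ?fib (?X x)" by auto
  let ?A = "%k. lab P ((shift^^k) x)"
  have A: "ALL k<n. ?A k \<in> P" using lab(1)[OF P shift_space[OF x(1)]] by auto
  have "?X x = map ?A [0..<n]" by (simp add: nm_def)
  then have "y \<in> B \<longleftrightarrow> y \<in> space \<mu> Int (\<Inter>k<n. (shift^^k) -` ?A k)" for y
   unfolding x(2) eqs[OF A] by auto
  then have "B = space \<mu> Int (\<Inter>k<n. (shift^^k) -` ?A k)" by (rule set_eqI)
  then show "B \<in> ?J - {{}}" using A x by (auto simp: join_part_def)
 qed
 have finJ: "finite ?J" using finite_imageI[OF fin, of ?fib] unfolding img[symmetric] by simp
 have "part_entropy \<mu> ?J = (SUM B:?J. \<eta> (measure \<mu> B))"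
  by (simp add: part_entropy_def \<eta>_def sum_negf)
 also have "... = (SUM B:?J - {{}}. \<eta> (measure \<mu> B))"
  by (rule sum.mono_neutral_right) (use finJ in auto)
 also have "... = (SUM v:?X ` space \<mu>. \<eta> (measure \<mu> (?fib v)))"
  unfolding img by (rule sum.reindex_cong[OF _ refl refl]) (auto simp: inj_on_def)
 finally show ?thesis by (simp add: Hent_def pr_def)
qed

lemma ent_rel_lim:
 assumes P: "fin_partition \<mu> P"
 shows "(%n. Hent \<mu> (nm (lab P) (Suc n))/real (Suc n)) \<longlonglongrightarrow> ent_rel \<mu> P"
 using Hent_nm_convergent[OF frv_lab[OF P]] unfolding ent_rel_def part_entropy_join[OF P] convergent_LIMSEQ_iff .

text \<open>The fibres of \<open>X\<close> form an admissible partition, and the constant loss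
  \<open>d\<close> disappears after division by the time.\<close>

lemma ks_entropy_ge:
 assumes X: "frv \<mu> X" and c: "!!n. real (Suc n) * c - d <= Hent \<mu> (nm X (Suc n))"
 shows "ereal c <= ks_entropy \<mu>"
proof -
 define P where "P = (%v. X -` {v} Int space \<mu>) ` (X ` space \<mu>)"
 have P: "fin_partition \<mu> P"
  unfolding fin_partition_def P_def disjoint_def using X by (auto simp: frv_def)
 have labX: "lab P x = X -` {X x} Int space \<mu>" if "x \<in> space \<mu>" for x
  using lab(3)[OF P that, of "X -` {X x} Int space \<mu>"] that by (auto simp: P_def)
 have "Hent \<mu> (nm (lab P) n) = Hent \<mu> (nm X n)" for n
 proof (rule Hent_eq[OF frv_nm[OF X]])
  fix x y assume xy: "x \<in> space \<mu>" "y \<in> space \<mu>"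
  have "X u = X v \<longleftrightarrow> lab P u = lab P v" if "u \<in> space \<mu>" "v \<in> space \<mu>" for u v
   using that unfolding labX[OF that(1)] labX[OF that(2)] by auto
  then show "nm X n x = nm X n y \<longleftrightarrow> nm (lab P) n x = nm (lab P) n y"
   unfolding nm_eq_iff using xy shift_space by auto
 qed
 then have L: "(%n. Hent \<mu> (nm X (Suc n))/real (Suc n)) \<longlonglongrightarrow> ent_rel \<mu> P" using ent_rel_lim[OF P] by simp
 have "(%n. c - d/real (Suc n)) \<longlonglongrightarrow> c"
  using tendsto_diff[OF tendsto_const[of c] tendsto_mult_right_zero[OF LIMSEQ_inverse_real_of_nat, of d]]
  by (simp add: divide_inverse)
 then have "c <= ent_rel \<mu> P"
 proof (rule LIMSEQ_le[OF _ L], intro exI allI impI)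
  fix n
  have "c - d/real (Suc n) = (real (Suc n) * c - d)/real (Suc n)" by (simp add: field_simps)
  also have "... <= Hent \<mu> (nm X (Suc n))/real (Suc n)" by (intro divide_right_mono c) simp
  finally show "c - d/real (Suc n) <= Hent \<mu> (nm X (Suc n))/real (Suc n)" .
 qed
 then show ?thesis unfolding ks_entropy_def by (intro SUP_upper2[of P]) (use P in auto)
qed

text \<open>Merging all states from \<open>k\<close> on gives a finite partition. As
  \<open>k\<close> grows these partitions and their shifts generate the Borel sets.\<close>

definition ck :: "nat => (nat => nat) => nat" where "ck k x = min (x 0) k"

lemma nm_ck_nth: "i < m ==> nm (ck k) m x ! i = min (x i) k"
 by (simp add: nm_def ck_def shift_pow)

lemma nm_ck_eq_iff: "nm (ck k) m x = nm (ck k) m y \<longleftrightarrow> (ALL i<m. min (x i) k = min (y i) k)"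
 by (auto simp: nm_def ck_def shift_pow)

lemma cyl_mu [simp]: "Cy w \<in> sets \<mu>" by (simp add: sets_mu cyl_sets)

lemma frv_coord: "(%x. x i) -` B Int space \<mu> \<in> sets \<mu>"
proof -
 have "(%x. x i) -` B Int space \<mu> = (\<Union>s\<in>B. (shift^^i) -` Cy [s] Int space \<mu>)"
  by (auto simp: cyl1_iff shift_pow space_mu Sigma_plus_def)
 also have "... \<in> sets \<mu>" by (rule sets.countable_UN') (auto intro!: measurable_sets[OF shift_pow_meas])
 finally show ?thesis .
qed

lemma frv_ck: "frv \<mu> (ck k)"
 unfolding frv_def
proof (intro conjI allI)
 show "finite (ck k ` space \<mu>)" by (rule finite_subset[of _ "{..k}"]) (auto simp: ck_def)
 fix v show "ck k -` {v} Int space \<mu> \<in> sets \<mu>"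
  using frv_coord[of 0 "{s. min s k = v}"] by (simp add: ck_def vimage_def)
qed

definition approx :: "nat => nat => nat list set => (nat => nat) set" where
 "approx k m G = {x\<in>space \<mu>. nm (ck k) m x \<in> G}"

lemma approx_sets [simp]: "approx k m G \<in> sets \<mu>"
 using frv_vimage[OF frv_nm[OF frv_ck], of k m G] by (simp add: approx_def vimage_def Int_def conj_commute)

lemma approx_refine: assumes "k <= k'" "m <= m'" shows "EX G'. approx k m G = approx k' m' G'"
proof -
 have dep: "nm (ck k) m x = nm (ck k) m y" if "nm (ck k') m' x = nm (ck k') m' y" for x y
  unfolding nm_ck_eq_iff
 proof (intro allI impI)
  fix i assume "i < m"
  then have "min (x i) k' = min (y i) k'" using that assms(2) by (auto simp: nm_ck_eq_iff)
  then show "min (x i) k = min (y i) k" using assms(1) by (auto simp: min_def split: if_splits)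
 qed
 have "approx k m G = approx k' m' (nm (ck k') m' ` approx k m G)"
 proof (intro equalityI subsetI)
  fix x assume "x \<in> approx k m G"
  then show "x \<in> approx k' m' (nm (ck k') m' ` approx k m G)" unfolding approx_def[of k'] by (simp add: approx_def)
 next
  fix x assume "x \<in> approx k' m' (nm (ck k') m' ` approx k m G)"
  then obtain y where "x \<in> space \<mu>" "y \<in> approx k m G" "nm (ck k') m' x = nm (ck k') m' y"
   unfolding approx_def[of k'] by blast
  with dep[of x y] show "x \<in> approx k m G" by (simp add: approx_def)
 qed
 then show ?thesis by blast
qed

text \<open>Induction over the generated sigma-algebra. The conclusion for all large
  \<open>k\<close> and \<open>m\<close> at once comes from \<open>approx_refine\<close>; it lets
  finitely many sets share one pair of parameters.\<close>

lemma borel_approx: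
 assumes "B \<in> sets \<mu>" "dlt > 0"
 shows "EX k0. ALL k>=k0. ALL m>=k0. EX G. measure \<mu> (B - approx k m G Un (approx k m G - B)) < dlt"
proof -
 have "B \<in> sigma_sets (Sg) (range (Cy))" using assms sets_mu sets_borel_Sigma by simp
 then have "ALL dlt>0. EX k m G. measure \<mu> (B - approx k m G Un (approx k m G - B)) < dlt"
 proof (induction rule: sigma_sets.induct)
  case (Basic B)
  then obtain w where w: "B = Cy w" by auto
  define k where "k = Suc (Max (insert 0 (set w)))"
  have k: "w ! i < k" if "i < length w" for i using that by (auto simp: k_def less_Suc_eq_le)
  have "approx k (length w) {w} = B"
  proof -
   have "nm (ck k) (length w) x = w \<longleftrightarrow> (ALL i<length w. x i = w ! i)" for x
   proof
    assume H: "nm (ck k) (length w) x = w"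
    show "ALL i<length w. x i = w ! i"
    proof (intro allI impI)
     fix i assume i: "i < length w"
     have "min (x i) k = w ! i" using nm_ck_nth[OF i, of k x] H by simp
     with k[OF i] show "x i = w ! i" by (auto simp: min_def split: if_splits)
    qed
   next
    assume H: "ALL i<length w. x i = w ! i"
    show "nm (ck k) (length w) x = w"
    proof (rule nth_equalityI)
     show "length (nm (ck k) (length w) x) = length w" by (simp add: nm_def)
     fix i assume "i < length (nm (ck k) (length w) x)"
     then have i: "i < length w" by (simp add: nm_def)
     show "nm (ck k) (length w) x ! i = w ! i"
      using nm_ck_nth[OF i, of k x] H i k[OF i] by simp
    qed
   qed
   then show ?thesis unfolding w approx_def by (auto simp: cyl_def space_mu)
  qed
  then have "B - approx k (length w) {w} Un (approx k (length w) {w} - B) = {}" by auto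
  then show ?case by (metis measure_empty)
 next
  case Empty
  have "{} - approx 0 0 {} Un (approx 0 0 {} - {}) = {}" by (auto simp: approx_def)
  then show ?case by (metis measure_empty)
 next
  case (Compl B)
  show ?case
  proof (intro allI impI)
   fix dlt :: real assume "dlt > 0"
   then obtain k m G where G: "measure \<mu> (B - approx k m G Un (approx k m G - B)) < dlt" using Compl by blast
   have "(Sg - B) - approx k m (- G) Un (approx k m (- G) - (Sg - B))
     = (B Int Sg) - approx k m G Un (approx k m G - B)"
    by (auto simp: approx_def space_mu)
   also have "B Int Sg = B"
    using sigma_sets_into_sp[OF _ Compl.hyps] cyl_subset by blast
   finally show "EX k m G. measure \<mu> (Sg - B - approx k m G Un (approx k m G - (Sg - B))) < dlt"
    using G by metis
  qed
 next
  case (Union B)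
  have Bs: "B i \<in> sets \<mu>" for i using Union.hyps by (simp add: sets_mu sets_borel_Sigma)
  show ?case
  proof (intro allI impI)
   fix dlt :: real assume dlt: "dlt > 0"
   let ?U = "%n. \<Union>i<n. B i"
   have "(%n. measure \<mu> (?U n)) \<longlonglongrightarrow> measure \<mu> (\<Union>n. ?U n)"
    by (rule finite_Lim_measure_incseq) (use Bs in "auto simp: incseq_def intro: less_le_trans")
   moreover have "(\<Union>n. ?U n) = (\<Union>i. B i)" by auto
   ultimately have "(%n. measure \<mu> (?U n)) \<longlonglongrightarrow> measure \<mu> (\<Union>i. B i)" by simp
   from LIMSEQ_D[OF this, of "dlt/2"] dlt obtain n where n: "\<bar>measure \<mu> (?U n) - measure \<mu> (\<Union>i. B i)\<bar> < dlt/2"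
    by auto
   have "measure \<mu> ((\<Union>i. B i) - ?U n) = measure \<mu> (\<Union>i. B i) - measure \<mu> (?U n)"
    by (rule finite_measure_Diff) (use Bs in auto)
   with n have tail: "measure \<mu> ((\<Union>i. B i) - ?U n) < dlt/2" by linarith
   define e where "e = dlt/(2*(real n+1))"
   have e: "e > 0" using dlt by (simp add: e_def)
   have "EX k m G. measure \<mu> (B i - approx k m G Un (approx k m G - B i)) < e" for i using Union.IH[of i] e by blast
   then obtain kk mm GG where G: "!!i. measure \<mu> (B i - approx (kk i) (mm i) (GG i) Un (approx (kk i) (mm i) (GG i) - B i)) < e"
    by metis
   define k where "k = Max (insert 0 (kk ` {..<n}))" define m where "m = Max (insert 0 (mm ` {..<n}))"
   have km: "kk i <= k" "mm i <= m" if "i < n" for i using that by (auto simp: k_def m_def)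
   have "ALL i. EX G'. i < n --> approx (kk i) (mm i) (GG i) = approx k m G'" using approx_refine km by blast
   then obtain G' where G': "!!i. i < n ==> approx (kk i) (mm i) (GG i) = approx k m (G' i)" by metis
   let ?A = "approx k m (\<Union>i<n. G' i)"
   let ?D = "%i. B i - approx k m (G' i) Un (approx k m (G' i) - B i)"
   have Ds: "?D i \<in> sets \<mu>" for i by (intro sets.Un sets.Diff Bs approx_sets)
   have DL: "measure \<mu> (?D i) <= e" if "i < n" for i using G[of i] unfolding G'[OF that] by (rule less_imp_le)
   have sub: "(\<Union>i. B i) - ?A Un (?A - (\<Union>i. B i)) <= ((\<Union>i. B i) - ?U n) Un (\<Union>i<n. ?D i)"
    by (auto simp: approx_def)
   have "measure \<mu> ((\<Union>i. B i) - ?A Un (?A - (\<Union>i. B i))) <= measure \<mu> (((\<Union>i. B i) - ?U n) Un (\<Union>i<n. ?D i))"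
    by (rule finite_measure_mono[OF sub]) (use Bs Ds in auto)
   also have "... <= measure \<mu> ((\<Union>i. B i) - ?U n)+measure \<mu> (\<Union>i<n. ?D i)"
    by (rule measure_Un_le) (use Bs Ds in auto)
   also have "measure \<mu> (\<Union>i<n. ?D i) <= (\<Sum>i<n. measure \<mu> (?D i))"
    by (rule finite_measure_subadditive_finite) (use Ds in auto)
   also have "(\<Sum>i<n. measure \<mu> (?D i)) <= real n*e"
    using sum_bounded_above[of "{..<n}" "%i. measure \<mu> (?D i)" e] DL by simp
   also have "real n*e <= dlt/2" using dlt by (simp add: e_def field_simps)
   finally show "EX k m G. measure \<mu> (\<Union> (range B) - approx k m G Un (approx k m G - \<Union> (range B))) < dlt"
    using tail by (intro exI[of _ k] exI[of _ m] exI[of _ "\<Union>i<n. G' i"]) simp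
  qed
 qed
 then obtain k m G where G: "measure \<mu> (B - approx k m G Un (approx k m G - B)) < dlt" using assms by blast
 show ?thesis
 proof (intro exI[of _ "max k m"] allI impI)
  fix k' m' assume "max k m <= k'" "max k m <= m'"
  then obtain G' where "approx k m G = approx k' m' G'" using approx_refine[of k k' m m' G] by auto
  with G show "EX G. measure \<mu> (B - approx k' m' G Un (approx k' m' G - B)) < dlt" by metis
 qed
qed

text \<open>A cell of \<open>P\<close> is determined by the truncated word \<open>R\<close> together
  with the set of cells at which the approximation errs. The indicators of these errors have small
  entropy, so H(P | R) <= e.\<close>

lemma partition_approx:
 assumes P: "fin_partition \<mu> P" and e: "e > 0"
 shows "EX k>=k0. EX m. ALL n. Hent \<mu> (nm (lab P) n) <= Hent \<mu> (nm (ck k) (n+m))+real n*e"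
proof -
 have finP: "finite P" and Ps: "!!B. B \<in> P ==> B \<in> sets \<mu>" using P by (auto simp: fin_partition_def)
 \<comment> \<open>Chosen so that \<open>card P\<close> error indicators, each of entropy at most
   \<open>3 * sqrt dlt\<close> by \<open>\<eta>_small\<close>, cost less than \<open>e\<close> in
   total.\<close>
 define dlt where "dlt = (e/(3*(real (card P)+1)))\<^sup>2"
 have dlt: "dlt > 0" using e by (auto simp: dlt_def intro!: zero_less_power divide_pos_pos)
 have "ALL B:P. EX k1. ALL k>=k1. ALL m>=k1. EX G. measure \<mu> (B - approx k m G Un (approx k m G - B)) < dlt"
  using borel_approx[OF Ps dlt] by blast
 then obtain k1 where k1: "!!B k m. B \<in> P ==> k >= k1 B ==> m >= k1 B ==>
   EX G. measure \<mu> (B - approx k m G Un (approx k m G - B)) < dlt" by metis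
 define k where "k = Max (insert k0 (k1 ` P))"
 have k: "k >= k0" "!!B. B \<in> P ==> k >= k1 B" using finP by (auto simp: k_def)
 have "ALL B:P. EX G. measure \<mu> (B - approx k k G Un (approx k k G - B)) < dlt" using k1 k by blast
 then obtain G where G: "!!B. B \<in> P ==> measure \<mu> (B - approx k k (G B) Un (approx k k (G B) - B)) < dlt" by metis
 define D where "D B = B - approx k k (G B) Un (approx k k (G B) - B)" for B
 have Ds: "D B \<in> sets \<mu>" if "B \<in> P" for B using Ps[OF that] unfolding D_def by (intro sets.Un sets.Diff approx_sets)
 define R where "R = nm (ck k) k"
 have fR: "frv \<mu> R" unfolding R_def by (intro frv_nm frv_ck)
 have DH: "frv \<mu> (%x. {B\<in>Q. x \<in> D B}) & Hent \<mu> (%x. {B\<in>Q. x \<in> D B}) <= (SUM B:Q. Hent \<mu> (%x. x \<in> D B))" if "Q <= P" for Q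
  using finite_subset[OF that finP] that
 proof (induction Q rule: finite_induct)
  case empty then show ?case by (simp add: frv_const Hent_const)
 next
  case (insert B Q)
  have fB: "frv \<mu> (%x. x \<in> D B)" using Ds insert.prems by (intro frv_indicator) auto
  have fQ: "frv \<mu> (%x. {B\<in>Q. x \<in> D B})" using insert by auto
  have dep: "{C\<in>insert B Q. x \<in> D C} = {C\<in>insert B Q. y \<in> D C}"
   if "(x \<in> D B, {B\<in>Q. x \<in> D B}) = (y \<in> D B, {B\<in>Q. y \<in> D B})" for x y using that by auto
  note H = Hent_dep[OF frv_pair[OF fB fQ], of "%x. {C\<in>insert B Q. x \<in> D C}", OF dep]
  have "Hent \<mu> (%x. {C\<in>insert B Q. x \<in> D C}) <= Hent \<mu> (%x. x \<in> D B)+Hent \<mu> (%x. {B\<in>Q. x \<in> D B})"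
   using H(2) Hent_subadd[OF fB fQ] by linarith
  then show ?case using H(1) insert by auto
 qed
 have fD: "frv \<mu> (%x. {B\<in>P. x \<in> D B})" using DH by auto
 have "Hent \<mu> (%x. {B\<in>P. x \<in> D B}) <= (SUM B:P. Hent \<mu> (%x. x \<in> D B))" using DH by auto
 also have "... <= real (card P)*(3 * sqrt dlt)"
 proof (rule sum_bounded_above)
  fix B assume B: "B \<in> P"
  have "Hent \<mu> (%x. x \<in> D B) <= 3 * sqrt (measure \<mu> (D B))"
   unfolding Hent_indicator_le[OF Ds[OF B]] by (rule \<eta>_small) auto
  also have "... <= 3 * sqrt dlt" using G[OF B] by (simp add: D_def)
  finally show "Hent \<mu> (%x. x \<in> D B) <= 3 * sqrt dlt" .
 qed
 also have "... <= e"
 proof -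
  have "sqrt dlt = e/(3*(real (card P)+1))" unfolding dlt_def using e by simp
  then have "real (card P)*(3 * sqrt dlt)+3 * sqrt dlt = e" by (simp add: field_simps)
  moreover have "sqrt dlt >= 0" using dlt by simp
  ultimately show ?thesis by linarith
 qed
 finally have HD: "Hent \<mu> (%x. {B\<in>P. x \<in> D B}) <= e" .
 have "Hent \<mu> (%x. (lab P x, R x)) <= Hent \<mu> (%x. ({B\<in>P. x \<in> D B}, R x))"
 proof (rule Hent_dep(2)[OF frv_pair[OF fD fR]])
  fix x y assume xy: "x \<in> space \<mu>" "y \<in> space \<mu>" and eq: "({B\<in>P. x \<in> D B}, R x) = ({B\<in>P. y \<in> D B}, R y)"
  have "x \<in> approx k k (G B) \<longleftrightarrow> y \<in> approx k k (G B)" for B using eq xy by (auto simp: approx_def R_def)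
  moreover have "x \<in> D B \<longleftrightarrow> y \<in> D B" if "B \<in> P" for B using eq that by auto
  ultimately have "x \<in> B \<longleftrightarrow> y \<in> B" if "B \<in> P" for B using that by (auto simp: D_def)
  then have "y \<in> lab P x" using lab[OF P xy(1)] by auto
  then have "lab P x = lab P y" using lab(3)[OF P xy(2) lab(1)[OF P xy(1)]] by simp
  then show "(lab P x, R x) = (lab P y, R y)" using eq by simp
 qed
 also have "... <= Hent \<mu> (%x. {B\<in>P. x \<in> D B})+Hent \<mu> R" by (rule Hent_subadd[OF fD fR])
 finally have cond: "Hent \<mu> (%x. (lab P x, R x)) - Hent \<mu> R <= e" using HD by simp
 have "Hent \<mu> (nm (lab P) n) <= Hent \<mu> (nm (ck k) (n+k))+real n*e" for n
 proof -
  have "Hent \<mu> (nm (lab P) n) <= Hent \<mu> (nm R n)+real n*(Hent \<mu> (%x. (lab P x, R x)) - Hent \<mu> R)"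
   by (rule Hent_nm_cond[OF frv_lab[OF P] fR])
  also have "... <= Hent \<mu> (nm R n)+real n*e" using cond by (intro add_left_mono mult_left_mono) auto
  also have "Hent \<mu> (nm R n) <= Hent \<mu> (nm (ck k) (n+k))"
  proof (rule Hent_dep(2)[OF frv_nm[OF frv_ck]])
   fix x y assume H: "nm (ck k) (n+k) x = nm (ck k) (n+k) y"
   show "nm R n x = nm R n y"
    unfolding nm_eq_iff[of R]
   proof (intro allI impI)
    fix i assume i: "i < n"
    show "R ((shift^^i) x) = R ((shift^^i) y)"
     unfolding R_def nm_ck_eq_iff
    proof (intro allI impI)
     fix j assume "j < k"
     then have "j+i < n+k" using i by simp
     then show "min ((shift^^i) x j) k = min ((shift^^i) y j) k"
      using H[unfolded nm_ck_eq_iff, rule_format, of "j+i"] by (simp add: shift_pow)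
    qed
   qed
  qed
  finally show ?thesis by simp
 qed
 with k show ?thesis by blast
qed

text \<open>By \<open>partition_approx\<close> it is enough to bound the truncated partitions for
  all large \<open>k\<close>. The error of order \<open>sqrt n\<close> leaves room for logarithmic
  terms.\<close>

lemma ks_entropy_le:
 assumes "!!e k0. e > 0 ==> EX k1>=k0. ALL k>=k1. EX d. ALL n>=1. Hent \<mu> (nm (ck k) n) <= real n*(c+e)+d * sqrt (real n)"
 shows "ks_entropy \<mu> <= ereal c"
 unfolding ks_entropy_def
proof (rule SUP_least, clarify)
 fix P assume P: "fin_partition \<mu> P"
 have "ent_rel \<mu> P <= c+2*e" if e: "e > 0" for e
 proof -
  obtain k1 where k1: "!!k. k >= k1 ==> EX d. ALL n>=1. Hent \<mu> (nm (ck k) n) <= real n*(c+e)+d * sqrt (real n)"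
   using assms[OF e, of 0] by blast
  obtain k m where k: "k >= k1" "!!n. Hent \<mu> (nm (lab P) n) <= Hent \<mu> (nm (ck k) (n+m))+real n*e"
   using partition_approx[OF P e, of k1] by blast
  obtain d where d: "!!n. n >= 1 ==> Hent \<mu> (nm (ck k) n) <= real n*(c+e)+d * sqrt (real n)"
   using k1[OF k(1)] by blast
  have le: "Hent \<mu> (nm (lab P) (Suc n))/real (Suc n) <= c+2*e+(real m*(c+e))/real (Suc n)+\<bar>d\<bar> * sqrt (1+real m)/sqrt (real (Suc n))" for n
  proof -
   let ?N = "real (Suc n)"
   have s: "sqrt (real (Suc n+m)) <= sqrt (1+real m) * sqrt ?N"
    unfolding real_sqrt_mult[symmetric] by (rule real_sqrt_le_mono) (simp add: algebra_simps)
   have "Hent \<mu> (nm (lab P) (Suc n)) <= (real (Suc n+m)*(c+e)+d * sqrt (real (Suc n+m)))+?N*e"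
    using k(2)[of "Suc n"] d[of "Suc n+m"] by simp
   also have "... <= (real (Suc n+m)*(c+e)+\<bar>d\<bar>*(sqrt (1+real m) * sqrt ?N))+?N*e"
    by (intro add_mono order_refl mult_mono s) auto
   finally have "Hent \<mu> (nm (lab P) (Suc n)) <= ?N*(c+2*e)+real m*(c+e)+\<bar>d\<bar> * sqrt (1+real m) * sqrt ?N"
    by (simp add: algebra_simps)
   then have "Hent \<mu> (nm (lab P) (Suc n))/?N <= (?N*(c+2*e)+real m*(c+e)+\<bar>d\<bar> * sqrt (1+real m) * sqrt ?N)/?N"
    by (rule divide_right_mono) simp
   also have "... = c+2*e+(real m*(c+e))/?N+\<bar>d\<bar> * sqrt (1+real m)*(sqrt ?N/?N)"
    by (simp add: add_divide_distrib)
   also have "sqrt ?N/?N = 1/sqrt ?N" by (simp add: real_div_sqrt field_simps)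
   finally show ?thesis by simp
  qed
  have "(%n. c+2*e+(real m*(c+e))/real (Suc n)+\<bar>d\<bar> * sqrt (1+real m)/sqrt (real (Suc n))) \<longlonglongrightarrow> c+2*e+0+0"
  proof (intro tendsto_add tendsto_const)
   show "(%n. (real m*(c+e))/real (Suc n)) \<longlonglongrightarrow> 0"
    using tendsto_mult_right_zero[OF LIMSEQ_inverse_real_of_nat] by (simp add: divide_inverse)
   have "(%n. sqrt (inverse (real (Suc n)))) \<longlonglongrightarrow> sqrt 0" by (intro tendsto_real_sqrt LIMSEQ_inverse_real_of_nat)
   from tendsto_mult_right_zero[OF this[simplified], of "\<bar>d\<bar> * sqrt (1+real m)"]
   show "(%n. \<bar>d\<bar> * sqrt (1+real m)/sqrt (real (Suc n))) \<longlonglongrightarrow> 0"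
    by (simp add: divide_inverse real_sqrt_inverse)
  qed
  from LIMSEQ_le[OF ent_rel_lim[OF P] this] le show ?thesis by auto
 qed
 then have "ent_rel \<mu> P <= c+e" if "e > 0" for e using that[THEN half_gt_zero] by fastforce
 then show "ereal (ent_rel \<mu> P) <= ereal c" by (auto intro: field_le_epsilon)
qed

end

section \<open>The variational upper bound\<close>

lemma cyl_continuous_measurable:
 fixes g :: "(nat => nat) => real"
 assumes sets: "sets M = sets (borel_Sigma S E)"
  and cont: "!!x e. x \<in> Sigma_plus S E ==> e > 0 ==> EX n. ALL y:Sigma_plus S E. (ALL i<n. x i = y i) --> \<bar>g x - g y\<bar> < e"
 shows "g \<in> borel_measurable M"
proof (rule borel_measurableI)
 fix U :: "real set" assume U: "open U"
 have sp: "space M = Sigma_plus S E" using sets_eq_imp_space_eq[OF sets] by (simp add: space_borel_Sigma)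
 let ?V = "g -` U Int Sigma_plus S E"
 have "?V = (\<Union>w\<in>{w. cyl S E w <= ?V}. cyl S E w)"
 proof (intro equalityI subsetI)
  fix x assume x: "x \<in> ?V"
  then obtain e where e: "e > 0" "ball (g x) e <= U" using U open_contains_ball[of U] by blast
  obtain n where n: "!!y. y \<in> Sigma_plus S E ==> (ALL i<n. x i = y i) ==> \<bar>g x - g y\<bar> < e" using cont[of x e] x e by auto
  have "cyl S E (map x [0..<n]) <= ?V"
  proof
   fix y assume y: "y \<in> cyl S E (map x [0..<n])"
   then have yS: "y \<in> Sigma_plus S E" and eq: "ALL i<n. x i = y i" by (auto simp: cyl_def)
   from n[OF yS eq] have "g y \<in> ball (g x) e" by (simp add: dist_real_def)
   with e yS show "y \<in> ?V" by auto
  qed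
  moreover have "x \<in> cyl S E (map x [0..<n])" using x by (auto simp: cyl_def)
  ultimately show "x \<in> (\<Union>w\<in>{w. cyl S E w <= ?V}. cyl S E w)" by blast
 qed auto
 also have "... \<in> sets M" by (rule sets.countable_UN') (auto simp: sets cyl_sets)
 finally show "g -` U Int space M \<in> sets M" by (simp add: sp)
qed

lemma (in prob_space) integral_frv:
 fixes g :: "'b => real"
 assumes X: "frv M X"
 shows "integrable M (%x. g (X x))" "(\<integral>x. g (X x) \<partial>M) = (SUM v:X ` space M. pr M X v * g v)"
proof -
 let ?R = "X ` space M"
 have fin: "finite ?R" using X by (simp add: frv_def)
 have eq: "g (X x) = (SUM v:?R. g v * indicator (X -` {v} Int space M) x)" if "x \<in> space M" for x
 proof -
  have "(SUM v:?R. g v * indicator (X -` {v} Int space M) x) = (SUM v:?R. if v = X x then g v else 0)"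
   by (rule sum.cong) (use that in "auto simp: indicator_def")
  also have "... = g (X x)" using fin that by simp
  finally show ?thesis by simp
 qed
 have int: "integrable M (%x. g v * indicator (X -` {v} Int space M) x)" for v
  using X by (intro integrable_mult_right integrable_real_indicator) (auto simp: frv_def emeasure_eq_measure)
 have "integrable M (%x. SUM v:?R. g v * indicator (X -` {v} Int space M) x)" by (intro Bochner_Integration.integrable_sum int)
 then show "integrable M (%x. g (X x))" by (subst Bochner_Integration.integrable_cong[OF refl eq])
 have "(\<integral>x. g (X x) \<partial>M) = (\<integral>x. (SUM v:?R. g v * indicator (X -` {v} Int space M) x) \<partial>M)"
  by (rule Bochner_Integration.integral_cong[OF refl eq])
 also have "... = (SUM v:?R. \<integral>x. g v * indicator (X -` {v} Int space M) x \<partial>M)"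
  by (rule Bochner_Integration.integral_sum) (rule int)
 also have "... = (SUM v:?R. pr M X v * g v)"
  by (rule sum.cong) (auto simp: pr_def)
 finally show "(\<integral>x. g (X x) \<partial>M) = (SUM v:?R. pr M X v * g v)" .
qed

lemma (in prob_space) pr_sum_1: assumes X: "frv M X" shows "(SUM v:X ` space M. pr M X v) = 1"
 using integral_frv(2)[OF X, of "%_. 1"] by (simp add: prob_space)

text \<open>The finite variational principle, from \<open>ln t <= t - 1\<close> at
  \<open>t = exp (s v) / (Z * pr M X v)\<close>.\<close>

lemma (in prob_space) gibbs_inequality:
 assumes X: "frv M X"
 shows "Hent M X+(SUM v:X ` space M. pr M X v * s v) <= ln (SUM v:X ` space M. exp (s v))"
proof -
 let ?R = "X ` space M"
 define Z where "Z = (SUM v:?R. exp (s v))"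
 have fin: "finite ?R" using X by (simp add: frv_def)
 have ne: "?R ~= {}" using not_empty by auto
 have Z: "Z > 0" unfolding Z_def by (rule sum_pos[OF fin ne]) simp
 have "\<eta> (pr M X v)+pr M X v * s v - pr M X v * ln Z <= exp (s v)/Z - pr M X v" for v
 proof (cases "pr M X v = 0")
  case True then show ?thesis using Z by simp
 next
  case False
  then have p: "pr M X v > 0" using pr_nonneg[of M X v] by linarith
  let ?t = "exp (s v)/(Z * pr M X v)"
  have "ln ?t <= ?t - 1" by (rule ln_le_minus_one) (use p Z in simp)
  moreover have "ln ?t = s v - ln Z - ln (pr M X v)" using p Z by (simp add: ln_div ln_mult)
  ultimately have "pr M X v * (s v - ln Z - ln (pr M X v)) <= pr M X v * (?t - 1)" using p by simp
  also have "... = exp (s v)/Z - pr M X v" using p Z by (simp add: field_simps)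
  finally show ?thesis by (simp add: \<eta>_def algebra_simps)
 qed
 then have "(SUM v:?R. \<eta> (pr M X v)+pr M X v * s v - pr M X v * ln Z) <= (SUM v:?R. exp (s v)/Z - pr M X v)"
  by (intro sum_mono)
 also have "... = 0" using pr_sum_1[OF X] Z by (simp add: sum_subtractf sum_divide_distrib[symmetric] Z_def)
 also have "(SUM v:?R. \<eta> (pr M X v)+pr M X v * s v - pr M X v * ln Z) = Hent M X+(SUM v:?R. pr M X v * s v) - ln Z"
  using pr_sum_1[OF X] by (simp add: sum.distrib sum_subtractf Hent_def sum_distrib_right[symmetric])
 finally show ?thesis by (simp add: Z_def)
qed

locale potm = pot + inv_meas
begin

lemma f_meas [measurable]: "f \<in> borel_measurable \<mu>"
proof (rule cyl_continuous_measurable[OF sets_mu])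
 fix x and e :: real assume x: "x \<in> Sg" and e: "e > 0"
 have "(%n. A*\<theta>^n) \<longlonglongrightarrow> A*0" using \<theta> by (intro tendsto_mult tendsto_const LIMSEQ_realpow_zero) auto
 then have "\<forall>\<^sub>F n in sequentially. A*\<theta>^n < e" using e by (intro order_tendstoD(2)) auto
 then obtain N where N: "!!n. n >= N ==> A*\<theta>^n < e" by (auto simp: eventually_sequentially)
 show "EX n. ALL y:Sg. (ALL i<n. x i = y i) --> \<bar>f x - f y\<bar> < e"
 proof (intro exI[of _ "N+2"] ballI impI)
  fix y assume y: "y \<in> Sg" "ALL i<N+2. x i = y i"
  from osc[OF _ x y] N[of "N+2"] show "\<bar>f x - f y\<bar> < e" by force
 qed
qed

text \<open>The position lies between two visits to states below \<open>k\<close>. Only this stretch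
  is a path between finitely many endpoints, to which \<open>path_growth\<close> applies; it is
  determined by the truncated name.\<close>

definition md :: "nat => nat => (nat => nat) => nat => bool" where
 "md k n x i \<longleftrightarrow> (EX j<=i. x j < k) & (EX j>i. j < n & x j < k)"

text \<open>The finite variational principle is applied to truncated names, each scored by the
  supremum of a modified Birkhoff sum. The partition sum is bounded by paths between the first and
  last visit to states below \<open>k\<close>, and the modification costs at most the frequency of
  large states.\<close>

lemma Hent_truncated_bound:
 assumes g: "gr q" and int: "integrable \<mu> f"
 shows "EX C>=1. ALL n>=1. Hent \<mu> (nm (ck k) n) <= real n*(q - (\<integral>x. f x \<partial>\<mu>))+ln (C * real n^2)
  + (\<bar>B\<bar>+\<bar>q\<bar>)*(2 * real n * measure \<mu> {x\<in>space \<mu>. k <= x 0} + 1)"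
proof -
 define F where "F = S Int {..<k}"
 have finF: "finite F" by (simp add: F_def)
 obtain a where a: "a \<in> S" using S_ne by auto
 have ga: "growth f (Fr a) (pt a) q" using g gr_iff[OF a] by simp
 define CC where "CC s t = (SOME C. ALL n. rsum {w\<in>Ph s t. length w = n} (%w. wt f w (pt t)) <= ennreal (C*exp (q * real n)))" for s t
 have CC: "rsum {w\<in>Ph s t. length w = n} (%w. wt f w (pt t)) <= ennreal (CC s t*exp (q * real n))"
  if "s \<in> S" "t \<in> S" for s t n
  using someI_ex[OF path_growth[OF a ga that]] unfolding CC_def by blast
 define C1 where "C1 = exp kap*(\<Sum>(s,t)\<in>F \<times> F. \<bar>CC s t\<bar>)"
 have C1: "C1 >= 0" unfolding C1_def by (intro mult_nonneg_nonneg sum_nonneg) auto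
 define C where "C = exp 1*(1+C1)"
 have "C >= 1" unfolding C_def using C1 mult_mono[of 1 "exp 1" 1 "1+C1"] by simp
 moreover have "Hent \<mu> (nm (ck k) n) <= real n*(q - (\<integral>x. f x \<partial>\<mu>))+ln (C * real n^2)
  + (\<bar>B\<bar>+\<bar>q\<bar>)*(2 * real n * measure \<mu> {x\<in>space \<mu>. k <= x 0} + 1)" if n: "n >= 1" for n
 proof -
  define X where "X = nm (ck k) n"
  define V where "V = X ` space \<mu>"
  have fX: "frv \<mu> X" unfolding X_def by (intro frv_nm frv_ck)
  have finV: "finite V" using fX by (simp add: frv_def V_def)
  have X_low: "x i < k \<longleftrightarrow> y i < k" "x i < k ==> x i = y i" if "X x = X y" "i < n" for x y i
  proof -
   have "min (x i) k = min (y i) k" using that by (simp add: X_def nm_ck_eq_iff)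
   then show "x i < k \<longleftrightarrow> y i < k" "x i < k ==> x i = y i" by (auto simp: min_def split: if_splits)
  qed
  have md_eq: "md k n x i = md k n y i" if "X x = X y" "i < n" for x y i
   unfolding md_def using X_low[OF that(1)] that(2) by (metis le_less_trans)
  \<comment> \<open>Outside the middle stretch infinitely many states share one symbol; replacing
    \<open>f\<close> by \<open>q\<close> there gives these positions exactly the factor
    \<open>exp q\<close>.\<close>
  define J where "J x = (\<Sum>i<n. if md k n x i then f ((shift^^i) x) else q)" for x
  define M where "M = \<bar>B\<bar>+\<bar>q\<bar>"
  have M: "M >= 0" by (simp add: M_def)
  have fM: "f x <= M" if "x \<in> space \<mu>" for x using f_le[of x] that by (simp add: space_mu M_def)
  have J_le: "J x <= real n * M" if x: "x \<in> space \<mu>" for x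
  proof -
   have "J x <= (\<Sum>i<n. M)" unfolding J_def
    by (rule sum_mono) (use fM[OF shift_space[OF x]] in "auto simp: M_def")
   then show ?thesis by simp
  qed
  \<comment> \<open>Each name gets a representative \<open>r v\<close> within 1 of this supremum,
    which is the origin of the factor \<open>exp 1\<close> in \<open>C\<close>.\<close>
  define sJ where "sJ v = Sup (J ` {x\<in>space \<mu>. X x = v})" for v
  have bdd: "bdd_above (J ` {x\<in>space \<mu>. X x = v})" for v
   using J_le by (auto intro!: bdd_aboveI[of _ "real n * M"])
  have sJ_ge: "J x <= sJ (X x)" if "x \<in> space \<mu>" for x
   unfolding sJ_def by (rule cSup_upper[OF _ bdd]) (use that in auto)
  have "EX x. x \<in> space \<mu> & X x = v & sJ v - 1 < J x" if "v \<in> V" for v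
  proof -
   have "J ` {x\<in>space \<mu>. X x = v} ~= {}" using that by (auto simp: V_def)
   from less_cSupD[OF this, of "sJ v - 1"] show ?thesis unfolding sJ_def by auto
  qed
  then obtain r where r: "!!v. v \<in> V ==> r v \<in> space \<mu>" "!!v. v \<in> V ==> X (r v) = v" "!!v. v \<in> V ==> sJ v - 1 < J (r v)"
   by metis
  have mdm: "{x\<in>space \<mu>. md k n x i} \<in> sets \<mu>" if "i < n" for i
  proof -
   have "{x\<in>space \<mu>. md k n x i} = X -` (X ` {x\<in>space \<mu>. md k n x i}) Int space \<mu>" using md_eq that by blast
   also have "... \<in> sets \<mu>" by (rule frv_vimage[OF fX])
   finally show ?thesis .
  qed
  have Jalt: "J x = (\<Sum>i<n. indicator {x\<in>space \<mu>. md k n x i} x*(f ((shift^^i) x) - q)+q)" if "x \<in> space \<mu>" for x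
   unfolding J_def by (rule sum.cong) (use that in "auto simp: indicator_def")
  have intJ: "integrable \<mu> J"
  proof -
   have "integrable \<mu> (%x. \<Sum>i<n. indicator {x\<in>space \<mu>. md k n x i} x*(f ((shift^^i) x) - q)+q)"
    using mdm integrable_shift_pow[OF int]
    by (intro Bochner_Integration.integrable_sum Bochner_Integration.integrable_add integrable_const
       integrable_real_mult_indicator[unfolded mult.commute[of _ "indicator _ _"]] Bochner_Integration.integrable_diff) auto
   then show ?thesis by (subst Bochner_Integration.integrable_cong[OF refl Jalt])
  qed
  define eta where "eta = measure \<mu> {x\<in>space \<mu>. k <= x 0}"
  have set0: "{x\<in>space \<mu>. k <= x i} \<in> sets \<mu>" for i
   using frv_coord[of i "{k..}"] by (simp add: vimage_def Int_def conj_commute)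
  have eta_i: "measure \<mu> {x\<in>space \<mu>. k <= x i} = eta" for i
  proof -
   have "{x\<in>space \<mu>. k <= x i} = (shift^^i) -` {x\<in>space \<mu>. k <= x 0} Int space \<mu>"
    using shift_space[of _ i] by (auto simp: shift_pow)
   then show ?thesis unfolding eta_def using measure_shift_pow[OF set0[of 0], of i] by simp
  qed
  \<comment> \<open>Bounds the number of replaced positions. If both \<open>x 0\<close> and
    \<open>x (n - 1)\<close> are below \<open>k\<close>, every position except \<open>n - 1\<close>
    is in the middle; the 1 accounts for that last position.\<close>
  define bd where "bd x = (\<Sum>i<n. indicator {x\<in>space \<mu>. k <= x 0} x+indicator {x\<in>space \<mu>. k <= x (n - 1)} x)+(1::real)" for x
  have intbd: "integrable \<mu> bd" unfolding bd_def
   by (intro Bochner_Integration.integrable_sum Bochner_Integration.integrable_add integrable_const integrable_real_indicator set0)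
    (auto simp: emeasure_eq_measure)
  have "(\<integral>x. bd x \<partial>\<mu>) = real n*(eta+eta)+1"
   unfolding bd_def using eta_i
   by (simp add: set0 emeasure_eq_measure prob_space)
  then have bd_int: "(\<integral>x. bd x \<partial>\<mu>) = 2 * real n*eta+1" by simp
  have J_ge: "birk shift f n x - M * bd x <= J x" if x: "x \<in> space \<mu>" for x
  proof -
   let ?b = "%i. indicator {x\<in>space \<mu>. k <= x 0} x+indicator {x\<in>space \<mu>. k <= x (n - 1)} x+(if i = n - 1 then 1 else 0) :: real"
   have "f ((shift^^i) x) - M*?b i <= (if md k n x i then f ((shift^^i) x) else q)" if i: "i < n" for i
   proof (cases "md k n x i")
    case True then show ?thesis using M by (auto simp: indicator_def)
   next
    case False
    have "f ((shift^^i) x) <= B" using f_le shift_space[OF x] by (simp add: space_mu)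
    then have fq: "f ((shift^^i) x) - M <= q" by (auto simp: M_def)
    have "?b i >= 1"
    proof (rule ccontr)
     assume b: "\<not> 1 <= ?b i"
     have "x 0 < k" using b x by (auto simp: indicator_def of_bool_def split: if_splits)
     moreover have "x (n - 1) < k" using b x by (auto simp: indicator_def of_bool_def split: if_splits)
     moreover have "i ~= n - 1" using b by (auto simp: indicator_def of_bool_def split: if_splits)
     ultimately have "md k n x i" unfolding md_def using i by (intro conjI exI[of _ 0] exI[of _ "n - 1"]) auto
     with False show False by simp
    qed
    then have "M*1 <= M*?b i" using M by (rule mult_left_mono)
    then show ?thesis using False fq by simp
   qed
   then have "(\<Sum>i<n. f ((shift^^i) x) - M*?b i) <= J x" unfolding J_def by (intro sum_mono) auto
   moreover have "(\<Sum>i<n. f ((shift^^i) x) - M*?b i) = birk shift f n x - M * bd x"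
    using n by (simp add: birk_def bd_def sum_subtractf sum_distrib_left[symmetric] sum.distrib)
   ultimately show ?thesis by simp
  qed
  have intb: "integrable \<mu> (birk shift f n)"
   unfolding birk_def by (intro Bochner_Integration.integrable_sum integrable_shift_pow int)
  have birk_int: "(\<integral>x. birk shift f n x \<partial>\<mu>) = real n*(\<integral>x. f x \<partial>\<mu>)"
   unfolding birk_def by (simp add: Bochner_Integration.integral_sum integrable_shift_pow[OF int] integral_shift_pow[OF f_meas])
  have "real n*(\<integral>x. f x \<partial>\<mu>) - M*(2 * real n*eta+1) = (\<integral>x. birk shift f n x - M * bd x \<partial>\<mu>)"
   using intb intbd by (simp add: birk_int bd_int)
  also have "... <= (\<integral>x. J x \<partial>\<mu>)"
   by (rule integral_mono[OF _ intJ J_ge]) (use intb intbd in auto)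
  also have "... <= (\<integral>x. sJ (X x) \<partial>\<mu>)" by (rule integral_mono[OF intJ integral_frv(1)[OF fX] sJ_ge])
  also have "... = (SUM v:V. pr \<mu> X v * sJ v)" unfolding V_def by (rule integral_frv(2)[OF fX])
  finally have lowJ: "real n*(\<integral>x. f x \<partial>\<mu>) - M*(2 * real n*eta+1) <= (SUM v:V. pr \<mu> X v * sJ v)" .
  define vis where "vis x \<longleftrightarrow> (EX i<n. x i < k)" for x :: "nat => nat"
  define i0 where "i0 x = Min {i. i < n & x i < k}" for x :: "nat => nat"
  define j0 where "j0 x = Max {i. i < n & x i < k}" for x :: "nat => nat"
  have ij: "i0 x < n" "x (i0 x) < k" "j0 x < n" "x (j0 x) < k" "i0 x <= j0 x"
    "!!i. i < n ==> x i < k ==> i0 x <= i & i <= j0 x" if "vis x" for x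
  proof -
   have fi: "finite {i. i < n & x i < k}" and ne: "{i. i < n & x i < k} ~= {}" using that by (auto simp: vis_def)
   show "i0 x < n" "x (i0 x) < k" using Min_in[OF fi ne] by (auto simp: i0_def)
   show "j0 x < n" "x (j0 x) < k" using Max_in[OF fi ne] by (auto simp: j0_def)
   show *: "i0 x <= i & i <= j0 x" if "i < n" "x i < k" for i
    using Min_le[OF fi] Max_ge[OF fi] that by (auto simp: i0_def j0_def)
   show "i0 x <= j0 x" using *[OF \<open>i0 x < n\<close> \<open>x (i0 x) < k\<close>] by simp
  qed
  have md_iff: "md k n x i \<longleftrightarrow> i0 x <= i & i < j0 x" if "vis x" "i < n" for x i
  proof
   assume "md k n x i"
   then obtain j j' where "j <= i" "x j < k" "j' > i" "j' < n" "x j' < k" by (auto simp: md_def)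
   then show "i0 x <= i & i < j0 x" using ij(6)[OF that(1), of j] ij(6)[OF that(1), of j'] that(2) by auto
  next
   assume "i0 x <= i & i < j0 x"
   then show "md k n x i" unfolding md_def using ij(2-4)[OF that(1)] by blast
  qed
  \<comment> \<open>Records the times and states of the first and last visit below \<open>k\<close>,
    and the actual path between them in the representative.\<close>
  define T where "T x = ((i0 x, j0 x, x (i0 x), x (j0 x)), map x [i0 x..<j0 x])" for x :: "nat => nat"
  define g where "g = (%((i::nat, j::nat, s::nat, t::nat), u). exp kap * wt f u (pt t)*exp (q * real (n - (j - i))))"
  have J_T: "exp (J x) <= g (T x)" if x: "x \<in> space \<mu>" and v: "vis x" for x
  proof -
   let ?i = "i0 x" and ?j = "j0 x"
   let ?u = "map x [?i..<?j]"
   have xS: "x \<in> Sg" using x by (simp add: space_mu)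
   have u: "?u \<in> Ph (x ?i) (x ?j)" by (rule Pth_sub[OF xS ij(5)[OF v]])
   have cat: "cat ?u ((shift^^?j) x) = (shift^^?i) x"
    using ij(5)[OF v] by (intro ext) (auto simp: cat_def shift_pow ac_simps)
   have "J x = (\<Sum>i<n. if ?i <= i & i < ?j then f ((shift^^i) x) else q)"
    unfolding J_def by (rule sum.cong) (auto simp: md_iff[OF v])
   also have "... = (SUM i:{..<n} Int {?i..<?j}. f ((shift^^i) x))+(SUM i:{..<n} - {?i..<?j}. q)"
    by (subst sum.If_cases) (auto simp: Int_def Diff_eq Compl_eq intro!: arg_cong2[where f="(+)"] sum.cong)
   also have "{..<n} Int {?i..<?j} = {?i..<?j}" using ij(3)[OF v] by auto
   also have "(SUM i:{?i..<?j}. f ((shift^^i) x)) = (\<Sum>l<?j - ?i. f ((shift^^l) ((shift^^?i) x)))"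
    using ij(5)[OF v]
    by (intro sum.reindex_bij_witness[of _ "%l. l+?i" "%l. l - ?i"]) (auto simp: shift_pow ac_simps)
   also have "... = birk shift f (length ?u) (cat ?u ((shift^^?j) x))" by (simp add: birk_def cat)
   also have "(SUM i:{..<n} - {?i..<?j}. q) = q * real (n - (?j - ?i))"
   proof -
    have "card ({..<n} - {?i..<?j}) = n - (?j - ?i)"
     using ij(3)[OF v] by (subst card_Diff_subset) auto
    then show ?thesis by (simp add: mult.commute)
   qed
   finally have "exp (J x) = wt f ?u ((shift^^?j) x)*exp (q * real (n - (?j - ?i)))"
    by (simp add: wt_def exp_add)
   also have "... <= (exp kap * wt f ?u (pt (x ?j)))*exp (q * real (n - (?j - ?i)))"
   proof (rule mult_right_mono[OF wt_dist[OF u]])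
    show "(shift^^?j) x \<in> Cy [x ?j]" using Sigma_plus_shift[OF xS] by (simp add: cyl1_iff shift_pow)
    show "pt (x ?j) \<in> Cy [x ?j]" using xS by (intro pt) (auto simp: Sigma_plus_def)
   qed simp
   finally show ?thesis by (simp add: g_def T_def)
  qed
  define Vv where "Vv = {v\<in>V. vis (r v)}"
  define Idx where "Idx = {..<n} \<times> {..<n} \<times> F \<times> F"
  define UU where "UU = (%(i, j, s, t). {u\<in>Ph s t. length u = j - i & j - i <= n})"
  \<comment> \<open>Before the first and after the last visit only the merged symbol
    \<open>k\<close> can occur, so the recorded path determines the truncated name.\<close>
  have inj: "inj_on (%v. T (r v)) Vv"
  proof (rule inj_onI)
   fix v v' assume v: "v \<in> Vv" and v': "v' \<in> Vv" and eq: "T (r v) = T (r v')"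
   let ?x = "r v" and ?y = "r v'"
   have vx: "vis ?x" and vy: "vis ?y" using v v' by (auto simp: Vv_def)
   have e: "i0 ?x = i0 ?y" "j0 ?x = j0 ?y" "?x (j0 ?x) = ?y (j0 ?y)" "map ?x [i0 ?x..<j0 ?x] = map ?y [i0 ?x..<j0 ?x]"
    using eq by (auto simp: T_def)
   have "X ?x = X ?y" unfolding X_def nm_ck_eq_iff
   proof (intro allI impI)
    fix i assume i: "i < n"
    consider "i < i0 ?x" | "i0 ?x <= i & i < j0 ?x" | "i = j0 ?x" | "i > j0 ?x" by linarith
    then show "min (?x i) k = min (?y i) k"
    proof cases
     case 1
     then have "\<not> ?x i < k" "\<not> ?y i < k" using ij(6)[OF vx i] ij(6)[OF vy i] e by auto
     then show ?thesis by simp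
    next
     case 2 then have "?x i = ?y i" using e(4) by auto
     then show ?thesis by simp
    next
     case 3 then show ?thesis using e by simp
    next
     case 4
     then have "\<not> ?x i < k" "\<not> ?y i < k" using ij(6)[OF vx i] ij(6)[OF vy i] e by auto
     then show ?thesis by simp
    qed
   qed
   then show "v = v'" using r(2) v v' by (auto simp: Vv_def)
  qed
  have TS: "T (r v) \<in> Sigma Idx UU" if v: "v \<in> Vv" for v
  proof -
   let ?x = "r v"
   have vx: "vis ?x" and xS: "?x \<in> Sg" using v r(1) by (auto simp: Vv_def space_mu)
   show ?thesis
    using ij(1-4)[OF vx] Pth_sub[OF xS ij(5)[OF vx]] xS
    unfolding T_def Idx_def UU_def F_def Sigma_plus_def by (simp add: le_diff_conv less_imp_le trans_le_add1)
  qed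
  have finVv: "finite Vv" using finV by (simp add: Vv_def)
  have finI: "finite Idx" using finF by (simp add: Idx_def)
  have "(SUM v:Vv. ennreal (exp (J (r v)))) <= (SUM v:Vv. ennreal (g (T (r v))))"
   by (intro sum_mono ennreal_leI J_T) (auto simp: Vv_def r)
  also have "... = (SUM y:(%v. T (r v)) ` Vv. ennreal (g y))" by (simp add: sum.reindex[OF inj])
  also have "... <= rsum (Sigma Idx UU) (%y. g y)"
   by (rule nsum_sum_le[OF finite_imageI[OF finVv] image_subsetI[OF TS]])
  also have "... = (SUM \<iota>:Idx. rsum (UU \<iota>) (%u. g (\<iota>, u)))"
   by (simp add: nsum_Sigma nsum_finite[OF finI])
  also have "... <= (\<Sum>(i, j, s, t)\<in>Idx. ennreal (exp kap*\<bar>CC s t\<bar>*exp (q * real n)))"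
  proof (rule sum_mono, clarify)
   fix i j s t assume I: "(i, j, s, t) \<in> Idx"
   then have st: "s \<in> S" "t \<in> S" by (auto simp: Idx_def F_def)
   show "rsum (UU (i, j, s, t)) (%u. g ((i, j, s, t), u)) <= ennreal (exp kap*\<bar>CC s t\<bar>*exp (q * real n))"
   proof -
    have jn: "j - i <= n" using I by (auto simp: Idx_def)
    have "rsum (UU (i, j, s, t)) (%u. g ((i, j, s, t), u))
     = ennreal (exp kap*exp (q * real (n - (j - i)))) * rsum {u\<in>Ph s t. length u = j - i} (%u. wt f u (pt t))"
     unfolding nsum_cmult[symmetric]
     by (rule nsum_cong) (use jn in "auto simp: UU_def g_def ennreal_mult[symmetric] ac_simps")
    also have "... <= ennreal (exp kap*exp (q * real (n - (j - i))))*ennreal (CC s t*exp (q * real (j - i)))"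
     by (intro mult_left_mono CC st) simp
    also have "... <= ennreal (exp kap*exp (q * real (n - (j - i))))*ennreal (\<bar>CC s t\<bar>*exp (q * real (j - i)))"
     by (intro mult_left_mono ennreal_leI mult_right_mono) auto
    also have "... = ennreal (exp kap*\<bar>CC s t\<bar>*(exp (q * real (n - (j - i)))*exp (q * real (j - i))))"
     by (simp add: ennreal_mult[symmetric] ac_simps)
    also have "exp (q * real (n - (j - i)))*exp (q * real (j - i)) = exp (q * real n)"
     using jn by (simp add: exp_add[symmetric] algebra_simps)
    finally show ?thesis .
   qed
  qed
  also have "... = ennreal (\<Sum>(i, j, s, t)\<in>Idx. exp kap*\<bar>CC s t\<bar>*exp (q * real n))"
   by (subst sum_ennreal[symmetric]) (auto simp: case_prod_unfold)
  also have "(\<Sum>(i, j, s, t)\<in>Idx. exp kap*\<bar>CC s t\<bar>*exp (q * real n)) = real n^2*(C1*exp (q * real n))"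
   unfolding Idx_def C1_def
   by (simp add: sum.cartesian_product[symmetric] sum_distrib_left sum_distrib_right power2_eq_square ac_simps)
  finally have "ennreal (SUM v:Vv. exp (J (r v))) <= ennreal (real n^2*(C1*exp (q * real n)))"
   by (simp add: sum_ennreal)
  then have sv: "(SUM v:Vv. exp (J (r v))) <= real n^2*(C1*exp (q * real n))"
   using C1 by (subst (asm) ennreal_le_iff) auto
  \<comment> \<open>A single name has no visit below \<open>k\<close>, the constant one, and there
    \<open>J\<close> equals \<open>q * n\<close>.\<close>
  have nv: "(SUM v:V - Vv. exp (J (r v))) <= exp (q * real n)"
  proof -
   have "v = v'" if "v \<in> V - Vv" "v' \<in> V - Vv" for v v'
   proof -
    have nvx: "\<not> vis (r v)" and nvy: "\<not> vis (r v')" using that by (auto simp: Vv_def)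
    have "X (r v) = X (r v')" unfolding X_def nm_ck_eq_iff
    proof (intro allI impI)
     fix i assume "i < n"
     then have "k <= r v i" "k <= r v' i" using nvx nvy unfolding vis_def by (meson not_less)+
     then show "min (r v i) k = min (r v' i) k" by simp
    qed
    then show ?thesis using r(2) that by auto
   qed
   then have "V - Vv = {} | (EX v. V - Vv = {v})" by blast
   then show ?thesis
   proof
    assume "EX v. V - Vv = {v}"
    then obtain v where v: "V - Vv = {v}" by auto
    then have "\<not> vis (r v)" by (auto simp: Vv_def)
    then have "\<not> md k n (r v) i" if "i < n" for i using that by (auto simp: md_def vis_def)
    then have "J (r v) = q * real n" by (simp add: J_def mult.commute)
    then show ?thesis by (simp add: v)
   next
    assume "V - Vv = {}"
    then show ?thesis by (simp only: sum.empty) simp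
   qed
  qed
  have "(SUM v:V. exp (sJ v)) <= (SUM v:V. exp 1*exp (J (r v)))"
   by (intro sum_mono) (use r(3) in "force simp: exp_add[symmetric]")
  also have "... = exp 1*((SUM v:V - Vv. exp (J (r v)))+(SUM v:Vv. exp (J (r v))))"
   using finV by (subst sum.subset_diff[of Vv V, symmetric]) (auto simp: Vv_def sum_distrib_left)
  also have "... <= exp 1*(exp (q * real n)+real n^2*(C1*exp (q * real n)))"
   by (intro mult_left_mono add_mono nv sv) simp
  also have "... <= exp 1*(real n^2*exp (q * real n)+real n^2*(C1*exp (q * real n)))"
   using n by (intro mult_left_mono add_mono order_refl) (auto simp: mult_le_cancel_right1)
  also have "... = C * real n^2*exp (q * real n)" by (simp add: C_def algebra_simps)
  finally have Zb: "(SUM v:V. exp (sJ v)) <= C * real n^2*exp (q * real n)" .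
  have Vne: "V ~= {}" using not_empty by (auto simp: V_def)
  have "Hent \<mu> X+(SUM v:V. pr \<mu> X v * sJ v) <= ln (SUM v:V. exp (sJ v))"
   unfolding V_def by (rule gibbs_inequality[OF fX])
  also have "... <= ln (C * real n^2*exp (q * real n))"
   using Zb finV Vne by (subst ln_le_cancel_iff) (auto intro!: sum_pos less_le_trans[OF sum_pos Zb])
  also have "... = ln (C * real n^2)+q * real n"
   using \<open>C >= 1\<close> n by (subst ln_mult) auto
  finally show ?thesis using lowJ unfolding X_def M_def eta_def by (simp add: algebra_simps)
 qed
 ultimately show ?thesis by blast
qed

lemma tail_measure_0: "(%k. measure \<mu> {x\<in>space \<mu>. k <= x 0}) \<longlonglongrightarrow> 0"
proof -
 have "(%k. measure \<mu> {x\<in>space \<mu>. k <= x 0}) \<longlonglongrightarrow> measure \<mu> (\<Inter>k. {x\<in>space \<mu>. k <= x 0})"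
 proof (rule finite_Lim_measure_decseq)
  show "range (%k. {x\<in>space \<mu>. k <= x 0}) <= events"
   using frv_coord[of 0 "{_..}"] by (auto simp: vimage_def Int_def conj_commute)
 qed (auto simp: decseq_def)
 moreover have "(\<Inter>k. {x\<in>space \<mu>. k <= x 0}) = {}" using not_less_eq_eq by auto
 ultimately show ?thesis by simp
qed

text \<open>The loss per unit of time is proportional to the mass of states from \<open>k\<close>
  on, which tends to 0. The polynomial factor enters only through a logarithm, absorbed into
  \<open>sqrt n\<close>.\<close>

lemma ks_entropy_upper:
 assumes g: "gr q" and int: "integrable \<mu> f"
 shows "ks_entropy \<mu> <= ereal (q - (\<integral>x. f x \<partial>\<mu>))"
proof (rule ks_entropy_le)
 fix e :: real and k0 :: nat assume e: "e > 0"
 define M where "M = \<bar>B\<bar>+\<bar>q\<bar>"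
 have "(%k. M*(2 * measure \<mu> {x\<in>space \<mu>. k <= x 0})) \<longlonglongrightarrow> M*(2*0)"
  by (intro tendsto_intros tail_measure_0)
 then have "\<forall>\<^sub>F k in sequentially. M*(2 * measure \<mu> {x\<in>space \<mu>. k <= x 0}) < e"
  using e by (intro order_tendstoD(2)) auto
 then obtain K where K: "!!k. k >= K ==> M*(2 * measure \<mu> {x\<in>space \<mu>. k <= x 0}) < e"
  by (auto simp: eventually_sequentially)
 show "EX k1>=k0. ALL k>=k1. EX d. ALL n>=1. Hent \<mu> (nm (ck k) n) <= real n*(q - (\<integral>x. f x \<partial>\<mu>)+e)+d * sqrt (real n)"
 proof (intro exI[of _ "max k0 K"] conjI allI impI)
  fix k assume k: "max k0 K <= k"
  obtain C where C: "C >= 1" "!!n. n >= 1 ==> Hent \<mu> (nm (ck k) n) <= real n*(q - (\<integral>x. f x \<partial>\<mu>))+ln (C * real n^2)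
  + M*(2 * real n * measure \<mu> {x\<in>space \<mu>. k <= x 0} + 1)"
   using Hent_truncated_bound[OF g int, of k] unfolding M_def by blast
  show "EX d. ALL n>=1. Hent \<mu> (nm (ck k) n) <= real n*(q - (\<integral>x. f x \<partial>\<mu>)+e)+d * sqrt (real n)"
  proof (intro exI[of _ "ln C+4+M"] allI impI)
   fix n :: nat assume n: "1 <= n"
   have s1: "sqrt (real n) >= 1" using n by simp
   have "ln (real n) = 2 * ln (sqrt (real n))" using n by (simp add: ln_sqrt)
   also have "... <= 2 * sqrt (real n)" using ln_le_minus_one[of "sqrt (real n)"] s1 by simp
   finally have lnn: "ln (real n) <= 2 * sqrt (real n)" .
   have "ln (C * real n^2) = ln C+2 * ln (real n)" using C n by (simp add: ln_mult ln_realpow)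
   also have "... <= ln C * sqrt (real n)+4 * sqrt (real n)"
    using lnn C s1 by (intro add_mono) (auto simp: mult_le_cancel_left1)
   finally have 1: "ln (C * real n^2) <= ln C * sqrt (real n)+4 * sqrt (real n)" .
   have 2: "M <= M * sqrt (real n)" using mult_left_mono[OF s1, of M] by (simp add: M_def)
   have "real n*(M*(2 * measure \<mu> {x\<in>space \<mu>. k <= x 0})) <= real n*e"
    using K[of k] k by (intro mult_left_mono) auto
   with C(2)[OF n] 1 2 show "Hent \<mu> (nm (ck k) n) <= real n*(q - (\<integral>x. f x \<partial>\<mu>)+e)+(ln C+4+M) * sqrt (real n)"
    by (simp add: algebra_simps)
  qed
 qed simp
qed

lemma int_ereal_integrable:
 fixes g :: "'a => real"
 assumes "integrable M g" shows "int_ereal M g = ereal (\<integral>x. g x \<partial>M)"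
proof -
 have "int_plus M g < \<infinity>" "int_minus M g < \<infinity>"
  using assms unfolding real_integrable_def int_plus_def int_minus_def by (auto simp: less_top)
 moreover have "(\<integral>x. g x \<partial>M) = enn2real (int_plus M g) - enn2real (int_minus M g)"
  unfolding int_plus_def int_minus_def by (rule real_lebesgue_integral_def[OF assms])
 ultimately show ?thesis unfolding int_ereal_def
  by (cases "int_plus M g"; cases "int_minus M g") (auto simp: enn2ereal_ennreal)
qed

lemma int_plus_f: "int_plus \<mu> f < \<infinity>"
proof -
 have "int_plus \<mu> f <= (\<integral>\<^sup>+x. ennreal \<bar>B\<bar> \<partial>\<mu>)"
  unfolding int_plus_def by (rule nn_integral_mono) (use f_le in "force simp: space_mu intro!: ennreal_leI")
 also have "... < \<infinity>" by (simp add: emeasure_space_1)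
 finally show ?thesis .
qed

lemma int_ereal_cases: "integrable \<mu> f & int_ereal \<mu> f = ereal (\<integral>x. f x \<partial>\<mu>) | ~ integrable \<mu> f & int_ereal \<mu> f = - \<infinity>"
proof (cases "integrable \<mu> f")
 case True then show ?thesis using int_ereal_integrable by blast
next
 case False
 then have "int_minus \<mu> f = \<infinity>"
  using int_plus_f unfolding real_integrable_def int_plus_def int_minus_def by (auto simp: f_meas)
 moreover obtain r where "int_plus \<mu> f = ennreal r" "r >= 0" using int_plus_f by (cases "int_plus \<mu> f") auto
 ultimately have "int_ereal \<mu> f = - \<infinity>" unfolding int_ereal_def by (simp add: enn2ereal_ennreal)
 with False show ?thesis by simp
qed

end

section \<open>Quadratic bound for the perturbed pressure\<close>

context pot
begin

text \<open>A Hoelder bound with control already from the first coordinate on. Such a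
  \<open>g\<close> is itself a potential with all constants equal to \<open>dlt\<close>, so the
  distortion estimates apply to it.\<close>

definition okg :: "real => ((nat => nat) => real) => bool" where
 "okg dlt g \<longleftrightarrow> 0 <= dlt & (ALL x:Sg. \<bar>g x\<bar> <= dlt) &
  (ALL n>=1. ALL x:Sg. ALL y:Sg. (ALL i<n. x i = y i) --> \<bar>g x - g y\<bar> <= dlt*\<theta>^n)"

lemma okg_pot: "okg dlt g ==> pot S E g dlt \<theta> dlt"
 by unfold_locales (use \<theta> in "force simp: okg_def")+

end

locale spr = pot +
 fixes a :: nat and P eps :: real
 assumes a: "a \<in> S"
  and gP: "!!q. P < q ==> growth f (FR S E a) (pt a) q"
  and eps: "eps > 0"
  and tail: "rsum (FR S E a) (%w. wq f (P - eps) w (pt a)) < \<infinity>"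
begin

abbreviation "W == Fr a"
abbreviation "C == Cy [a]"

definition w0 where "w0 = (SOME w. w \<in> W)"
lemma w0: "w0 \<in> W" unfolding w0_def using FR_exists[OF a] by (simp add: some_in_eq)

text \<open>Domination constant of the return kernel (\<open>K_dom\<close>). Evaluating the fixed
  word \<open>w0\<close> at \<open>P + 1\<close> makes it uniform over the exponents
  \<open>P + s\<close> with \<open>s <= 1\<close>.\<close>

definition M0 where "M0 = exp (4 * kap)/wq f (P+1) w0 (pt a)"
definition TT where "TT = enn2real (rsum W (%w. wq f (P - eps) w (pt a)))"
definition M1 where "M1 = M0 * TT"
text \<open>Log-distortion of the kernel: one \<open>kap\<close> from the weight, one from
  \<open>h\<close> at the image point, two from the normalisation. The added 1 keeps it
  positive.\<close>

definition k1 where "k1 = 4 * kap+1"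
definition lam where "lam = (1+\<theta>)/2"
text \<open>Solves \<open>k1 + b1 * \<theta> = lam * b1\<close>, the balance on which the
  contraction in \<open>Dm_contract\<close> rests.\<close>

definition b1 where "b1 = k1/(lam - \<theta>)"
definition rho where "rho = 1 - exp (- b1)*(1 - lam)"
text \<open>A bounded distance for points agreeing in \<open>m\<close> coordinates, comparable with
  \<open>\<theta>^m\<close>. Its form matches the probability with which two kernels fail to be
  coupled.\<close>

definition Dm where "Dm m = 1 - exp (- b1*\<theta>^m)"

lemma M0: "M0 > 0" by (simp add: M0_def)
lemma TT: "TT >= 0" "rsum W (%w. wq f (P - eps) w (pt a)) = ennreal TT"
 using tail by (auto simp: TT_def)
lemma M1: "M1 >= 0" using M0 TT by (simp add: M1_def)
lemma k1: "k1 >= 1" using kap_nonneg by (simp add: k1_def)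
lemma lam: "\<theta> < lam" "lam < 1" using \<theta> by (auto simp: lam_def)
lemma b1: "b1 > 0" using k1 lam by (simp add: b1_def)
lemma b1_eq: "k1+b1*\<theta> = lam * b1" using lam by (simp add: b1_def field_simps)

lemma rho: "0 <= rho" "rho < 1"
proof -
 have "exp (- b1)*(1 - lam) <= 1*1" using b1 lam \<theta> by (intro mult_mono) auto
 then show "0 <= rho" by (simp add: rho_def)
 show "rho < 1" using lam by (simp add: rho_def)
qed

lemma Dm_nonneg: "0 <= Dm m" and Dm_le_1: "Dm m <= 1"
 using b1 \<theta> by (auto simp: Dm_def)

lemma Dm_ge: "b1*exp (- b1)*\<theta>^m <= Dm m"
proof -
 let ?z = "b1*\<theta>^m"
 have z: "0 <= ?z" "?z <= b1" using b1 \<theta> by (auto simp: mult_left_le power_le_one)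
 have "?z*exp (- b1) <= ?z*exp (- ?z)" using z by (intro mult_left_mono) auto
 also have "... <= 1 - exp (- ?z)"
 proof -
  have "1+?z <= exp ?z" by (rule exp_ge_add_one_self)
  then have "(1+?z)*exp (- ?z) <= exp ?z*exp (- ?z)" by (intro mult_right_mono) auto
  then show ?thesis by (simp add: exp_minus algebra_simps)
 qed
 finally show ?thesis by (simp add: Dm_def mult_ac)
qed

text \<open>With probability \<open>exp (- k1 * \<theta>^m)\<close> the coupled points gain a common
  coordinate, otherwise the distance is at most 1. The product of exponentials collapses to the
  exponent \<open>lam * b1 * \<theta>^m\<close>, and \<open>lam < 1\<close> gives the factor
  \<open>rho\<close>.\<close>

lemma Dm_contract: "exp (- k1*\<theta>^m) * Dm (Suc m)+(1 - exp (- k1*\<theta>^m)) <= rho * Dm m"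
proof -
 let ?z = "b1*\<theta>^m"
 have z: "0 <= ?z" "?z <= b1" using b1 \<theta> by (auto simp: mult_left_le power_le_one)
 have "exp (- k1*\<theta>^m) * Dm (Suc m)+(1 - exp (- k1*\<theta>^m)) = 1 - exp (- k1*\<theta>^m)*exp (- b1*\<theta>^Suc m)"
  by (simp add: Dm_def algebra_simps)
 also have "exp (- k1*\<theta>^m)*exp (- b1*\<theta>^Suc m) = exp (- ((k1+b1*\<theta>)*\<theta>^m))"
  unfolding exp_add[symmetric] by (simp add: algebra_simps)
 also have "... = exp (- (lam*?z))" unfolding b1_eq by (simp add: algebra_simps)
 also have "1 - exp (- (lam*?z)) <= rho*(1 - exp (- ?z))"
 proof -
  have e1: "exp (- (lam*?z)) = exp (- ?z)*exp ((1 - lam)*?z)" unfolding exp_add[symmetric] by (simp add: algebra_simps)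
  have "1 - exp (- ?z) <= ?z" using exp_ge_add_one_self[of "- ?z"] by simp
  then have "exp (- b1)*(1 - lam)*(1 - exp (- ?z)) <= exp (- b1)*(1 - lam)*?z"
   using lam by (intro mult_left_mono) auto
  also have "... = exp (- b1)*((1 - lam)*?z)" by simp
  also have "... <= exp (- ?z)*(exp ((1 - lam)*?z) - 1)"
  proof (rule mult_mono)
   show "(1 - lam)*?z <= exp ((1 - lam)*?z) - 1" using exp_ge_add_one_self[of "(1 - lam)*?z"] by linarith
  qed (use z lam in auto)
  finally show ?thesis unfolding rho_def e1 by (simp add: algebra_simps)
 qed
 finally show ?thesis by (simp add: Dm_def)
qed

text \<open>The Lipschitz constant of \<open>U g\<close> per unit size of \<open>g\<close>; the
  divisor converts \<open>\<theta>^m\<close> into \<open>Dm m\<close>.\<close>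

definition C5 where "C5 = (\<theta>/(1 - \<theta>)+3 * k1 * M1/eps)/(b1*exp (- b1))"
definition c2 where "c2 = 1+C5/(1 - rho)"

lemma C5: "C5 >= 0" using \<theta> k1 M1 eps b1 by (simp add: C5_def)
lemma c2: "c2 >= 1" using C5 rho by (simp add: c2_def)

definition Lip :: "real => ((nat => nat) => real) => bool" where
 "Lip b v \<longleftrightarrow> (ALL x:C. ALL y:C. ALL m>=1. (ALL i<m. x i = y i) --> \<bar>v x - v y\<bar> <= b * Dm m)"

definition bdd :: "((nat => nat) => real) => bool" where "bdd v \<longleftrightarrow> (EX M. ALL x:C. \<bar>v x\<bar> <= M)"

lemma Lip_osc: assumes "Lip b v" "b >= 0" "x \<in> C" "y \<in> C" shows "\<bar>v x - v y\<bar> <= b"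
proof -
 have "\<bar>v x - v y\<bar> <= b * Dm 1" using assms by (auto simp: Lip_def cyl1_iff)
 also have "... <= b" using assms(2) Dm_le_1[of 1] by (simp add: mult_left_le)
 finally show ?thesis .
qed

lemma Lip_bdd: assumes "Lip b v" "b >= 0" shows "bdd v"
 unfolding bdd_def
proof (intro exI[of _ "\<bar>v (pt a)\<bar>+b"] ballI)
 fix x assume "x \<in> C"
 then show "\<bar>v x\<bar> <= \<bar>v (pt a)\<bar>+b" using Lip_osc[OF assms, of x "pt a"] a by auto
qed

end

lemma pmf_compare:
 assumes "!!w. c * pmf p w <= pmf p' w" "c >= 0" "!!w. w \<in> set_pmf p ==> 0 <= (g w::real)"
  "integrable (measure_pmf p) g" "integrable (measure_pmf p') g" "!!w. w \<in> set_pmf p' ==> 0 <= (g w::real)"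
 shows "c * measure_pmf.expectation p g <= measure_pmf.expectation p' g"
proof -
 have "ennreal (c * measure_pmf.expectation p g) = ennreal c*(\<integral>\<^sup>+w. ennreal (g w) \<partial>measure_pmf p)"
  using assms by (subst nn_integral_eq_integral) (auto simp: AE_measure_pmf_iff ennreal_mult' integral_nonneg_AE)
 also have "... = (\<integral>\<^sup>+w. ennreal (c * pmf p w)*ennreal (g w) \<partial>count_space UNIV)"
  unfolding nn_integral_measure_pmf using assms(2)
  by (subst nn_integral_cmult[symmetric]) (auto simp: ennreal_mult' mult.assoc)
 also have "... <= (\<integral>\<^sup>+w. ennreal (pmf p' w)*ennreal (g w) \<partial>count_space UNIV)"
  by (intro nn_integral_mono mult_right_mono ennreal_leI assms) auto
 also have "... = (\<integral>\<^sup>+w. ennreal (g w) \<partial>measure_pmf p')" unfolding nn_integral_measure_pmf ..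
 also have "... = ennreal (measure_pmf.expectation p' g)"
  using assms by (subst nn_integral_eq_integral) (auto simp: AE_measure_pmf_iff)
 finally show ?thesis
  using assms by (subst (asm) ennreal_le_iff) (auto intro!: integral_nonneg_AE simp: AE_measure_pmf_iff)
qed

section \<open>The normalised return kernel just above the critical exponent\<close>

locale kern = spr +
 fixes s :: real
 assumes s: "0 < s" "s <= 1"
begin

definition h where "h x = enn2real (Hs f W (P+s) x)"

lemma Hs_h: assumes "x \<in> C" shows "Hs f W (P+s) x = ennreal (h x)" "1 <= h x"
proof -
 have "Hs f W (P+s) (pt a) < \<infinity>"
  by (rule growth_imp_Hs[of _ _ _ "P+s/2"]) (use s in "auto intro!: gP")
 then have "Hs f W (P+s) x < \<infinity>" using Hs_finite_indep[OF _ assms pt[OF a]] by blast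
 then show *: "Hs f W (P+s) x = ennreal (h x)" by (simp add: h_def)
 show "1 <= h x" using Hs_ge_1[of f W "P+s" x] unfolding * by (simp add: h_def)
qed

lemma cat_C: "w \<in> W ==> x \<in> C ==> cat w x \<in> C"
 by (rule PthD[OF FR_Pth])

text \<open>Rearranges the finite identity h = 1 + L h. Strict positivity of \<open>h - 1\<close>
  comes from the single word \<open>w0\<close>.\<close>

lemma Lop_h: assumes x: "x \<in> C"
 shows "rsum W (%w. wq f (P+s) w x * h (cat w x)) = ennreal (h x - 1)" "0 < h x - 1"
proof -
 have "ennreal (h x) = 1+Lop f W (P+s) (Hs f W (P+s)) x"
  using Hs_eq[OF a order_refl, of f "P+s" x] Hs_h[OF x] by simp
 also have "Lop f W (P+s) (Hs f W (P+s)) x = rsum W (%w. wq f (P+s) w x * h (cat w x))"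
  unfolding Lop_def by (rule nsum_cong) (auto simp: Hs_h[OF cat_C[OF _ x]] ennreal_mult')
 finally have eq: "ennreal (h x) = 1+rsum W (%w. wq f (P+s) w x * h (cat w x))" .
 then have "rsum W (%w. wq f (P+s) w x * h (cat w x)) ~= \<top>" by (metis ennreal_add_eq_top ennreal_neq_top)
 then obtain r where r: "rsum W (%w. wq f (P+s) w x * h (cat w x)) = ennreal r" "r >= 0"
  by (cases "rsum W (%w. wq f (P+s) w x * h (cat w x))") auto
 have "ennreal (h x) = ennreal (1+r)" using eq r by (simp add: ennreal_plus)
 then have hr: "h x = 1+r" using Hs_h[OF x] r by (subst (asm) ennreal_inj) auto
 then show "rsum W (%w. wq f (P+s) w x * h (cat w x)) = ennreal (h x - 1)" using r by simp
 have "ennreal (wq f (P+s) w0 x * h (cat w0 x)) <= ennreal r"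
  unfolding r(1)[symmetric] by (rule nsum_member[OF w0])
 moreover have "0 < wq f (P+s) w0 x * h (cat w0 x)" using Hs_h(2)[OF cat_C[OF w0 x]] by simp
 ultimately show "0 < h x - 1" using hr r by (simp add: ennreal_le_iff)
qed

lemma h_dist_m:
 assumes "x \<in> C" "y \<in> C" "m >= 1" "!!i. i < m ==> x i = y i"
 shows "h x <= exp (kap*\<theta>^m) * h y"
 using Hs_dist_m[OF order_refl assms, of "P+s"] Hs_h[OF assms(1)] Hs_h[OF assms(2)]
 by (simp add: ennreal_mult[symmetric] ennreal_le_iff)

lemma h_dist: assumes "x \<in> C" "y \<in> C" shows "h x <= exp kap * h y"
 using Hs_dist[OF order_refl assms, of "P+s"] Hs_h[OF assms(1)] Hs_h[OF assms(2)]
 by (simp add: ennreal_mult[symmetric] ennreal_le_iff)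

lemma cat_agree: "w \<in> W ==> (!!i. i < m ==> x i = y i) ==> i < Suc m ==> cat w x i = cat w y i"
 using FR_ne[of w S E a] by (cases w) (auto simp: cat_def)

text \<open>A Doob transform. As \<open>h\<close> solves L h = h - 1 and not L h = h, the
  normalising factor is \<open>h x - 1\<close>.\<close>

definition G where "G x w = (if w \<in> W then wq f (P+s) w x * h (cat w x)/(h x - 1) else 0)"

lemma G_nonneg: "x \<in> C ==> 0 <= G x w"
 using Lop_h(2)[of x] Hs_h(2)[OF cat_C[of w x]] by (auto simp: G_def)

definition K :: "(nat => nat) => nat list pmf" where "K x = embed_pmf (G x)"

lemma pmf_K: assumes x: "x \<in> C" shows "pmf (K x) w = G x w"
 unfolding K_def
proof (rule pmf_embed_pmf)
 show "0 <= G x w" for w by (rule G_nonneg[OF x])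
 have "(\<integral>\<^sup>+w. ennreal (G x w) \<partial>count_space UNIV) = nsum W (%w. ennreal (wq f (P+s) w x * h (cat w x))*ennreal (1/(h x - 1)))"
  unfolding nsum_indicator[of W] unfolding nsum_def
  by (rule nn_integral_cong) (use Lop_h(2)[OF x] Hs_h(2)[OF cat_C[OF _ x]] in "auto simp: G_def indicator_def ennreal_mult''[symmetric]")
 also have "... = ennreal (h x - 1)*ennreal (1/(h x - 1))" unfolding nsum_multc Lop_h(1)[OF x] ..
 also have "... = 1" using Lop_h(2)[OF x] by (simp add: ennreal_mult''[symmetric])
 finally show "(\<integral>\<^sup>+w. ennreal (G x w) \<partial>count_space UNIV) = 1" .
qed

lemma set_K: "x \<in> C ==> w \<in> set_pmf (K x) ==> w \<in> W"
 by (auto simp: set_pmf_iff pmf_K G_def split: if_splits)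

text \<open>Prepending a nonempty word gains a coordinate, so \<open>h\<close> at the image is at
  least as regular as the weight. These two factors enter once directly and once through
  \<open>h - 1\<close>, four in all.\<close>

lemma K_ratio:
 assumes x: "x \<in> C" and y: "y \<in> C" and m: "m >= 1" "!!i. i < m ==> x i = y i"
 shows "pmf (K x) w <= exp (k1*\<theta>^m) * pmf (K y) w"
proof (cases "w \<in> W")
 case w: True
 let ?e = "exp (kap*\<theta>^m)"
 have e1: "?e >= 1" using kap_nonneg \<theta> by simp
 have ra: "wq f (P+s) v x <= ?e * wq f (P+s) v y" if "v \<in> W" for v
  by (rule wq_dist_m[OF FR_Pth[OF that] x y m])
 have rb: "wq f (P+s) v y <= ?e * wq f (P+s) v x" if "v \<in> W" for v
  by (rule wq_dist_m[OF FR_Pth[OF that] y x m(1)]) (use m in auto)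
 have mm: "exp (kap*\<theta>^Suc m) <= ?e"
  using kap_nonneg \<theta> by (auto intro!: mult_left_mono power_decreasing)
 have rc: "h (cat v x) <= ?e * h (cat v y)" if "v \<in> W" for v
 proof -
  have "h (cat v x) <= exp (kap*\<theta>^Suc m) * h (cat v y)"
   by (rule h_dist_m[OF cat_C[OF that x] cat_C[OF that y]]) (use cat_agree[OF that, of m x y] m in auto)
  also have "... <= ?e * h (cat v y)" using mm Hs_h(2)[OF cat_C[OF that y]] by (intro mult_right_mono) auto
  finally show ?thesis .
 qed
 have rd: "h (cat v y) <= ?e * h (cat v x)" if "v \<in> W" for v
 proof -
  have "h (cat v y) <= exp (kap*\<theta>^Suc m) * h (cat v x)"
   by (rule h_dist_m[OF cat_C[OF that y] cat_C[OF that x]]) (use cat_agree[OF that, of m y x] m in auto)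
  also have "... <= ?e * h (cat v x)" using mm Hs_h(2)[OF cat_C[OF that x]] by (intro mult_right_mono) auto
  finally show ?thesis .
 qed
 have pos: "0 < h (cat v z)" if "v \<in> W" "z \<in> C" for v z using Hs_h(2)[OF cat_C[OF that]] by simp
 have "ennreal (h y - 1) <= ennreal (?e*?e*(h x - 1))"
 proof -
  have "ennreal (h y - 1) <= nsum W (%w. ennreal (?e*?e)*ennreal (wq f (P+s) w x * h (cat w x)))"
   unfolding Lop_h(1)[OF y, symmetric]
  proof (rule nsum_mono)
   fix v assume v: "v \<in> W"
   have "wq f (P+s) v y * h (cat v y) <= (?e * wq f (P+s) v x)*(?e * h (cat v x))"
    using pos[OF v y] by (intro mult_mono rb[OF v] rd[OF v]) auto
   then show "ennreal (wq f (P+s) v y * h (cat v y)) <= ennreal (?e*?e)*ennreal (wq f (P+s) v x * h (cat v x))"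
    by (subst ennreal_mult'[symmetric]) (auto intro!: ennreal_leI simp: mult_ac)
  qed
  then show ?thesis unfolding nsum_cmult Lop_h(1)[OF x] using Lop_h(2)[OF x] by (simp add: ennreal_mult')
 qed
 then have re: "h y - 1 <= ?e*?e*(h x - 1)" using Lop_h(2)[OF x] by (subst (asm) ennreal_le_iff) auto
 have "pmf (K x) w = wq f (P+s) w x * h (cat w x)/(h x - 1)" using w by (simp add: pmf_K[OF x] G_def)
 also have "... <= (?e * wq f (P+s) w y)*(?e * h (cat w y))/(h x - 1)"
  using pos[OF w x] Lop_h(2)[OF x] by (intro divide_right_mono mult_mono ra[OF w] rc[OF w]) auto
 also have "... = ?e*?e*(wq f (P+s) w y * h (cat w y))*(1/(h x - 1))" by simp
 also have "1/(h x - 1) <= ?e*?e/(h y - 1)" using re Lop_h(2)[OF x] Lop_h(2)[OF y] by (simp add: field_simps)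
 also have "?e*?e*(wq f (P+s) w y * h (cat w y))*(?e*?e/(h y - 1)) = (?e*?e*?e*?e) * pmf (K y) w"
  using w by (simp add: pmf_K[OF y] G_def)
 also have "?e*?e*?e*?e = exp (4 * kap*\<theta>^m)" by (simp add: exp_add[symmetric])
 also have "exp (4 * kap*\<theta>^m) * pmf (K y) w <= exp (k1*\<theta>^m) * pmf (K y) w"
  using \<theta> by (intro mult_right_mono) (auto simp: k1_def algebra_simps)
 finally show ?thesis using pos[OF w y] by (simp add: mult_left_mono)
next
 case False then show ?thesis by (simp add: pmf_K[OF x] pmf_K[OF y] G_def)
qed

text \<open>The danger is a small denominator. Keeping only the word \<open>w0\<close> in the series
  for \<open>h x - 1\<close> bounds it below by a fixed multiple of \<open>h x\<close>.\<close>

lemma K_dom: assumes x: "x \<in> C" and w: "w \<in> W" shows "pmf (K x) w <= M0 * wq f P w (pt a)"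
proof -
 have hx: "h x >= 1" by (rule Hs_h(2)[OF x])
 let ?c = "wq f (P+1) w0 (pt a)"
 have p: "pt a \<in> C" using a by simp
 have "?c <= wq f (P+s) w0 (pt a)" by (rule wq_antimono) (use s in simp)
 also have "... <= exp kap * wq f (P+s) w0 x" by (rule wq_dist[OF FR_Pth[OF w0] p x])
 finally have 1: "?c <= exp kap * wq f (P+s) w0 x" .
 have 2: "h x <= exp kap * h (cat w0 x)" by (rule h_dist[OF x cat_C[OF w0 x]])
 have "ennreal (wq f (P+s) w0 x * h (cat w0 x)) <= ennreal (h x - 1)"
  unfolding Lop_h(1)[OF x, symmetric] by (rule nsum_member[OF w0])
 then have 3: "wq f (P+s) w0 x * h (cat w0 x) <= h x - 1" using Lop_h(2)[OF x] by (subst (asm) ennreal_le_iff) auto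
 have "?c * h x <= (exp kap * wq f (P+s) w0 x)*(exp kap * h (cat w0 x))"
  using hx by (intro mult_mono 1 2) auto
 also have "... = exp (2 * kap)*(wq f (P+s) w0 x * h (cat w0 x))" by (simp add: exp_add[symmetric] mult_ac flip: mult_2)
 also have "... <= exp (2 * kap)*(h x - 1)" by (intro mult_left_mono 3) simp
 finally have 4: "?c * h x <= exp (2 * kap)*(h x - 1)" .
 have "wq f (P+s) w x <= exp kap * wq f (P+s) w (pt a)" by (rule wq_dist[OF FR_Pth[OF w] x p])
 also have "... <= exp kap * wq f P w (pt a)" using s by (intro mult_left_mono wq_antimono) auto
 finally have 5: "wq f (P+s) w x <= exp kap * wq f P w (pt a)" .
 have 6: "h (cat w x) <= exp kap * h x" by (rule h_dist[OF cat_C[OF w x] x])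
 have "wq f (P+s) w x * h (cat w x) <= (exp kap * wq f P w (pt a))*(exp kap * h x)"
  using Hs_h(2)[OF cat_C[OF w x]] by (intro mult_mono 5 6) auto
 also have "... = exp (2 * kap) * wq f P w (pt a)/?c*(?c * h x)"
  by (simp add: exp_add[symmetric] mult_ac less_imp_neq[OF wq_pos, symmetric] flip: mult_2)
 also have "... <= exp (2 * kap) * wq f P w (pt a)/?c*(exp (2 * kap)*(h x - 1))"
  by (intro mult_left_mono 4) simp
 also have "... = M0 * wq f P w (pt a)*(h x - 1)"
  by (simp add: M0_def exp_add[symmetric] mult_ac)
 finally have "wq f (P+s) w x * h (cat w x)/(h x - 1) <= M0 * wq f P w (pt a)"
  using Lop_h(2)[OF x] by (simp add: pos_divide_le_eq)
 then show ?thesis using w by (simp add: pmf_K[OF x] G_def)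
qed

lemma K_exp_moment:
 assumes x: "x \<in> C"
 shows "integrable (measure_pmf (K x)) (%w. exp (eps * real (length w)))"
  "measure_pmf.expectation (K x) (%w. exp (eps * real (length w))) <= M1"
proof -
 have "(\<integral>\<^sup>+w. ennreal (exp (eps * real (length w))) \<partial>measure_pmf (K x))
  = nsum UNIV (%w. ennreal (pmf (K x) w)*ennreal (exp (eps * real (length w))))"
  unfolding nn_integral_measure_pmf nsum_def ..
 also have "... <= nsum UNIV (%w. ennreal M0*(ennreal (wq f (P - eps) w (pt a)) * indicator W w))"
 proof (rule nsum_mono)
  fix w
  show "ennreal (pmf (K x) w)*ennreal (exp (eps * real (length w))) <= ennreal M0*(ennreal (wq f (P - eps) w (pt a)) * indicator W w)"
  proof (cases "w \<in> W")
   case True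
   have "pmf (K x) w*exp (eps * real (length w)) <= M0 * wq f P w (pt a)*exp (eps * real (length w))"
    by (intro mult_right_mono K_dom[OF x True]) simp
   also have "... = M0 * wq f (P - eps) w (pt a)" by (subst wq_change[of _ "P - eps" _ _ P]) simp
   finally show ?thesis using True M0 by (simp add: ennreal_mult[symmetric])
  next
   case False
   then have "pmf (K x) w = 0" by (simp add: pmf_K[OF x] G_def)
   then show ?thesis by simp
  qed
 qed
 also have "... = ennreal M1"
  unfolding nsum_cmult nsum_indicator[symmetric] TT(2) M1_def using M0 TT by (simp add: ennreal_mult')
 finally have le: "(\<integral>\<^sup>+w. ennreal (exp (eps * real (length w))) \<partial>measure_pmf (K x)) <= ennreal M1" .
 show int: "integrable (measure_pmf (K x)) (%w. exp (eps * real (length w)))"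
  by (rule integrableI_bounded) (use le in "auto simp: le_less_trans")
 have "ennreal (measure_pmf.expectation (K x) (%w. exp (eps * real (length w)))) <= ennreal M1"
  using le by (subst nn_integral_eq_integral[OF int, symmetric]) auto
 then show "measure_pmf.expectation (K x) (%w. exp (eps * real (length w))) <= M1" using M1 by simp
qed

lemma K_integrable:
 assumes x: "x \<in> C" and b: "!!w. w \<in> W ==> \<bar>F w\<bar> <= c*exp (eps * real (length w))"
 shows "integrable (measure_pmf (K x)) F"
 by (rule Bochner_Integration.integrable_bound[OF integrable_mult_right[OF K_exp_moment(1)[OF x], of c]])
  (use b set_K[OF x] in "auto simp: AE_measure_pmf_iff intro!: order_trans[OF _ abs_ge_self]")

lemma K_bound:
 assumes x: "x \<in> C" and b: "!!w. w \<in> W ==> \<bar>F w\<bar> <= c*exp (eps * real (length w))" and c: "c >= 0"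
 shows "\<bar>measure_pmf.expectation (K x) F\<bar> <= c * M1"
proof -
 have i: "integrable (measure_pmf (K x)) F" by (rule K_integrable[OF x b])
 have "\<bar>measure_pmf.expectation (K x) F\<bar> <= measure_pmf.expectation (K x) (%w. \<bar>F w\<bar>)"
  by (rule integral_abs_bound)
 also have "... <= measure_pmf.expectation (K x) (%w. c*exp (eps * real (length w)))"
  by (rule integral_mono_AE) (use i K_exp_moment(1)[OF x] b set_K[OF x] in "auto simp: AE_measure_pmf_iff")
 also have "... <= c * M1" using K_exp_moment(2)[OF x] c by (simp add: mult_left_mono)
 finally show ?thesis .
qed

definition KK :: "((nat => nat) => real) => (nat => nat) => real" where
 "KK v x = measure_pmf.expectation (K x) (%w. v (cat w x))"

lemma KK_integrable: assumes "bdd v" "x \<in> C" shows "integrable (measure_pmf (K x)) (%w. v (cat w x))"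
proof -
 obtain M where M: "!!x. x \<in> C ==> \<bar>v x\<bar> <= M" using assms by (auto simp: bdd_def)
 show ?thesis
  by (rule measure_pmf.integrable_const_bound[where B=M]) (use M cat_C set_K assms in "auto simp: AE_measure_pmf_iff")
qed

lemma KK_cong: "(!!x. x \<in> C ==> v x = v' x) ==> x \<in> C ==> KK v x = KK v' x"
proof -
 assume H: "!!x. x \<in> C ==> v x = v' x" and x: "x \<in> C"
 have "v (cat w x) = v' (cat w x)" if "w \<in> set_pmf (K x)" for w
  by (rule H[OF cat_C[OF set_K[OF x that] x]])
 then show ?thesis unfolding KK_def by (intro integral_cong_AE) (auto simp: AE_measure_pmf_iff)
qed

lemma KK_lin: assumes "bdd v" "bdd v'" "x \<in> C" shows "KK (%x. v x+r * v' x) x = KK v x+r * KK v' x"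
 unfolding KK_def using KK_integrable[OF assms(1,3)] KK_integrable[OF assms(2,3)] by simp

lemma KK_mono: assumes "bdd v" "bdd v'" "x \<in> C" "!!x. x \<in> C ==> v x <= v' x" shows "KK v x <= KK v' x"
 unfolding KK_def
 by (rule integral_mono_AE[OF KK_integrable[OF assms(1,3)] KK_integrable[OF assms(2,3)]])
  (simp add: AE_measure_pmf_iff assms(4)[OF cat_C[OF set_K[OF assms(3)] assms(3)]])

lemma KK_const: "KK (%_. c) x = c" by (simp add: KK_def)

lemma KK_bdd: assumes "bdd v" shows "bdd (KK v)"
proof -
 obtain M where M: "!!x. x \<in> C ==> \<bar>v x\<bar> <= M" using assms by (auto simp: bdd_def)
 have "\<bar>KK v x\<bar> <= M" if x: "x \<in> C" for x
 proof -
  have b: "bdd (%_. M)" "bdd (%_. - M)" by (auto simp: bdd_def)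
  have "KK v x <= KK (%_. M) x" by (rule KK_mono[OF assms b(1) x]) (use M in force)
  moreover have "KK (%_. - M) x <= KK v x" by (rule KK_mono[OF b(2) assms x]) (use M in force)
  ultimately show ?thesis by (simp add: KK_const abs_le_iff)
 qed
 then show ?thesis by (auto simp: bdd_def)
qed

lemma bdd_lin: "bdd v ==> bdd v' ==> bdd (%x. v x+r * v' x)"
proof -
 assume "bdd v" "bdd v'"
 then obtain M M' where M: "!!x. x \<in> C ==> \<bar>v x\<bar> <= M" "!!x. x \<in> C ==> \<bar>v' x\<bar> <= M'" by (auto simp: bdd_def)
 have "\<bar>v x+r * v' x\<bar> <= M+\<bar>r\<bar> * M'" if "x \<in> C" for x
 proof -
  have "\<bar>v x+r * v' x\<bar> <= \<bar>v x\<bar>+\<bar>r\<bar>*\<bar>v' x\<bar>" using abs_triangle_ineq[of "v x" "r * v' x"] by (simp add: abs_mult)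
  also have "... <= M+\<bar>r\<bar> * M'" by (intro add_mono mult_left_mono M that) simp
  finally show ?thesis .
 qed
 then show ?thesis by (auto simp: bdd_def)
qed

lemma KK_pow_bdd: "bdd v ==> bdd ((KK^^m) v)" by (induction m) (auto intro: KK_bdd)

lemma KK_pow_lin:
 assumes "bdd v" "bdd v'" "x \<in> C"
 shows "(KK^^m) (%x. v x+r * v' x) x = (KK^^m) v x+r*(KK^^m) v' x"
 using assms(3)
proof (induction m arbitrary: x)
 case (Suc m)
 have "(KK^^Suc m) (%x. v x+r * v' x) x = KK (%x. (KK^^m) v x+r*(KK^^m) v' x) x"
  unfolding funpow.simps comp_def by (rule KK_cong) (use Suc in auto)
 also have "... = (KK^^Suc m) v x+r*(KK^^Suc m) v' x"
  by (simp add: KK_lin[OF KK_pow_bdd[OF assms(1)] KK_pow_bdd[OF assms(2)] Suc.prems])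
 finally show ?case .
qed simp

lemma KK_pow_mono:
 assumes "bdd v" "bdd v'" "!!x. x \<in> C ==> v x <= v' x" "x \<in> C"
 shows "(KK^^m) v x <= (KK^^m) v' x"
 using assms(4)
proof (induction m arbitrary: x)
 case (Suc m)
 show ?case unfolding funpow.simps comp_def
  by (rule KK_mono[OF KK_pow_bdd[OF assms(1)] KK_pow_bdd[OF assms(2)] Suc.prems Suc.IH])
qed (use assms in auto)

text \<open>Coupling without a joint law: \<open>K y\<close> dominates the multiple
  \<open>exp (- k1 * \<theta>^m)\<close> of \<open>K x\<close>. On this common part the images agree
  in \<open>m + 1\<close> coordinates, and on the remainder \<open>v\<close> varies by at most
  \<open>b\<close>.\<close>

lemma KK_Lip: assumes L: "Lip b v" and b: "b >= 0" shows "Lip (rho * b) (KK v)"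
proof -
 have one: "KK v x - KK v y <= rho * b * Dm m"
  if x: "x \<in> C" and y: "y \<in> C" and m: "m >= 1" and eq: "!!i. i < m ==> x i = y i" for x y m
 proof -
  \<comment> \<open>Subtracting the infimum makes the integrand nonnegative, as the comparison of
    the two laws requires, with values at most \<open>b\<close>.\<close>
  define lo where "lo = Inf (v ` C)"
  have ne: "v ` C ~= {}" using x by auto
  have bb: "bdd_below (v ` C)"
   using Lip_osc[OF L b _ x] by (intro bdd_belowI[of _ "v x - b"]) (force simp: abs_le_iff)
  have lo1: "lo <= v z" if "z \<in> C" for z unfolding lo_def by (rule cInf_lower) (use that bb in auto)
  have lo2: "v z <= lo+b" if "z \<in> C" for z
  proof -
   have "v z - b <= lo" unfolding lo_def
    by (rule cInf_greatest[OF ne]) (use Lip_osc[OF L b that] in "force simp: abs_le_iff")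
   then show ?thesis by simp
  qed
  let ?g = "%w. v (cat w y) - lo" and ?gx = "%w. v (cat w x) - lo"
  define c where "c = exp (- k1*\<theta>^m)"
  have c: "0 <= c" "c <= 1" using k1 \<theta> by (auto simp: c_def)
  have vb: "bdd v" by (rule Lip_bdd[OF L b])
  obtain M where M: "!!x. x \<in> C ==> \<bar>v x\<bar> <= M" using vb by (auto simp: bdd_def)
  have iy: "integrable (measure_pmf (K y)) ?g" using KK_integrable[OF vb y] by simp
  have ix: "integrable (measure_pmf (K x)) ?gx" using KK_integrable[OF vb x] by simp
  have ixy: "integrable (measure_pmf (K x)) ?g"
   by (rule measure_pmf.integrable_const_bound[where B="M+\<bar>lo\<bar>"])
    (use M[OF cat_C[OF set_K[OF x] y]] in "force simp: AE_measure_pmf_iff")+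
  have "c * measure_pmf.expectation (K x) ?g <= measure_pmf.expectation (K y) ?g"
  proof (rule pmf_compare[OF _ c(1) _ ixy iy])
   fix w
   have "c * pmf (K x) w <= c*(exp (k1*\<theta>^m) * pmf (K y) w)" by (intro mult_left_mono K_ratio x y m eq c)
   then show "c * pmf (K x) w <= pmf (K y) w" by (simp add: c_def mult.assoc[symmetric] exp_add[symmetric] del: mult_le_cancel_left_pos)
  qed (use lo1 cat_C[OF set_K y] x y in auto)
  moreover have "measure_pmf.expectation (K x) ?gx <= c*(measure_pmf.expectation (K x) ?g+b * Dm (Suc m))+(1 - c) * b"
  proof -
   have "measure_pmf.expectation (K x) ?gx <= measure_pmf.expectation (K x) (%w. c*(?g w+b * Dm (Suc m))+(1 - c) * b)"
   proof (rule integral_mono_AE[OF ix])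
    show "AE w in measure_pmf (K x). ?gx w <= c*(?g w+b * Dm (Suc m))+(1 - c) * b"
     unfolding AE_measure_pmf_iff
    proof
     fix w assume "w \<in> set_pmf (K x)"
     then have w: "w \<in> W" by (rule set_K[OF x])
     have "\<bar>v (cat w x) - v (cat w y)\<bar> <= b * Dm (Suc m)"
      using L cat_C[OF w x] cat_C[OF w y] cat_agree[OF w, of m x y] eq unfolding Lip_def by auto
     then have "c*?gx w <= c*(?g w+b * Dm (Suc m))" using c by (intro mult_left_mono) auto
     moreover have "(1 - c)*?gx w <= (1 - c) * b" using c lo2[OF cat_C[OF w x]] by (intro mult_left_mono) auto
     ultimately show "?gx w <= c*(?g w+b * Dm (Suc m))+(1 - c) * b" by (simp add: algebra_simps)
    qed
   qed (use ixy in simp)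
   also have "... = c*(measure_pmf.expectation (K x) ?g+b * Dm (Suc m))+(1 - c) * b" using ixy by simp
   finally show ?thesis .
  qed
  ultimately have "measure_pmf.expectation (K x) ?gx - measure_pmf.expectation (K y) ?g <= b*(c * Dm (Suc m)+(1 - c))"
   by (simp add: algebra_simps)
  also have "... <= b*(rho * Dm m)" unfolding c_def by (intro mult_left_mono Dm_contract b)
  finally show ?thesis using KK_integrable[OF vb x] KK_integrable[OF vb y] by (simp add: KK_def algebra_simps)
 qed
 show ?thesis unfolding Lip_def
 proof (intro ballI allI impI)
  fix x y m assume H: "x \<in> C" "y \<in> C" "1 <= m" "ALL i<m. x i = y i"
  have "KK v x - KK v y <= rho * b * Dm m" by (rule one) (use H in auto)
  moreover have "KK v y - KK v x <= rho * b * Dm m" by (rule one) (use H in auto)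
  ultimately show "\<bar>KK v x - KK v y\<bar> <= rho * b * Dm m" by auto
 qed
qed

lemma KK_pow_Lip: assumes "Lip b v" "b >= 0" shows "Lip (rho^m * b) ((KK^^m) v)"
proof (induction m)
 case (Suc m)
 from KK_Lip[OF this] show ?case using rho assms by (simp add: mult.assoc)
qed (use assms in auto)

text \<open>The first-order effect of a perturbation \<open>g\<close>: its expected Birkhoff sum
  over one return.\<close>

definition U :: "((nat => nat) => real) => (nat => nat) => real" where
 "U g x = measure_pmf.expectation (K x) (%w. birk shift g (length w) (cat w x))"

lemma birk_abs_le: assumes "okg dlt g" "x \<in> Sg" shows "\<bar>birk shift g n x\<bar> <= dlt * real n"
proof -
 have "\<bar>birk shift g n x\<bar> <= (\<Sum>k<n. \<bar>g ((shift^^k) x)\<bar>)" unfolding birk_def by (rule sum_abs)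
 also have "... <= real (card {..<n}) * dlt"
  by (rule sum_bounded_above) (use assms Sigma_plus_shift[OF assms(2)] in "auto simp: okg_def")
 finally show ?thesis by (simp add: mult.commute)
qed

lemma length_le_exp: "real l <= exp (eps * real l)/eps"
proof -
 have "eps * real l <= exp (eps * real l)" using exp_ge_add_one_self[of "eps * real l"] by linarith
 then show ?thesis using eps by (simp add: field_simps)
qed

lemma catw: "w \<in> W ==> x \<in> C ==> cat w x \<in> Sg"
 using cat_C by (auto simp: cyl1_iff)

lemma birk_exp_bound:
 assumes "okg dlt g" "w \<in> W" "x \<in> C"
 shows "\<bar>birk shift g (length w) (cat w x)\<bar> <= dlt/eps*exp (eps * real (length w))"
proof -
 have "\<bar>birk shift g (length w) (cat w x)\<bar> <= dlt * real (length w)" by (rule birk_abs_le[OF assms(1) catw[OF assms(2,3)]])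
 also have "... <= dlt*(exp (eps * real (length w))/eps)"
  using assms(1) by (intro mult_left_mono length_le_exp) (auto simp: okg_def)
 finally show ?thesis by simp
qed

lemma U_integrable:
 assumes "okg dlt g" "x \<in> C" "y \<in> C"
 shows "integrable (measure_pmf (K x)) (%w. birk shift g (length w) (cat w y))"
 by (rule K_integrable[OF assms(2) birk_exp_bound[OF assms(1) _ assms(3)]])

lemma len_integrable: "x \<in> C ==> integrable (measure_pmf (K x)) (%w. real (length w))"
 by (rule K_integrable[of _ _ "1/eps"]) (use length_le_exp in auto)

lemma U_const: "U (%_. r) x = r * measure_pmf.expectation (K x) (%w. real (length w))"
 unfolding U_def by simp

lemma U_add: assumes "okg dlt g" "x \<in> C"
 shows "U (%x. g x+r) x = U g x+r * U (%_. 1) x"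
 unfolding U_const using U_integrable[OF assms(1,2,2)] len_integrable[OF assms(2)]
 by (simp add: U_def birk_add_fun)

lemma U1_ge: assumes x: "x \<in> C" shows "1 <= U (%_. 1) x"
proof -
 have "measure_pmf.expectation (K x) (%_. 1) <= measure_pmf.expectation (K x) (%w. real (length w))"
 proof (rule integral_mono_AE[OF _ len_integrable[OF x]])
  have "1 <= real (length w)" if "w \<in> set_pmf (K x)" for w
   using FR_ne[OF set_K[OF x that]] by (cases w) auto
  then show "AE w in measure_pmf (K x). 1 <= real (length w)" by (simp add: AE_measure_pmf_iff)
 qed simp
 then show ?thesis by (simp add: U_const)
qed

lemma U_abs: assumes "okg dlt g" "x \<in> C" shows "\<bar>U g x\<bar> <= dlt * U (%_. 1) x"
proof -
 have "\<bar>U g x\<bar> <= measure_pmf.expectation (K x) (%w. \<bar>birk shift g (length w) (cat w x)\<bar>)"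
  unfolding U_def by (rule integral_abs_bound)
 also have "... <= measure_pmf.expectation (K x) (%w. dlt * real (length w))"
 proof (rule integral_mono_AE)
  show "AE w in measure_pmf (K x). \<bar>birk shift g (length w) (cat w x)\<bar> <= dlt * real (length w)"
   using birk_abs_le[OF assms(1) catw[OF set_K[OF assms(2)] assms(2)]] by (simp add: AE_measure_pmf_iff)
 qed (use U_integrable[OF assms(1,2,2)] len_integrable[OF assms(2)] in auto)
 finally show ?thesis by (simp add: U_const)
qed

lemma expectation_diff:
 assumes x: "x \<in> C" and y: "y \<in> C" and m: "m >= 1" "!!i. i < m ==> x i = y i"
  and F: "!!w. w \<in> W ==> 0 <= F w" "!!w. w \<in> W ==> F w <= d * real (length w)" and d: "d >= 0"
 shows "measure_pmf.expectation (K x) F - measure_pmf.expectation (K y) F <= k1*\<theta>^m*(d * M1/eps)"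
proof -
 let ?c = "exp (- k1*\<theta>^m)"
 have b: "\<bar>F w\<bar> <= d/eps*exp (eps * real (length w))" if "w \<in> W" for w
  using F[OF that] mult_left_mono[OF length_le_exp d, of "length w"] by simp
 have i: "integrable (measure_pmf (K z)) F" if "z \<in> C" for z by (rule K_integrable[OF that b])
 have "?c * measure_pmf.expectation (K x) F <= measure_pmf.expectation (K y) F"
 proof (rule pmf_compare[OF _ _ _ i[OF x] i[OF y]])
  fix w
  have "?c * pmf (K x) w <= ?c*(exp (k1*\<theta>^m) * pmf (K y) w)" by (intro mult_left_mono K_ratio x y m) auto
  then show "?c * pmf (K x) w <= pmf (K y) w" by (simp add: mult.assoc[symmetric] exp_add[symmetric] del: mult_le_cancel_left_pos)
 qed (use F set_K x y in auto)
 moreover have "(1 - ?c) * measure_pmf.expectation (K x) F <= k1*\<theta>^m*(d * M1/eps)"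
 proof (rule mult_mono)
  show "1 - ?c <= k1*\<theta>^m" using exp_ge_add_one_self[of "- k1*\<theta>^m"] by simp
  have "\<bar>measure_pmf.expectation (K x) F\<bar> <= d/eps * M1" by (rule K_bound[OF x b]) (use d eps in auto)
  then show "measure_pmf.expectation (K x) F <= d * M1/eps" by simp
  show "0 <= k1*\<theta>^m" using k1 \<theta> by simp
  show "0 <= measure_pmf.expectation (K x) F"
   by (rule integral_nonneg_AE) (use F set_K[OF x] in "auto simp: AE_measure_pmf_iff")
 qed
 ultimately show ?thesis by (simp add: algebra_simps)
qed

text \<open>Moving the point inside the Birkhoff sum costs the distortion of \<open>g\<close>.
  Changing the law needs a nonnegative integrand, so \<open>dlt\<close> times the length is added
  and subtracted; the bounds 2 and 1 make up the 3 in \<open>C5\<close>.\<close>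

lemma U_Lip: assumes ok: "okg dlt g" shows "Lip (C5 * dlt) (U g)"
proof -
 interpret g: pot S E g dlt \<theta> dlt by (rule okg_pot[OF ok])
 have dlt: "dlt >= 0" using ok by (simp add: okg_def)
 have one: "U g x - U g y <= C5 * dlt * Dm m"
  if x: "x \<in> C" and y: "y \<in> C" and m: "m >= 1" and eq: "!!i. i < m ==> x i = y i" for x y m
 proof -
  let ?F = "%z w. birk shift g (length w) (cat w z)"
  let ?E = "%z F. measure_pmf.expectation (K z) F"
  have ix: "integrable (measure_pmf (K x)) (?F x)" "integrable (measure_pmf (K x)) (?F y)" "integrable (measure_pmf (K y)) (?F y)"
   using U_integrable[OF ok] x y by auto
  have "?E x (?F x) <= ?E x (%w. ?F y w+g.kap*\<theta>^m)"
  proof (rule integral_mono_AE[OF ix(1)])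
   have "?F x w <= ?F y w+g.kap*\<theta>^m" if "w \<in> set_pmf (K x)" for w
    using g.birk_cat_dist[OF FR_Pth[OF set_K[OF x that]] x y m eq] by (auto simp: abs_le_iff)
   then show "AE w in measure_pmf (K x). ?F x w <= ?F y w+g.kap*\<theta>^m" by (simp add: AE_measure_pmf_iff)
  qed (use ix in simp)
  then have 1: "?E x (?F x) <= ?E x (?F y)+g.kap*\<theta>^m" using ix by simp
  have li: "integrable (measure_pmf (K z)) (%w. dlt * real (length w))" if "z \<in> C" for z using len_integrable[OF that] by simp
  have Fb: "0 <= ?F y w+dlt * real (length w)" "?F y w+dlt * real (length w) <= 2 * dlt * real (length w)" if "w \<in> W" for w
   using birk_abs_le[OF ok catw[OF that y], of "length w"] by (simp_all add: abs_le_iff)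
  have "?E x (%w. ?F y w+dlt * real (length w)) - ?E y (%w. ?F y w+dlt * real (length w)) <= k1*\<theta>^m*(2 * dlt * M1/eps)"
   by (rule expectation_diff[OF x y m eq])
    (use dlt Fb in auto)
  moreover have "?E y (%w. dlt * real (length w)) - ?E x (%w. dlt * real (length w)) <= k1*\<theta>^m*(dlt * M1/eps)"
   by (rule expectation_diff[OF y x m]) (use eq dlt in auto)
  moreover define R where "R = k1*\<theta>^m*(dlt * M1/eps)"
  moreover have "k1*\<theta>^m*(2 * dlt * M1/eps) = 2 * R" "k1*\<theta>^m*(3 * dlt * M1/eps) = 3 * R" by (simp_all add: R_def)
  moreover have "?E z (%w. ?F y w+dlt * real (length w)) = ?E z (?F y)+?E z (%w. dlt * real (length w))" if "z \<in> {x, y}" for z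
   using ix li[of z] that x y by auto
  ultimately have 2: "?E x (?F y) - ?E y (?F y) <= k1*\<theta>^m*(3 * dlt * M1/eps)" by simp
  have "U g x - U g y <= g.kap*\<theta>^m+k1*\<theta>^m*(3 * dlt * M1/eps)" using 1 2 by (simp add: U_def)
  also have "... = dlt*(\<theta>/(1 - \<theta>)+3 * k1 * M1/eps)*\<theta>^m" by (simp add: g.kap_def algebra_simps)
  also have "\<theta>/(1 - \<theta>)+3 * k1 * M1/eps = C5*(b1*exp (- b1))" using b1 by (simp add: C5_def)
  also have "dlt*(C5*(b1*exp (- b1)))*\<theta>^m = C5 * dlt*(b1*exp (- b1)*\<theta>^m)" by (simp add: mult_ac)
  also have "... <= C5 * dlt * Dm m" using C5 dlt by (intro mult_left_mono Dm_ge) auto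
  finally show ?thesis .
 qed
 show ?thesis unfolding Lip_def
 proof (intro ballI allI impI)
  fix x y m assume H: "x \<in> C" "y \<in> C" "1 <= m" "ALL i<m. x i = y i"
  have "U g x - U g y <= C5 * dlt * Dm m" by (rule one) (use H in auto)
  moreover have "U g y - U g x <= C5 * dlt * Dm m" by (rule one) (use H in auto)
  ultimately show "\<bar>U g x - U g y\<bar> <= C5 * dlt * Dm m" by auto
 qed
qed

lemma exp_le_quadratic: "exp z <= 1+z+z\<^sup>2*exp \<bar>z\<bar>" for z :: real
proof -
 obtain t where t: "\<bar>t\<bar> <= \<bar>z\<bar>" "exp z = (\<Sum>m<2. z^m/fact m)+exp t/fact 2 * z^2"
  using Maclaurin_exp_le[of z 2] by blast
 have "exp z = 1+z+exp t/2 * z\<^sup>2" using t(2) by (simp add: numeral_2_eq_2)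
 also have "exp t/2 * z\<^sup>2 <= exp \<bar>z\<bar> * z\<^sup>2" proof (rule mult_right_mono)
  have "exp t <= exp \<bar>z\<bar>" using t(1) by simp
  then show "exp t/2 <= exp \<bar>z\<bar>" using exp_ge_zero[of "\<bar>z\<bar>"] by linarith
 qed simp
 finally show ?thesis by (simp add: mult.commute)
qed

text \<open>The test function \<open>h * exp v\<close> is a supersolution for \<open>f + g\<close>,
  where \<open>v\<close> approximately solves the Poisson equation for \<open>U g\<close>. Since the
  linear term is cancelled by \<open>v\<close>, only a quadratic error remains.\<close>

lemma perturbed_growth:
 assumes ok: "okg d g" and z: "(KK^^m) (U g) (pt a) = 0" and small: "c2 * d <= eps/2"
 shows "growth (%x. f x+g x) W (pt a) (P+s+(C5 * d * rho^m+(c2 * d)\<^sup>2*(8/eps\<^sup>2) * M1))"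
proof -
 \<comment> \<open>The first summand bounds the remainder of the Poisson sum truncated after
   \<open>m\<close> terms, the second the expected Taylor remainder of the exponential.\<close>
 define \<zeta> where "\<zeta> = C5 * d * rho^m+(c2 * d)\<^sup>2*(8/eps\<^sup>2) * M1"
 have d: "d >= 0" using ok by (simp add: okg_def)
 define b0 where "b0 = C5 * d"
 have b0: "b0 >= 0" using C5 d by (simp add: b0_def)
 have uL: "Lip b0 (U g)" unfolding b0_def by (rule U_Lip[OF ok])
 define u where "u j = (KK^^j) (U g)" for j
 have Lu: "Lip (rho^j * b0) (u j)" for j unfolding u_def by (rule KK_pow_Lip[OF uL b0])
 have nn: "0 <= rho^j * b0" for j using rho b0 by simp
 have ub: "bdd (u j)" for j by (rule Lip_bdd[OF Lu nn])
 have pC: "pt a \<in> C" using a by simp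
 \<comment> \<open>By telescoping, \<open>v - KK v = U g - u m\<close>. The remainder
   \<open>u m\<close> is small because it vanishes at \<open>pt a\<close> and its oscillation has
   contracted by \<open>rho^m\<close>.\<close>
 define v where "v x = (\<Sum>j<m. u j x - u j (pt a))" for x
 have v_abs: "\<bar>v x\<bar> <= b0/(1 - rho)" if x: "x \<in> C" for x
 proof -
  have "\<bar>v x\<bar> <= (\<Sum>j<m. \<bar>u j x - u j (pt a)\<bar>)" unfolding v_def by (rule sum_abs)
  also have "... <= (\<Sum>j<m. rho^j * b0)" by (intro sum_mono Lip_osc[OF Lu nn x pC])
  also have "... = b0*((1 - rho^m)/(1 - rho))"
   unfolding sum_distrib_right[symmetric] using rho by (simp add: sum_gp_strict mult.commute)
  also have "... <= b0*(1/(1 - rho))" using rho b0 by (intro mult_left_mono divide_right_mono) auto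
  finally show ?thesis by simp
 qed
 have vb: "bdd v" using v_abs by (auto simp: bdd_def)
 have Kv: "KK v x = v x - U g x+u m x" if x: "x \<in> C" for x
 proof -
  have "KK v x = (\<Sum>j<m. KK (u j) x - u j (pt a))"
   unfolding KK_def v_def using KK_integrable[OF ub x] by (simp add: Bochner_Integration.integral_sum)
  also have "... = (\<Sum>j<m. u (Suc j) x - u j (pt a))" by (simp add: u_def)
  also have "... = v x+(\<Sum>j<m. u (Suc j) x - u j x)" by (simp add: v_def sum.distrib[symmetric])
  also have "(\<Sum>j<m. u (Suc j) x - u j x) = u m x - u 0 x" by (rule sum_lessThan_telescope)
  finally show ?thesis by (simp add: u_def)
 qed
 have um: "\<bar>u m x\<bar> <= rho^m * b0" if x: "x \<in> C" for x
  using Lip_osc[OF Lu nn x pC, of m] z by (simp add: u_def)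
 have Ez: "integrable (measure_pmf (K x)) (%w. exp (birk shift g (length w) (cat w x)+v (cat w x)))"
  "measure_pmf.expectation (K x) (%w. exp (birk shift g (length w) (cat w x)+v (cat w x))) <= exp (v x+\<zeta>)"
  if x: "x \<in> C" for x
 proof -
  let ?z = "%w. birk shift g (length w) (cat w x)+v (cat w x)"
  have zb: "\<bar>?z w\<bar> <= c2 * d * real (length w)" if w: "w \<in> W" for w
  proof -
   have l: "1 <= real (length w)" using FR_ne[OF w] by (cases w) auto
   have "\<bar>?z w\<bar> <= d * real (length w)+b0/(1 - rho)"
    using birk_abs_le[OF ok catw[OF w x], of "length w"] v_abs[OF cat_C[OF w x]] by linarith
   also have "... <= d * real (length w)+b0/(1 - rho) * real (length w)"
    using l b0 rho mult_left_mono[OF l, of "b0/(1 - rho)"] by simp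
   also have "... = c2 * d * real (length w)" by (simp add: c2_def b0_def algebra_simps)
   finally show ?thesis .
  qed
  have zb2: "\<bar>?z w\<bar> <= eps/2 * real (length w)" if w: "w \<in> W" for w
   using zb[OF w] mult_right_mono[OF small, of "real (length w)"] by simp
  have eb: "\<bar>exp (?z w)\<bar> <= 1*exp (eps * real (length w))" if w: "w \<in> W" for w
  proof -
   have "eps/2 * real (length w) <= eps * real (length w)" using eps by (intro mult_right_mono) auto
   then have "?z w <= eps * real (length w)" using zb2[OF w] by linarith
   then show ?thesis by simp
  qed
  show i1: "integrable (measure_pmf (K x)) (%w. exp (?z w))" by (rule K_integrable[OF x eb])
  have qb: "(?z w)\<^sup>2*exp \<bar>?z w\<bar> <= (c2 * d)\<^sup>2*(8/eps\<^sup>2)*exp (eps * real (length w))" if w: "w \<in> W" for w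
  proof -
   let ?l = "real (length w)"
   have "(?z w)\<^sup>2 = \<bar>?z w\<bar>\<^sup>2" by simp
   also have "... <= (c2 * d*?l)\<^sup>2" by (rule power_mono[OF zb[OF w]]) simp
   finally have 1: "(?z w)\<^sup>2 <= (c2 * d)\<^sup>2*?l\<^sup>2" by (simp add: power_mult_distrib)
   have "(eps/2*?l)\<^sup>2/2 <= exp (eps/2*?l)"
   proof -
    have "0 <= eps/2*?l" using eps by simp
    with exp_lower_Taylor_quadratic[OF this] show ?thesis by linarith
   qed
   then have 2: "?l\<^sup>2 <= 8/eps\<^sup>2*exp (eps/2*?l)" using eps by (simp add: power_mult_distrib power_divide field_simps)
   have "(?z w)\<^sup>2*exp \<bar>?z w\<bar> <= ((c2 * d)\<^sup>2*?l\<^sup>2)*exp (eps/2*?l)"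
    using 1 zb2[OF w] by (intro mult_mono) auto
   also have "... <= ((c2 * d)\<^sup>2*(8/eps\<^sup>2*exp (eps/2*?l)))*exp (eps/2*?l)"
    by (intro mult_right_mono mult_left_mono 2) auto
   also have "... = (c2 * d)\<^sup>2*(8/eps\<^sup>2)*exp (eps*?l)" by (simp add: exp_add[symmetric] mult_ac)
   finally show ?thesis .
  qed
  have i2: "integrable (measure_pmf (K x)) (%w. (?z w)\<^sup>2*exp \<bar>?z w\<bar>)"
   by (rule K_integrable[OF x, of _ "(c2 * d)\<^sup>2*(8/eps\<^sup>2)"]) (use qb in simp)
  have q: "measure_pmf.expectation (K x) (%w. (?z w)\<^sup>2*exp \<bar>?z w\<bar>) <= (c2 * d)\<^sup>2*(8/eps\<^sup>2) * M1"
  proof -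
   have "\<bar>measure_pmf.expectation (K x) (%w. (?z w)\<^sup>2*exp \<bar>?z w\<bar>)\<bar> <= (c2 * d)\<^sup>2*(8/eps\<^sup>2) * M1"
    by (rule K_bound[OF x]) (use qb in auto)
   then show ?thesis by simp
  qed
  have iz: "integrable (measure_pmf (K x)) (%w. birk shift g (length w) (cat w x))" "integrable (measure_pmf (K x)) (%w. v (cat w x))"
   using U_integrable[OF ok x x] KK_integrable[OF vb x] by auto
  have "measure_pmf.expectation (K x) (%w. exp (?z w)) <= measure_pmf.expectation (K x) (%w. 1+?z w+(?z w)\<^sup>2*exp \<bar>?z w\<bar>)"
   by (rule integral_mono[OF i1]) (use iz i2 exp_le_quadratic in auto)
  also have "... = 1+(U g x+KK v x)+measure_pmf.expectation (K x) (%w. (?z w)\<^sup>2*exp \<bar>?z w\<bar>)"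
   using iz i2 by (simp add: U_def KK_def)
  also have "... <= 1+(v x+\<zeta>)"
   using Kv[OF x] um[OF x] q by (simp add: \<zeta>_def b0_def algebra_simps abs_le_iff)
  also have "... <= exp (v x+\<zeta>)" by (rule exp_ge_add_one_self)
  finally show "measure_pmf.expectation (K x) (%w. exp (?z w)) <= exp (v x+\<zeta>)" .
 qed
 have \<zeta>0: "\<zeta> >= 0" unfolding \<zeta>_def using C5 d rho M1 by simp
 have "growth (%x. f x+g x) W (pt a) (P+s+\<zeta>)"
 proof (rule supersolution_growth[OF a order_refl pC, where h="%x. h x*exp (v x)" and c="exp (- (b0/(1 - rho)))"])
  fix x assume x: "x \<in> C"
  show "exp (- (b0/(1 - rho))) <= h x*exp (v x)"
  proof -
   have "exp (- (b0/(1 - rho))) <= exp (v x)" using v_abs[OF x] by (simp add: abs_le_iff)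
   also have "... <= h x*exp (v x)" using Hs_h(2)[OF x] by simp
   finally show ?thesis .
  qed
  let ?z = "%w. birk shift g (length w) (cat w x)+v (cat w x)"
  let ?c = "(h x - 1)*exp (- \<zeta>)"
  have "Lop (%x. f x+g x) W (P+s+\<zeta>) (%x. ennreal (h x*exp (v x))) x
    <= nsum W (%w. ennreal ?c*(ennreal (pmf (K x) w)*ennreal (exp (?z w))))"
   unfolding Lop_def
  proof (rule nsum_mono)
   fix w assume w: "w \<in> W"
   have l: "1 <= real (length w)" using FR_ne[OF w] by (cases w) auto
   have e: "wq (%x. f x+g x) (P+s+\<zeta>) w x = wq f (P+s) w x*exp (birk shift g (length w) (cat w x))*exp (- (\<zeta> * real (length w)))"
    by (simp add: wq_def wt_def birk_add_fun exp_add[symmetric] algebra_simps)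
   have hp: "0 < h (cat w x)" using Hs_h(2)[OF cat_C[OF w x]] by simp
   have "wq (%x. f x+g x) (P+s+\<zeta>) w x*(h (cat w x)*exp (v (cat w x)))
    = (wq f (P+s) w x * h (cat w x))*exp (?z w)*exp (- (\<zeta> * real (length w)))"
    unfolding e by (simp add: exp_add)
   \<comment> \<open>Return words have length at least 1, so the raised exponent gains at least one
     factor \<open>exp (- \<zeta>)\<close>.\<close>
   also have "... <= (wq f (P+s) w x * h (cat w x))*exp (?z w)*exp (- \<zeta>)"
    using hp \<zeta>0 l mult_left_mono[OF l \<zeta>0] by (intro mult_left_mono) auto
   also have "wq f (P+s) w x * h (cat w x) = (h x - 1) * pmf (K x) w"
    using w Lop_h(2)[OF x] by (simp add: pmf_K[OF x] G_def)
   finally show "ennreal (wq (%x. f x+g x) (P+s+\<zeta>) w x)*ennreal (h (cat w x)*exp (v (cat w x)))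
    <= ennreal ?c*(ennreal (pmf (K x) w)*ennreal (exp (?z w)))"
    using hp Lop_h(2)[OF x] by (simp add: ennreal_mult[symmetric] mult_ac)
  qed
  also have "... = ennreal ?c * nsum W (%w. ennreal (pmf (K x) w)*ennreal (exp (?z w)))" by (rule nsum_cmult)
  also have "... <= ennreal ?c * nsum UNIV (%w. ennreal (pmf (K x) w)*ennreal (exp (?z w)))"
   by (intro mult_left_mono nsum_subset) auto
  also have "nsum UNIV (%w. ennreal (pmf (K x) w)*ennreal (exp (?z w))) = (\<integral>\<^sup>+w. ennreal (exp (?z w)) \<partial>measure_pmf (K x))"
   unfolding nn_integral_measure_pmf nsum_def ..
  also have "... = ennreal (measure_pmf.expectation (K x) (%w. exp (?z w)))"
   by (rule nn_integral_eq_integral[OF Ez(1)[OF x]]) simp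
  also have "ennreal ?c * ... <= ennreal ?c*ennreal (exp (v x+\<zeta>))"
   by (intro mult_left_mono ennreal_leI Ez(2)[OF x]) simp
  also have "... = ennreal ((h x - 1)*exp (v x))"
   using Lop_h(2)[OF x] by (simp add: ennreal_mult[symmetric] exp_add exp_minus)
  also have "... <= ennreal (h x*exp (v x))" by (intro ennreal_leI mult_right_mono) auto
  finally show "Lop (%x. f x+g x) W (P+s+\<zeta>) (%x. ennreal (h x*exp (v x))) x <= ennreal (h x*exp (v x))" .
 qed simp
 then show ?thesis by (simp add: \<zeta>_def)
qed

end

lemma growth_add_const: "growth (%x. f x+r) W x q ==> growth f W x (q - r)"
proof -
 assume "growth (%x. f x+r) W x q"
 then obtain C where C: "!!n. rsum {w\<in>Star W. length w = n} (%w. wt (%x. f x+r) w x) <= ennreal (C*exp (q * real n))"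
  by (auto simp: growth_def)
 have "rsum {w\<in>Star W. length w = n} (%w. wt f w x) <= ennreal (C*exp ((q - r) * real n))" for n
 proof -
  have "rsum {w\<in>Star W. length w = n} (%w. wt f w x)
    = rsum {w\<in>Star W. length w = n} (%w. wt (%x. f x+r) w x)*ennreal (exp (- r * real n))"
   unfolding nsum_multc[symmetric]
   by (rule nsum_cong) (auto simp: wt_def birk_add_fun ennreal_mult[symmetric] exp_add[symmetric])
  also have "... <= ennreal (C*exp (q * real n))*ennreal (exp (- r * real n))" by (intro mult_right_mono C) simp
  also have "... = ennreal (C*exp ((q - r) * real n))"
   by (subst ennreal_mult''[symmetric]) (auto simp: mult.assoc exp_add[symmetric] algebra_simps)
  finally show ?thesis .
 qed
 then show ?thesis by (auto simp: growth_def)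
qed

context spr
begin

lemma okg_uminus: "okg d g ==> okg d (%x. - g x)"
 by (auto simp: okg_def abs_minus_commute)

text \<open>A constant \<open>r\<close> is added to make the m-step mean of the perturbation vanish.
  For \<open>- \<psi>\<close> the constant is \<open>- r\<close>, so in the sum of the two exponents
  the first-order parts cancel. As \<open>\<bar>r\<bar> <= dlt\<close>, the centred perturbation has
  size \<open>2 * dlt\<close>.\<close>

lemma quadratic_pressure:
 shows "EX C. EX dlt0>0. ALL \<psi> dlt e. 0 < dlt --> dlt <= dlt0 --> okg dlt \<psi> --> 0 < e -->
  (EX q1 q2. q1+q2 <= 2 * P+C * dlt\<^sup>2+e & growth (%x. f x+\<psi> x) W (pt a) q1 & growth (%x. f x - \<psi> x) W (pt a) q2)"
proof (rule exI[of _ "8 * c2\<^sup>2*(8/eps\<^sup>2) * M1"], rule exI[of _ "eps/(4 * c2)"], intro conjI allI impI)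
 show "0 < eps/(4 * c2)" using eps c2 by simp
 fix \<psi> :: "(nat => nat) => real" and dlt e :: real
 assume dlt: "0 < dlt" "dlt <= eps/(4 * c2)" and ok: "okg dlt \<psi>" and e: "0 < e"
 have small: "c2*(2 * dlt) <= eps/2" using dlt c2 by (simp add: field_simps)
 \<comment> \<open>The constants of the kernel estimates do not depend on \<open>s\<close>, so it
   may be chosen after \<open>e\<close>; two copies of it cost at most half of
   \<open>e\<close>.\<close>
 define s where "s = min 1 (e/4)"
 have se: "0 < s" "s <= 1" "2 * s <= e/2" using e by (auto simp: s_def)
 interpret kern S E f A \<theta> B a P eps s by unfold_locales (use se in auto)
 have "(%m. 2*(C5*(2 * dlt) * rho^m)) \<longlonglongrightarrow> 2*(C5*(2 * dlt)*0)"
  using rho by (intro tendsto_mult tendsto_const LIMSEQ_realpow_zero) auto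
 from order_tendstoD(2)[OF this, of "e/2"] have "\<forall>\<^sub>F m in sequentially. 2*(C5*(2 * dlt) * rho^m) < e/2" using e by simp
 then obtain m where m: "2*(C5*(2 * dlt) * rho^m) < e/2" by (auto simp: eventually_sequentially)
 have pC: "pt a \<in> C" using a by simp
 have ok1: "okg 1 (%_. 1)" using \<theta> by (auto simp: okg_def)
 have b1': "bdd (U (%_. 1))" by (rule Lip_bdd[OF U_Lip[OF ok1]]) (use C5 in simp)
 have b2': "bdd (U g)" if "okg d g" for d g by (rule Lip_bdd[OF U_Lip[OF that]]) (use C5 that in "simp add: okg_def")
 define D1 where "D1 = (KK^^m) (U (%_. 1)) (pt a)"
 have KK1: "(KK^^m) (%_. 1) x = 1" for x
  by (induction m arbitrary: x) (auto simp: KK_const cong: KK_cong, metis (no_types) KK_const ext)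
 have D1: "D1 >= 1"
  using KK_pow_mono[OF _ b1' U1_ge pC, of m] KK1[of "pt a"] by (auto simp: D1_def bdd_def)
 define r where "r = - (KK^^m) (U \<psi>) (pt a)/D1"
 have r: "\<bar>r\<bar> <= dlt"
 proof -
  have bb: "bdd (%x. 0+t * U (%_. 1) x)" for t by (rule bdd_lin[OF _ b1']) (auto simp: bdd_def)
  have lin: "(KK^^m) (%x. 0+t * U (%_. 1) x) (pt a) = t * D1" for t
  proof -
   have "(KK^^m) (%_. 0) x = 0" for x :: "nat => nat"
    using KK_pow_lin[of "%_. 0" "%_. 0" "pt a" m 0]
    by (induction m arbitrary: x) (auto simp: KK_const, metis (no_types) KK_const ext)
   moreover have "bdd (%_. 0)" unfolding bdd_def by (intro exI[of _ 0]) simp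
   ultimately show ?thesis using KK_pow_lin[OF _ b1' pC, of "%_. 0" m t] by (simp add: D1_def)
  qed
  have "(KK^^m) (U \<psi>) (pt a) <= (KK^^m) (%x. 0+dlt * U (%_. 1) x) (pt a)"
   by (rule KK_pow_mono[OF b2'[OF ok] bb _ pC]) (use U_abs[OF ok] in "force simp: abs_le_iff")
  moreover have "(KK^^m) (%x. 0+(- dlt) * U (%_. 1) x) (pt a) <= (KK^^m) (U \<psi>) (pt a)"
   by (rule KK_pow_mono[OF bb b2'[OF ok] _ pC]) (use U_abs[OF ok] in "force simp: abs_le_iff")
  ultimately have "\<bar>(KK^^m) (U \<psi>) (pt a)\<bar> <= dlt * D1" unfolding lin by (simp add: abs_le_iff)
  then show ?thesis using D1 by (simp add: r_def abs_divide pos_divide_le_eq)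
 qed
 define \<zeta> where "\<zeta> = C5*(2 * dlt) * rho^m+(c2*(2 * dlt))\<^sup>2*(8/eps\<^sup>2) * M1"
 have gen: "growth (%x. f x+g x) W (pt a) (P+s+\<zeta> - t)"
  if okg: "okg dlt g" and t: "\<bar>t\<bar> <= dlt" and zz: "(KK^^m) (U g) (pt a)+t * D1 = 0" for g t
 proof -
  have ok2: "okg (2 * dlt) (%x. g x+t)"
   unfolding okg_def
  proof (intro conjI ballI allI impI)
   fix x assume "x \<in> Sg"
   then show "\<bar>g x+t\<bar> <= 2 * dlt" using okg t by (force simp: okg_def abs_le_iff)
  next
   fix n x y assume H: "1 <= n" "x \<in> Sg" "y \<in> Sg" "ALL i<n. x i = y i"
   then have "\<bar>g x - g y\<bar> <= dlt*\<theta>^n" using okg by (auto simp: okg_def)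
   also have "... <= 2 * dlt*\<theta>^n" using dlt \<theta> by (intro mult_right_mono) auto
   finally show "\<bar>g x+t - (g y+t)\<bar> <= 2 * dlt*\<theta>^n" by simp
  qed (use dlt in simp)
  have "(KK^^m) (U (%x. g x+t)) (pt a) = (KK^^m) (%x. U g x+t * U (%_. 1) x) (pt a)"
  proof (rule antisym)
   show "(KK^^m) (U (%x. g x+t)) (pt a) <= (KK^^m) (%x. U g x+t * U (%_. 1) x) (pt a)"
    by (rule KK_pow_mono[OF b2'[OF ok2] bdd_lin[OF b2'[OF okg] b1'] _ pC]) (simp add: U_add[OF okg])
   show "(KK^^m) (%x. U g x+t * U (%_. 1) x) (pt a) <= (KK^^m) (U (%x. g x+t)) (pt a)"
    by (rule KK_pow_mono[OF bdd_lin[OF b2'[OF okg] b1'] b2'[OF ok2] _ pC]) (simp add: U_add[OF okg])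
  qed
  also have "... = 0" using KK_pow_lin[OF b2'[OF okg] b1' pC, of m t] zz by (simp add: D1_def)
  finally have "growth (%x. f x+(g x+t)) W (pt a) (P+s+\<zeta>)"
   unfolding \<zeta>_def by (intro perturbed_growth[OF ok2 _ small])
  then have "growth (%x. (f x+g x)+t) W (pt a) (P+s+\<zeta>)" by (simp add: add.assoc)
  then show ?thesis by (rule growth_add_const)
 qed
 have g1: "growth (%x. f x+\<psi> x) W (pt a) (P+s+\<zeta> - r)"
  by (rule gen[OF ok r]) (use D1 in "simp add: r_def")
 have "(KK^^m) (U (%x. - \<psi> x)) (pt a) = - (KK^^m) (U \<psi>) (pt a)"
 proof -
  have "U (%x. - \<psi> x) x = 0+(- 1) * U \<psi> x" for x
   unfolding U_def birk_def by (simp add: sum_negf)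
  then have "U (%x. - \<psi> x) = (%x. U (%_. 0) x+(- 1) * U \<psi> x)" by (auto simp: U_const)
  moreover have "okg 0 (%_. 0)" by (auto simp: okg_def)
  moreover have "(KK^^m) (U (%_. 0)) (pt a) = 0"
  proof -
   have "U (%_. 0) = (%x. U (%_. 0) x+1 * U (%_. 0) x)" by (auto simp: U_const)
   from KK_pow_lin[OF b2'[OF \<open>okg 0 (%_. 0)\<close>] b2'[OF \<open>okg 0 (%_. 0)\<close>] pC, of m 1]
   show ?thesis unfolding \<open>U (%_. 0) = _\<close>[symmetric] by simp
  qed
  ultimately show ?thesis using KK_pow_lin[OF b2'[of 0 "%_. 0"] b2'[OF ok] pC, of m "- 1"] by simp
 qed
 then have g2: "growth (%x. f x + - \<psi> x) W (pt a) (P+s+\<zeta> - (- r))"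
  by (intro gen[OF okg_uminus[OF ok]]) (use r D1 in "auto simp: r_def")
 \<comment> \<open>The 8 is 2 for the two signs times the square of the factor 2 in
   \<open>2 * dlt\<close>.\<close>
 have "(P+s+\<zeta> - r)+(P+s+\<zeta> - (- r)) <= 2 * P+8 * c2\<^sup>2*(8/eps\<^sup>2) * M1 * dlt\<^sup>2+e"
  using m se(3) by (simp add: \<zeta>_def power_mult_distrib algebra_simps)
 with g1 g2 show "EX q1 q2. q1+q2 <= 2 * P+8 * c2\<^sup>2*(8/eps\<^sup>2) * M1 * dlt\<^sup>2+e &
   growth (%x. f x+\<psi> x) W (pt a) q1 & growth (%x. f x - \<psi> x) W (pt a) q2"
  by (intro exI[of _ "P+s+\<zeta> - r"] exI[of _ "P+s+\<zeta> - (- r)"]) simp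
qed

end

section \<open>Invariant measures from loop systems\<close>

text \<open>Consistent cylinder weights are realised by subdividing \<open>[0,1)\<close> into nested intervals.\<close>

locale cyl_weights =
 fixes c :: "nat list => real"
 assumes c_nonneg: "!!v. 0 <= c v" and c_Nil: "c [] = 1" and c_sums: "!!v. (%s. c (v@[s])) sums c v"
begin

text \<open>Left endpoint of the interval of \<open>v\<close>: at each level the lengths of the
  intervals of all smaller siblings are added.\<close>

definition left :: "nat list => real" where
 "left v = (\<Sum>i<length v. \<Sum>s<v ! i. c (take i v@[s]))"

lemma left_Nil [simp]: "left [] = 0" by (simp add: left_def)

lemma left_snoc: "left (v@[s]) = left v+(\<Sum>s'<s. c (v@[s']))"
proof -
 have "left (v@[s]) = (\<Sum>i<length v. \<Sum>s'<(v@[s]) ! i. c (take i (v@[s])@[s']))+(\<Sum>s'<s. c (v@[s']))"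
  by (simp add: left_def)
 also have "(\<Sum>i<length v. \<Sum>s'<(v@[s]) ! i. c (take i (v@[s])@[s'])) = left v"
  unfolding left_def by (rule sum.cong) (auto simp: nth_append)
 finally show ?thesis .
qed

definition Iv :: "nat list => real set" where "Iv v = {left v..<left v+c v}"

definition nxt :: "real => nat list => nat" where
 "nxt u v = (LEAST s. u < left v+(\<Sum>s'<Suc s. c (v@[s'])))"

lemma partial_le: "(\<Sum>s'<s. c (v@[s'])) <= c v"
 using sum_le_suminf[of "%s. c (v@[s])" "{..<s}"] c_sums[of v] c_nonneg by (auto simp: sums_iff)

lemma Iv_snoc_subset: "Iv (v@[s]) <= Iv v"
proof -
 have "left v <= left (v@[s])" unfolding left_snoc using c_nonneg by (simp add: sum_nonneg)
 moreover have "left (v@[s])+c (v@[s]) <= left v+c v"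
  using partial_le[of v "Suc s"] by (simp add: left_snoc)
 ultimately show ?thesis by (auto simp: Iv_def)
qed

lemma Iv_snoc_iff: assumes u: "u \<in> Iv v" shows "u \<in> Iv (v@[s]) \<longleftrightarrow> s = nxt u v"
proof -
 let ?P = "%s. u < left v+(\<Sum>s'<Suc s. c (v@[s']))"
 have "EX s. ?P s"
 proof -
  have "(%n. \<Sum>s'<n. c (v@[s'])) \<longlonglongrightarrow> c v" using c_sums[of v] by (simp add: sums_def)
  moreover have "u - left v < c v" using u by (auto simp: Iv_def)
  ultimately have "\<forall>\<^sub>F n in sequentially. u - left v < (\<Sum>s'<n. c (v@[s']))" by (rule order_tendstoD(1))
  then obtain n where n: "u - left v < (\<Sum>s'<n. c (v@[s']))" by (auto simp: eventually_sequentially)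
  have "n > 0" using n u by (intro Nat.gr0I) (auto simp: Iv_def)
  then obtain m where "n = Suc m" by (cases n) auto
  with n show ?thesis by (intro exI[of _ m]) (simp add: algebra_simps)
 qed
 then have P: "?P (nxt u v)" unfolding nxt_def by (rule LeastI_ex)
 have L: "\<not> ?P s" if "s < nxt u v" for s using that not_less_Least unfolding nxt_def by blast
 have low: "left v+(\<Sum>s'<nxt u v. c (v@[s'])) <= u"
 proof (cases "nxt u v")
  case 0 then show ?thesis using u by (auto simp: Iv_def)
 next
  case (Suc k) then show ?thesis using L[of k] by simp
 qed
 show ?thesis
 proof
  assume "s = nxt u v" then show "u \<in> Iv (v@[s])" using P low by (auto simp: Iv_def left_snoc algebra_simps)
 next
  assume us: "u \<in> Iv (v@[s])"
  then have Ps: "?P s" and lows: "left v+(\<Sum>s'<s. c (v@[s'])) <= u" by (auto simp: Iv_def left_snoc algebra_simps)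
  have "nxt u v <= s" using Ps unfolding nxt_def by (rule Least_le)
  moreover have "s <= nxt u v"
  proof (rule ccontr)
   assume "\<not> s <= nxt u v"
   then have "(\<Sum>s'<Suc (nxt u v). c (v@[s'])) <= (\<Sum>s'<s. c (v@[s']))"
    by (intro sum_mono2) (auto simp: c_nonneg)
   with P lows show False by linarith
  qed
  ultimately show "s = nxt u v" by simp
 qed
qed

fun pre :: "real => nat => nat list" where
 "pre u 0 = []" | "pre u (Suc n) = pre u n@[nxt u (pre u n)]"

definition XX :: "real => nat => nat" where "XX u n = nxt u (pre u n)"

lemma pre_map: "pre u n = map (XX u) [0..<n]"
 by (induction n) (auto simp: XX_def)

lemma pre_in: "u \<in> {0..<1} ==> u \<in> Iv (pre u n)"
 by (induction n) (use c_Nil in \<open>auto simp: Iv_snoc_iff\<close>, simp add: Iv_def)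

lemma Iv_iff: "u \<in> {0..<1} ==> u \<in> Iv v \<longleftrightarrow> pre u (length v) = v"
proof (induction v rule: rev_induct)
 case Nil then show ?case using c_Nil by (simp add: Iv_def)
next
 case (snoc s v)
 show ?case
 proof
  assume us: "u \<in> Iv (v@[s])"
  then have "u \<in> Iv v" using Iv_snoc_subset by blast
  then show "pre u (length (v@[s])) = v@[s]" using snoc us Iv_snoc_iff[of u v s] by simp
 next
  assume "pre u (length (v@[s])) = v@[s]"
  with pre_in[OF snoc.prems, of "length (v@[s])"] show "u \<in> Iv (v@[s])" by metis
 qed
qed

lemma Iv_unit: "Iv v <= {0..<1}"
proof (induction v rule: rev_induct)
 case Nil then show ?case by (simp add: Iv_def c_Nil)
next
 case (snoc s v) then show ?case using Iv_snoc_subset by blast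
qed

text \<open>Lebesgue measure on the unit interval is pushed forward by the digit map
  \<open>XX\<close>. The intervals are half open, so words of weight zero have empty intervals and
  every digit sequence is an admissible path.\<close>

lemma kolmogorov:
 assumes adm: "!!v. 0 < c v ==> cyl S E v ~= {}"
 shows "EX \<mu>. sets \<mu> = sets (borel_Sigma S E) & prob_space \<mu> & (ALL v. measure \<mu> (cyl S E v) = c v)"
proof -
 define L where "L = restrict_space lborel {0..<1::real}"
 have spL: "space L = {0..<1}" by (simp add: L_def space_restrict_space)
 have X_in: "XX u \<in> Sigma_plus S E" if u: "u \<in> {0..<1}" for u
  unfolding Sigma_plus_def
 proof (intro CollectI allI)
  fix i
  \<comment> \<open>A prefix of length \<open>i + 2\<close> contains the edge from position
    \<open>i\<close> to \<open>i + 1\<close>.\<close>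
  have "u \<in> Iv (pre u (i+2))" by (rule pre_in[OF u])
  then have "c (pre u (i+2)) > 0" by (auto simp: Iv_def)
  then obtain y where y: "y \<in> cyl S E (pre u (i+2))" using adm by blast
  have "y j = XX u j" if "j < i+2" for j
  proof -
   have "y j = pre u (i+2) ! j" "length (pre u (i+2)) = i+2" using y that unfolding cyl_def pre_map by auto
   then show ?thesis using that unfolding pre_map by (simp del: upt_Suc)
  qed
  then have "XX u i = y i" "XX u (Suc i) = y (Suc i)" by simp_all
  then show "XX u i \<in> S & E (XX u i) (XX u (Suc i))" using y by (simp add: cyl_def Sigma_plus_def)
 qed
 have vim: "XX -` cyl S E v Int space L = Iv v" for v
 proof -
  have "u \<in> XX -` cyl S E v \<longleftrightarrow> u \<in> Iv v" if u: "u \<in> {0..<1}" for u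
  proof -
   have "XX u \<in> cyl S E v \<longleftrightarrow> map (XX u) [0..<length v] = v"
    unfolding cyl_def list_eq_iff_nth_eq[of "map (XX u) [0..<length v]"] using X_in[OF u] by simp
   then show ?thesis using Iv_iff[OF u, of v] by (simp add: pre_map)
  qed
  then show ?thesis using Iv_unit[of v] by (auto simp: spL)
 qed
 have Iv_L: "Iv v \<in> sets L" for v
  unfolding L_def by (subst sets_restrict_space_iff) (use Iv_unit[of v] in "auto simp: Iv_def")
 have meas: "XX \<in> measurable L (borel_Sigma S E)"
 proof (rule measurable_sigma_sets[OF sets_borel_Sigma])
  show "range (cyl S E) <= Pow (Sigma_plus S E)" using cyl_subset by blast
  show "XX \<in> space L \<rightarrow> Sigma_plus S E" using X_in by (auto simp: spL)
  show "XX -` y Int space L \<in> sets L" if "y \<in> range (cyl S E)" for y using that vim Iv_L by auto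
 qed
 define \<mu> where "\<mu> = distr L (borel_Sigma S E) XX"
 have em: "emeasure \<mu> (cyl S E v) = ennreal (c v)" for v
 proof -
  have "emeasure \<mu> (cyl S E v) = emeasure L (Iv v)"
   unfolding \<mu>_def by (subst emeasure_distr[OF meas cyl_sets]) (simp add: vim)
  also have "... = emeasure lborel (Iv v)" unfolding L_def by (rule emeasure_restrict_space) (use Iv_unit[of v] in auto)
  finally show ?thesis using c_nonneg[of v] by (simp add: Iv_def)
 qed
 have "prob_space \<mu>"
 proof
  show "emeasure \<mu> (space \<mu>) = 1"
   using em[of "[]"] by (simp add: \<mu>_def space_borel_Sigma cyl_Nil c_Nil)
 qed
 moreover have "sets \<mu> = sets (borel_Sigma S E)" by (simp add: \<mu>_def)
 moreover have "measure \<mu> (cyl S E v) = c v" for v using em[of v] c_nonneg[of v] by (simp add: measure_def)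
 ultimately show ?thesis by blast
qed

end

lemma cyl_Cons_0: "x \<in> cyl S E (s # v) ==> x 0 = s"
 by (force simp: cyl_def)

lemma cyl_Cons_shift:
 "shift -` cyl S E v Int Sigma_plus S E = (\<Union>s. cyl S E (s # v))"
proof (intro equalityI subsetI)
 fix x assume "x \<in> shift -` cyl S E v Int Sigma_plus S E"
 then have "x \<in> cyl S E (x 0 # v)" by (auto simp: cyl_def shift_def nth_Cons split: nat.splits)
 then show "x \<in> (\<Union>s. cyl S E (s # v))" by blast
next
 fix x assume "x \<in> (\<Union>s. cyl S E (s # v))"
 then obtain s where x: "x \<in> cyl S E (s # v)" by auto
 have "x (Suc i) = v ! i" if "i < length v" for i using x that by (force simp: cyl_def)
 moreover have "x \<in> Sigma_plus S E" using x by (simp add: cyl_def)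
 ultimately show "x \<in> shift -` cyl S E v Int Sigma_plus S E"
  using shift_in[of x S E] by (simp add: cyl_def) (simp add: shift_def)
qed

lemma invariant_from_weights:
 assumes mu: "sets \<mu> = sets (borel_Sigma S E)" "prob_space \<mu>" "!!v. measure \<mu> (cyl S E v) = c v"
  and inv: "!!v. (%s. c (s # v)) sums c v"
 shows "\<mu> \<in> inv_measures S E"
proof -
 interpret prob_space \<mu> by fact
 have sp: "space \<mu> = Sigma_plus S E" using sets_eq_imp_space_eq[OF mu(1)] by (simp add: space_borel_Sigma)
 have cs: "cyl S E v \<in> sets \<mu>" for v by (simp add: mu(1) cyl_sets)
 have vs: "shift -` cyl S E v Int space \<mu> \<in> sets \<mu>" for v
  unfolding sp cyl_Cons_shift by (intro sets.countable_UN') (use cs in auto)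
 have meas: "shift \<in> measurable \<mu> \<mu>"
 proof (rule measurable_sigma_sets[OF mu(1)[unfolded sets_borel_Sigma]])
  show "range (cyl S E) <= Pow (Sigma_plus S E)" using cyl_subset by blast
  show "shift \<in> space \<mu> \<rightarrow> Sigma_plus S E" by (auto simp: sp)
  show "shift -` y Int space \<mu> \<in> sets \<mu>" if "y \<in> range (cyl S E)" for y using that vs by auto
 qed
 have "distr \<mu> \<mu> shift = \<mu>"
 proof (rule cylinder_measure_eqI)
  show "finite_measure (distr \<mu> \<mu> shift)" by (rule finite_measure_distr[OF meas])
  fix v
  have "(%s. measure \<mu> (cyl S E (s # v))) sums measure \<mu> (\<Union>s. cyl S E (s # v))"
  proof (rule finite_measure_UNION)
   show "range (%s. cyl S E (s # v)) <= events" by (rule image_subsetI) (rule cs)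
   show "disjoint_family (%s. cyl S E (s # v))"
    unfolding disjoint_family_on_def
   proof (intro ballI impI)
    fix s s' :: nat assume "s ~= s'"
    then show "cyl S E (s # v) Int cyl S E (s' # v) = {}" by (metis cyl_Cons_0 disjoint_iff)
   qed
  qed
  then have "measure \<mu> (\<Union>s. cyl S E (s # v)) = c v" using inv[of v] sums_unique2 unfolding mu(3) by blast
  then have "measure \<mu> (shift -` cyl S E v Int space \<mu>) = measure \<mu> (cyl S E v)" unfolding sp cyl_Cons_shift by (simp add: mu(3))
  then show "emeasure (distr \<mu> \<mu> shift) (cyl S E v) = emeasure \<mu> (cyl S E v)"
   by (subst emeasure_distr[OF meas cs]) (simp add: emeasure_eq_measure)
 qed (use mu in auto)
 then show ?thesis unfolding inv_measures_def using mu meas by simp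
qed

text \<open>Sequential compactness of a countable product of unit intervals, in place of a diagonal
  argument.\<close>

lemma bounded_functions_subseq:
 fixes c :: "nat => 'a::countable => real"
 assumes "!!k v. c k v \<in> {0..1}"
 obtains r l where "strict_mono (r :: nat => nat)" "!!v. (%k. c (r k) v) \<longlonglongrightarrow> l v"
proof -
 have "compactin (product_topology (%_::'a. euclidean) UNIV) (PiE UNIV (%_. {0..1::real}))"
  by (subst compactin_PiE) (auto simp: compactin_euclidean_iff)
 then have "compact (PiE UNIV (%_::'a. {0..1::real}))"
  by (simp add: euclidean_product_topology compactin_euclidean_iff)
 then have "seq_compact (PiE UNIV (%_::'a. {0..1::real}))" by (rule compact_imp_seq_compact)
 moreover have "ALL k. c k \<in> PiE UNIV (%_::'a. {0..1::real})" using assms by (auto simp: PiE_def)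
 ultimately obtain l r where lr: "strict_mono (r :: nat => nat)" "(c \<circ> r) \<longlonglongrightarrow> l" unfolding seq_compact_def by blast
 have "(%k. c (r k) v) \<longlonglongrightarrow> l v" for v
  using continuous_on_tendsto_compose[OF continuous_on_product_coordinates[of v] lr(2)] by (simp add: comp_def)
 with lr(1) that show thesis by blast
qed

lemma nsum_tail:
 fixes g :: "'a::countable => ennreal"
 assumes fin: "nsum A g < \<infinity>" and e: "e > 0"
 obtains K where "!!k. k >= K ==> nsum {x\<in>A. k <= to_nat x} g <= ennreal e"
proof -
 define T where "T = enn2real (nsum A g)"
 have T: "nsum A g = ennreal T" "T >= 0" using fin by (auto simp: T_def)
 show thesis
 proof (cases "T <= e")
  case True
  have "nsum {x\<in>A. k <= to_nat x} g <= nsum A g" for k by (rule nsum_subset) auto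
  then show thesis using True T by (intro that[of 0]) (metis ennreal_leI order_trans)
 next
  case False
  then have "ennreal (T - e) < nsum A g" unfolding T using e by (simp add: ennreal_less_iff)
  then obtain F where F: "finite F" "F <= A" "ennreal (T - e) < sum g F" using nsum_approx by blast
  define K where "K = Suc (Max (insert 0 (to_nat ` F)))"
  have FK: "to_nat x < K" if "x \<in> F" for x using F that by (auto simp: K_def less_Suc_eq_le)
  have eq: "sum g F+nsum (A - F) g = ennreal T"
   using F nsum_Un_disj[of F "A - F" g] by (simp add: Un_absorb1 nsum_finite T)
  obtain r t where rt: "sum g F = ennreal r" "r >= 0" "nsum (A - F) g = ennreal t" "t >= 0"
  proof -
   have "sum g F < \<top>" "nsum (A - F) g < \<top>"
    using eq by (metis ennreal_less_top add_top ennreal_add_eq_top less_top top_add)+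
   then show thesis using that by (metis ennreal_cases less_top)
  qed
  have "r+t = T" using eq rt T by (simp add: ennreal_plus[symmetric] del: ennreal_plus)
  moreover have "T - e < r" using F(3) rt False by (simp add: ennreal_less_iff)
  ultimately have "nsum (A - F) g <= ennreal e" using rt by (simp add: ennreal_leI)
  moreover have "nsum {x\<in>A. k <= to_nat x} g <= nsum (A - F) g" if "k >= K" for k
   using that FK by (intro nsum_subset) force
  ultimately show thesis by (intro that[of K]) (metis order_trans)
 qed
qed

section \<open>Limits of periodic-orbit measures for a system of return words\<close>

locale gibbs = pot +
 fixes a :: nat and W :: "nat list set" and P eps :: real
 assumes a: "a \<in> S" and W: "W <= FR S E a" and Wne: "W ~= {}"
  and fin: "!!q. P < q ==> Hs f W q (pt a) < \<infinity>"
  and div: "Hs f W P (pt a) = \<infinity>"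
  and eps: "eps > 0" and tail: "rsum W (%w. wq f (P - eps) w (pt a)) < \<infinity>"
begin

abbreviation "C == Cy [a]"
abbreviation "\<omega> q b t == wq f q (b@t) (cyc (b@t))"
abbreviation "wp b == wq f P b (pt a)"

lemma WD: "b \<in> W ==> b \<in> Fr a" "b \<in> W ==> b \<in> Ph a a" "b \<in> W ==> b ~= []" "b \<in> W ==> b ! 0 = a"
 using W FR_Pth FR_ne FR_hd[OF a] by blast+

lemma StarP: "t \<in> Star W ==> t \<in> Ph a a" by (rule Star_FR_Pth[OF W])

lemma cyc_C: "w \<in> Star W ==> w ~= [] ==> cyc w \<in> C" by (rule cyc_in[OF a StarP])

lemma cyc_bt: "b \<in> W ==> t \<in> Star W ==> cyc (b@t) \<in> C"
 by (rule cyc_C) (auto intro: Star_Cons dest: WD)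

lemma pC: "pt a \<in> C" using a by simp

lemma om_le: assumes "b \<in> Ph a a" "t \<in> Ph a a" "z \<in> C"
 shows "wq f q (b@t) z <= exp (2 * kap) * wq f q b (pt a) * wq f q t (pt a)"
proof -
 have "wq f q (b@t) z = wq f q b (cat t z) * wq f q t z" by (rule wq_append)
 also have "... <= (exp kap * wq f q b (pt a))*(exp kap * wq f q t (pt a))"
  by (intro mult_mono wq_dist[OF assms(1) PthD[OF assms(2,3)] pC] wq_dist[OF assms(2,3) pC]) auto
 also have "... = exp (2 * kap) * wq f q b (pt a) * wq f q t (pt a)" by (simp add: exp_add[symmetric] mult_ac flip: mult_2)
 finally show ?thesis .
qed

lemma om_ge: assumes "b \<in> Ph a a" "t \<in> Ph a a" "z \<in> C"
 shows "exp (- (2 * kap)) * wq f q b (pt a) * wq f q t (pt a) <= wq f q (b@t) z"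
proof -
 have "wq f q b (pt a) * wq f q t (pt a) <= (exp kap * wq f q b (cat t z))*(exp kap * wq f q t z)"
  by (intro mult_mono wq_dist[OF assms(1) pC PthD[OF assms(2,3)]] wq_dist[OF assms(2) pC assms(3)]) auto
 also have "... = exp (2 * kap) * wq f q (b@t) z" by (simp add: exp_add[symmetric] mult_ac wq_append flip: mult_2)
 finally show ?thesis by (simp add: exp_minus field_simps)
qed

text \<open>An index is a loop \<open>b@t\<close> with first return word \<open>b\<close>, together
  with a position inside \<open>b\<close>.\<close>

definition J where "J = Sigma W (%b. Star W \<times> {..<length b})"
definition pp :: "nat list \<times> nat list \<times> nat => nat => nat" where "pp = (%(b, t, j). (shift^^j) (cyc (b@t)))"
definition og :: "real => nat list \<times> nat list \<times> nat => real" where "og q = (%(b, t, j). \<omega> q b t)"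

text \<open>The measures \<open>Mq q\<close> are weighted sums of periodic orbits, each periodic point being followed during
  its first excursion only; rotating the excursions cyclically shows that they are shift invariant.\<close>

definition Mq :: "real => (nat => nat) set => ennreal" where
 "Mq q Y = nsum J (%i. ennreal (og q i) * indicator Y (pp i))"

lemma Mq_nested: "Mq q Y = nsum W (%b. nsum (Star W) (%t. ennreal (\<omega> q b t) * nsum {..<length b} (%j. indicator Y ((shift^^j) (cyc (b@t))))))"
 unfolding Mq_def J_def by (simp add: nsum_Sigma nsum_Times pp_def og_def nsum_cmult)

lemma Mq_mono: "Y <= Y' ==> Mq q Y <= Mq q Y'"
 unfolding Mq_def by (intro nsum_mono mult_left_mono) (auto simp: indicator_def)

lemma pp_Sigma: "i \<in> J ==> pp i \<in> Sg"
 using cyc_bt Sigma_plus_shift by (fastforce simp: J_def pp_def cyl1_iff)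

lemma Mq_cong: "(!!x. x \<in> Sg ==> x \<in> Y \<longleftrightarrow> x \<in> Y') ==> Mq q Y = Mq q Y'"
 unfolding Mq_def by (rule nsum_cong[OF refl]) (use pp_Sigma in "auto simp: indicator_def")

lemma Mq_Un_le: "Mq q (Y Un Y') <= Mq q Y+Mq q Y'"
 unfolding Mq_def nsum_add[symmetric] by (rule nsum_mono) (auto simp: indicator_def)

lemma Mq_Un: "Y Int Y' = {} ==> Mq q (Y Un Y') = Mq q Y+Mq q Y'"
 unfolding Mq_def nsum_add[symmetric] by (rule nsum_cong[OF refl]) (auto simp: indicator_def)

text \<open>The loop \<open>t\<close> behind the first word contributes at most the whole series
  \<open>Hs\<close>, so the mass of a set reduces to counting positions in a single return
  word.\<close>

lemma Mq_count:
 assumes "!!b t j. b \<in> W ==> t \<in> Star W ==> j < length b ==> (shift^^j) (cyc (b@t)) \<in> Y ==> Q b j"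
 shows "Mq q Y <= ennreal (exp (2 * kap)) * Hs f W q (pt a) * rsum W (%b. wq f q b (pt a) * real (card {j. j < length b & Q b j}))"
proof -
 have cnt: "nsum {..<length b} (%j. indicator Y ((shift^^j) (cyc (b@t)))) <= ennreal (real (card {j. j < length b & Q b j}))"
  if "b \<in> W" "t \<in> Star W" for b t
 proof -
  have "nsum {..<length b} (%j. indicator Y ((shift^^j) (cyc (b@t)))) <= nsum {..<length b} (%j. indicator {j. j < length b & Q b j} j)"
   by (rule nsum_mono) (use assms that in "auto simp: indicator_def")
  also have "... = (\<Sum>j<length b. indicator {j. j < length b & Q b j} j)" by (simp add: nsum_finite)
  also have "... = of_nat (card {j. j < length b & Q b j})"
   by (simp add: indicator_def of_bool_def sum.If_cases Int_def)
  finally show ?thesis by (simp add: ennreal_of_nat_eq_real_of_nat)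
 qed
 have "Mq q Y <= nsum W (%b. nsum (Star W) (%t. (ennreal (exp (2 * kap))*ennreal (wq f q b (pt a))*ennreal (wq f q t (pt a)))*ennreal (real (card {j. j < length b & Q b j}))))"
  unfolding Mq_nested
 proof (intro nsum_mono mult_mono cnt)
  fix b t assume "b \<in> W" "t \<in> Star W"
  then have "\<omega> q b t <= exp (2 * kap) * wq f q b (pt a) * wq f q t (pt a)"
   by (intro om_le WD StarP cyc_bt)
  then show "ennreal (\<omega> q b t) <= ennreal (exp (2 * kap))*ennreal (wq f q b (pt a))*ennreal (wq f q t (pt a))"
   by (simp add: ennreal_mult[symmetric])
 qed auto
 also have "... = nsum W (%b. ennreal (exp (2 * kap)) * Hs f W q (pt a)*ennreal (wq f q b (pt a) * real (card {j. j < length b & Q b j})))"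
  unfolding Hs_def by (rule nsum_cong[OF refl]) (simp add: nsum_multc nsum_cmult ennreal_mult' mult_ac)
 finally show ?thesis by (simp add: nsum_cmult)
qed

definition b0 where "b0 = (SOME b. b \<in> W)"
lemma b0: "b0 \<in> W" unfolding b0_def using Wne by (simp add: some_in_eq)
definition cc where "cc = exp (- (2 * kap)) * wq f (P+1) b0 (pt a)"
lemma cc: "cc > 0" by (simp add: cc_def)
text \<open>Ratio of the upper constant in \<open>Mq_count\<close> to the lower constant in
  \<open>Z_lower\<close>. In the quotient the diverging factor \<open>Hs\<close> cancels, which
  leaves bounds uniform in the exponent.\<close>

definition C0 where "C0 = exp (2 * kap)/cc"
lemma C0: "C0 > 0" using cc by (simp add: C0_def)

abbreviation "Z q == Mq q UNIV"

lemma Z_lower: assumes "q <= P+1" shows "ennreal cc * Hs f W q (pt a) <= Z q"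
proof -
 have "ennreal cc * Hs f W q (pt a) = nsum (Star W) (%t. ennreal cc*ennreal (wq f q t (pt a)))" unfolding Hs_def nsum_cmult ..
 also have "... <= nsum (Star W) (%t. ennreal (\<omega> q b0 t) * nsum {..<length b0} (%j. indicator UNIV ((shift^^j) (cyc (b0@t)))))"
 proof (rule nsum_mono)
  fix t assume t: "t \<in> Star W"
  have "cc * wq f q t (pt a) <= exp (- (2 * kap)) * wq f q b0 (pt a) * wq f q t (pt a)"
   unfolding cc_def by (intro mult_right_mono mult_left_mono wq_antimono assms) auto
  also have "... <= \<omega> q b0 t" by (intro om_ge WD StarP cyc_bt b0 t)
  finally have 1: "ennreal cc*ennreal (wq f q t (pt a)) <= ennreal (\<omega> q b0 t)" using cc by (simp add: ennreal_mult[symmetric] less_imp_le)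
  have "1 <= nsum {..<length b0} (%j. indicator UNIV ((shift^^j) (cyc (b0@t))))"
   using nsum_member[of 0 "{..<length b0}" "%j. indicator UNIV ((shift^^j) (cyc (b0@t)))"] WD(3)[OF b0] by simp
  with 1 show "ennreal cc*ennreal (wq f q t (pt a)) <= ennreal (\<omega> q b0 t) * nsum {..<length b0} (%j. indicator UNIV ((shift^^j) (cyc (b0@t))))"
   using mult_mono[OF 1, of 1] by simp
 qed
 also have "... <= Z q" unfolding Mq_nested by (rule nsum_member[OF b0])
 finally show ?thesis .
qed

text \<open>The exponential tail at \<open>P - eps\<close> dominates every power of the length at
  \<open>P\<close>.\<close>

lemma len_tail: "rsum W (%b. wp b * real (length b)^n) < \<infinity>"
proof -
 have b: "real l^n <= fact n/eps^n*exp (eps * real l)" for l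
 proof -
  have "(eps * real l)^n/fact n <= exp (eps * real l)"
  proof -
   have "(SUM k:{n}. (eps * real l)^k /\<^sub>R fact k) <= (\<Sum>k. (eps * real l)^k /\<^sub>R fact k)"
    using eps by (intro sum_le_suminf summable_exp_generic) auto
   then show ?thesis by (simp add: exp_def divide_inverse mult.commute)
  qed
  then show ?thesis using eps by (simp add: power_mult_distrib field_simps)
 qed
 have "rsum W (%b. wp b * real (length b)^n) <= nsum W (%b. ennreal (fact n/eps^n)*ennreal (wq f (P - eps) b (pt a)))"
 proof (rule nsum_mono)
  fix v
  have "wp v * real (length v)^n <= wp v * (fact n/eps^n*exp (eps * real (length v)))"
   by (intro mult_left_mono b) simp
  also have "... = fact n/eps^n * wq f (P - eps) v (pt a)" by (subst wq_change[of _ "P - eps" _ _ P]) simp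
  finally show "ennreal (wp v * real (length v)^n) <= ennreal (fact n/eps^n)*ennreal (wq f (P - eps) v (pt a))"
   using eps by (simp add: ennreal_mult[symmetric])
 qed
 then show ?thesis using tail unfolding nsum_cmult by (auto simp: ennreal_mult_less_top intro: le_less_trans)
qed

lemma Z_finite: assumes "P < q" shows "Z q < \<infinity>"
proof -
 have "Z q <= ennreal (exp (2 * kap)) * Hs f W q (pt a) * rsum W (%b. wq f q b (pt a) * real (card {j. j < length b & True}))"
  by (rule Mq_count) simp
 also have "... <= ennreal (exp (2 * kap)) * Hs f W q (pt a) * rsum W (%b. wp b * real (length b)^1)"
  using assms by (intro mult_left_mono nsum_mono ennreal_leI) (auto intro!: mult_right_mono wq_antimono)
 also have "... < \<infinity>" using fin[OF assms] len_tail[of 1] by (simp add: ennreal_mult_less_top)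
 finally show ?thesis .
qed

lemma Z_pos: "q <= P+1 ==> Z q ~= 0"
proof -
 assume q: "q <= P+1"
 have "0 < Hs f W q (pt a)" using Hs_ge_1[of f W q "pt a"] by (rule less_le_trans[rotated]) simp
 then have "0 < ennreal cc * Hs f W q (pt a)" using cc by (simp add: ennreal_zero_less_mult_iff)
 with Z_lower[OF q] show ?thesis by auto
qed

text \<open>The two rotations of a closed loop have periodic points on the same orbit, hence equal
  Birkhoff sums over a period.\<close>

lemma \<omega>_rotate: assumes "b \<in> W" "t \<in> Star W" shows "\<omega> q b t = \<omega> q t b" "(shift^^length b) (cyc (b@t)) = cyc (t@b)"
proof -
 have ne: "b@t ~= []" "t@b ~= []" using WD(3)[OF assms(1)] by auto
 have sh: "(shift^^length u) (cyc (u@v)) = cyc (v@u)" if "u@v ~= []" for u v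
 proof -
  have "cyc (u@v) = cat u (cat v (cyc (u@v)))" using cat_cyc[OF that] by (simp add: cat_append)
  then have 1: "(shift^^length u) (cyc (u@v)) = cat v (cyc (u@v))" by (metis shift_cat)
  let ?y = "(shift^^length u) (cyc (u@v))"
  have per: "(shift^^length (v@u)) ?y = ?y"
  proof -
   have "(shift^^length (v@u)) ?y = (shift^^length u) ((shift^^length (u@v)) (cyc (u@v)))"
    by (simp add: shift_pow ac_simps)
   then show ?thesis by (simp only: shift_cyc)
  qed
  have "?y = cat (v@u) ?y"
   using 1 cat_cyc[OF that] \<open>cyc (u @ v) = cat u (cat v (cyc (u @ v)))\<close> by (metis cat_append)
  then have "map ?y [0..<length (v@u)] = v@u"
   by (intro nth_equalityI) (simp_all, metis cat_def length_append)
  moreover have "cyc (map ?y [0..<length (v@u)]) = ?y" by (rule cyc_eqI[OF per]) (use that in auto)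
  ultimately show ?thesis by simp
 qed
 show "(shift^^length b) (cyc (b@t)) = cyc (t@b)" by (rule sh[OF ne(1)])
 have "birk shift f (length b+length t) (cyc (b@t)) = birk shift f (length b) (cyc (b@t))+birk shift f (length t) (cyc (t@b))"
  by (simp add: birk_plus sh[OF ne(1)])
 moreover have "birk shift f (length t+length b) (cyc (t@b)) = birk shift f (length t) (cyc (t@b))+birk shift f (length b) (cyc (b@t))"
  by (simp add: birk_plus sh[OF ne(2)])
 ultimately show "\<omega> q b t = \<omega> q t b" using ne by (simp add: wq_def wt_def cat_cyc add.commute)
qed

text \<open>Along each first word the shift telescopes to two boundary terms: loops counted at their
  start (\<open>B1\<close>) and after their first word (\<open>B2\<close>). Rotation identifies
  them, and they cancel because they are finite.\<close>

lemma Mq_shift: assumes "P < q" shows "Mq q (shift -` Y) = Mq q Y"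
proof -
 define B1 where "B1 = nsum W (%b. nsum (Star W) (%t. ennreal (\<omega> q b t) * indicator Y (cyc (b@t))))"
 define B2 where "B2 = nsum W (%b. nsum (Star W) (%t. ennreal (\<omega> q b t) * indicator Y ((shift^^length b) (cyc (b@t)))))"
 let ?g = "%w. ennreal (wq f q w (cyc w))*(indicator Y (cyc w) :: ennreal)"
 have "B1 = nsum (W \<times> Star W) (%(b, t). ?g (b@t))" by (simp add: B1_def nsum_Times)
 also have "... = nsum (Star W - {[]}) ?g"
  by (subst nsum_reindex_bij[OF Star_Cons_bij[OF a W]]) (simp add: case_prod_unfold)
 also have "... = nsum (W \<times> Star W) (%(b, t). ?g (t@b))"
  by (subst nsum_reindex_bij[OF Star_snoc_bij[OF a W]]) (simp add: case_prod_unfold)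
 also have "... = B2"
  unfolding B2_def nsum_Times
 proof (intro nsum_cong refl)
  fix b t assume "b \<in> W" "t \<in> Star W"
  from \<omega>_rotate(1)[OF this, of q] \<omega>_rotate(2)[OF this] show "(case (b, t) of (b, t) => ?g (t@b)) = ennreal (\<omega> q b t) * indicator Y ((shift^^length b) (cyc (b@t)))" by simp
 qed
 finally have B: "B1 = B2" .
 have B1fin: "B1 < \<infinity>"
 proof -
  have "B1 <= Z q" unfolding B1_def Mq_nested
  proof (intro nsum_mono mult_left_mono)
   fix b t assume b: "b \<in> W"
   have "(1::ennreal) <= nsum {..<length b} (%j. indicator UNIV ((shift^^j) (cyc (b@t))))"
    using nsum_member[of 0 "{..<length b}" "%j. indicator UNIV ((shift^^j) (cyc (b@t)))"] WD(3)[OF b] by simp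
   then show "indicator Y (cyc (b@t)) <= nsum {..<length b} (%j. indicator UNIV ((shift^^j) (cyc (b@t))))"
    by (rule order_trans[rotated]) (simp add: indicator_def)
  qed simp
  then show ?thesis using Z_finite[OF assms] by (rule le_less_trans)
 qed
 have step: "nsum {..<n} (%j. indicator (shift -` Y) ((shift^^j) x))+indicator Y x
   = nsum {..<n} (%j. indicator Y ((shift^^j) x))+(indicator Y ((shift^^n) x) :: ennreal)" for n x
  by (induction n) (simp_all add: nsum_finite indicator_def ac_simps)
 have "Mq q (shift -` Y)+B1 = Mq q Y+B2"
  unfolding Mq_nested B1_def B2_def nsum_add[symmetric] distrib_left[symmetric] step ..
 then show ?thesis using B B1fin by (auto simp: add.commute)
qed

lemma Mq_shift_pow: "P < q ==> Mq q ((shift^^n) -` Y) = Mq q Y"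
proof (induction n)
 case (Suc n)
 have "(shift^^Suc n) -` Y = shift -` ((shift^^n) -` Y)" by (auto simp: shift_pow shift_def)
 then show ?case by (simp only: Mq_shift[OF Suc.prems] Suc)
qed simp

definition qk :: "nat => real" where "qk k = P+1/real (Suc k)"
lemma qk: "P < qk k" "qk k <= P+1" by (auto simp: qk_def)

definition nu :: "nat => (nat => nat) set => ennreal" where "nu k Y = Mq (qk k) Y/Z (qk k)"

lemma Zk: "Z (qk k) ~= 0" "Z (qk k) < \<top>" using Z_pos[OF qk(2)] Z_finite[OF qk(1)] by auto

lemma nu_mono: "Y <= Y' ==> nu k Y <= nu k Y'"
 unfolding nu_def divide_ennreal_def by (intro mult_right_mono Mq_mono) auto

lemma nu_UNIV: "nu k UNIV = 1" unfolding nu_def using Zk by (simp add: ennreal_divide_self less_top)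

lemma nu_cong: "(!!x. x \<in> Sg ==> x \<in> Y \<longleftrightarrow> x \<in> Y') ==> nu k Y = nu k Y'"
 unfolding nu_def using Mq_cong[of Y Y'] by simp

lemma nu_le_1: "nu k Y <= 1" using nu_mono[of Y UNIV k] nu_UNIV by simp

lemma nu_fin: "nu k Y < \<top>" using nu_le_1[of k Y] by (rule le_less_trans) simp

lemma nu_Un_le: "nu k (Y Un Y') <= nu k Y+nu k Y'"
 unfolding nu_def divide_ennreal_def distrib_right[symmetric] by (intro mult_right_mono Mq_Un_le) auto

lemma nu_Un: "Y Int Y' = {} ==> nu k (Y Un Y') = nu k Y+nu k Y'"
 unfolding nu_def divide_ennreal_def distrib_right[symmetric] by (simp add: Mq_Un)

lemma nu_empty: "nu k {} = 0" by (simp add: nu_def Mq_def nsum_def)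

lemma nu_UN: assumes "finite I" "!!i i'. i \<in> I ==> i' \<in> I ==> i ~= i' ==> Y i Int Y i' = {}"
 shows "nu k (\<Union>i\<in>I. Y i) = (SUM i:I. nu k (Y i))"
 using assms
proof (induction I rule: finite_induct)
 case (insert i I)
 have "Y i Int (\<Union>i\<in>I. Y i) = {}" using insert by blast
 then show ?case using insert nu_Un[of "Y i" "\<Union>i\<in>I. Y i" k] by auto
qed (simp add: nu_empty)

lemma nu_shift_pow: "nu k ((shift^^n) -` Y) = nu k Y"
 unfolding nu_def Mq_shift_pow[OF qk(1)] ..

lemma nu_count:
 assumes "!!b t j. b \<in> W ==> t \<in> Star W ==> j < length b ==> (shift^^j) (cyc (b@t)) \<in> Y ==> Q b j"
 shows "nu k Y <= ennreal C0 * rsum W (%b. wp b * real (card {j. j < length b & Q b j}))"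
proof -
 let ?N = "rsum W (%b. wp b * real (card {j. j < length b & Q b j}))"
 have "Mq (qk k) Y <= ennreal (exp (2 * kap)) * Hs f W (qk k) (pt a) * rsum W (%b. wq f (qk k) b (pt a) * real (card {j. j < length b & Q b j}))"
  by (rule Mq_count[OF assms])
 also have "... <= ennreal (exp (2 * kap)) * Hs f W (qk k) (pt a)*?N"
  using qk(1)[of k] by (intro mult_left_mono nsum_mono ennreal_leI mult_right_mono wq_antimono) auto
 also have "... = ennreal C0*(ennreal cc * Hs f W (qk k) (pt a))*?N"
  using cc by (simp add: C0_def mult.assoc[symmetric] ennreal_mult[symmetric])
 also have "... <= ennreal C0 * Z (qk k)*?N"
  by (intro mult_right_mono mult_left_mono Z_lower qk) auto
 also have "... = (ennreal C0*?N) * Z (qk k)" by (simp add: mult_ac)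
 finally have "Mq (qk k) Y/Z (qk k) <= ((ennreal C0*?N) * Z (qk k))/Z (qk k)" by (rule divide_right_mono_ennreal)
 also have "... = ennreal C0*?N" using Zk by (simp add: ennreal_mult_divide_eq less_top)
 finally show ?thesis by (simp add: nu_def)
qed

text \<open>A bound, uniform in \<open>k\<close> and in the coordinate, for the mass of points whose
  coordinate is at least \<open>K\<close>; it provides tightness on the infinite alphabet.\<close>

definition dK :: "nat => ennreal" where
 "dK K = ennreal C0 * rsum W (%b. wp b * real (card {j. j < length b & K <= b ! j}))"

lemma nu_high: "nu k {x. K <= x i} <= dK K"
proof -
 have "{x. K <= x i} = (shift^^i) -` {x. K <= x 0}" by (auto simp: shift_pow)
 then have "nu k {x. K <= x i} = nu k {x. K <= x 0}" by (simp only: nu_shift_pow)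
 also have "... <= dK K"
  unfolding dK_def by (rule nu_count) (auto simp: shift_pow cyc_def nth_append)
 finally show ?thesis .
qed

text \<open>Finitely many return words use boundedly many states, and the remaining ones have small
  length-weighted mass.\<close>

lemma dK_small: assumes "e > 0" shows "EX K0. ALL K>=K0. dK K <= ennreal e"
proof -
 obtain K1 where K1: "!!k. k >= K1 ==> rsum {b\<in>W. k <= to_nat b} (%b. wp b * real (length b)^1) <= ennreal (e/C0)"
  by (rule nsum_tail[OF len_tail[of 1], of "e/C0"]) (use assms C0 in auto)
 define Fs where "Fs = {b\<in>W. to_nat b < K1}"
 have finF: "finite Fs"
 proof -
  have "Fs <= from_nat ` {..<K1}" unfolding Fs_def by (auto intro!: image_eqI[of _ from_nat "to_nat _"])
  then show ?thesis by (rule finite_subset) simp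
 qed
 define K0 where "K0 = Suc (Max (insert 0 (\<Union>b\<in>Fs. set b)))"
 have K0: "b ! j < K0" if "b \<in> Fs" "j < length b" for b j
  unfolding K0_def less_Suc_eq_le by (rule Max_ge) (use finF that nth_mem in auto)
 have "dK K <= ennreal e" if K: "K >= K0" for K
 proof -
  have "rsum W (%b. wp b * real (card {j. j < length b & K <= b ! j}))
    <= nsum W (%b. ennreal (wp b * real (length b)^1) * indicator {b\<in>W. K1 <= to_nat b} b)"
  proof (rule nsum_mono)
   fix b assume b: "b \<in> W"
   show "ennreal (wp b * real (card {j. j < length b & K <= b ! j})) <= ennreal (wp b * real (length b)^1) * indicator {b\<in>W. K1 <= to_nat b} b"
   proof (cases "K1 <= to_nat b")
    case True
    have "card {j. j < length b & K <= b ! j} <= card {..<length b}" by (rule card_mono) auto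
    then show ?thesis using True b by (auto intro!: ennreal_leI mult_left_mono)
   next
    case False
    then have "b \<in> Fs" using b by (simp add: Fs_def)
    then have "{j. j < length b & K <= b ! j} = {}" using K0 K by (auto simp: not_le) (meson less_le_trans not_le)
    then show ?thesis by (simp only: card.empty) simp
   qed
  qed
  also have "... = rsum {b\<in>W. K1 <= to_nat b} (%b. wp b * real (length b)^1)"
   unfolding nsum_indicator[of W] nsum_indicator[of "{b\<in>W. K1 <= to_nat b}"]
   by (rule nsum_cong[OF refl]) (auto simp: indicator_def)
  also have "... <= ennreal (e/C0)" by (rule K1) simp
  finally have "dK K <= ennreal C0*ennreal (e/C0)" unfolding dK_def by (rule mult_left_mono) simp
  then show ?thesis using C0 assms by (simp add: ennreal_mult[symmetric] less_imp_le)
 qed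
 then show ?thesis by blast
qed

definition cr :: "nat => nat list => real" where "cr k v = enn2real (nu k (Cy v))"

lemma cr: "nu k (Cy v) = ennreal (cr k v)" "cr k v \<in> {0..1}"
proof -
 show *: "nu k (Cy v) = ennreal (cr k v)" using nu_fin[of k "Cy v"] by (simp add: cr_def)
 show "cr k v \<in> {0..1}" using nu_le_1[of k "Cy v"] unfolding * by (simp add: cr_def)
qed

lemma cyl_disj: assumes "length u = length v" "u ~= v" shows "Cy u Int Cy v = {}"
proof (rule ccontr)
 assume "Cy u Int Cy v ~= {}"
 then obtain x where x: "x \<in> Cy u" "x \<in> Cy v" by auto
 have "ALL i<length u. u ! i = v ! i"
 proof (intro allI impI)
  fix i assume that: "i < length u"
  have "x i = u ! i" using x(1) that unfolding cyl_def by blast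
  moreover have "x i = v ! i" using x(2) that assms(1) unfolding cyl_def by auto
  ultimately show "u ! i = v ! i" by simp
 qed
 then have "u = v" using assms(1) by (simp add: list_eq_iff_nth_eq)
 with assms(2) show False by simp
qed

lemma enn_sum: "finite I ==> (SUM i:I. nu k (Cy (v i))) = ennreal (SUM i:I. cr k (v i))"
 unfolding cr(1) by (rule sum_ennreal) (use cr(2) in auto)

text \<open>Finitely many one-letter extensions exhaust a cylinder up to the mass of a large
  coordinate. Stated for an arbitrary position \<open>i\<close>, so that it covers extension on the
  right (additivity) and on the left (invariance).\<close>

lemma sandwich:
 assumes v: "!!s. length (vs s) = L" "inj vs" and sub: "!!s. nu k (Cy (vs s)) <= 1"
  and tot: "nu k Y = ennreal r" "r >= 0"
  and A1: "(\<Union>s<K. Cy (vs s)) Int Sg <= Y" and A2: "Y Int Sg <= (\<Union>s<K. Cy (vs s)) Un {x. K <= x i}"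
  and d: "dK K <= ennreal e" "e >= 0"
 shows "(\<Sum>s<K. cr k (vs s)) <= r" "r <= (\<Sum>s<K. cr k (vs s))+e"
proof -
 have S: "nu k (\<Union>s<K. Cy (vs s)) = ennreal (\<Sum>s<K. cr k (vs s))"
 proof -
  have "nu k (\<Union>s\<in>{..<K}. Cy (vs s)) = (\<Sum>s<K. nu k (Cy (vs s)))"
  proof (rule nu_UN)
   fix s s' :: nat assume "s ~= s'"
   then have "vs s ~= vs s'" using v(2) by (simp add: inj_eq)
   then show "Cy (vs s) Int Cy (vs s') = {}" by (intro cyl_disj) (simp add: v(1))
  qed simp
  then show ?thesis unfolding enn_sum[OF finite_lessThan] .
 qed
 have nn: "0 <= (\<Sum>s<K. cr k (vs s))" using cr(2) by (intro sum_nonneg) auto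
 have "nu k (\<Union>s<K. Cy (vs s)) = nu k ((\<Union>s<K. Cy (vs s)) Int Sg)" by (rule nu_cong) auto
 also have "... <= nu k Y" by (rule nu_mono[OF A1])
 finally show "(\<Sum>s<K. cr k (vs s)) <= r" unfolding S tot using tot nn by simp
 have "nu k Y = nu k (Y Int Sg)" by (rule nu_cong) auto
 also have "... <= nu k ((\<Union>s<K. Cy (vs s)) Un {x. K <= x i})" by (rule nu_mono[OF A2])
 also have "... <= nu k (\<Union>s<K. Cy (vs s))+nu k {x. K <= x i}" by (rule nu_Un_le)
 also have "... <= ennreal (\<Sum>s<K. cr k (vs s))+ennreal e"
  unfolding S by (intro add_mono order_refl order_trans[OF nu_high d(1)])
 finally show "r <= (\<Sum>s<K. cr k (vs s))+e" unfolding tot using nn d by (simp add: ennreal_plus[symmetric] del: ennreal_plus)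
qed

text \<open>Left cancellation in \<open>Star W\<close>. As \<open>W\<close> may be a proper set of
  first-return words, being a path at \<open>a\<close> would not suffice; unique factorisation is
  used.\<close>

lemma Star_prefix:
 assumes "u \<in> Star W" "u@z \<in> Star W" "z = [] | z ! 0 = a" shows "z \<in> Star W"
 using assms(1,2)
proof (induction rule: Star_induct)
 case (Cons b u)
 then have bu: "b@(u@z) \<in> Star W" by simp
 have ne: "b@(u@z) ~= []" using WD(3)[OF Cons(1)] by simp
 then obtain b' w' where b': "b' \<in> W" "w' \<in> Star W" "b@(u@z) = b'@w'" using Star_first[OF bu] by auto
 have "u@z = [] | (u@z) ! 0 = a"
  using assms(3) Pth_hd'[OF a StarP[OF Cons(2)]] by (cases "u = []") (auto simp: nth_append)
 then have "u@z \<in> Ph a a"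
  using Pth_split(2)[OF StarP[OF bu] a, of a] by auto
 from FR_prefix_unique[OF a WD(1)[OF Cons(1)] WD(1)[OF b'(1)] this StarP[OF b'(2)] b'(3)]
 have "u@z \<in> Star W" using b'(2) by simp
 then show ?case by (rule Cons.IH)
qed simp

text \<open>A large finite partial sum at \<open>P\<close> depends continuously on the exponent, so
  divergence at \<open>P\<close> forces the series at \<open>qk k\<close> to tend to
  infinity.\<close>

lemma Hs_blowup: "EX k0. ALL k>=k0. ennreal R <= Hs f W (qk k) (pt a)"
proof -
 have "ennreal R < rsum (Star W) (%w. wp w)" using div by (simp add: Hs_def)
 then obtain F where F: "finite F" "F <= Star W" "ennreal R < (SUM w:F. ennreal (wp w))" by (rule nsum_approx)
 then have R: "R < (SUM w:F. wp w)" by (simp add: sum_ennreal ennreal_less_iff sum_nonneg)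
   (metis ennreal_less_iff ennreal_neg linorder_not_le not_le_imp_less order_le_less_trans sum_nonneg wq_nonneg)
 have "(%k. SUM w:F. wq f (qk k) w (pt a)) \<longlonglongrightarrow> (SUM w:F. wp w)"
 proof (intro tendsto_sum)
  fix w
  have "qk \<longlonglongrightarrow> P" unfolding qk_def[abs_def]
   using tendsto_add[OF tendsto_const[of P] LIMSEQ_inverse_real_of_nat] by (simp add: divide_inverse)
  then show "(%k. wq f (qk k) w (pt a)) \<longlonglongrightarrow> wp w" unfolding wq_def by (intro tendsto_intros)
 qed
 from order_tendstoD(1)[OF this R] obtain k0 where k0: "!!k. k >= k0 ==> R < (SUM w:F. wq f (qk k) w (pt a))"
  by (auto simp: eventually_sequentially)
 have "ennreal R <= Hs f W (qk k) (pt a)" if "k >= k0" for k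
 proof -
  have "ennreal R <= ennreal (SUM w:F. wq f (qk k) w (pt a))" using k0[OF that] by (intro ennreal_leI) simp
  also have "... = (SUM w:F. ennreal (wq f (qk k) w (pt a)))" by (simp add: sum_ennreal)
  also have "... <= Hs f W (qk k) (pt a)" unfolding Hs_def by (rule nsum_sum_le[OF F(1,2)])
  finally show ?thesis .
 qed
 then show ?thesis by blast
qed

text \<open>A loop whose periodic point reads \<open>u\<close> and then \<open>a\<close> either
  continues \<open>u\<close> by a further loop, or is shorter than \<open>u\<close> and hence one of
  its prefixes. The second kind contributes a bounded amount, which normalisation later
  removes.\<close>

lemma Mq_loop:
 assumes u: "u \<in> Star W" "u ~= []" and q: "P < q"
 shows "Mq q (Cy (u@[a])) <= ennreal (\<Sum>k<length u. wq f P (take k u) (cyc (take k u)))+ennreal (exp (2 * kap) * wp u) * Hs f W q (pt a)"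
proof -
 let ?Y = "Cy (u@[a])"
 let ?g = "%w. ennreal (wq f q w (cyc w))"
 let ?D = "{w \<in> Star W - {[]}. cyc w \<in> ?Y}"
 have u0: "u ! 0 = a" using Pth_hd'[OF a StarP[OF u(1)] u(2)] .
 have "Mq q ?Y <= nsum W (%b. nsum (Star W) (%t. ennreal (\<omega> q b t) * indicator ?Y (cyc (b@t))))"
  unfolding Mq_nested
 proof (intro nsum_mono mult_left_mono)
  fix b t assume b: "b \<in> W"
  \<comment> \<open>Inside the first return word, \<open>a\<close> occurs only at position
    0.\<close>
  have z: "indicator ?Y ((shift^^j) (cyc (b@t))) = (0::ennreal)" if "j < length b" "j ~= 0" for j
  proof -
   have "b ! j ~= a" using WD(1)[OF b] that by (auto simp: FR_def)
   then have "(shift^^j) (cyc (b@t)) 0 ~= a" using that by (simp add: shift_pow cyc_def nth_append)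
   moreover have "x 0 = a" if "x \<in> ?Y" for x
    using that u(2) u0 unfolding cyl_def by (auto simp: nth_append dest!: spec[of _ 0])
   ultimately show ?thesis by (auto simp: indicator_def)
  qed
  have "nsum {..<length b} (%j. indicator ?Y ((shift^^j) (cyc (b@t)))) = (\<Sum>j<length b. indicator ?Y ((shift^^j) (cyc (b@t))))"
   by (simp add: nsum_finite)
  also have "... = (SUM j:{0}. indicator ?Y ((shift^^j) (cyc (b@t))))"
   using WD(3)[OF b] z by (intro sum.mono_neutral_right) auto
  finally show "nsum {..<length b} (%j. indicator ?Y ((shift^^j) (cyc (b@t)))) <= (indicator ?Y (cyc (b@t)) :: ennreal)" by simp
 qed simp
 also have "... = nsum (W \<times> Star W) (%(b, t). ?g (b@t) * indicator ?Y (cyc (b@t)))" by (simp add: nsum_Times)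
 also have "... = nsum (Star W - {[]}) (%w. ?g w * indicator ?Y (cyc w))"
  by (subst nsum_reindex_bij[OF Star_Cons_bij[OF a W]]) (simp add: case_prod_unfold)
 also have "... = nsum ?D ?g"
  unfolding nsum_indicator[of "Star W - {[]}"] nsum_indicator[of ?D] by (rule nsum_cong[OF refl]) (auto simp: indicator_def)
 also have "... <= nsum ((%k. take k u) ` {..<length u} Un (%z. u@z) ` Star W) ?g"
 proof (rule nsum_subset, rule subsetI)
  fix w assume w: "w \<in> ?D"
  have cw: "cyc w i = (u@[a]) ! i" if "i <= length u" for i using w that unfolding cyl_def by auto
  show "w \<in> (%k. take k u) ` {..<length u} Un (%z. u@z) ` Star W"
  proof (cases "length w < length u")
   case True
   have "w = take (length w) u"
   proof (rule nth_equalityI)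
    fix i assume "i < length w"
    then show "w ! i = take (length w) u ! i" using cw[of i] True by (simp add: cyc_def nth_append)
   qed (use True in simp)
   then show ?thesis using True by blast
  next
   case False
   have "take (length u) w = u"
   proof (rule nth_equalityI)
    fix i assume "i < length (take (length u) w)"
    then show "take (length u) w ! i = u ! i" using cw[of i] False by (simp add: cyc_def nth_append)
   qed (use False in simp)
   then have wz: "u@drop (length u) w = w" by (metis append_take_drop_id)
   have "drop (length u) w = [] | drop (length u) w ! 0 = a"
    using cw[of "length u"] False by (cases "length u = length w") (auto simp: cyc_def)
   then have "drop (length u) w \<in> Star W" using Star_prefix[OF u(1), of "drop (length u) w"] wz w by auto
   then show ?thesis using wz by (intro UnI2 image_eqI[of _ _ "drop (length u) w"]) auto
  qed
 qed
 also have "... <= nsum ((%k. take k u) ` {..<length u}) ?g+nsum ((%z. u@z) ` Star W) ?g" by (rule nsum_Un_le)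
 also have "... <= nsum {..<length u} (%k. ?g (take k u))+nsum (Star W) (%z. ?g (u@z))" by (intro add_mono nsum_image_le)
 also have "... <= ennreal (\<Sum>k<length u. wq f P (take k u) (cyc (take k u)))+ennreal (exp (2 * kap) * wp u) * Hs f W q (pt a)"
 proof (rule add_mono)
  have "nsum {..<length u} (%k. ?g (take k u)) = (\<Sum>k<length u. ?g (take k u))" by (simp add: nsum_finite)
  also have "... <= (\<Sum>k<length u. ennreal (wq f P (take k u) (cyc (take k u))))"
   using q by (intro sum_mono ennreal_leI wq_antimono) simp
  finally show "nsum {..<length u} (%k. ?g (take k u)) <= ennreal (\<Sum>k<length u. wq f P (take k u) (cyc (take k u)))"
   by (simp add: sum_ennreal)
  have "nsum (Star W) (%z. ?g (u@z)) <= nsum (Star W) (%z. ennreal (exp (2 * kap) * wp u)*ennreal (wq f q z (pt a)))"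
  proof (rule nsum_mono)
   fix z assume z: "z \<in> Star W"
   have "wq f q (u@z) (cyc (u@z)) <= exp (2 * kap) * wq f q u (pt a) * wq f q z (pt a)"
    by (rule om_le[OF StarP[OF u(1)] StarP[OF z]]) (rule cyc_C[OF Star_append[OF u(1) z]], use u in simp)
   also have "... <= exp (2 * kap) * wp u * wq f q z (pt a)"
    using q by (intro mult_right_mono mult_left_mono wq_antimono) auto
   finally show "?g (u@z) <= ennreal (exp (2 * kap) * wp u)*ennreal (wq f q z (pt a))" by (simp add: ennreal_mult[symmetric])
  qed
  then show "nsum (Star W) (%z. ?g (u@z)) <= ennreal (exp (2 * kap) * wp u) * Hs f W q (pt a)"
   by (simp add: nsum_cmult Hs_def)
 qed
 finally show ?thesis .
qed

text \<open>Counts the starting positions in \<open>b\<close> at which \<open>v\<close> can be read.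
  Letters beyond the closing \<open>a\<close> are left unconstrained, so that the count does not
  depend on the loop following \<open>b\<close>.\<close>

definition Nb :: "nat list => nat list => nat" where
 "Nb b v = card {j. j < length b & (ALL i<length v. j+i <= length b --> (b@[a]) ! (j+i) = v ! i)}"

lemma cyc_bt_nth:
 assumes "b \<in> W" "t \<in> Star W" "i <= length b" shows "cyc (b@t) i = (b@[a]) ! i"
proof (cases "i < length b")
 case True then show ?thesis by (simp add: cyc_def nth_append)
next
 case False
 then have i: "i = length b" using assms by simp
 show ?thesis
 proof (cases "t = []")
  case True then show ?thesis using i WD(3,4)[OF assms(1)] by (simp add: cyc_def)
 next
  case False then show ?thesis using i Pth_hd'[OF a StarP[OF assms(2)]] by (simp add: cyc_def nth_append)
 qed
qed

text \<open>Beside invariance, four features pass to the limit: control of cylinders by counts in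
  single return words, an upper Gibbs bound for loops, the fact that almost every visit to
  \<open>a\<close> is followed by a word of \<open>W\<close>, and visit frequencies valid in every
  word. Lower Gibbs bounds are not among them; the entropy estimate works with upper ones.\<close>

lemma gibbs_measure:
 shows "EX \<mu>:IM.
  (ALL v. ennreal (measure \<mu> (Cy v)) <= ennreal C0 * rsum W (%b. wp b * real (Nb b v))) &
  (ALL u:Star W. u ~= [] --> measure \<mu> (Cy (u@[a])) <= C0 * wp u) &
  measure \<mu> (Cy [a] - (\<Union>b\<in>W. Cy (b@[a]))) = 0 &
  (ALL F r. finite F --> 0 <= r --> (ALL b:W. real (card {j. j < length b & b ! j \<in> F}) <= r * real (length b)) -->
   (SUM s:F. measure \<mu> (Cy [s])) <= r)"
proof -
 obtain r l where r: "strict_mono (r :: nat => nat)" and l: "!!v. (%k. cr (r k) v) \<longlonglongrightarrow> l v"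
  by (rule bounded_functions_subseq[of cr]) (use cr(2) in auto)
 have l0: "0 <= l v" for v by (rule LIMSEQ_le_const[OF l]) (use cr(2) in auto)
 have l_sum: "(%k. SUM s:I. cr (r k) (vs s)) \<longlonglongrightarrow> (SUM s:I. l (vs s))" for I and vs :: "nat => nat list"
  by (intro tendsto_sum l)
 have l_Nil: "l [] = 1"
 proof -
  have "nu k (Cy []) = nu k UNIV" for k by (rule nu_cong) (simp add: cyl_Nil)
  then have "cr k [] = 1" for k unfolding cr_def by (simp add: nu_UNIV)
  then show ?thesis using l[of "[]"] LIMSEQ_unique tendsto_const by (metis (no_types, lifting) LIMSEQ_const_iff ext)
 qed
 \<comment> \<open>Limits and infinite sums over letters are exchanged here; tightness makes the
   truncation error uniform in \<open>k\<close>.\<close>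
 have sums_lim: "(%s. l (vs s)) sums l v"
  if B: "!!k K e. dK K <= ennreal e ==> 0 <= e ==> (\<Sum>s<K. cr k (vs s)) <= cr k v & cr k v <= (\<Sum>s<K. cr k (vs s))+e" for vs v
  unfolding sums_def
 proof (rule LIMSEQ_I)
  fix e :: real assume e: "0 < e"
  obtain K0 where K0: "!!K. K >= K0 ==> dK K <= ennreal (e/2)" using dK_small[of "e/2"] e by auto
  show "EX no. ALL n>=no. norm ((\<Sum>s<n. l (vs s)) - l v) < e"
  proof (intro exI[of _ K0] allI impI)
   fix K assume "K0 <= K"
   note b = B[OF K0[OF this]]
   have "(\<Sum>s<K. l (vs s)) <= l v" by (rule LIMSEQ_le[OF l_sum l]) (use b e in auto)
   moreover have "l v <= (\<Sum>s<K. l (vs s))+e/2"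
    by (rule LIMSEQ_le[OF l tendsto_add[OF l_sum tendsto_const]]) (use b e in auto)
   ultimately show "norm ((\<Sum>s<K. l (vs s)) - l v) < e" using e by auto
  qed
 qed
 have s1: "(%s. l (v@[s])) sums l v" for v
 proof (rule sums_lim)
  fix k K e assume d: "dK K <= ennreal e" "0 <= e"
  have "(\<Union>s<K. Cy (v@[s])) Int Sg <= Cy v"
   by (auto simp: cyl_def nth_append)
  moreover have "Cy v Int Sg <= (\<Union>s<K. Cy (v@[s])) Un {x. K <= x (length v)}"
  proof
   fix x assume x: "x \<in> Cy v Int Sg"
   then have "x \<in> Cy (v@[x (length v)])" by (auto simp: cyl_def nth_append less_Suc_eq)
   then show "x \<in> (\<Union>s<K. Cy (v@[s])) Un {x. K <= x (length v)}" by (cases "x (length v) < K") auto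
  qed
  ultimately show "(\<Sum>s<K. cr k (v@[s])) <= cr k v & cr k v <= (\<Sum>s<K. cr k (v@[s]))+e"
   using sandwich[of "%s. v@[s]" "Suc (length v)" k "Cy v" "cr k v" K "length v" e] cr d
   by (auto simp: inj_def nu_le_1)
 qed
 have s2: "(%s. l (s # v)) sums l v" for v
 proof (rule sums_lim)
  fix k K e assume d: "dK K <= ennreal e" "0 <= e"
  have n1: "nu k (shift -` Cy v) = ennreal (cr k v)" using nu_shift_pow[of k 1 "Cy v"] cr(1) by simp
  have "(\<Union>s<K. Cy (s # v)) Int Sg <= shift -` Cy v"
   using cyl_Cons_shift[of S E v] by blast
  moreover have "shift -` Cy v Int Sg <= (\<Union>s<K. Cy (s # v)) Un {x. K <= x 0}"
  proof
   fix x assume "x \<in> shift -` Cy v Int Sg"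
   then obtain s where "x \<in> Cy (s # v)" using cyl_Cons_shift[of S E v] by blast
   then show "x \<in> (\<Union>s<K. Cy (s # v)) Un {x. K <= x 0}" using cyl_Cons_0[of x S E s v] by (cases "s < K") auto
  qed
  ultimately show "(\<Sum>s<K. cr k (s # v)) <= cr k v & cr k v <= (\<Sum>s<K. cr k (s # v))+e"
   using sandwich[of "%s. s # v" "Suc (length v)" k "shift -` Cy v" "cr k v" K 0 e] cr(2)[of k v] d n1
   by (auto simp: inj_def nu_le_1)
 qed
 interpret cyl_weights l by unfold_locales (use l0 l_Nil s1 in auto)
 have l_le: "ennreal (l v) <= b" if "!!k. nu k (Cy v) <= b" for v b
  by (rule LIMSEQ_le_const2[OF tendsto_ennrealI[OF l]]) (use that in "auto simp: cr(1)[symmetric]")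
 have "Cy v ~= {}" if "0 < l v" for v
 proof
  assume "Cy v = {}"
  then have "ennreal (l v) <= 0" by (intro l_le) (simp add: nu_empty)
  with that show False by (simp add: ennreal_eq_0_iff)
 qed
 from kolmogorov[of S E, OF this] obtain \<mu> where mu: "sets \<mu> = sets (borel_Sigma S E)" "prob_space \<mu>" "!!v. measure \<mu> (Cy v) = l v"
  by blast
 have inv: "\<mu> \<in> IM" by (rule invariant_from_weights[OF mu s2])
 have G1: "ennreal (l v) <= ennreal C0 * rsum W (%b. wp b * real (Nb b v))" for v
  unfolding Nb_def
 proof (rule l_le, rule nu_count, intro allI impI)
  fix b t j i assume H: "b \<in> W" "t \<in> Star W" "j < length b" "(shift^^j) (cyc (b@t)) \<in> Cy v" "i < length v" "j+i <= length b"
  have "(shift^^j) (cyc (b@t)) i = v ! i" using H(4,5) unfolding cyl_def by blast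
  then show "(b@[a]) ! (j+i) = v ! i" using cyc_bt_nth[OF H(1,2,6)] by (simp add: shift_pow add.commute)
 qed
 have G2: "l (u@[a]) <= C0 * wp u" if u: "u \<in> Star W" "u ~= []" for u
 proof (rule field_le_epsilon)
  fix e :: real assume e: "e > 0"
  \<comment> \<open>The bounded part from \<open>Mq_loop\<close>; divided by the normalising mass,
    which blows up, it becomes smaller than \<open>e\<close>.\<close>
  define Ku where "Ku = (\<Sum>k<length u. wq f P (take k u) (cyc (take k u)))"
  have Ku: "Ku >= 0" unfolding Ku_def by (intro sum_nonneg) simp
  obtain k0 where k0: "!!k. k >= k0 ==> ennreal (Ku/(e * cc)+1) <= Hs f W (qk k) (pt a)" using Hs_blowup by blast
  have "cr k (u@[a]) <= C0 * wp u+e" if "k >= k0" for k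
  proof -
   have "ennreal Ku <= ennreal e*(ennreal cc*ennreal (Ku/(e * cc)+1))"
    using e cc Ku by (simp add: ennreal_mult[symmetric] field_simps)
   also have "... <= ennreal e*(ennreal cc * Hs f W (qk k) (pt a))" by (intro mult_left_mono k0 that) auto
   also have "... <= ennreal e * Z (qk k)" by (intro mult_left_mono Z_lower qk) auto
   finally have 1: "ennreal Ku <= ennreal e * Z (qk k)" .
   have "ennreal (exp (2 * kap) * wp u) * Hs f W (qk k) (pt a) = ennreal (C0 * wp u)*(ennreal cc * Hs f W (qk k) (pt a))"
    using cc by (simp add: C0_def mult.assoc[symmetric] ennreal_mult[symmetric])
   also have "... <= ennreal (C0 * wp u) * Z (qk k)" by (intro mult_left_mono Z_lower qk) auto
   finally have 2: "ennreal (exp (2 * kap) * wp u) * Hs f W (qk k) (pt a) <= ennreal (C0 * wp u) * Z (qk k)" .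
   have "Mq (qk k) (Cy (u@[a])) <= ennreal Ku+ennreal (exp (2 * kap) * wp u) * Hs f W (qk k) (pt a)"
    unfolding Ku_def by (rule Mq_loop[OF u qk(1)])
   also have "... <= ennreal e * Z (qk k)+ennreal (C0 * wp u) * Z (qk k)" by (intro add_mono 1 2)
   also have "... = (ennreal e+ennreal (C0 * wp u)) * Z (qk k)" by (simp add: distrib_right)
   finally have "nu k (Cy (u@[a])) <= ((ennreal e+ennreal (C0 * wp u)) * Z (qk k))/Z (qk k)"
    unfolding nu_def by (rule divide_right_mono_ennreal)
   also have "... = ennreal (C0 * wp u+e)" using Zk[of k] e C0 by (simp add: ennreal_mult_divide_eq less_top add.commute less_imp_le)
   finally show ?thesis unfolding cr(1) using e C0 by (subst (asm) ennreal_le_iff) (auto intro!: add_nonneg_nonneg less_imp_le)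
  qed
  moreover have "r k >= k" for k by (rule seq_suble[OF r])
  ultimately show "l (u@[a]) <= C0 * wp u+e"
   by (intro LIMSEQ_le_const2[OF l]) (meson order_trans)
 qed
 interpret inv_meas S E \<mu> by unfold_locales (use inv in auto)
 \<comment> \<open>Before the limit every visit starts some word of \<open>W\<close>. The small tail
   of the sum over \<open>W\<close> prevents mass from escaping into infinitely many words.\<close>
 have G3: "measure \<mu> (Cy [a] - (\<Union>b\<in>W. Cy (b@[a]))) = 0"
 proof (rule antisym, rule field_le_epsilon)
  fix e :: real assume e: "e > 0"
  obtain K where K: "!!k. k >= K ==> rsum {b\<in>W. k <= to_nat b} (%b. wp b * real (length b)^0) <= ennreal (e/C0)"
   by (rule nsum_tail[OF len_tail[of 0], of "e/C0"]) (use e C0 in auto)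
  define Fs where "Fs = {b\<in>W. to_nat b < K}"
  have finF: "finite Fs"
  proof -
   have "Fs <= from_nat ` {..<K}" unfolding Fs_def by (auto intro!: image_eqI[of _ from_nat "to_nat _"])
   then show ?thesis by (rule finite_subset) simp
  qed
  let ?U = "\<Union>b\<in>Fs. Cy (b@[a])"
  have dis: "Cy (b@[a]) Int Cy (b'@[a]) = {}" if "b \<in> Fs" "b' \<in> Fs" "b ~= b'" for b b'
  proof -
   have *: False if x: "x \<in> Cy (b@[a])" "x \<in> Cy (b'@[a])" and b: "b \<in> W" "b' \<in> W" "length b < length b'" for x b b'
   proof -
    have "x (length b) = a" using x(1) by (auto simp: cyl_def nth_append dest!: spec[of _ "length b"])
    moreover have "x (length b) = b' ! length b" using x(2) b(3) by (auto simp: cyl_def nth_append dest!: spec[of _ "length b"])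
    moreover have "0 < length b" using WD(3)[OF b(1)] by simp
    ultimately show False using WD(1)[OF b(2)] b(3) by (auto simp: FR_def)
   qed
   show ?thesis
   proof (cases "length b = length b'")
    case True then show ?thesis using that by (intro cyl_disj) auto
   next
    case False then show ?thesis using *[of _ b b'] *[of _ b' b] that unfolding Fs_def by (metis (mono_tags, lifting) disjoint_iff linorder_neqE_nat mem_Collect_eq)
   qed
  qed
  have tl: "nu k (Cy [a] - ?U) <= ennreal e" for k
  proof -
   have "nu k (Cy [a] - ?U) <= ennreal C0 * rsum W (%b. wp b * real (card {j. j < length b & j = 0 & K <= to_nat b}))"
   proof (rule nu_count)
    fix b t j assume H: "b \<in> W" "t \<in> Star W" "j < length b" "(shift^^j) (cyc (b@t)) \<in> Cy [a] - ?U"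
    have "b ! j = a" using H(3,4) by (auto simp: cyl1_iff shift_pow cyc_def nth_append)
    then have j: "j = 0" using WD(1)[OF H(1)] H(3) by (auto simp: FR_def)
    have "cyc (b@t) \<in> Cy (b@[a])"
     using cyc_bt[OF H(1,2)] cyc_bt_nth[OF H(1,2)] by (auto simp: cyl_def)
    then have "b ~: Fs" using H(4) j by auto
    then show "j = 0 & K <= to_nat b" using j H(1) by (auto simp: Fs_def)
   qed
   also have "rsum W (%b. wp b * real (card {j. j < length b & j = 0 & K <= to_nat b}))
     <= rsum {b\<in>W. K <= to_nat b} (%b. wp b * real (length b)^0)"
    unfolding nsum_indicator[of W] nsum_indicator[of "{b\<in>W. K <= to_nat b}"]
   proof (rule nsum_mono)
    fix b :: "nat list"
    have "card {j. j < length b & j = 0 & K <= to_nat b} <= card {0::nat}" by (rule card_mono) auto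
    then show "ennreal (wp b * real (card {j. j < length b & j = 0 & K <= to_nat b})) * indicator W b
     <= ennreal (wp b * real (length b)^0) * indicator {b\<in>W. K <= to_nat b} b"
     by (auto simp: indicator_def intro!: ennreal_leI mult_left_le)
   qed
   also have "... <= ennreal (e/C0)" by (rule K) simp
   also have "ennreal C0*ennreal (e/C0) = ennreal e" using C0 e by (simp add: ennreal_mult[symmetric] less_imp_le)
   finally show ?thesis by (simp add: mult_left_mono)
  qed
  have "cr k [a] <= (SUM b:Fs. cr k (b@[a]))+e" for k
  proof -
   have "nu k (Cy [a]) <= nu k (?U Un (Cy [a] - ?U))" by (rule nu_mono) auto
   also have "... <= nu k ?U+nu k (Cy [a] - ?U)" by (rule nu_Un_le)
   also have "nu k ?U = (SUM b:Fs. nu k (Cy (b@[a])))" by (rule nu_UN[OF finF dis])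
   also have "... = ennreal (SUM b:Fs. cr k (b@[a]))" by (rule enn_sum[OF finF])
   finally have "ennreal (cr k [a]) <= ennreal (SUM b:Fs. cr k (b@[a]))+ennreal e"
    unfolding cr(1) using tl[of k] by (meson add_left_mono order_trans)
   moreover have "0 <= (SUM b:Fs. cr k (b@[a]))" using cr(2) by (intro sum_nonneg) auto
   ultimately show ?thesis using e by (simp add: ennreal_plus[symmetric] del: ennreal_plus)
  qed
  then have le: "l [a] <= (SUM b:Fs. l (b@[a]))+e"
   by (intro LIMSEQ_le[OF l tendsto_add[OF tendsto_sum[OF l] tendsto_const]]) auto
  have "measure \<mu> ?U = (SUM b:Fs. l (b@[a]))"
   using finite_measure_finite_Union[of Fs "%b. Cy (b@[a])"] finF dis by (simp add: disjoint_family_on_def mu(3) image_subset_iff)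
  moreover have "?U <= Cy [a]"
   using WD(3,4) unfolding Fs_def cyl_def by (auto simp: nth_append dest!: spec[of _ 0])
  ultimately have "measure \<mu> (Cy [a] - ?U) <= e"
   using le finF by (subst finite_measure_Diff) (auto simp: mu(3))
  moreover have "measure \<mu> (Cy [a] - (\<Union>b\<in>W. Cy (b@[a]))) <= measure \<mu> (Cy [a] - ?U)"
   by (rule finite_measure_mono) (use finF in "auto simp: Fs_def intro!: sets.Diff sets.finite_UN")
  ultimately show "measure \<mu> (Cy [a] - (\<Union>b\<in>W. Cy (b@[a]))) <= 0+e" by simp
 qed simp
 have G4: "(SUM s:F. l [s]) <= \<rho>"
  if F: "finite F" and \<rho>: "0 <= \<rho>" and b: "ALL b:W. real (card {j. j < length b & b ! j \<in> F}) <= \<rho> * real (length b)" for F \<rho>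
 proof -
  have "(SUM s:F. cr k [s]) <= \<rho>" for k
  proof -
   let ?Y = "\<Union>s\<in>F. Cy [s]"
   have "Mq (qk k) ?Y <= nsum W (%b. nsum (Star W) (%t. ennreal \<rho>*(ennreal (\<omega> (qk k) b t) * nsum {..<length b} (%j. indicator UNIV ((shift^^j) (cyc (b@t)))))))"
    unfolding Mq_nested
   proof (intro nsum_mono)
    fix w t assume w: "w \<in> W" and t: "t \<in> Star W"
    have "nsum {..<length w} (%j. indicator ?Y ((shift^^j) (cyc (w@t)))) <= nsum {..<length w} (%j. indicator {j. j < length w & w ! j \<in> F} j)"
     by (rule nsum_mono) (auto simp: indicator_def cyl1_iff shift_pow cyc_def nth_append)
    also have "... = (\<Sum>j<length w. indicator {j. j < length w & w ! j \<in> F} j)" by (simp add: nsum_finite)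
    also have "... = of_nat (card {j. j < length w & w ! j \<in> F})"
     by (simp add: indicator_def of_bool_def sum.If_cases Int_def)
    also have "... <= ennreal (\<rho> * real (length w))" using b w by (simp add: ennreal_of_nat_eq_real_of_nat ennreal_leI)
    also have "... = ennreal \<rho> * nsum {..<length w} (%j. indicator UNIV ((shift^^j) (cyc (w@t))))"
     using \<rho> by (simp add: nsum_finite ennreal_mult' ennreal_of_nat_eq_real_of_nat)
    finally have "nsum {..<length w} (%j. indicator ?Y ((shift^^j) (cyc (w@t)))) <= ennreal \<rho> * nsum {..<length w} (%j. indicator UNIV ((shift^^j) (cyc (w@t))))" .
    from mult_left_mono[OF this, of "ennreal (\<omega> (qk k) w t)"]
    show "ennreal (\<omega> (qk k) w t) * nsum {..<length w} (%j. indicator ?Y ((shift^^j) (cyc (w@t))))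
     <= ennreal \<rho>*(ennreal (\<omega> (qk k) w t) * nsum {..<length w} (%j. indicator UNIV ((shift^^j) (cyc (w@t)))))"
     by (simp add: mult.left_commute)
   qed
   also have "... = ennreal \<rho> * Z (qk k)" unfolding Mq_nested nsum_cmult ..
   finally have "nu k ?Y <= ennreal \<rho> * Z (qk k)/Z (qk k)" unfolding nu_def by (rule divide_right_mono_ennreal)
   also have "... = ennreal \<rho>" using Zk by (simp add: ennreal_mult_divide_eq less_top)
   finally have "nu k ?Y <= ennreal \<rho>" .
   moreover have "nu k ?Y = (SUM s:F. nu k (Cy [s]))" by (rule nu_UN[OF F]) (auto intro!: cyl_disj)
   moreover have "... = ennreal (SUM s:F. cr k [s])" by (rule enn_sum[OF F])
   ultimately show ?thesis using \<rho> by simp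
  qed
  then show ?thesis by (intro LIMSEQ_le_const2[OF tendsto_sum[OF l]]) auto
 qed
 show ?thesis
  by (intro bexI[OF _ inv] conjI allI ballI impI) (use G1 G2 G3 G4 in "auto simp: mu(3)")
qed

end

section \<open>The entropy lower bound\<close>

lemma card_nsum: "ennreal (real (card {j. j < n & Q j})) = nsum {..<n::nat} (%j. indicator {j. Q j} j)"
proof -
 have "nsum {..<n} (%j. indicator {j. Q j} j) = (\<Sum>j<n. indicator {j. Q j} j :: ennreal)" by (simp add: nsum_finite)
 also have "... = of_nat (card {j. j < n & Q j})" by (simp add: indicator_def of_bool_def sum.If_cases Int_def)
 finally show ?thesis by (simp add: ennreal_of_nat_eq_real_of_nat)
qed

text \<open>\<open>h0\<close> bounds the exponential rate of the number of return words. It controls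
  the entropy of long words and the integrability of \<open>f\<close>, for which no lower bound is
  assumed.\<close>

locale gibbsm = gibbs + inv_meas +
 fixes h0 :: real
 assumes G1: "!!v. ennreal (prob (cyl S E v)) <= ennreal C0 * rsum W (%b. wp b * real (Nb b v))"
  and G2: "!!u. u \<in> Star W ==> u ~= [] ==> prob (cyl S E (u@[a])) <= C0 * wp u"
  and G3: "prob (cyl S E [a] - (\<Union>b\<in>W. cyl S E (b@[a]))) = 0"
  and h0: "h0 >= 0" "rsum W (%w. exp (- h0 * real (length w))) < \<infinity>"
begin

sublocale potm S E f A \<theta> B \<mu> by unfold_locales

lemma coord_meas [measurable]: "(%x. x i) \<in> measurable \<mu> (count_space UNIV)"
 by (rule measurableI) (use frv_coord in auto)

definition NA where "NA i = {x\<in>space \<mu>. ALL j<=i. x j ~= a}"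

lemma NA_sets [measurable]: "NA i \<in> sets \<mu>" unfolding NA_def by measurable

text \<open>A stretch of \<open>i + 1\<close> letters without \<open>a\<close> must fit inside one
  return word. Summing over starting position and length gives the square of the word
  length.\<close>

lemma NA_bound: "nsum UNIV (%i. emeasure \<mu> (NA i)) <= ennreal C0 * rsum W (%b. wp b * real (length b)^2)"
proof -
 have one: "emeasure \<mu> (NA i) <= ennreal C0 * nsum W (%b. ennreal (wp b) * nsum {..<length b} (%j. indicator {j. j+i < length b} j))" for i
 proof -
  define V where "V = {v. length v = Suc i & a ~: set v}"
  have "NA i <= (\<Union>v\<in>V. Cy v)"
  proof
   fix x assume x: "x \<in> NA i"
   then have "map x [0..<Suc i] \<in> V" by (auto simp: V_def NA_def less_Suc_eq_le simp del: upt_Suc)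
   moreover have "x \<in> Cy (map x [0..<Suc i])" using x by (auto simp: cyl_def NA_def space_mu simp del: upt_Suc)
   ultimately show "x \<in> (\<Union>v\<in>V. Cy v)" by blast
  qed
  then have "emeasure \<mu> (NA i) <= emeasure \<mu> (\<Union>v\<in>V. Cy v)" by (intro emeasure_mono sets.countable_UN') auto
  also have "... = nsum V (%v. emeasure \<mu> (Cy v))"
   unfolding nsum_def by (rule emeasure_UN_countable) (auto simp: disjoint_family_on_def V_def intro!: cyl_disj)
  also have "... <= nsum V (%v. ennreal C0 * rsum W (%b. wp b * real (Nb b v)))"
   using G1 by (intro nsum_mono) (simp add: emeasure_eq_measure)
  also have "... = ennreal C0 * nsum W (%b. ennreal (wp b) * rsum V (%v. real (Nb b v)))"
   unfolding nsum_cmult by (subst nsum_swap) (simp add: ennreal_mult nsum_cmult)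
  also have "... <= ennreal C0 * nsum W (%b. ennreal (wp b) * nsum {..<length b} (%j. indicator {j. j+i < length b} j))"
  proof (intro mult_left_mono nsum_mono)
   fix b
   let ?c = "%v j. ALL i<length v. j+i <= length b --> (b@[a]) ! (j+i) = v ! i"
   \<comment> \<open>A window running past the end of \<open>b\<close> would meet the closing
     \<open>a\<close>. Hence it stays inside \<open>b\<close>, and the position determines
     \<open>v\<close>.\<close>
   have imp: "j+i < length b & v = map (%l. b ! (j+l)) [0..<Suc i]" if v: "v \<in> V" and j: "j < length b" and c: "?c v j" for v j
   proof -
    have len: "length v = Suc i" and av: "a ~: set v" using v by (auto simp: V_def)
    have ji: "j+i < length b"
    proof (rule ccontr)
     assume "\<not> j+i < length b"
     then have l: "length b - j < length v" "j+(length b - j) = length b" using j len by auto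
     from c[rule_format, OF l(1)] l(2) have "v ! (length b - j) = a" by simp
     with l(1) av show False by (auto simp: in_set_conv_nth)
    qed
    moreover have "v = map (%l. b ! (j+l)) [0..<Suc i]"
    proof (rule nth_equalityI)
     fix l assume l: "l < length v"
     then have "(b@[a]) ! (j+l) = v ! l" using c ji len by auto
     then show "v ! l = map (%l. b ! (j+l)) [0..<Suc i] ! l" using l len ji by (simp add: nth_append del: upt_Suc)
    qed (simp add: len)
    ultimately show ?thesis by simp
   qed
   have "rsum V (%v. real (Nb b v)) = nsum {..<length b} (%j. nsum V (%v. indicator {j. ?c v j} j))"
    unfolding Nb_def card_nsum by (rule nsum_swap)
   also have "... <= nsum {..<length b} (%j. indicator {j. j+i < length b} j)"
   proof (rule nsum_mono)
    fix j assume "j \<in> {..<length b}"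
    then have j: "j < length b" by simp
    have "nsum V (%v. indicator {j. ?c v j} j) <= nsum {map (%l. b ! (j+l)) [0..<Suc i]} (%v. indicator {j. j+i < length b} j)"
     unfolding nsum_indicator[of V] nsum_indicator[of "{map (%l. b ! (j+l)) [0..<Suc i]}"]
    proof (rule nsum_mono)
     fix v
     show "indicator {j. ?c v j} j * indicator V v <= indicator {j. j+i < length b} j*(indicator {map (%l. b ! (j+l)) [0..<Suc i]} v :: ennreal)"
     proof (cases "v \<in> V & ?c v j")
      case True
      then have "j+i < length b" "v = map (%l. b ! (j+l)) [0..<Suc i]" using imp[of v j] j by blast+
      then have 1: "j \<in> {j. j+i < length b}" and 2: "v \<in> {map (%l. b ! (j+l)) [0..<Suc i]}" by blast+
      show ?thesis unfolding indicator_simps(1)[OF 1] indicator_simps(1)[OF 2] by (simp add: indicator_def)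
     next
      case False
      then have "j ~: {j. ?c v j} | v ~: V" by blast
      then have "indicator {j. ?c v j} j * indicator V v = (0::ennreal)" by (elim disjE) (simp_all only: indicator_simps mult_zero_left mult_zero_right not_False_eq_True)
      then show ?thesis by (simp only: zero_le)
     qed
    qed
    then show "nsum V (%v. indicator {j. ?c v j} j) <= (indicator {j. j+i < length b} j :: ennreal)"
     by (simp add: nsum_finite del: upt_Suc)
   qed
   finally show "rsum V (%v. real (Nb b v)) <= nsum {..<length b} (%j. indicator {j. j+i < length b} j)" .
  qed simp_all
  finally show ?thesis .
 qed
 have "nsum UNIV (%i. emeasure \<mu> (NA i)) <= nsum UNIV (%i. ennreal C0 * nsum W (%b. ennreal (wp b) * nsum {..<length b} (%j. indicator {j. j+i < length b} j)))"
  by (intro nsum_mono one)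
 also have "... = ennreal C0 * nsum W (%b. ennreal (wp b) * nsum {..<length b} (%j. nsum UNIV (%i. indicator {j. j+i < length b} j)))"
  unfolding nsum_cmult nsum_swap[of UNIV W]
  by (simp only: nsum_swap[of UNIV "{..<length _}"])
 also have "... <= ennreal C0 * rsum W (%b. wp b * real (length b)^2)"
 proof (intro mult_left_mono nsum_mono)
  fix b :: "nat list"
  have "nsum UNIV (%i. indicator {j. j+i < length b} j) <= (ennreal (real (length b)))" for j
  proof -
   have "nsum UNIV (%i. indicator {j. j+i < length b} j) <= nsum UNIV (%i. 1 * indicator {..<length b} i :: ennreal)"
    by (rule nsum_mono) (auto simp: indicator_def)
   also have "... = ennreal (real (length b))" 
    using nsum_indicator[of "{..<length b}" "%_. 1"] by (simp add: nsum_finite ennreal_of_nat_eq_real_of_nat)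
   finally show ?thesis .
  qed
  then have "nsum {..<length b} (%j. nsum UNIV (%i. indicator {j. j+i < length b} j)) <= rsum {..<length b} (%j. real (length b))"
   by (intro nsum_mono)
  also have "... = ennreal (real (length b)^2)"
   by (simp add: nsum_finite ennreal_of_nat_eq_real_of_nat ennreal_mult[symmetric] power2_eq_square)
  finally show "ennreal (wp b) * nsum {..<length b} (%j. nsum UNIV (%i. indicator {j. j+i < length b} j)) <= ennreal (wp b * real (length b)^2)"
   by (simp add: ennreal_mult mult_left_mono)
 qed simp
 finally show ?thesis .
qed

lemma NA_finite: "nsum UNIV (%i. emeasure \<mu> (NA i)) < \<infinity>"
 using NA_bound len_tail[of 2] by (auto simp: ennreal_mult_less_top intro: le_less_trans)

text \<open>Words with a Birkhoff sum not too negative are controlled by the length moment. For the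
  others the exponential of the sum beats the sum itself, and the number of words of each length is
  paid by half of the exponent.\<close>

lemma birk_moment: "rsum W (%b. wp b*\<bar>birk shift f (length b) (cat b (pt a))\<bar>) < \<infinity>"
proof -
 \<comment> \<open>Half of \<open>M\<close>, corrected by \<open>P\<close>, is then at least
   \<open>h0\<close>.\<close>
 define M where "M = 2*(h0+\<bar>P\<bar>)"
 have M: "M >= 0" "h0 <= M/2+P"
  using h0(1) abs_ge_minus_self[of P] by (simp_all add: M_def add_divide_distrib)
 have pw: "wp b*\<bar>birk shift f (length b) (cat b (pt a))\<bar> <= (M+\<bar>B\<bar>)*(wp b * real (length b)^1)+1*exp (- h0 * real (length b))"
  if b: "b \<in> W" for b
 proof -
  let ?r = "birk shift f (length b) (cat b (pt a))" and ?l = "real (length b)"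
  have rB: "?r <= \<bar>B\<bar>*?l"
   using birk_le[of "cat b (pt a)" "length b"] PthD[OF WD(2)[OF b] pC] mult_right_mono[OF abs_ge_self[of B], of ?l] by (simp add: cyl1_iff)
  show ?thesis
  proof (cases "- ?r <= M*?l")
   case True
   have "0 <= M*?l" "0 <= \<bar>B\<bar>*?l" using M by simp_all
   then have "\<bar>?r\<bar> <= (M+\<bar>B\<bar>)*?l" using True rB unfolding distrib_right by linarith
   then have "wp b*\<bar>?r\<bar> <= wp b*((M+\<bar>B\<bar>)*?l)" by (intro mult_left_mono) auto
   also have "... = (M+\<bar>B\<bar>)*(wp b*?l^1)" by simp
   finally show ?thesis by (simp add: add_increasing2)
  next
   case False
   define y where "y = - ?r"
   have "0 <= M*?l" using M by simp
   then have y: "y > M*?l" "y >= 0" using False by (simp_all add: y_def)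
   have "y*exp (- (y/2)) <= 1*1"
   proof -
    have "y/2 <= exp (y/2)/2"
    proof -
     have "1+y/2+(y/2)\<^sup>2/2 <= exp (y/2)" using y by (intro exp_lower_Taylor_quadratic) simp
     moreover have "2*(y/2) <= 1+y/2+(y/2)\<^sup>2/2"
      using zero_le_power2[of "y/2 - 1"] by (simp add: power2_eq_square field_simps)
     ultimately show ?thesis by simp
    qed
    then show ?thesis by (simp add: exp_minus field_simps)
   qed
   then have e: "y*exp (- (y/2)) <= 1" by simp
   have "wp b = exp (- y)*exp (- P*?l)" by (simp add: wq_def wt_def y_def)
   then have "wp b*\<bar>?r\<bar> = (y*exp (- (y/2)))*(exp (- (y/2))*exp (- P*?l))"
    using y by (simp add: y_def exp_add[symmetric])
   also have "... <= 1*(exp (- (y/2))*exp (- P*?l))" by (intro mult_right_mono e) simp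
   also have "... = exp (- (y/2) - P*?l)" by (simp add: exp_add[symmetric])
   also have "... <= exp (- h0*?l)"
   proof -
    have "h0*?l <= (M/2+P)*?l" using M by (intro mult_right_mono) auto
    then show ?thesis using y(1) by (simp add: algebra_simps)
   qed
   finally show ?thesis using M by (simp add: add_increasing)
  qed
 qed
 have "rsum W (%b. wp b*\<bar>birk shift f (length b) (cat b (pt a))\<bar>)
  <= nsum W (%b. ennreal (M+\<bar>B\<bar>)*ennreal (wp b * real (length b)^1)+ennreal (exp (- h0 * real (length b))))"
  by (rule nsum_mono) (use pw M in "simp add: ennreal_mult[symmetric] ennreal_plus[symmetric] del: ennreal_plus")
 also have "... < \<infinity>" unfolding nsum_add nsum_cmult using len_tail[of 1] h0 by (simp add: ennreal_mult_less_top)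
 finally show ?thesis .
qed

text \<open>Up to the constant \<open>A\<close> the potential depends on two letters. The cylinder
  bound for pairs, summed along a return word, reassembles its Birkhoff sum, so the integral of the
  negative part is bounded by \<open>birk_moment\<close>.\<close>

lemma f_integrable: "integrable \<mu> f"
proof -
 define rep where "rep s t = (SOME x. x \<in> Cy [s, t])" for s t
 define g where "g = (%(s, t). - f (rep s t)+A)"
 have A2: "A*\<theta>^2 <= A" using A \<theta> by (simp add: mult_left_le power_le_one)
 have rep: "\<bar>f x - f (rep (x 0) (x 1))\<bar> <= A" if x: "x \<in> Sg" for x
 proof -
  have "x \<in> Cy [x 0, x 1]" using x by (auto simp: cyl_def less_Suc_eq)
  then have r: "rep (x 0) (x 1) \<in> Cy [x 0, x 1]" unfolding rep_def by (rule someI[of "%y. y \<in> Cy [x 0, x 1]"])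
  have "\<bar>f x - f (rep (x 0) (x 1))\<bar> <= A*\<theta>^2"
  proof (rule osc[OF _ x])
   have "rep (x 0) (x 1) 0 = x 0 & rep (x 0) (x 1) 1 = x 1" using r by (auto simp: cyl_def)
   then show "ALL i<2. x i = rep (x 0) (x 1) i" by (auto simp: numeral_2_eq_2 less_Suc_eq)
  qed (use r in "auto simp: cyl_def")
  with A2 show ?thesis by simp
 qed
 have pt_le: "ennreal (- f x) <= nsum UNIV (%p. ennreal (g p) * indicator (Cy [fst p, snd p]) x)" if x: "x \<in> space \<mu>" for x
 proof -
  have xS: "x \<in> Sg" using x by (simp add: space_mu)
  have "x \<in> Cy [x 0, x 1]" using xS by (auto simp: cyl_def less_Suc_eq)
  moreover have "- f x <= g (x 0, x 1)" using rep[OF xS] by (auto simp: g_def abs_le_iff)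
  ultimately have "ennreal (- f x) <= ennreal (g (x 0, x 1)) * indicator (Cy [x 0, x 1]) x" by (simp add: ennreal_leI)
  also have "... <= nsum UNIV (%p. ennreal (g p) * indicator (Cy [fst p, snd p]) x)"
   using nsum_member[of "(x 0, x 1)" UNIV "%p. ennreal (g p) * indicator (Cy [fst p, snd p]) x"] by simp
  finally show ?thesis .
 qed
 have "int_minus \<mu> f <= (\<integral>\<^sup>+x. nsum UNIV (%p. ennreal (g p) * indicator (Cy [fst p, snd p]) x) \<partial>\<mu>)"
  unfolding int_minus_def by (rule nn_integral_mono) (rule pt_le)
 also have "... = nsum UNIV (%p. \<integral>\<^sup>+x. ennreal (g p) * indicator (Cy [fst p, snd p]) x \<partial>\<mu>)"
  unfolding nsum_def by (rule nn_integral_count_space_nn_integral) (auto intro!: borel_measurable_times_ennreal borel_measurable_indicator)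
 also have "... = nsum UNIV (%p. ennreal (g p)*emeasure \<mu> (Cy [fst p, snd p]))"
  by (simp add: nn_integral_cmult_indicator)
 also have "... <= nsum UNIV (%p. ennreal (g p)*(ennreal C0 * rsum W (%b. wp b * real (Nb b [fst p, snd p]))))"
  using G1 by (intro nsum_mono mult_left_mono) (simp_all add: emeasure_eq_measure)
 also have "... = ennreal C0 * nsum UNIV (%p. nsum W (%b. ennreal (g p)*ennreal (wp b * real (Nb b [fst p, snd p]))))"
  unfolding nsum_cmult[symmetric] by (simp add: mult.left_commute)
 also have "... = ennreal C0 * nsum W (%b. nsum UNIV (%p. ennreal (g p)*ennreal (wp b * real (Nb b [fst p, snd p]))))"
  by (subst nsum_swap) simp
 also have "... = ennreal C0 * nsum W (%b. ennreal (wp b) * nsum UNIV (%p. ennreal (g p)*ennreal (real (Nb b [fst p, snd p]))))"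
  unfolding nsum_cmult[symmetric] by (simp add: ennreal_mult mult.left_commute)
 also have "... <= ennreal C0 * nsum W (%b. ennreal (wp b)*ennreal (\<bar>birk shift f (length b) (cat b (pt a))\<bar>+(2 * A+\<bar>B\<bar>) * real (length b)^1))"
 proof (intro mult_left_mono nsum_mono)
  fix b assume b: "b \<in> W"
  let ?x = "cat b (pt a)"
  have xS: "?x \<in> Sg" using PthD[OF WD(2)[OF b] pC] by (simp add: cyl1_iff)
  have xb: "?x j = (b@[a]) ! j" if "j <= length b" for j
   using that pC by (auto simp: cat_def nth_append cyl1_iff)
  have Nbe: "Nb b [s, t] = card {j. j < length b & (?x j, ?x (Suc j)) = (s, t)}" for s t
   unfolding Nb_def by (rule arg_cong[where f=card]) (auto simp: xb numeral_2_eq_2 less_Suc_eq)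
  have "nsum UNIV (%p. ennreal (g p)*ennreal (real (Nb b [fst p, snd p])))
   = nsum UNIV (%p. nsum {..<length b} (%j. ennreal (g p) * indicator {j. (?x j, ?x (Suc j)) = p} j))"
   unfolding Nbe card_nsum nsum_cmult by simp
  also have "... = nsum {..<length b} (%j. nsum UNIV (%p. ennreal (g p) * indicator {j. (?x j, ?x (Suc j)) = p} j))" by (rule nsum_swap)
  also have "... = rsum {..<length b} (%j. g (?x j, ?x (Suc j)))"
  proof (rule nsum_cong[OF refl])
   fix j
   have "nsum UNIV (%p. ennreal (g p) * indicator {j. (?x j, ?x (Suc j)) = p} j) = nsum UNIV (%p. ennreal (g p) * indicator {(?x j, ?x (Suc j))} p)"
    by (rule nsum_cong) (auto simp: indicator_def)
   also have "... = ennreal (g (?x j, ?x (Suc j)))" unfolding nsum_indicator[symmetric] by (simp add: nsum_finite)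
   finally show "nsum UNIV (%p. ennreal (g p) * indicator {j. (?x j, ?x (Suc j)) = p} j) = ennreal (g (?x j, ?x (Suc j)))" .
  qed
  also have "... <= rsum {..<length b} (%j. - f ((shift^^j) ?x)+2 * A+\<bar>B\<bar>)"
  proof (intro nsum_mono ennreal_leI)
   fix j
   have "\<bar>f ((shift^^j) ?x) - f (rep (?x j) (?x (Suc j)))\<bar> <= A"
    using rep[OF Sigma_plus_shift[OF xS, of j]] by (simp add: shift_pow)
   then show "g (?x j, ?x (Suc j)) <= - f ((shift^^j) ?x)+2 * A+\<bar>B\<bar>" using A by (auto simp: g_def abs_le_iff)
  qed
  also have "... = ennreal (\<Sum>j<length b. - f ((shift^^j) ?x)+2 * A+\<bar>B\<bar>)"
  proof -
   have "0 <= - f ((shift^^j) ?x)+2 * A+\<bar>B\<bar>" for j using f_le[OF Sigma_plus_shift[OF xS, of j]] A by linarith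
   then show ?thesis by (simp add: nsum_finite sum_ennreal)
  qed
  also have "(\<Sum>j<length b. - f ((shift^^j) ?x)+2 * A+\<bar>B\<bar>) = - birk shift f (length b) ?x+(2 * A+\<bar>B\<bar>) * real (length b)^1"
   unfolding birk_def sum.distrib sum_negf by (simp add: distrib_left mult.commute)
  also have "ennreal ... <= ennreal (\<bar>birk shift f (length b) ?x\<bar>+(2 * A+\<bar>B\<bar>) * real (length b)^1)"
   by (intro ennreal_leI add_right_mono) simp
  finally show "nsum UNIV (%p. ennreal (g p)*ennreal (real (Nb b [fst p, snd p]))) <= ..." .
 qed simp_all
 also have "... = ennreal C0*(rsum W (%b. wp b*\<bar>birk shift f (length b) (cat b (pt a))\<bar>)+ennreal (2 * A+\<bar>B\<bar>) * rsum W (%b. wp b * real (length b)^1))"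
  unfolding nsum_cmult[symmetric] nsum_add[symmetric] using A
  by (intro arg_cong2[where f="(*)"] refl nsum_cong) (simp_all add: ennreal_mult[symmetric] ennreal_plus[symmetric] algebra_simps del: ennreal_plus)
 also have "... < \<infinity>" using birk_moment len_tail[of 1] by (simp add: ennreal_mult_less_top)
 finally have "int_minus \<mu> f ~= \<infinity>" by simp
 then show ?thesis using int_plus_f unfolding real_integrable_def int_plus_def int_minus_def by auto
qed

abbreviation "pw w == prob (Cy (w@[a]))"

lemma pw_le: "w \<in> W ==> pw w <= C0 * wp w"
 using G2[of w] Star_Cons[of w W "[]"] WD(3) by simp

definition rr where "rr K = enn2real (rsum {w\<in>W. K <= to_nat w} (%w. \<eta> (pw w)+pw w))"

text \<open>From \<open>\<eta> p <= p * t + exp (- t)\<close> with \<open>t\<close> equal to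
  \<open>h0\<close> times the word length: the first part is a length moment, the second the series
  of all return words.\<close>

lemma eta_sum: "rsum W (%w. \<eta> (pw w)+pw w) < \<infinity>"
proof -
 have \<eta>_le: "\<eta> p <= p * t+exp (- t)" if "0 <= p" for p t
 proof (cases "p = 0")
  case False
  then have p: "p > 0" using that by simp
  have "ln (exp (- t)/p) <= exp (- t)/p - 1" by (rule ln_le_minus_one) (use p in simp)
  then have "p*(- t - ln p) <= p*(exp (- t)/p - 1)" using p by (intro mult_left_mono) (simp_all add: ln_div)
  then show ?thesis using p by (simp add: \<eta>_def algebra_simps)
 qed simp
 have "rsum W (%w. \<eta> (pw w)+pw w) <= nsum W (%w. ennreal (C0 * h0)*ennreal (wp w * real (length w)^1)+ennreal (exp (- h0 * real (length w)))+ennreal C0*ennreal (wp w * real (length w)^0))"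
 proof (rule nsum_mono)
  fix w assume w: "w \<in> W"
  have "\<eta> (pw w) <= pw w*(h0 * real (length w))+exp (- (h0 * real (length w)))" by (rule \<eta>_le) simp
  also have "pw w*(h0 * real (length w)) <= (C0 * wp w)*(h0 * real (length w))" using h0 by (intro mult_right_mono pw_le w) auto
  finally have "\<eta> (pw w)+pw w <= C0 * h0*(wp w * real (length w)^1)+exp (- h0 * real (length w))+C0*(wp w * real (length w)^0)"
   using pw_le[OF w] by (simp add: algebra_simps)
  then have "ennreal (\<eta> (pw w)+pw w) <= ennreal (C0 * h0*(wp w * real (length w)^1)+exp (- h0 * real (length w))+C0*(wp w * real (length w)^0))"
   by (rule ennreal_leI)
  then show "ennreal (\<eta> (pw w)+pw w) <= ennreal (C0 * h0)*ennreal (wp w * real (length w)^1)+ennreal (exp (- h0 * real (length w)))+ennreal C0*ennreal (wp w * real (length w)^0)"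
   using C0 h0 by (simp add: ennreal_mult[symmetric] ennreal_plus[symmetric] del: ennreal_plus)
 qed
 also have "... < \<infinity>" unfolding nsum_add nsum_cmult using len_tail[of 1] len_tail[of 0] h0 by (simp add: ennreal_mult_less_top)
 finally show ?thesis .
qed

lemma rr: "rsum {w\<in>W. K <= to_nat w} (%w. \<eta> (pw w)+pw w) = ennreal (rr K)" "0 <= rr K"
proof -
 have "rsum {w\<in>W. K <= to_nat w} (%w. \<eta> (pw w)+pw w) <= rsum W (%w. \<eta> (pw w)+pw w)" by (rule nsum_subset) auto
 with eta_sum show "rsum {w\<in>W. K <= to_nat w} (%w. \<eta> (pw w)+pw w) = ennreal (rr K)"
  unfolding rr_def by (auto intro: le_less_trans)
 show "0 <= rr K" by (simp add: rr_def)
qed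

lemma rr_small: "e > 0 ==> EX K. rr K <= e"
proof -
 assume e: "e > 0"
 obtain K where "!!k. k >= K ==> rsum {w\<in>W. k <= to_nat w} (%w. \<eta> (pw w)+pw w) <= ennreal e"
  using nsum_tail[OF eta_sum e] by blast
 from this[of K] show ?thesis unfolding rr(1) using e by auto
qed

lemma loop_unique:
 assumes x: "x \<in> Cy (b@[a])" "x \<in> Cy (b'@[a])" and b: "b \<in> W" "b' \<in> W" shows "b = b'"
proof -
 have *: "\<not> length b < length b'" if x: "x \<in> Cy (b@[a])" "x \<in> Cy (b'@[a])" and b: "b \<in> W" "b' \<in> W" for b b'
 proof
  assume l: "length b < length b'"
  have "x (length b) = a" using x(1) by (auto simp: cyl_def nth_append dest!: spec[of _ "length b"])
  moreover have "x (length b) = b' ! length b" using x(2) l by (auto simp: cyl_def nth_append dest!: spec[of _ "length b"])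
  moreover have "0 < length b" using WD(3)[OF b(1)] by simp
  ultimately show False using WD(1)[OF b(2)] l by (auto simp: FR_def)
 qed
 have "length b = length b'" using *[OF x b] *[OF x(2,1) b(2,1)] by simp
 then show ?thesis using cyl_disj[of "b@[a]" "b'@[a]"] x by auto
qed

definition Wk where "Wk K = {w\<in>W. to_nat w < K}"

lemma Wk_fin: "finite (Wk K)"
proof -
 have "Wk K <= from_nat ` {..<K}" unfolding Wk_def by (auto intro!: image_eqI[of _ from_nat "to_nat _"])
 then show ?thesis by (rule finite_subset) simp
qed

lemma Wk_W: "w \<in> Wk K ==> w \<in> W" by (simp add: Wk_def)

text \<open>Codes a point by its current return word if that word is among the finitely many in
  \<open>Wk K\<close>. \<open>Some []\<close> marks a visit with any other word; this code is free
  since return words are nonempty.\<close>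

definition QK :: "nat => (nat => nat) => nat list option" where
 "QK K x = (if x 0 ~= a then None else if EX w:Wk K. x \<in> Cy (w@[a]) then Some (THE w. w \<in> Wk K & x \<in> Cy (w@[a])) else Some [])"

lemma cyl_loop_0: "w \<in> W ==> x \<in> Cy (w@[a]) ==> x 0 = a"
 using WD(3,4)[of w] by (auto simp: cyl_def nth_append dest!: spec[of _ 0])

lemma QK_None: "QK K x = None \<longleftrightarrow> x 0 ~= a" by (simp add: QK_def)

lemma QK_Some: assumes "w \<in> Wk K" shows "QK K x = Some w \<longleftrightarrow> x \<in> Cy (w@[a])"
proof -
 have the: "(THE w. w \<in> Wk K & x \<in> Cy (w@[a])) = v" if "v \<in> Wk K" "x \<in> Cy (v@[a])" for v
  by (rule the_equality) (use that loop_unique Wk_W in auto)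
 show ?thesis
 proof
  assume x: "x \<in> Cy (w@[a])"
  then show "QK K x = Some w" using the[OF assms x] cyl_loop_0[OF Wk_W[OF assms] x] assms by (auto simp: QK_def)
 next
  assume H: "QK K x = Some w"
  have "w ~= []" using WD(3)[OF Wk_W[OF assms]] .
  with H have "EX w:Wk K. x \<in> Cy (w@[a])" by (auto simp: QK_def split: if_splits)
  then obtain v where v: "v \<in> Wk K" "x \<in> Cy (v@[a])" by auto
  have "QK K x = Some v" using the[OF v] cyl_loop_0[OF Wk_W[OF v(1)] v(2)] v by (auto simp: QK_def)
  with H v show "x \<in> Cy (w@[a])" by simp
 qed
qed

lemma QK_cases: "QK K x = None | QK K x = Some [] | (EX w:Wk K. QK K x = Some w)"
proof (cases "EX w:Wk K. x \<in> Cy (w@[a])")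
 case True then show ?thesis using QK_Some by auto
next
 case False then show ?thesis by (simp add: QK_def)
qed

lemma QK_range: "QK K ` space \<mu> <= insert None (insert (Some []) (Some ` Wk K))"
proof (rule image_subsetI)
 fix x show "QK K x \<in> insert None (insert (Some []) (Some ` Wk K))" using QK_cases[of K x] by (elim disjE bexE) simp_all
qed

lemma QK_Nil: "QK K x = Some [] \<longleftrightarrow> x 0 = a & ~ (EX w:Wk K. x \<in> Cy (w@[a]))"
proof
 assume H: "QK K x = Some []"
 have "QK K x ~= Some w" if "w \<in> Wk K" for w using H WD(3)[OF Wk_W[OF that]] by auto
 with H QK_Some QK_None show "x 0 = a & ~ (EX w:Wk K. x \<in> Cy (w@[a]))" by (metis option.distinct(1))
qed (simp add: QK_def)

lemma frv_QK: "frv \<mu> (QK K)"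
 unfolding frv_def
proof (intro conjI allI)
 show "finite (QK K ` space \<mu>)" by (rule finite_subset[OF QK_range]) (simp add: Wk_fin)
 fix v
 consider "v = None" | "v = Some []" | w where "v = Some w" "w \<in> Wk K" | "v ~: insert None (insert (Some []) (Some ` Wk K))" by blast
 then show "QK K -` {v} Int space \<mu> \<in> sets \<mu>"
 proof cases
  case 1
  then have "QK K -` {v} Int space \<mu> = space \<mu> - Cy [a]" by (auto simp: QK_None cyl1_iff space_mu)
  then show ?thesis using cyl_mu by (simp add: sets.Diff)
 next
  case 2
  then have "QK K -` {v} Int space \<mu> = Cy [a] - (\<Union>w\<in>Wk K. Cy (w@[a]))"
   by (auto simp: QK_Nil cyl1_iff space_mu)
  then show ?thesis using Wk_fin by (auto intro!: sets.Diff sets.finite_UN)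
 next
  case 3
  then have "QK K -` {v} Int space \<mu> = Cy (w@[a])" using cyl_subset[of S E] by (auto simp: QK_Some space_mu)
  then show ?thesis by simp
 next
  case 4
  then have "QK K -` {v} Int space \<mu> = {}" using QK_range[of K] by auto
  then show ?thesis by simp
 qed
qed

definition oK where "oK K = prob (Cy [a] - (\<Union>w\<in>Wk K. Cy (w@[a])))"

lemma oK_eq: "oK K = prob (Cy [a]) - (SUM w:Wk K. pw w)"
proof -
 have "(\<Union>w\<in>Wk K. Cy (w@[a])) <= Cy [a]"
  using cyl_loop_0 Wk_W cyl_subset by (fastforce simp: cyl1_iff)
 moreover have "prob (\<Union>w\<in>Wk K. Cy (w@[a])) = (SUM w:Wk K. pw w)"
  using Wk_fin loop_unique Wk_W
  by (intro finite_measure_finite_Union) (auto simp: disjoint_family_on_def)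
 ultimately show ?thesis unfolding oK_def using Wk_fin by (subst finite_measure_Diff) auto
qed

lemma Hent_QK: "Hent \<mu> (QK K) = \<eta> (prob (space \<mu> - Cy [a]))+\<eta> (oK K)+(SUM w:Wk K. \<eta> (pw w))"
proof -
 have n: "Some [] ~: Some ` Wk K" using WD(3) Wk_W by blast
 have 1: "pr \<mu> (QK K) None = prob (space \<mu> - Cy [a])"
  unfolding pr_def by (rule arg_cong[where f=prob]) (auto simp: QK_None cyl1_iff space_mu)
 have 2: "pr \<mu> (QK K) (Some []) = oK K"
  unfolding pr_def oK_def by (rule arg_cong[where f=prob]) (auto simp: QK_Nil cyl1_iff space_mu)
 have 3: "pr \<mu> (QK K) (Some w) = pw w" if "w \<in> Wk K" for w
  unfolding pr_def by (rule arg_cong[where f=prob]) (use cyl_subset[of S E] in "auto simp: QK_Some[OF that] space_mu")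
 have "Hent \<mu> (QK K) = (SUM v:insert None (insert (Some []) (Some ` Wk K)). \<eta> (pr \<mu> (QK K) v))"
  by (rule Hent_superset[OF _ QK_range]) (simp add: Wk_fin)
 also have "... = \<eta> (pr \<mu> (QK K) None)+(\<eta> (pr \<mu> (QK K) (Some []))+(SUM v:Some ` Wk K. \<eta> (pr \<mu> (QK K) v)))"
  using n Wk_fin by (subst sum.insert) auto
 also have "(SUM v:Some ` Wk K. \<eta> (pr \<mu> (QK K) v)) = (SUM w:Wk K. \<eta> (pw w))"
  by (subst sum.reindex) (auto simp: 3)
 finally show ?thesis by (simp add: 1 2)
qed

text \<open>Passing to a larger \<open>K'\<close> only splits the class \<open>Some []\<close>. The
  new words cost their own \<open>\<eta>\<close>, and the change of the remaining class costs at
  most the mass it loses; together this is the tail \<open>rr K\<close>.\<close>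

lemma Hent_QK_cond:
 assumes "K <= K'" shows "Hent \<mu> (%x. (QK K' x, QK K x)) - Hent \<mu> (QK K) <= rr K"
proof -
 have sub: "Wk K <= Wk K'" using assms by (auto simp: Wk_def)
 have dep: "QK K x = QK K y" if "QK K' x = QK K' y" for x y
 proof -
  consider "QK K' x = None" | "QK K' x = Some []" | w where "w \<in> Wk K'" "QK K' x = Some w" using QK_cases[of K' x] by (elim disjE bexE)
  then show ?thesis
  proof cases
   case 1 then show ?thesis using that by (metis QK_None)
  next
   case 2
   then have "QK K' y = Some []" using that by simp
   with 2 have "QK K x = Some []" "QK K y = Some []" using sub unfolding QK_Nil by blast+
   then show ?thesis by simp
  next
   case (3 w)
   then have x: "x \<in> Cy (w@[a])" and y: "y \<in> Cy (w@[a])" using that by (simp_all only: QK_Some[OF 3(1), symmetric])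
   show ?thesis
   proof (cases "w \<in> Wk K")
    case True
    have "QK K x = Some w" "QK K y = Some w" unfolding QK_Some[OF True] by (rule x, rule y)
    then show ?thesis by simp
   next
    case False
    have "\<not> (EX v:Wk K. x \<in> Cy (v@[a]))" "\<not> (EX v:Wk K. y \<in> Cy (v@[a]))"
     using False loop_unique[OF x _ Wk_W[OF 3(1)]] loop_unique[OF y _ Wk_W[OF 3(1)]] Wk_W by blast+
    then show ?thesis using cyl_loop_0[OF Wk_W[OF 3(1)]] x y by (simp add: QK_def)
   qed
  qed
 qed
 have "Hent \<mu> (%x. (QK K' x, QK K x)) = Hent \<mu> (QK K')"
 proof (rule Hent_eq[OF frv_QK])
  fix x y
  show "QK K' x = QK K' y \<longleftrightarrow> (QK K' x, QK K x) = (QK K' y, QK K y)" unfolding prod.inject using dep[of x y] by blast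
 qed
 moreover have "Hent \<mu> (QK K') - Hent \<mu> (QK K) = (SUM w:Wk K' - Wk K. \<eta> (pw w))+(\<eta> (oK K') - \<eta> (oK K))"
  unfolding Hent_QK using sum.subset_diff[OF sub Wk_fin, of "%w. \<eta> (pw w)"] by simp
 moreover have "\<eta> (oK K') - \<eta> (oK K) <= oK K - oK K'"
 proof -
  have o: "0 <= oK K'" "oK K' <= oK K" "oK K <= 1"
   unfolding oK_def using sub Wk_fin by (auto intro!: finite_measure_mono sets.Diff sets.finite_UN)
  show ?thesis
  proof (cases "oK K' = 0")
   case True then show ?thesis using o \<eta>_nonneg[of "oK K"] by simp
  next
   case False
   then have p: "0 < oK K'" "0 < oK K" using o by auto
   have "ln (oK K/oK K') <= oK K/oK K' - 1" by (rule ln_le_minus_one) (use p in simp)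
   then have "oK K'*(ln (oK K) - ln (oK K')) <= oK K'*(oK K/oK K' - 1)" using p by (intro mult_left_mono) (simp_all add: ln_div)
   then have "oK K'*(ln (oK K) - ln (oK K')) <= oK K - oK K'" using p by (simp add: right_diff_distrib)
   moreover have "(oK K - oK K') * ln (oK K) <= 0" using o p by (intro mult_nonneg_nonpos) auto
   ultimately show ?thesis by (simp add: \<eta>_def algebra_simps)
  qed
 qed
 moreover have "oK K - oK K' = (SUM w:Wk K' - Wk K. pw w)"
  unfolding oK_eq using sum.subset_diff[OF sub Wk_fin, of pw] by simp
 moreover have "(SUM w:Wk K' - Wk K. \<eta> (pw w)+pw w) <= rr K"
 proof -
  have nn: "0 <= \<eta> (pw w)+pw w" for w using \<eta>_nonneg[of "pw w"] by simp
  have "ennreal (SUM w:Wk K' - Wk K. \<eta> (pw w)+pw w) = (SUM w:Wk K' - Wk K. ennreal (\<eta> (pw w)+pw w))" using nn by (simp add: sum_ennreal)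
  also have "... <= ennreal (rr K)" unfolding rr(1)[symmetric] using Wk_fin[of K'] by (intro nsum_sum_le) (auto simp: Wk_def)
  finally show ?thesis using rr(2) by simp
 qed
 ultimately show ?thesis by (simp add: sum.distrib)
qed

text \<open>Waiting time for \<open>a\<close>. The value 0 for points that never visit is harmless:
  \<open>hit\<close> is only subtracted in lower bounds, and information estimates are made at
  visiting points.\<close>

definition hit :: "(nat => nat) => real" where
 "hit y = (if EX j. y j = a then real (LEAST j. y j = a) else 0)"

lemma hit_meas [measurable]: "hit \<in> borel_measurable \<mu>"
 unfolding hit_def by measurable

lemma hit_integrable: "integrable \<mu> hit"
proof (rule integrableI_bounded)
 have "ennreal (norm (hit y)) <= nsum UNIV (%j. indicator (NA j) y)" if y: "y \<in> space \<mu>" for y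
 proof (cases "EX j. y j = a")
  case True
  let ?m = "LEAST j. y j = a"
  have "y \<in> NA j" if j: "j < ?m" for j
  proof -
   have "y i ~= a" if "i <= j" for i using not_less_Least[of i "%j. y j = a"] that j by simp
   with y show ?thesis unfolding NA_def by blast
  qed
  then have "nsum UNIV (%j. 1 * indicator {..<?m} j) <= nsum UNIV (%j. indicator (NA j) y :: ennreal)"
   by (intro nsum_mono) (auto simp: indicator_def)
  then have "nsum {..<?m} (%_. 1) <= nsum UNIV (%j. indicator (NA j) y :: ennreal)" 
   unfolding nsum_indicator[of "{..<?m}"] .
  then show ?thesis using True by (simp add: nsum_finite hit_def ennreal_of_nat_eq_real_of_nat)
 qed (simp add: hit_def)
 then have "(\<integral>\<^sup>+y. ennreal (norm (hit y)) \<partial>\<mu>) <= (\<integral>\<^sup>+y. nsum UNIV (%j. indicator (NA j) y) \<partial>\<mu>)" by (rule nn_integral_mono)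
 also have "... = nsum UNIV (%j. \<integral>\<^sup>+y. indicator (NA j) y \<partial>\<mu>)"
  unfolding nsum_def by (rule nn_integral_count_space_nn_integral) auto
 also have "... < \<infinity>" using NA_finite by simp
 finally show "(\<integral>\<^sup>+y. ennreal (norm (hit y)) \<partial>\<mu>) < \<infinity>" .
qed simp

text \<open>From a visit to \<open>a\<close> the codes spell out consecutive return words until time
  \<open>n\<close> is passed. Every point with the same code name therefore follows the same loop
  \<open>u\<close> from time \<open>l\<close> on.\<close>

lemma visit_block:
 assumes x: "x \<in> space \<mu>" and full: "!!i. i < n ==> x i = a ==> QK K ((shift^^i) x) ~= Some []"
  and l: "l < n" "x l = a"
 shows "EX u:Star W. u ~= [] & n <= l+length u & (ALL j. n <= j --> j < l+length u --> x j ~= a) & x (l+length u) = a &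
  (ALL y:space \<mu>. nm (QK K) n y = nm (QK K) n x --> (shift^^l) y \<in> Cy (u@[a]))"
 using l
proof (induction "n - l" arbitrary: l rule: less_induct)
 case less
 have "QK K ((shift^^l) x) ~= None" using less.prems by (simp add: QK_None shift_pow)
 with QK_cases[of K "(shift^^l) x"] full[OF less.prems] obtain w where w: "w \<in> Wk K" "QK K ((shift^^l) x) = Some w" by blast
 have wW: "w \<in> W" by (rule Wk_W[OF w(1)])
 note wne = WD(3)[OF wW]
 have Y: "(shift^^l) y \<in> Cy (w@[a])" if y: "y \<in> space \<mu>" "nm (QK K) n y = nm (QK K) n x" for y
 proof -
  have "QK K ((shift^^l) y) = Some w" using y(2) w(2) less.prems(1) by (simp add: nm_eq_iff)
  then show ?thesis using QK_Some[OF w(1)] by simp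
 qed
 have xw: "x (l+i) = (w@[a]) ! i" if "i <= length w" for i
 proof -
  have "((shift^^l) x) i = (w@[a]) ! i" using Y[OF x refl] that unfolding cyl_def by simp
  then show ?thesis by (simp add: shift_pow add.commute)
 qed
 have end_a: "x (l+length w) = a" using xw[of "length w"] by simp
 have avoid: "x j ~= a" if j: "l < j" "j < l+length w" for j
 proof -
  have "j - l < length w" using j by linarith
  then have "x j = w ! (j - l)" using xw[of "j - l"] j by (simp add: nth_append)
  moreover have "w ! (j - l) ~= a" using WD(1)[OF wW] j unfolding FR_def by auto
  ultimately show ?thesis by simp
 qed
 show ?case
 proof (cases "n <= l+length w")
  case True
  have "w \<in> Star W" using Star_Cons[OF wW, of "[]"] by simp
  moreover have "ALL j. n <= j --> j < l+length w --> x j ~= a" using avoid less.prems(1) by simp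
  ultimately show ?thesis using wne True end_a Y by blast
 next
  case False
  let ?l = "l+length w"
  have l2: "n - ?l < n - l" "?l < n" using False less.prems(1) wne by (simp_all add: diff_less_mono2)
  from less.hyps[OF l2 end_a] obtain u where u: "u \<in> Star W" "u ~= []" "n <= ?l+length u"
   "ALL j. n <= j --> j < ?l+length u --> x j ~= a" "x (?l+length u) = a"
   "!!y. y \<in> space \<mu> ==> nm (QK K) n y = nm (QK K) n x ==> (shift^^?l) y \<in> Cy (u@[a])" by blast
  have "(shift^^l) y \<in> Cy ((w@u)@[a])" if y: "y \<in> space \<mu>" "nm (QK K) n y = nm (QK K) n x" for y
  proof -
   have 1: "y (i+l) = w ! i" if "i < length w" for i
   proof -
    have "((shift^^l) y) i = (w@[a]) ! i" using Y[OF y] that unfolding cyl_def by simp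
    then show ?thesis using that by (simp add: shift_pow nth_append)
   qed
   have 2: "y (i+?l) = (u@[a]) ! i" if "i < length (u@[a])" for i
   proof -
    have "((shift^^?l) y) i = (u@[a]) ! i" using u(6)[OF y] that unfolding cyl_def by simp
    then show ?thesis by (simp add: shift_pow)
   qed
   have "((shift^^l) y) i = ((w@u)@[a]) ! i" if i: "i < length ((w@u)@[a])" for i
   proof (cases "i < length w")
    case True then show ?thesis using 1 by (simp add: shift_pow nth_append)
   next
    case False
    then have "y (i+l) = (u@[a]) ! (i - length w)" using 2[of "i - length w"] i by (simp add: add.commute add.left_commute)
    with False show ?thesis by (simp add: shift_pow nth_append)
   qed
   moreover have "(shift^^l) y \<in> Sg" using shift_space[OF y(1)] by (simp add: space_mu)
   ultimately show ?thesis unfolding cyl_def by simp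
  qed
  moreover have "w@u \<in> Star W" by (rule Star_Cons[OF wW u(1)])
  moreover have "l+length (w@u) = ?l+length u" by simp
  ultimately show ?thesis using u(2-5) by (intro bexI[of _ "w@u"]) (auto simp: add.assoc)
 qed
qed

abbreviation "Dh == \<bar>P\<bar>+\<bar>B\<bar>"
abbreviation "Ch == \<bar>ln C0\<bar>+kap"

text \<open>A lower bound for the information of the first \<open>n\<close> codes. Times before the
  first visit to \<open>a\<close> are dropped, \<open>Dh * hit\<close> pays for the last return word
  overshooting time \<open>n\<close>, and \<open>Ch\<close> collects the Gibbs constant and the
  distortion.\<close>

definition RR :: "nat => (nat => nat) => real" where
 "RR n x = (\<Sum>i<n. (1 - indicator (NA i) x)*(P - f ((shift^^i) x))) - Dh * hit ((shift^^n) x) - Ch"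

definition good where
 "good n K = {x\<in>space \<mu>. (EX i<n. x i = a) & (ALL i<n. x i = a --> QK K ((shift^^i) x) ~= Some [])}"

text \<open>The class of the name lies in a preimage of one loop cylinder, whose measure is bounded
  by the upper Gibbs bound. The weight of the loop is a Birkhoff sum from the first visit to the
  first return at or after time \<open>n\<close>.\<close>

lemma RR_le:
 assumes x: "x \<in> good n K" and pos: "pr \<mu> (nm (QK K) n) (nm (QK K) n x) ~= 0" (is "?p ~= 0")
 shows "RR n x <= - ln ?p"
proof -
 have xs: "x \<in> space \<mu>" and full: "!!i. i < n ==> x i = a ==> QK K ((shift^^i) x) ~= Some []" and ex: "EX i<n. x i = a"
  using x by (auto simp: good_def)
 have xS: "x \<in> Sg" using xs by (simp add: space_mu)
 define l where "l = (LEAST i. x i = a)"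
 have l: "x l = a" unfolding l_def using ex by (auto intro: LeastI)
 have lmin: "x i ~= a" if "i < l" for i using that not_less_Least unfolding l_def by blast
 obtain i0 where i0: "i0 < n" "x i0 = a" using ex by blast
 have ln: "l < n" using Least_le[of "%i. x i = a" i0] i0 by (simp add: l_def)
 obtain u where u: "u \<in> Star W" "u ~= []" "n <= l+length u"
   "!!j. n <= j ==> j < l+length u ==> x j ~= a" "x (l+length u) = a"
   "!!y. y \<in> space \<mu> ==> nm (QK K) n y = nm (QK K) n x ==> (shift^^l) y \<in> Cy (u@[a])"
  using visit_block[OF xs full ln l] by blast
 define e where "e = l+length u"
 have hit: "hit ((shift^^n) x) = real (e - n)"
 proof -
  have xe: "x (e - n+n) = a" using u(3,5) by (simp add: e_def)
  have "(LEAST j. x (j+n) = a) = e - n"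
  proof (rule Least_equality)
   show "x (e - n+n) = a" by (rule xe)
   fix j assume j: "x (j+n) = a"
   show "e - n <= j"
   proof (rule ccontr)
    assume "\<not> e - n <= j"
    then have "j+n < l+length u" by (simp add: e_def)
    with u(4)[of "j+n"] j show False by simp
   qed
  qed
  then show ?thesis using xe unfolding hit_def shift_pow by auto
 qed
 let ?y = "(shift^^e) x"
 have yC: "?y \<in> Cy [a]" using Sigma_plus_shift[OF xS, of e] u(5) by (simp add: cyl1_iff e_def shift_pow)
 have xl: "cat u ?y = (shift^^l) x"
 proof -
  have "map ((shift^^l) x) [0..<length u] = u"
  proof (rule nth_equalityI)
   fix i assume i: "i < length (map ((shift^^l) x) [0..<length u])"
   have "((shift^^l) x) i = (u@[a]) ! i" using u(6)[OF xs refl] i unfolding cyl_def by simp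
   then show "map ((shift^^l) x) [0..<length u] ! i = u ! i" using i by (simp add: nth_append)
  qed simp
  from cat_prefix[OF this] show ?thesis by (simp add: e_def shift_pow add.commute add.left_commute)
 qed
 have "?p <= prob ((shift^^l) -` Cy (u@[a]) Int space \<mu>)"
  unfolding pr_def using u(6) by (intro finite_measure_mono measurable_sets[OF shift_pow_meas]) auto
 also have "... = prob (Cy (u@[a]))" by (rule measure_shift_pow) simp
 also have "... <= C0 * wp u" by (rule G2[OF u(1,2)])
 also have "... <= C0*(exp kap * wq f P u ?y)"
  by (intro mult_left_mono wq_dist[OF StarP[OF u(1)] pC yC]) (use C0 in auto)
 finally have ple: "?p <= C0*(exp kap * wq f P u ?y)" .
 have "ln ?p <= ln (C0*(exp kap * wq f P u ?y))" using ple pos pr_nonneg[of \<mu> "nm (QK K) n" "nm (QK K) n x"] by (intro ln_mono) linarith+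
 also have "... = ln C0+kap+ln (wq f P u ?y)" using C0 wq_pos[of f P u ?y] by (simp add: ln_mult less_imp_neq[THEN not_sym])
 also have "ln (wq f P u ?y) = birk shift f (length u) ((shift^^l) x) - P * real (length u)"
  by (simp add: wq_def wt_def xl ln_mult)
 finally have A: "ln ?p <= ln C0+kap+birk shift f (length u) ((shift^^l) x) - P * real (length u)" by simp
 have len: "length u = (n - l)+(e - n)" using u(3) ln by (simp add: e_def)
 have "birk shift f (length u) ((shift^^l) x) = birk shift f (n - l) ((shift^^l) x)+birk shift f (e - n) ((shift^^(n - l)) ((shift^^l) x))"
  unfolding len by (rule birk_plus)
 also have "(shift^^(n - l)) ((shift^^l) x) = (shift^^n) x" using ln by (simp add: shift_pow)
 also have "birk shift f (e - n) ((shift^^n) x) <= B * real (e - n)" by (rule birk_le[OF Sigma_plus_shift[OF xS]])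
 finally have B2: "birk shift f (length u) ((shift^^l) x) <= birk shift f (n - l) ((shift^^l) x)+B * real (e - n)" by simp
 have sum: "(\<Sum>i<n. (1 - indicator (NA i) x)*(P - f ((shift^^i) x))) = P * real (n - l) - birk shift f (n - l) ((shift^^l) x)"
 proof -
  have "(\<Sum>i<n. (1 - indicator (NA i) x)*(P - f ((shift^^i) x))) = (SUM i:{l..<n}. P - f ((shift^^i) x))"
  proof (rule sum.mono_neutral_cong_right)
   show "ALL i:{..<n} - {l..<n}. (1 - indicator (NA i) x)*(P - f ((shift^^i) x)) = 0"
   proof
    fix i assume i: "i \<in> {..<n} - {l..<n}"
    have "x j ~= a" if "j <= i" for j using lmin[of j] i that by auto
    then have "x \<in> NA i" unfolding NA_def using xs by blast
    then show "(1 - indicator (NA i) x)*(P - f ((shift^^i) x)) = 0" by simp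
   qed
   fix i assume "i \<in> {l..<n}"
   then have "x ~: NA i" unfolding NA_def using l by auto
   then show "(1 - indicator (NA i) x)*(P - f ((shift^^i) x)) = P - f ((shift^^i) x)" by simp
  qed auto
  also have "... = (\<Sum>i<n - l. P - f ((shift^^(i+l)) x))"
   using sum.shift_bounds_nat_ivl[of "%i. P - f ((shift^^i) x)" 0 l "n - l"] ln by (simp add: atLeast0LessThan)
  also have "... = P * real (n - l) - birk shift f (n - l) ((shift^^l) x)"
   by (simp add: birk_def sum_subtractf shift_pow add.commute add.left_commute)
  finally show ?thesis .
 qed
 have "(P - B) * real (e - n) >= - Dh * real (e - n)" by (rule mult_right_mono) auto
 moreover have "P * real (length u) = P * real (n - l)+P * real (e - n)" unfolding len by (simp add: distrib_left)
 ultimately show ?thesis using A B2 abs_ge_self[of "ln C0"] 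
  unfolding RR_def sum hit unfolding left_diff_distrib distrib_right minus_mult_left[symmetric] by linarith
qed

lemma hit_nonneg: "0 <= hit y" by (simp add: hit_def)

lemma g_integrable: "integrable \<mu> (%x. P - f x)" using f_integrable by simp

lemma NA_term_integrable: "integrable \<mu> (%x. (1 - indicator (NA i) x)*(P - f ((shift^^i) x)))"
 by (rule Bochner_Integration.integrable_bound[OF integrable_shift_pow[OF g_integrable, of i]])
  (use f_meas in "auto simp: indicator_def")

lemma RR_integrable: "integrable \<mu> (RR n)"
proof -
 have 1: "integrable \<mu> (%x. \<Sum>i<n. (1 - indicator (NA i) x)*(P - f ((shift^^i) x)))"
  by (rule Bochner_Integration.integrable_sum) (rule NA_term_integrable)
 have 2: "integrable \<mu> (%x. Dh * hit ((shift^^n) x))" using integrable_shift_pow[OF hit_integrable, of n] by simp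
 show ?thesis unfolding RR_def[abs_def] by (rule Bochner_Integration.integrable_diff[OF Bochner_Integration.integrable_diff[OF 1 2]]) simp
qed

lemma good_sets [measurable]: "good n K \<in> sets \<mu>"
proof -
 have 1: "(%x. x i) -` {a} Int space \<mu> \<in> sets \<mu>" for i by (rule frv_coord)
 have 2: "(%x. QK K ((shift^^i) x)) -` {Some []} Int space \<mu> \<in> sets \<mu>" for i using frv_shift[OF frv_QK, of K i] by (simp add: frv_def)
 have "good n K = (\<Union>i<n. (%x. x i) -` {a} Int space \<mu>) -
   (\<Union>i<n. ((%x. x i) -` {a} Int space \<mu>) Int ((%x. QK K ((shift^^i) x)) -` {Some []} Int space \<mu>))"
  unfolding good_def by blast
 also have "... \<in> sets \<mu>" by (intro sets.Diff sets.finite_UN sets.Int 1 2) auto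
 finally show ?thesis .
qed

lemma good_Hent: "(\<integral>x. indicator (good n K) x * RR n x \<partial>\<mu>) <= Hent \<mu> (nm (QK K) n)"
proof -
 let ?X = "nm (QK K) n"
 have X: "frv \<mu> ?X" by (rule frv_nm[OF frv_QK])
 let ?h = "%v. - ln (pr \<mu> ?X v)"
 have pos: "AE x in \<mu>. pr \<mu> ?X (?X x) ~= 0"
 proof -
  have "AE x in \<mu>. x ~: ?X -` {v} Int space \<mu>" if "v \<in> ?X ` space \<mu> Int {v. pr \<mu> ?X v = 0}" for v
  proof -
   have "?X -` {v} Int space \<mu> \<in> null_sets \<mu>" using that X by (auto simp: null_sets_def frv_def pr_def emeasure_eq_measure)
   then show ?thesis by (rule AE_not_in)
  qed
  then have "AE x in \<mu>. ALL v:?X ` space \<mu> Int {v. pr \<mu> ?X v = 0}. x ~: ?X -` {v} Int space \<mu>"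
   using X by (intro AE_finite_allI) (auto simp: frv_def)
  then show ?thesis by (rule AE_mp) (auto intro!: AE_I2)
 qed
 have "(\<integral>x. indicator (good n K) x * RR n x \<partial>\<mu>) <= (\<integral>x. ?h (?X x) \<partial>\<mu>)"
 proof (rule integral_mono_AE)
  show "integrable \<mu> (%x. indicator (good n K) x * RR n x)"
   using integrable_mult_indicator[OF good_sets RR_integrable] by simp
  show "integrable \<mu> (%x. ?h (?X x))" using integral_frv(1)[OF X, of ?h] .
  show "AE x in \<mu>. indicator (good n K) x * RR n x <= ?h (?X x)"
  proof (rule AE_mp[OF pos AE_I2], rule impI)
   fix x assume p: "pr \<mu> ?X (?X x) ~= 0"
   have "0 < pr \<mu> ?X (?X x)" using pr_nonneg[of \<mu> ?X "?X x"] p by linarith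
   then have "0 <= ?h (?X x)" using pr_le_1[of ?X "?X x"] by simp
   then show "indicator (good n K) x * RR n x <= ?h (?X x)" using RR_le[of x n K, OF _ p] by (auto simp: indicator_def)
  qed
 qed
 also have "... = Hent \<mu> ?X" unfolding integral_frv(2)[OF X, of ?h] Hent_def by (simp add: \<eta>_def)
 finally show ?thesis .
qed

lemma AE_loops: "AE x in \<mu>. ALL i. x i = a --> (EX b:W. (shift^^i) x \<in> Cy (b@[a]))"
proof -
 let ?N = "Cy [a] - (\<Union>b\<in>W. Cy (b@[a]))"
 have N: "?N \<in> sets \<mu>" by (intro sets.Diff sets.countable_UN') auto
 have "AE x in \<mu>. x ~: (shift^^i) -` ?N Int space \<mu>" for i
 proof (rule AE_not_in)
  show "(shift^^i) -` ?N Int space \<mu> \<in> null_sets \<mu>"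
   using measure_shift_pow[OF N, of i] G3 measurable_sets[OF shift_pow_meas N, of i] by (simp add: null_sets_def emeasure_eq_measure)
 qed
 then have "AE x in \<mu>. ALL i. x ~: (shift^^i) -` ?N Int space \<mu>" by (simp add: AE_all_countable)
 then show ?thesis
 proof (rule AE_mp, intro AE_I2 impI allI)
  fix x i assume x: "x \<in> space \<mu>" "ALL i. x ~: (shift^^i) -` ?N Int space \<mu>" "x i = a"
  have "(shift^^i) x \<in> Cy [a]" using shift_space[OF x(1)] x(3) by (simp add: cyl1_iff space_mu shift_pow)
  with x(1,2) show "EX b:W. (shift^^i) x \<in> Cy (b@[a])" by blast
 qed
qed

text \<open>The information bound holds only where all words met before time \<open>n\<close> are
  coded. Almost surely this is so for large codings, and returning to the fixed coding
  \<open>QK K\<close> costs at most \<open>rr K\<close> per step.\<close>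

lemma RR_Hent: "(\<integral>x. RR n x \<partial>\<mu>) <= Hent \<mu> (nm (QK K) n)+real n * rr K"
proof -
 define V where "V = {x\<in>space \<mu>. EX i<n. x i = a}"
 have V: "V \<in> sets \<mu>" unfolding V_def by measurable
 have "(%k. \<integral>x. indicator (good n (k+K)) x * RR n x \<partial>\<mu>) \<longlonglongrightarrow> (\<integral>x. indicator V x * RR n x \<partial>\<mu>)"
 proof (rule integral_dominated_convergence[where w="%x. \<bar>RR n x\<bar>"])
  show "AE x in \<mu>. (%k. indicator (good n (k+K)) x * RR n x) \<longlonglongrightarrow> indicator V x * RR n x"
  proof (rule AE_mp[OF AE_loops AE_I2], rule impI)
   fix x assume x: "x \<in> space \<mu>" and L: "ALL i. x i = a --> (EX b:W. (shift^^i) x \<in> Cy (b@[a]))"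
   then obtain b where b: "!!i. x i = a ==> b i \<in> W & (shift^^i) x \<in> Cy (b i@[a])" by metis
   define k0 where "k0 = Suc (\<Sum>i<n. to_nat (b i))"
   have "indicator (good n (k+K)) x = (indicator V x :: real)" if k: "k >= k0" for k
   proof -
    have "QK (k+K) ((shift^^i) x) ~= Some []" if i: "i < n" "x i = a" for i
    proof -
     have "to_nat (b i) <= (\<Sum>i<n. to_nat (b i))" by (rule member_le_sum) (use i in auto)
     then have "b i \<in> Wk (k+K)" using b[OF i(2)] k by (simp add: Wk_def k0_def)
     then show ?thesis using b[OF i(2)] unfolding QK_Nil by blast
    qed
    then have "x \<in> good n (k+K) \<longleftrightarrow> x \<in> V" unfolding good_def V_def by blast
    then show ?thesis by (simp add: indicator_def)
   qed
   then have "eventually (%k. indicator (good n (k+K)) x * RR n x = indicator V x * RR n x) sequentially"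
    unfolding eventually_sequentially by (intro exI[of _ k0]) simp
   then show "(%k. indicator (good n (k+K)) x * RR n x) \<longlonglongrightarrow> indicator V x * RR n x" by (rule tendsto_eventually)
  qed
  show "(%x. indicator V x * RR n x) \<in> borel_measurable \<mu>" "!!k. (%x. indicator (good n (k+K)) x * RR n x) \<in> borel_measurable \<mu>"
   using V borel_measurable_integrable[OF RR_integrable] by measurable
  show "integrable \<mu> (%x. \<bar>RR n x\<bar>)" using RR_integrable by (rule integrable_abs)
 qed (auto simp: indicator_def)
 moreover have "(\<integral>x. indicator (good n (k+K)) x * RR n x \<partial>\<mu>) <= Hent \<mu> (nm (QK K) n)+real n * rr K" for k
 proof -
  have "(\<integral>x. indicator (good n (k+K)) x * RR n x \<partial>\<mu>) <= Hent \<mu> (nm (QK (k+K)) n)" by (rule good_Hent)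
  also have "... <= Hent \<mu> (nm (QK K) n)+real n*(Hent \<mu> (%x. (QK (k+K) x, QK K x)) - Hent \<mu> (QK K))" by (rule Hent_nm_cond[OF frv_QK frv_QK])
  also have "... <= Hent \<mu> (nm (QK K) n)+real n * rr K" by (intro add_left_mono mult_left_mono Hent_QK_cond) auto
  finally show ?thesis .
 qed
 ultimately have "(\<integral>x. indicator V x * RR n x \<partial>\<mu>) <= Hent \<mu> (nm (QK K) n)+real n * rr K" by (intro LIMSEQ_le_const2) auto
 moreover have "(\<integral>x. RR n x \<partial>\<mu>) <= (\<integral>x. indicator V x * RR n x \<partial>\<mu>)"
 proof (rule integral_mono[OF RR_integrable])
  show "integrable \<mu> (%x. indicator V x * RR n x)" using integrable_mult_indicator[OF V RR_integrable] by simp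
  fix x assume x: "x \<in> space \<mu>"
  show "RR n x <= indicator V x * RR n x"
  proof (cases "x \<in> V")
   case False
   then have "x \<in> NA i" if "i < n" for i using x that unfolding V_def NA_def by auto
   then have "(\<Sum>i<n. (1 - indicator (NA i) x)*(P - f ((shift^^i) x))) = 0" by simp
   moreover have "0 <= Dh * hit ((shift^^n) x)" using hit_nonneg by simp
   ultimately show ?thesis using False kap_nonneg by (simp add: RR_def)
  qed simp
 qed
 ultimately show ?thesis by simp
qed

lemma tail_integral: "e > 0 ==> EX M>=0. (\<integral>x. \<bar>P - f x\<bar> * indicator {y. \<bar>P - f y\<bar> > M} x \<partial>\<mu>) <= e"
proof -
 assume e: "e > 0"
 have "(%k. \<integral>x. \<bar>P - f x\<bar> * indicator {y. \<bar>P - f y\<bar> > real k} x \<partial>\<mu>) \<longlonglongrightarrow> (\<integral>x. 0 \<partial>\<mu>)"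
 proof (rule integral_dominated_convergence[where w="%x. \<bar>P - f x\<bar>"])
  show "AE x in \<mu>. (%k. \<bar>P - f x\<bar> * indicator {y. \<bar>P - f y\<bar> > real k} x) \<longlonglongrightarrow> 0"
  proof (rule AE_I2)
   fix x
   obtain k0 :: nat where k0: "\<bar>P - f x\<bar> <= real k0" using real_arch_simple by blast
   then have "eventually (%k. \<bar>P - f x\<bar> * indicator {y. \<bar>P - f y\<bar> > real k} x = 0) sequentially"
    unfolding eventually_sequentially by (intro exI[of _ k0]) (auto simp: indicator_def)
   then show "(%k. \<bar>P - f x\<bar> * indicator {y. \<bar>P - f y\<bar> > real k} x) \<longlonglongrightarrow> 0" by (rule tendsto_eventually)
  qed
  show "!!k. (%x. \<bar>P - f x\<bar> * indicator {y. \<bar>P - f y\<bar> > real k} x) \<in> borel_measurable \<mu>"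
  proof -
   fix k
   have "(%x. \<bar>P - f x\<bar> * indicator {y. \<bar>P - f y\<bar> > real k} x) = (%x. if \<bar>P - f x\<bar> > real k then \<bar>P - f x\<bar> else 0)" by (auto simp: indicator_def)
   then show "(%x. \<bar>P - f x\<bar> * indicator {y. \<bar>P - f y\<bar> > real k} x) \<in> borel_measurable \<mu>" using f_meas by simp
  qed
  show "integrable \<mu> (%x. \<bar>P - f x\<bar>)" using g_integrable by (rule integrable_abs)
 qed (auto simp: indicator_def)
 then have "eventually (%k. (\<integral>x. \<bar>P - f x\<bar> * indicator {y. \<bar>P - f y\<bar> > real k} x \<partial>\<mu>) < e) sequentially"
  using e by (intro order_tendstoD(2)) auto
 then obtain k :: nat where "(\<integral>x. \<bar>P - f x\<bar> * indicator {y. \<bar>P - f y\<bar> > real k} x \<partial>\<mu>) < e" using eventually_happens by fastforce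
 then show ?thesis by (intro exI[of _ "real k"]) auto
qed

text \<open>Dropping the times before the first visit loses at most \<open>M\<close> times the
  summable probabilities of \<open>NA i\<close>, a constant in \<open>n\<close>, plus the tail
  \<open>e\<close> of the unbounded function P - f at each time.\<close>

lemma RR_integral_ge:
 assumes M: "M >= 0" "(\<integral>x. \<bar>P - f x\<bar> * indicator {y. \<bar>P - f y\<bar> > M} x \<partial>\<mu>) <= e"
 shows "real n*(P - (\<integral>x. f x \<partial>\<mu>) - e) - (M*enn2real (nsum UNIV (%i. emeasure \<mu> (NA i)))+Dh*(\<integral>x. hit x \<partial>\<mu>)+Ch) <= (\<integral>x. RR n x \<partial>\<mu>)"
proof -
 let ?t = "%x. \<bar>P - f x\<bar> * indicator {y. \<bar>P - f y\<bar> > M} x"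
 have tm: "?t \<in> borel_measurable \<mu>"
 proof -
  have "?t = (%x. if \<bar>P - f x\<bar> > M then \<bar>P - f x\<bar> else 0)" by (auto simp: indicator_def)
  then show ?thesis using f_meas by simp
 qed
 have ti: "integrable \<mu> ?t"
  by (rule Bochner_Integration.integrable_bound[OF g_integrable tm]) (auto simp: indicator_def)
 have one: "P - (\<integral>x. f x \<partial>\<mu>) - e - M * prob (NA i) <= (\<integral>x. (1 - indicator (NA i) x)*(P - f ((shift^^i) x)) \<partial>\<mu>)" for i
 proof -
  have "(\<integral>x. (P - f ((shift^^i) x)) - ?t ((shift^^i) x) - M * indicator (NA i) x \<partial>\<mu>) <= (\<integral>x. (1 - indicator (NA i) x)*(P - f ((shift^^i) x)) \<partial>\<mu>)"
  proof (rule integral_mono[OF _ NA_term_integrable])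
   show "integrable \<mu> (%x. (P - f ((shift^^i) x)) - ?t ((shift^^i) x) - M * indicator (NA i) x)"
    by (rule Bochner_Integration.integrable_diff[OF Bochner_Integration.integrable_diff[OF integrable_shift_pow[OF g_integrable] integrable_shift_pow[OF ti]]])
     (auto simp: less_top[symmetric])
   fix x
   show "(P - f ((shift^^i) x)) - ?t ((shift^^i) x) - M * indicator (NA i) x <= (1 - indicator (NA i) x)*(P - f ((shift^^i) x))"
    using M(1) by (auto simp: indicator_def)
  qed
  also have "(\<integral>x. (P - f ((shift^^i) x)) - ?t ((shift^^i) x) - M * indicator (NA i) x \<partial>\<mu>)
   = (\<integral>x. P - f ((shift^^i) x) \<partial>\<mu>) - (\<integral>x. ?t ((shift^^i) x) \<partial>\<mu>) - M * prob (NA i)"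
  proof -
   have iN: "integrable \<mu> (%x. M * indicator (NA i) x :: real)" by (auto simp: less_top[symmetric])
   note ig = integrable_shift_pow[OF g_integrable, of i] and it = integrable_shift_pow[OF ti, of i]
   show ?thesis
    unfolding Bochner_Integration.integral_diff[OF Bochner_Integration.integrable_diff[OF ig it] iN] Bochner_Integration.integral_diff[OF ig it]
    by simp
  qed
  also have "(\<integral>x. P - f ((shift^^i) x) \<partial>\<mu>) = P - (\<integral>x. f x \<partial>\<mu>)"
   using integral_shift_pow[of "%x. P - f x" i] f_integrable f_meas by (simp add: prob_space)
  also have "(\<integral>x. ?t ((shift^^i) x) \<partial>\<mu>) = (\<integral>x. ?t x \<partial>\<mu>)" by (rule integral_shift_pow[OF tm])
  finally show ?thesis using M(2) by linarith
 qed
 have NAs: "(\<Sum>i<n. prob (NA i)) <= enn2real (nsum UNIV (%i. emeasure \<mu> (NA i)))"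
 proof -
  have "ennreal (\<Sum>i<n. prob (NA i)) = (\<Sum>i<n. emeasure \<mu> (NA i))" by (simp add: emeasure_eq_measure sum_ennreal)
  also have "... <= nsum UNIV (%i. emeasure \<mu> (NA i))" by (rule nsum_sum_le) auto
  also have "... = ennreal (enn2real (nsum UNIV (%i. emeasure \<mu> (NA i))))" using NA_finite by simp
  finally show ?thesis by simp
 qed
 have "real n*(P - (\<integral>x. f x \<partial>\<mu>) - e) - M*(\<Sum>i<n. prob (NA i)) = (\<Sum>i<n. P - (\<integral>x. f x \<partial>\<mu>) - e - M * prob (NA i))"
  by (simp add: sum_subtractf sum_distrib_left)
 also have "... <= (\<Sum>i<n. \<integral>x. (1 - indicator (NA i) x)*(P - f ((shift^^i) x)) \<partial>\<mu>)" by (rule sum_mono) (rule one)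
 also have "... = (\<integral>x. (\<Sum>i<n. (1 - indicator (NA i) x)*(P - f ((shift^^i) x))) \<partial>\<mu>)"
  by (rule Bochner_Integration.integral_sum[symmetric]) (rule NA_term_integrable)
 also have "... = (\<integral>x. RR n x+Dh * hit ((shift^^n) x)+Ch \<partial>\<mu>)" by (simp add: RR_def)
 also have "... = (\<integral>x. RR n x \<partial>\<mu>)+Dh*(\<integral>x. hit ((shift^^n) x) \<partial>\<mu>)+Ch"
  using RR_integrable[of n] integrable_shift_pow[OF hit_integrable, of n] by (simp add: prob_space)
 also have "(\<integral>x. hit ((shift^^n) x) \<partial>\<mu>) = (\<integral>x. hit x \<partial>\<mu>)" by (rule integral_shift_pow) simp
 finally show ?thesis using mult_left_mono[OF NAs M(1)] by linarith
qed

lemma entropy_lower: "ereal (P - (\<integral>x. f x \<partial>\<mu>)) <= ks_entropy \<mu>"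
proof (rule ereal_le_epsilon2)
 fix e :: real assume e: "e > 0"
 obtain M where M: "M >= 0" "(\<integral>x. \<bar>P - f x\<bar> * indicator {y. \<bar>P - f y\<bar> > M} x \<partial>\<mu>) <= e/2" using tail_integral[of "e/2"] e by auto
 obtain K where K: "rr K <= e/2" using rr_small[of "e/2"] e by auto
 have "ereal (P - (\<integral>x. f x \<partial>\<mu>) - e) <= ks_entropy \<mu>"
 proof (rule ks_entropy_ge[OF frv_QK])
  fix n
  have "real (Suc n) * rr K <= real (Suc n)*(e/2)" by (rule mult_left_mono[OF K]) simp
  then show "real (Suc n)*(P - (\<integral>x. f x \<partial>\<mu>) - e) - (M*enn2real (nsum UNIV (%i. emeasure \<mu> (NA i)))+Dh*(\<integral>x. hit x \<partial>\<mu>)+Ch) <= Hent \<mu> (nm (QK K) (Suc n))"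
   using RR_integral_ge[OF M, of "Suc n"] RR_Hent[of "Suc n" K] unfolding right_diff_distrib by linarith
 qed
 then show "ereal (P - (\<integral>x. f x \<partial>\<mu>)) <= ks_entropy \<mu>+ereal e"
  by (cases "ks_entropy \<mu>") auto
qed

end

section \<open>From strong positive recurrence to the EKP inequality and escape of pressure\<close>

lemma Hs_antimono: "q <= q' ==> Hs f W q' x <= Hs f W q x"
 unfolding Hs_def by (intro nsum_mono ennreal_leI wq_antimono)

context pot
begin

text \<open>If the loop series converges at \<open>P\<close>, then \<open>h\<close> is bounded by
  some \<open>M\<close> uniformly for exponents from \<open>P\<close> on. Thus L h = h - 1 has the
  uniform relative deficit \<open>1/M\<close>, and the gap lemma lowers the exponent.\<close>

lemma Hs_finite_imp_below:
 assumes a: "a \<in> S" and W: "W <= Fr a"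
  and eps: "eps > 0" and tail: "rsum W (%w. wq f (P - eps) w (pt a)) < \<infinity>"
  and H: "Hs f W P (pt a) < \<infinity>"
 shows "EX q<P. Hs f W q (pt a) < \<infinity>"
proof -
 define h where "h q x = enn2real (Hs f W q x)" for q x
 have h: "Hs f W q x = ennreal (h q x)" if "x \<in> Cy [a]" "P <= q" for q x
 proof -
  have "Hs f W P x < \<infinity>" by (rule Hs_finite_indep[OF W that(1) _ H]) (use a in simp)
  with Hs_antimono[OF that(2), of f W x] show ?thesis unfolding h_def by (auto intro: le_less_trans)
 qed
 have h0: "0 <= h q x" for q x by (simp add: h_def)
 have h1: "1 <= h q x" if "x \<in> Cy [a]" "P <= q" for q x
  using Hs_ge_1[of f W q x] h0[of q x] unfolding h[OF that] by simp
 have hd: "h q x <= exp kap * h q y" if "x \<in> Cy [a]" "y \<in> Cy [a]" "P <= q" for q x y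
  using Hs_dist[OF W that(1,2), of q] h0 that by (simp add: h ennreal_mult[symmetric])
 have pa: "pt a \<in> Cy [a]" using a by simp
 define M where "M = exp kap * h P (pt a)"
 have M: "M > 0" using h1[OF pa, of P] by (simp add: M_def)
 have hM: "h q x <= M" if "x \<in> Cy [a]" "P <= q" for q x
 proof -
  have "h q x <= h P x" using Hs_antimono[OF that(2), of f W x] h0 by (simp add: h that)
  also have "... <= M" unfolding M_def by (rule hd[OF that(1) pa]) simp
  finally show ?thesis .
 qed
 show ?thesis
 proof (rule gap_imp_Hs_below[OF a W eps tail, where c="1/M" and k=kap])
  show "1/M > 0" using M by simp
  fix q assume q: "P < q" "q < P+1"
  show "EX h. (ALL x:Cy [a]. 0 < h x & Lop f W q (%x. ennreal (h x)) x+ennreal (1/M * h x) <= ennreal (h x)) &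
    (ALL x:Cy [a]. ALL y:Cy [a]. h x <= exp kap * h y)"
  proof (intro exI[of _ "h q"] conjI ballI)
   fix x assume x: "x \<in> Cy [a]"
   show "0 < h q x" using h1[OF x, of q] q by simp
   have "Lop f W q (%x. ennreal (h q x)) x = Lop f W q (Hs f W q) x"
    unfolding Lop_def
   proof (rule nsum_cong[OF refl])
    fix w assume "w \<in> W"
    then have "cat w x \<in> Cy [a]" using PthD[OF FR_Pth x] W by blast
    then show "ennreal (wq f q w x)*ennreal (h q (cat w x)) = ennreal (wq f q w x) * Hs f W q (cat w x)" using h[of "cat w x" q] q by simp
   qed
   moreover have "1/M * h q x <= 1" using hM[OF x, of q] q M by simp
   ultimately have "Lop f W q (%x. ennreal (h q x)) x+ennreal (1/M * h q x) <= Lop f W q (Hs f W q) x+1"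
    by (intro add_mono) (auto simp flip: ennreal_1 intro!: ennreal_leI)
   also have "... = ennreal (h q x)" using Hs_eq[OF a W, of f q x] h[OF x, of q] q by (simp add: add.commute)
   finally show "Lop f W q (%x. ennreal (h q x)) x+ennreal (1/M * h q x) <= ennreal (h q x)" .
  next
   fix x y assume "x \<in> Cy [a]" "y \<in> Cy [a]"
   then show "h q x <= exp kap * h q y" using hd q by simp
  qed
 qed
qed

end

context potm
begin

lemma bounded_integrable: assumes "!!x. x \<in> Sg ==> \<bar>f x\<bar> <= N" shows "integrable \<mu> f"
 by (rule integrable_const_bound[of _ N]) (use assms f_meas in "auto simp: space_mu")

lemma mpress_real:
 assumes "mpress \<mu> f ~= - \<infinity>" "ks_entropy \<mu> < \<infinity>"
 obtains h where "integrable \<mu> f" "ks_entropy \<mu> = ereal h" "mpress \<mu> f = ereal (h+(\<integral>x. f x \<partial>\<mu>))"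
proof -
 have i: "integrable \<mu> f" "int_ereal \<mu> f = ereal (\<integral>x. f x \<partial>\<mu>)"
  using int_ereal_cases assms by (auto simp: mpress_def)
 moreover obtain h where "ks_entropy \<mu> = ereal h" using assms i by (cases "ks_entropy \<mu>") (auto simp: mpress_def)
 ultimately show thesis using that by (simp add: mpress_def)
qed

end

section \<open>Finite Gurevich entropy and the EKP inequality\<close>

locale potz = pot +
 fixes q0 :: real
 assumes zg: "pot.gr S E (%_. 0) q0"
begin

lemma pot_zero: "pot S E (%_. 0) 0 \<theta> 0" by unfold_locales (use \<theta> in auto)

lemma zgrowth: "a \<in> S ==> growth (%_. 0) (Fr a) (pt a) q0"
 using pot.gr_iff[OF pot_zero] zg by blast

text \<open>Each weight of length \<open>n\<close> is at most \<open>exp (B * n)\<close>, and finite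
  entropy bounds the number of loops.\<close>

lemma gr_ex: "gr (q0+B)"
proof -
 obtain a where a: "a \<in> S" using S_ne by blast
 let ?N = "%n. {w\<in>Star (Fr a). length w = n}"
 obtain C where C: "rsum (?N n) (%w. wt (%_. 0) w (pt a)) <= ennreal (C*exp (q0 * real n))" for n
  using zgrowth[OF a] by (auto simp: growth_def)
 have "rsum (?N n) (%w. wt f w (pt a)) <= ennreal (C*exp ((q0+B) * real n))" for n
 proof -
  have "rsum (?N n) (%w. wt f w (pt a)) <= nsum (?N n) (%w. ennreal (wt (%_. 0) w (pt a))*ennreal (exp (B * real n)))"
  proof (rule nsum_mono)
   fix w assume w: "w \<in> ?N n"
   have "cat w (pt a) \<in> Sg" using w PthD[OF Star_FR_Pth[OF order_refl] pt[OF a]] by (auto simp: cyl1_iff)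
   from birk_le[OF this, of n] show "ennreal (wt f w (pt a)) <= ennreal (wt (%_. 0) w (pt a))*ennreal (exp (B * real n))"
    using w by (simp add: wt_def birk_def)
  qed
  also have "... <= ennreal (C*exp (q0 * real n))*ennreal (exp (B * real n))" unfolding nsum_multc by (rule mult_right_mono[OF C]) simp
  also have "... = ennreal (C*exp ((q0+B) * real n))"
   by (subst ennreal_mult''[symmetric]) (simp_all add: distrib_right exp_add mult.assoc)
  finally show ?thesis .
 qed
 then show ?thesis using a unfolding gr_def growth_def by blast
qed

lemma gr_gt: "crit < q ==> gr q" by (rule gr_above_crit[OF gr_ex])

lemma Hs_gt: assumes "a \<in> S" "W <= Fr a" "crit < q" shows "Hs f W q (pt a) < \<infinity>"
proof -
 obtain q' where "crit < q'" "q' < q" using dense[OF assms(3)] by blast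
 then have "Hs f (Fr a) q (pt a) < \<infinity>" using growth_imp_Hs gr_gt gr_iff[OF assms(1)] by blast
 moreover have "Hs f W q (pt a) <= Hs f (Fr a) q (pt a)" unfolding Hs_def by (rule nsum_subset[OF Star_mono[OF assms(2)]])
 ultimately show ?thesis by (rule le_less_trans[rotated])
qed

lemma loops_finite: assumes a: "a \<in> S" and W: "W <= Fr a"
 shows "rsum W (%w. exp (- (\<bar>q0\<bar>+1) * real (length w))) < \<infinity>"
proof -
 have "Hs (%_. 0) (Fr a) (\<bar>q0\<bar>+1) (pt a) < \<infinity>" by (rule growth_imp_Hs[OF zgrowth[OF a]]) simp
 moreover have "W <= Star (Fr a)"
 proof
  fix w assume "w \<in> W"
  then show "w \<in> Star (Fr a)" using W Star_Cons[of w "Fr a" "[]"] by auto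
 qed
 then have "rsum W (%w. wq (%_. 0) (\<bar>q0\<bar>+1) w (pt a)) <= Hs (%_. 0) (Fr a) (\<bar>q0\<bar>+1) (pt a)"
  unfolding Hs_def by (rule nsum_subset)
 moreover have "wq (%_. 0) q w x = exp (- q * real (length w))" for q w x by (simp add: wq_def wt_def birk_def)
 ultimately show ?thesis by (simp add: le_less_trans)
qed

lemma gibbs_pressure:
 assumes "gibbs S E f A \<theta> B a W P eps"
 shows "EX \<mu>:IM. integrable \<mu> f & ereal P <= mpress \<mu> f &
  (ALL F r. finite F --> 0 <= r --> (ALL b:W. real (card {j. j < length b & b ! j \<in> F}) <= r * real (length b)) -->
   (SUM s:F. measure \<mu> (Cy [s])) <= r)"
proof -
 interpret gibbs S E f A \<theta> B a W P eps by (rule assms)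
 from gibbs_measure obtain \<mu> where mu: "\<mu> \<in> IM" and G: "(ALL v. ennreal (measure \<mu> (Cy v)) <= ennreal C0 * rsum W (%b. wp b * real (Nb b v))) &
  (ALL u:Star W. u ~= [] --> measure \<mu> (Cy (u@[a])) <= C0 * wp u) &
  measure \<mu> (Cy [a] - (\<Union>b\<in>W. Cy (b@[a]))) = 0 &
  (ALL F r. finite F --> 0 <= r --> (ALL b:W. real (card {j. j < length b & b ! j \<in> F}) <= r * real (length b)) -->
   (SUM s:F. measure \<mu> (Cy [s])) <= r)" (is "_ & _ & _ & ?G4") by (rule bexE)
 have G4: ?G4 using G by (elim conjE)
 interpret gibbsm S E f A \<theta> B a W P eps \<mu> "\<bar>q0\<bar>+1"
 proof unfold_locales
  show "\<mu> \<in> IM" by (rule mu)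
  from G show "!!v. ennreal (measure \<mu> (Cy v)) <= ennreal C0 * rsum W (%b. wp b * real (Nb b v))"
   "!!u. u \<in> Star W ==> u ~= [] ==> measure \<mu> (Cy (u@[a])) <= C0 * wp u"
   "measure \<mu> (Cy [a] - (\<Union>b\<in>W. Cy (b@[a]))) = 0" by simp_all
  show "0 <= \<bar>q0\<bar>+1" by simp
  show "rsum W (%w. exp (- (\<bar>q0\<bar>+1) * real (length w))) < \<infinity>" by (rule loops_finite[OF a W])
 qed
 have "ereal P <= mpress \<mu> f"
  using entropy_lower int_ereal_integrable[OF f_integrable] unfolding mpress_def by (cases "ks_entropy \<mu>") auto
 then show ?thesis using mu f_integrable G4 by (intro bexI[OF _ mu] conjI)
qed

text \<open>The variational upper bound for the zero potential, which is integrable for every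
  measure.\<close>

lemma ks_finite: assumes "\<mu> \<in> IM" shows "ks_entropy \<mu> < \<infinity>"
proof -
 interpret Z: potm S E "%_. 0" 0 \<theta> 0 \<mu> by (intro potm.intro pot_zero inv_meas.intro inv_meas_axioms.intro tms_axioms assms)
 have "ks_entropy \<mu> <= ereal (q0 - (\<integral>x. 0 \<partial>\<mu>))" by (rule Z.ks_entropy_upper[OF zg]) simp
 then show ?thesis by (auto intro: le_less_trans)
qed

lemma potm_f: "\<mu> \<in> IM ==> potm S E f A \<theta> B \<mu>"
 by (intro potm.intro pot_axioms inv_meas.intro inv_meas_axioms.intro tms_axioms)

lemma mpress_split:
 assumes mu: "\<mu> \<in> IM" and p: "mpress \<mu> f = ereal p"
 shows "EX h. integrable \<mu> f & ks_entropy \<mu> = ereal h & p = h+(\<integral>x. f x \<partial>\<mu>)"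
proof -
 interpret potm S E f A \<theta> B \<mu> by (rule potm_f[OF mu])
 have "mpress \<mu> f ~= - \<infinity>" using p by simp
 then obtain h where "integrable \<mu> f" "ks_entropy \<mu> = ereal h" "mpress \<mu> f = ereal (h+(\<integral>x. f x \<partial>\<mu>))"
  by (rule mpress_real[OF _ ks_finite[OF mu]])
 then show ?thesis using p by (intro exI[of _ h]) simp
qed

lemma pressure_defined_inv: assumes "\<mu> \<in> IM" shows "pressure_defined \<mu> f"
 using ks_finite[OF assms] potm.int_plus_f[OF potm_f[OF assms]] by (auto simp: pressure_defined_def)

lemma mpress_le_crit: assumes "\<mu> \<in> IM" shows "mpress \<mu> f <= ereal crit"
proof (cases "mpress \<mu> f = - \<infinity>")
 case False
 interpret potm S E f A \<theta> B \<mu> by (rule potm_f[OF assms])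
 obtain h where h: "integrable \<mu> f" "ks_entropy \<mu> = ereal h" "mpress \<mu> f = ereal (h+(\<integral>x. f x \<partial>\<mu>))"
  by (rule mpress_real[OF False ks_finite[OF assms]])
 have "h+(\<integral>x. f x \<partial>\<mu>) <= crit"
 proof (rule field_le_epsilon)
  fix e :: real assume "e > 0"
  then show "h+(\<integral>x. f x \<partial>\<mu>) <= crit+e" using ks_entropy_upper[OF gr_gt[of "crit+e"] h(1)] h(2) by simp
 qed
 then show ?thesis using h(3) by simp
qed simp

text \<open>Divergence at \<open>crit\<close> is forced: convergence would give a growth exponent
  below the infimum of all of them.\<close>

lemma SPR_data:
 assumes "SPR S E f"
 obtains a eps where "spr S E f A \<theta> B a crit eps" "gibbs S E f A \<theta> B a (Fr a) crit eps"
proof -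
 obtain a q where a: "a \<in> S" and q: "q < crit" "rsum (Fr a) (%w. wq f q w (pt a)) < \<infinity>"
  using assms SPR_iff[OF gr_ex] by blast
 define eps where "eps = crit - q"
 have eps: "eps > 0" "rsum (Fr a) (%w. wq f (crit - eps) w (pt a)) < \<infinity>" using q by (simp_all add: eps_def)
 have "Hs f (Fr a) crit (pt a) = \<infinity>"
 proof (rule ccontr)
  assume "Hs f (Fr a) crit (pt a) ~= \<infinity>"
  then have "Hs f (Fr a) crit (pt a) < \<infinity>" by (simp add: less_top)
  from Hs_finite_imp_below[OF a order_refl eps this] obtain q' where "q' < crit" "Hs f (Fr a) q' (pt a) < \<infinity>" by blast
  then show False using Hs_imp_growth gr_iff[OF a] crit_le by force
 qed
 then have "gibbs S E f A \<theta> B a (Fr a) crit eps"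
  by unfold_locales (use a eps FR_exists[OF a] Hs_gt[OF a order_refl] in auto)
 moreover have "spr S E f A \<theta> B a crit eps" by unfold_locales (use a eps gr_gt gr_iff[OF a] in auto)
 ultimately show thesis using that by blast
qed

lemma SPR_equilibrium:
 assumes "SPR S E f"
 obtains \<nu> where "equilibrium S E f \<nu>" "mpress \<nu> f = ereal crit"
proof -
 obtain a eps where "gibbs S E f A \<theta> B a (Fr a) crit eps" using SPR_data[OF assms] by blast
 from gibbs_pressure[OF this] obtain \<nu> where n: "\<nu> \<in> IM" "ereal crit <= mpress \<nu> f" by blast
 have "mpress \<nu> f = ereal crit" by (rule order_antisym[OF mpress_le_crit[OF n(1)] n(2)])
 with n(1) that[of \<nu>] show thesis by (auto simp: equilibrium_def pressure_defined_inv mpress_le_crit)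
qed

text \<open>The variational upper bound is applied to the perturbed potential, which lies in the
  same class with enlarged constants; \<open>s\<close> selects the sign.\<close>

lemma perturbed_entropy:
 assumes ok: "okg dlt g" and mu: "\<mu> \<in> IM" "integrable \<mu> f" and a: "a \<in> S"
  and gr: "growth (%x. f x+s * g x) (Fr a) (pt a) q" and s: "\<bar>s\<bar> = 1"
 shows "ks_entropy \<mu> <= ereal (q - (\<integral>x. f x \<partial>\<mu>) - s*(\<integral>x. g x \<partial>\<mu>))"
proof -
 interpret g: potm S E g dlt \<theta> dlt \<mu> by (intro potm.intro okg_pot[OF ok] inv_meas.intro inv_meas_axioms.intro tms_axioms mu)
 have gi: "integrable \<mu> g" by (rule g.bounded_integrable) (use ok in "auto simp: okg_def")
 have "pot S E (%x. f x+s * g x) (A+dlt) \<theta> (B+dlt)"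
 proof unfold_locales
  fix n :: nat and x y assume H: "2 <= n" "x \<in> Sg" "y \<in> Sg" "ALL i<n. x i = y i"
  have "\<bar>f x+s * g x - (f y+s * g y)\<bar> = \<bar>(f x - f y)+s*(g x - g y)\<bar>" by (simp add: algebra_simps)
  also have "... <= \<bar>f x - f y\<bar>+\<bar>g x - g y\<bar>" using abs_triangle_ineq[of "f x - f y" "s*(g x - g y)"] s by (simp add: abs_mult)
  finally show "\<bar>f x+s * g x - (f y+s * g y)\<bar> <= (A+dlt)*\<theta>^n" using osc[OF H] g.osc[OF H] by (simp add: distrib_right)
 next
  fix x assume x: "x \<in> Sg"
  have "s * g x <= \<bar>s * g x\<bar>" by simp
  also have "... <= dlt" using ok x s by (auto simp: okg_def abs_mult)
  finally show "f x+s * g x <= B+dlt" using f_le[OF x] by simp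
 qed (use \<theta> A ok in "auto simp: okg_def")
 then interpret h: potm S E "%x. f x+s * g x" "A+dlt" \<theta> "B+dlt" \<mu>
  by (intro potm.intro inv_meas.intro inv_meas_axioms.intro tms_axioms mu)
 have "ks_entropy \<mu> <= ereal (q - (\<integral>x. f x+s * g x \<partial>\<mu>))"
  by (rule h.ks_entropy_upper) (use h.gr_iff[OF a] gr gi mu(2) in auto)
 also have "(\<integral>x. f x+s * g x \<partial>\<mu>) = (\<integral>x. f x \<partial>\<mu>)+s*(\<integral>x. g x \<partial>\<mu>)" using gi mu(2) by simp
 finally show ?thesis by (simp add: diff_diff_eq)
qed

text \<open>Points agreeing in \<open>n\<close> coordinates separate at time \<open>n\<close> or
  later, and \<open>exp (- \<beta>) <= \<theta>\<close> turns this into the rate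
  \<open>\<theta>^n\<close>. The norm is the sum of the two constants, so it dominates both.\<close>

lemma H_beta_norm:
 assumes p: "\<psi> \<in> H_beta S E \<beta>" and b: "exp (- \<beta>) <= \<theta>" "\<beta> > 0"
 defines "N == real_of_ereal (hnorm S E \<beta> \<psi>)"
 shows "0 <= N" "okg N \<psi>"
proof -
 define u where "u = Sup (insert 0 ((%x. ereal \<bar>\<psi> x\<bar>) ` Sg))"
 define v where "v = Sup (insert 0 {ereal (\<bar>\<psi> x - \<psi> y\<bar>*exp (\<beta> * real (tsep x y))) | x y.
    x \<in> Sg & y \<in> Sg & x ~= y})"
 have h: "hnorm S E \<beta> \<psi> = u+v" by (simp add: hnorm_def u_def v_def)
 have uv: "0 <= u" "0 <= v" unfolding u_def v_def by (auto intro: Sup_upper)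
 have fin: "u+v < \<infinity>" using p h by (simp add: H_beta_def)
 then obtain u' v' where r: "u = ereal u'" "v = ereal v'" using uv by (cases u; cases v) auto
 have N: "N = u'+v'" by (simp add: N_def h r)
 have uv': "0 <= u'" "0 <= v'" using uv r by auto
 show N0: "0 <= N" using uv' N by simp
 have U: "\<bar>\<psi> x\<bar> <= u'" if "x \<in> Sg" for x
 proof -
  have "ereal \<bar>\<psi> x\<bar> <= u" unfolding u_def using that by (intro Sup_upper) auto
  then show ?thesis by (simp add: r)
 qed
 have V: "\<bar>\<psi> x - \<psi> y\<bar> <= v'*\<theta>^n" if H: "x \<in> Sg" "y \<in> Sg" "ALL i<n. x i = y i" for x y n
 proof (cases "x = y")
  case True then show ?thesis using uv' \<theta> by simp
 next
  case False
  then obtain i where "x i ~= y i" by (auto simp: fun_eq_iff)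
  then have "x (tsep x y) ~= y (tsep x y)" unfolding tsep_def by (rule LeastI)
  then have tn: "n <= tsep x y" using H(3) by (auto simp: not_less[symmetric])
  have "ereal (\<bar>\<psi> x - \<psi> y\<bar>*exp (\<beta> * real (tsep x y))) <= v" unfolding v_def using H False by (intro Sup_upper) auto
  then have "\<bar>\<psi> x - \<psi> y\<bar>*exp (\<beta> * real (tsep x y)) <= v'" by (simp add: r)
  then have "\<bar>\<psi> x - \<psi> y\<bar> <= v'*exp (- \<beta> * real (tsep x y))" by (simp add: exp_minus field_simps)
  also have "... <= v'*\<theta>^n"
  proof (rule mult_left_mono[OF _ uv'(2)])
   have "exp (- \<beta> * real (tsep x y)) <= exp (- \<beta> * real n)" using tn b by simp
   also have "... = exp (- \<beta>)^n" by (simp add: exp_of_nat_mult[symmetric] mult.commute)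
   also have "... <= \<theta>^n" by (rule power_mono[OF b(1)]) simp
   finally show "exp (- \<beta> * real (tsep x y)) <= \<theta>^n" .
  qed
  finally show ?thesis .
 qed
 show "okg N \<psi>" unfolding okg_def
 proof (intro conjI ballI allI impI N0)
  fix x assume "x \<in> Sg" then show "\<bar>\<psi> x\<bar> <= N" using U[of x] uv' N by simp
 next
  fix n :: nat and x y assume "1 <= n" "x \<in> Sg" "y \<in> Sg" "ALL i<n. x i = y i"
  then have "\<bar>\<psi> x - \<psi> y\<bar> <= v'*\<theta>^n" using V by blast
  also have "... <= N*\<theta>^n" using uv' N \<theta> by (intro mult_right_mono) auto
  finally show "\<bar>\<psi> x - \<psi> y\<bar> <= N*\<theta>^n" .
 qed
qed

lemma okg_scale: assumes "okg N g" shows "okg (\<bar>t\<bar> * N) (%x. t * g x)"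
proof -
 have "\<bar>t * g x - t * g y\<bar> = \<bar>t\<bar>*\<bar>g x - g y\<bar>" for x y by (simp add: right_diff_distrib[symmetric] abs_mult)
 then show ?thesis using assms unfolding okg_def by (simp add: abs_mult mult_left_mono mult.assoc)
qed

text \<open>Adding the perturbed bounds for \<open>\<mu>\<close> and the equilibrium measure gives a
  difference of at most \<open>D + C * dlt\<^sup>2\<close>, with \<open>D\<close> the pressure
  deficit. Rescaling \<open>\<psi>\<close> to size \<open>dlt\<close> yields
  \<open>N * (D/dlt + \<bar>C\<bar> * dlt)\<close>, optimal near
  \<open>dlt = sqrt D\<close>.\<close>

lemma SPR_imp_EKP:
 assumes "SPR S E f" shows "EKP S E \<theta> f"
proof -
 obtain a eps where "spr S E f A \<theta> B a crit eps" using SPR_data[OF assms] by blast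
 then interpret sp: spr S E f A \<theta> B a crit eps .
 obtain \<nu> where eq: "equilibrium S E f \<nu>" and pn: "mpress \<nu> f = ereal crit" by (rule SPR_equilibrium[OF assms])
 have nu: "\<nu> \<in> IM" using eq by (simp add: equilibrium_def)
 obtain C dlt0 where d0: "dlt0 > 0" and Q: "!!\<psi> dlt e. 0 < dlt ==> dlt <= dlt0 ==> okg dlt \<psi> ==> 0 < e ==>
  EX q1 q2. q1+q2 <= 2 * crit+C * dlt\<^sup>2+e & growth (%x. f x+\<psi> x) (Fr a) (pt a) q1 & growth (%x. f x - \<psi> x) (Fr a) (pt a) q2"
 proof -
  obtain C dlt0 where "dlt0 > 0" "ALL \<psi> dlt e. 0 < dlt --> dlt <= dlt0 --> okg dlt \<psi> --> 0 < e -->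
   (EX q1 q2. q1+q2 <= 2 * crit+C * dlt\<^sup>2+e & growth (%x. f x+\<psi> x) (Fr a) (pt a) q1 & growth (%x. f x - \<psi> x) (Fr a) (pt a) q2)"
   using sp.quadratic_pressure by (elim exE conjE)
  then show thesis by (intro that[of dlt0 C]) simp_all
 qed
 \<comment> \<open>The part \<open>1 + \<bar>C\<bar>\<close> serves deficits for which
   \<open>dlt = sqrt D\<close> is admissible. For larger ones the trivial bound \<open>2 * N\<close>
   is used, whence \<open>2/dlt0\<close>.\<close>
 define K where "K = 1+\<bar>C\<bar>+2/dlt0"
 have main: "\<bar>(\<integral>x. \<psi> x \<partial>\<mu>) - (\<integral>x. \<psi> x \<partial>\<nu>)\<bar> <= K * N * sqrt (crit - p)"
  if ok: "okg N \<psi>" and mu: "\<mu> \<in> IM" and p: "mpress \<mu> f = ereal p" for \<psi> N \<mu> p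
 proof -
  have N0: "0 <= N" using ok by (simp add: okg_def)
  define D where "D = crit - p"
  have D0: "0 <= D" using mpress_le_crit[OF mu] p by (simp add: D_def)
  obtain h where h: "integrable \<mu> f" "ks_entropy \<mu> = ereal h" "p = h+(\<integral>x. f x \<partial>\<mu>)"
   using mpress_split[OF mu p] by blast
  obtain k where k: "integrable \<nu> f" "ks_entropy \<nu> = ereal k" "crit = k+(\<integral>x. f x \<partial>\<nu>)"
   using mpress_split[OF nu pn] by blast
  have step: "(\<integral>x. g x \<partial>\<mu>) - (\<integral>x. g x \<partial>\<nu>) <= D+C * dlt\<^sup>2" if g: "okg dlt g" "0 < dlt" "dlt <= dlt0" for g dlt
  proof (rule field_le_epsilon)
   fix e :: real assume "e > 0"
   from Q[OF g(2,3,1) this] obtain q1 q2 where q: "q1+q2 <= 2 * crit+C * dlt\<^sup>2+e"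
    "growth (%x. f x+1 * g x) (Fr a) (pt a) q1" "growth (%x. f x+(-1) * g x) (Fr a) (pt a) q2" by auto
   from perturbed_entropy[OF g(1) mu h(1) sp.a q(2)] perturbed_entropy[OF g(1) nu k(1) sp.a q(3)]
   show "(\<integral>x. g x \<partial>\<mu>) - (\<integral>x. g x \<partial>\<nu>) <= D+C * dlt\<^sup>2+e" using h k q(1) by (simp add: D_def)
  qed
  have bd: "\<bar>\<integral>x. \<psi> x \<partial>m\<bar> <= N" if m: "m \<in> IM" for m
  proof -
   interpret g: potm S E \<psi> N \<theta> N m by (intro potm.intro okg_pot[OF ok] inv_meas.intro inv_meas_axioms.intro tms_axioms m)
   have b: "!!x. x \<in> Sg ==> \<bar>\<psi> x\<bar> <= N" using ok by (simp add: okg_def)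
   have i: "integrable m \<psi>" by (rule g.bounded_integrable[OF b])
   have "\<bar>\<integral>x. \<psi> x \<partial>m\<bar> <= (\<integral>x. \<bar>\<psi> x\<bar> \<partial>m)" by (rule integral_abs_bound)
   also have "... <= (\<integral>x. N \<partial>m)" by (rule integral_mono) (use i b in "auto simp: g.space_mu")
   finally show ?thesis by (simp add: g.prob_space)
  qed
  define J where "J = (\<integral>x. \<psi> x \<partial>\<mu>) - (\<integral>x. \<psi> x \<partial>\<nu>)"
  have J2: "\<bar>J\<bar> <= 2 * N" using bd[OF mu] bd[OF nu] unfolding J_def by linarith
  show ?thesis
  proof (cases "N = 0")
   case False
   then have N: "N > 0" using N0 by simp
   have st: "\<bar>J\<bar> <= N*(D/dlt+\<bar>C\<bar> * dlt)" if d: "0 < dlt" "dlt <= dlt0" for dlt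
   proof -
    have "t * J <= D+C * dlt\<^sup>2" if t: "\<bar>t\<bar> = dlt/N" for t
    proof -
     have "okg dlt (%x. t*\<psi> x)" using okg_scale[OF ok, of t] t N by simp
     from step[OF this d] show ?thesis by (simp add: J_def right_diff_distrib)
    qed
    moreover have "\<bar>dlt/N\<bar> = dlt/N" "\<bar>- (dlt/N)\<bar> = dlt/N" using d N by simp_all
    ultimately have "dlt/N * J <= D+C * dlt\<^sup>2" "- (dlt/N) * J <= D+C * dlt\<^sup>2" by blast+
    then have "dlt/N*\<bar>J\<bar> <= D+C * dlt\<^sup>2" by (cases "J >= 0") simp_all
    also have "... <= D+\<bar>C\<bar> * dlt\<^sup>2" by (intro add_left_mono mult_right_mono) auto
    finally have "\<bar>J\<bar> <= N*(D+\<bar>C\<bar> * dlt\<^sup>2)/dlt" using d N by (simp add: field_simps)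
    also have "... = N*(D/dlt+\<bar>C\<bar> * dlt)" using d by (simp add: field_simps power2_eq_square)
    finally show ?thesis .
   qed
   have "\<bar>J\<bar> <= K * N * sqrt D"
   proof (cases "D = 0")
    case True
    have "\<bar>J\<bar> <= 0"
    proof (rule field_le_epsilon)
     fix e :: real assume e: "e > 0"
     \<comment> \<open>For zero deficit the optimal size would be 0, so \<open>dlt\<close> is sent
       to 0 through positive values.\<close>
     define dlt where "dlt = min dlt0 (e/(N*(\<bar>C\<bar>+1)))"
     have p: "0 < N*(\<bar>C\<bar>+1)" using N by simp
     then have d: "0 < dlt" "dlt <= dlt0" using d0 e by (simp_all add: dlt_def)
     have "\<bar>J\<bar> <= N*(\<bar>C\<bar> * dlt)" using st[OF d] True by simp
     also have "... <= N*((\<bar>C\<bar>+1) * dlt)" using N d by (intro mult_left_mono mult_right_mono) auto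
     also have "... = (N*(\<bar>C\<bar>+1)) * dlt" by simp
     also have "... <= (N*(\<bar>C\<bar>+1))*(e/(N*(\<bar>C\<bar>+1)))" using p by (intro mult_left_mono) (auto simp: dlt_def)
     also have "... = e" using N by (simp add: mult.assoc)
     finally show "\<bar>J\<bar> <= 0+e" by simp
    qed
    then show ?thesis using True by simp
   next
    case False
    then have s: "sqrt D > 0" "sqrt D * sqrt D = D" using D0 by auto
    show ?thesis
    proof (cases "sqrt D <= dlt0")
     case True
     have "\<bar>J\<bar> <= N*(D/sqrt D+\<bar>C\<bar> * sqrt D)" by (rule st[OF s(1) True])
     also have "D/sqrt D = sqrt D" using s by (simp add: field_simps)
     also have "N*(sqrt D+\<bar>C\<bar> * sqrt D) = (1+\<bar>C\<bar>) * N * sqrt D" by (simp add: algebra_simps)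
     also have "... <= K * N * sqrt D" using d0 N s by (intro mult_right_mono) (auto simp: K_def)
     finally show ?thesis .
    next
     case False
     have "2 * N <= (2/dlt0) * N * sqrt D" using False d0 N by (simp add: field_simps)
     also have "... <= K * N * sqrt D" using d0 N s by (intro mult_right_mono) (auto simp: K_def)
     finally show ?thesis using J2 by simp
    qed
   qed
   then show ?thesis by (simp add: J_def D_def)
  qed (use J2 in "simp add: J_def")
 qed
 show ?thesis unfolding EKP_def
 proof (intro exI[of _ \<nu>] conjI eq allI impI exI[of _ K] ballI)
  fix \<beta> :: real and \<psi> \<mu>
  assume b: "\<beta> > 0" "exp (- \<beta>) <= \<theta>" and ps: "\<psi> \<in> H_beta S E \<beta>" and mu: "\<mu> \<in> IM" and p: "mpress \<mu> f ~= - \<infinity>"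
  obtain p' where "mpress \<mu> f = ereal p'" using p mpress_le_crit[OF mu] by (cases "mpress \<mu> f") auto
  then show "\<bar>(\<integral>x. \<psi> x \<partial>\<mu>) - (\<integral>x. \<psi> x \<partial>\<nu>)\<bar> <= K * real_of_ereal (hnorm S E \<beta> \<psi>) * sqrt (real_of_ereal (mpress \<nu> f) - real_of_ereal (mpress \<mu> f))"
   using main[OF H_beta_norm(2)[OF ps b(2,1)] mu] pn by simp
 qed
qed

text \<open>A measure giving little mass to a cylinder charged by the equilibrium measure is far
  from it in the EKP sense, hence has a pressure deficit of at least a fixed \<open>c\<close>.
  Escaping sequences consist eventually of such measures.\<close>

lemma EKP_imp_P_inf:
 assumes "EKP S E \<theta> f" shows "P_inf S E f < ereal crit"
proof -
 obtain \<nu> where eq: "equilibrium S E f \<nu>" and ek: "!!\<beta>. \<beta>>0 ==> exp (- \<beta>) <= \<theta> ==> EX C::real. ALL \<psi>:H_beta S E \<beta>. ALL \<mu>:IM.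
    pressure_defined \<mu> f --> mpress \<mu> f ~= - \<infinity> --> \<bar>(\<integral>x. \<psi> x \<partial>\<mu>) - (\<integral>x. \<psi> x \<partial>\<nu>)\<bar>
     <= C * real_of_ereal (hnorm S E \<beta> \<psi>) * sqrt (real_of_ereal (mpress \<nu> f) - real_of_ereal (mpress \<mu> f))"
  using assms unfolding EKP_def by blast
 have nu: "\<nu> \<in> IM" and max: "!!\<mu>. \<mu> \<in> IM ==> mpress \<mu> f <= mpress \<nu> f" and "\<bar>mpress \<nu> f\<bar> ~= \<infinity>"
  using eq by (auto simp: equilibrium_def pressure_defined_inv)
 then obtain p where p: "mpress \<nu> f = ereal p" by (cases "mpress \<nu> f") auto
 have pc: "p <= crit" using mpress_le_crit[OF nu] p by simp
 interpret n: inv_meas S E \<nu> by (intro inv_meas.intro inv_meas_axioms.intro tms_axioms nu)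
 obtain s where s: "measure \<nu> (Cy [s]) > 0"
 proof (rule ccontr)
  assume "\<not> thesis"
  then have "measure \<nu> (Cy [s]) = 0" for s using that[of s] measure_nonneg[of \<nu> "Cy [s]"] by linarith
  then have "Cy [s] \<in> null_sets \<nu>" for s by (simp add: null_sets_def n.emeasure_eq_measure)
  then have "(\<Union>s. Cy [s]) \<in> null_sets \<nu>" by (rule null_sets_UN)
  moreover have "(\<Union>s. Cy [s]) = space \<nu>" by (auto simp: cyl1_iff n.space_mu)
  ultimately show False using n.emeasure_space_1 by (simp add: null_sets_def)
 qed
 \<comment> \<open>The boundary value with \<open>exp (- \<beta>) = \<theta>\<close>. The indicator
   depends on the first coordinate only, so points where it differs separate at time 0 and its norm
   is at most 2.\<close>
 let ?\<beta> = "- ln \<theta>" and ?\<psi> = "indicator (Cy [s]) :: (nat => nat) => real"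
 have b: "?\<beta> > 0" "exp (- ?\<beta>) <= \<theta>" using \<theta> by simp_all
 have "hnorm S E ?\<beta> ?\<psi> <= 1+1" unfolding hnorm_def
 proof (rule add_mono)
  show "Sup (insert 0 ((%x. ereal \<bar>?\<psi> x\<bar>) ` Sg)) <= 1" by (rule Sup_least) (auto simp: indicator_def)
  show "Sup (insert 0 {ereal (\<bar>?\<psi> x - ?\<psi> y\<bar>*exp (?\<beta> * real (tsep x y))) | x y. x \<in> Sg & y \<in> Sg & x ~= y}) <= 1"
  proof (rule Sup_least)
   fix z assume "z \<in> insert 0 {ereal (\<bar>?\<psi> x - ?\<psi> y\<bar>*exp (?\<beta> * real (tsep x y))) | x y. x \<in> Sg & y \<in> Sg & x ~= y}"
   then consider "z = 0" | x y where "z = ereal (\<bar>?\<psi> x - ?\<psi> y\<bar>*exp (?\<beta> * real (tsep x y)))" "x \<in> Sg" "y \<in> Sg" by blast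
   then show "z <= 1"
   proof cases
    case (2 x y)
    show ?thesis
    proof (cases "x 0 = y 0")
     case True then show ?thesis using 2 by (simp add: indicator_def cyl1_iff)
    next
     case False
     then have "tsep x y = 0" unfolding tsep_def by (intro Least_eq_0)
     then show ?thesis using 2 by (simp add: indicator_def)
    qed
   qed simp
  qed
 qed
 also have "... < \<infinity>" by simp
 finally have ps: "?\<psi> \<in> H_beta S E ?\<beta>" by (simp add: H_beta_def)
 define N where "N = real_of_ereal (hnorm S E ?\<beta> ?\<psi>)"
 obtain C where C: "!!\<mu>. \<mu> \<in> IM ==> mpress \<mu> f ~= - \<infinity> ==> \<bar>(\<integral>x. ?\<psi> x \<partial>\<mu>) - (\<integral>x. ?\<psi> x \<partial>\<nu>)\<bar>
     <= C * N * sqrt (p - real_of_ereal (mpress \<mu> f))"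
  using ek[OF b] ps p pressure_defined_inv unfolding N_def by (metis real_of_ereal.simps(1))
 have N0: "0 <= N" unfolding N_def by (rule H_beta_norm(1)[OF ps b(2,1)])
 define m where "m = measure \<nu> (Cy [s])"
 \<comment> \<open>The added 1 allows division whatever the sign or size of
   \<open>C\<close>.\<close>
 define M where "M = \<bar>C\<bar> * N+1"
 have M: "M > 0" using N0 by (simp add: M_def add_nonneg_pos)
 define c where "c = (m/(2 * M))\<^sup>2"
 have c: "c > 0" using s M by (simp add: c_def m_def)
 have gap: "mpress \<mu> f <= ereal (p - c)" if mu: "\<mu> \<in> IM" and sm: "measure \<mu> (Cy [s]) < m/2" for \<mu>
 proof (cases "mpress \<mu> f = - \<infinity>")
  case False
  then obtain r where r: "mpress \<mu> f = ereal r" using mpress_le_crit[OF mu] by (cases "mpress \<mu> f") auto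
  have rp: "r <= p" using max[OF mu] r p by simp
  interpret i: inv_meas S E \<mu> by (intro inv_meas.intro inv_meas_axioms.intro tms_axioms mu)
  have "\<bar>measure \<mu> (Cy [s]) - m\<bar> <= C * N * sqrt (p - r)" using C[OF mu False] r by (simp add: m_def)
  then have "m/2 <= C * N * sqrt (p - r)" using sm by linarith
  also have "... <= M * sqrt (p - r)"
  proof (rule mult_right_mono)
   have "C * N <= \<bar>C\<bar> * N" by (intro mult_right_mono N0) simp
   then show "C * N <= M" by (simp add: M_def)
  qed (use rp in simp)
  finally have "m/(2 * M) <= sqrt (p - r)" using M by (simp add: field_simps)
  moreover have "0 <= m/(2 * M)" using M by (simp add: m_def)
  ultimately have "c <= (sqrt (p - r))\<^sup>2" unfolding c_def by (rule power_mono)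
  then show ?thesis using rp r by simp
 qed simp
 have "P_inf S E f <= ereal (p - c)" unfolding P_inf_def
 proof (rule SUP_least, clarify)
  fix \<mu>s :: "nat => (nat => nat) measure" assume H: "ALL n. \<mu>s n \<in> IM & pressure_defined (\<mu>s n) f"
   "ALL w. 1 <= length w --> (%n. measure (\<mu>s n) (Cy w)) \<longlonglongrightarrow> 0"
  have "(%n. measure (\<mu>s n) (Cy [s])) \<longlonglongrightarrow> 0" using H(2) by simp
  then have "eventually (%n. measure (\<mu>s n) (Cy [s]) < m/2) sequentially" using s by (intro order_tendstoD(2)) (auto simp: m_def)
  then show "limsup (%n. mpress (\<mu>s n) f) <= ereal (p - c)" using gap H(1) by (intro Limsup_bounded) (auto elim: eventually_mono)
 qed
 also have "... < ereal crit" using pc c by simp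
 finally show ?thesis .
qed

end

section \<open>Excursions between finitely many states\<close>

definition Exc where
 "Exc S E F s t = {w\<in>Pth S E s t. w ~= [] & (ALL i. 0 < i --> i < length w --> w ! i ~: F)}"

lemma Exc_FR: "b \<in> F ==> Exc S E F b b <= FR S E b" unfolding Exc_def FR_def by blast

context tms
begin

abbreviation "Ec == Exc S E"

lemma Exc_tail:
 assumes "b ~: F" "b \<in> S" "t \<in> F" "t \<in> S"
 shows "v \<in> Ph b t ==> (!!i. 0 < i ==> i < length v ==> v ! i ~: F) ==>
  EX u:Star (Ec (insert b F) b b). EX \<beta>:Ec (insert b F) b t. v = u@\<beta>"
proof (induction "length v" arbitrary: v rule: less_induct)
 case less
 have vne: "v ~= []" using Pth_hd[OF less.prems(1) assms(4)] assms by auto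
 show ?case
 proof (cases "EX i. 0 < i & i < length v & v ! i = b")
  case False
  then have "v \<in> Ec (insert b F) b t" using less.prems vne unfolding Exc_def by blast
  then show ?thesis using Star_Nil append_Nil by metis
 next
  case True
  define i where "i = (LEAST i. 0 < i & i < length v & v ! i = b)"
  have i: "0 < i" "i < length v" "v ! i = b" using LeastI_ex[OF True] unfolding i_def by auto
  have imin: "v ! j ~= b" if "0 < j" "j < i" for j using not_less_Least[of j "%i. 0 < i & i < length v & v ! i = b"] that i(2) unfolding i_def by auto
  have r: "b = (if drop i v = [] then t else drop i v ! 0)" using i by simp
  have sp: "take i v \<in> Ph b b" "drop i v \<in> Ph b t"
   using Pth_split[of "take i v" "drop i v" b t b] less.prems(1) assms(4) r by simp_all
  have tk: "take i v \<in> Ec (insert b F) b b" unfolding Exc_def using sp(1) i less.prems(2) imin by auto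
  have "EX u:Star (Ec (insert b F) b b). EX \<beta>:Ec (insert b F) b t. drop i v = u@\<beta>"
   by (rule less.hyps) (use i sp(2) less.prems(2) in auto)
  then obtain u \<beta> where u: "u \<in> Star (Ec (insert b F) b b)" "\<beta> \<in> Ec (insert b F) b t" "drop i v = u@\<beta>" by blast
  have "v = (take i v@u)@\<beta>" using u(3) append_take_drop_id[of i v] by simp
  then show ?thesis using Star_Cons[OF tk u(1)] u(2) by blast
 qed
qed

text \<open>State elimination as in Kleene's algorithm: an excursion outside \<open>F\<close> either
  avoids \<open>b\<close>, or consists of an approach to \<open>b\<close>, loops at
  \<open>b\<close>, and a departure.\<close>

lemma Exc_remove:
 assumes "b ~: F" "b \<in> S" "s \<in> F" "t \<in> F" "t \<in> S"
 shows "Ec F s t <= Ec (insert b F) s t \<union>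
  (%(\<alpha>, u, \<beta>). \<alpha>@u@\<beta>) ` (Ec (insert b F) s b \<times> Star (Ec (insert b F) b b) \<times> Ec (insert b F) b t)"
proof
 fix w assume w: "w \<in> Ec F s t"
 have wP: "w \<in> Ph s t" and wne: "w ~= []" and wF: "!!i. 0 < i ==> i < length w ==> w ! i ~: F" using w by (auto simp: Exc_def)
 show "w \<in> Ec (insert b F) s t Un (%(\<alpha>, u, \<beta>). \<alpha>@u@\<beta>) ` (Ec (insert b F) s b \<times> Star (Ec (insert b F) b b) \<times> Ec (insert b F) b t)"
 proof (cases "EX i. 0 < i & i < length w & w ! i = b")
  case False
  then have "w \<in> Ec (insert b F) s t" using w unfolding Exc_def by blast
  then show ?thesis ..
 next
  case True
  define i where "i = (LEAST i. 0 < i & i < length w & w ! i = b)"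
  have i: "0 < i" "i < length w" "w ! i = b" using LeastI_ex[OF True] unfolding i_def by auto
  have imin: "w ! j ~= b" if "0 < j" "j < i" for j using not_less_Least[of j "%i. 0 < i & i < length w & w ! i = b"] that i(2) unfolding i_def by auto
  have r: "b = (if drop i w = [] then t else drop i w ! 0)" using i by simp
  have sp: "take i w \<in> Ph s b" "drop i w \<in> Ph b t"
   using Pth_split[of "take i w" "drop i w" s t b] wP assms(5) r by simp_all
  have tk: "take i w \<in> Ec (insert b F) s b" unfolding Exc_def using sp(1) i wF imin by auto
  obtain u \<beta> where u: "u \<in> Star (Ec (insert b F) b b)" "\<beta> \<in> Ec (insert b F) b t" "drop i w = u@\<beta>"
   using Exc_tail[OF assms(1,2,4,5) sp(2)] wF i by auto
  have "w = (%(\<alpha>, u, \<beta>). \<alpha>@u@\<beta>) (take i w, u, \<beta>)" using u(3) append_take_drop_id[of i w] by simp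
  then show ?thesis using tk u(1,2) by blast
 qed
qed

text \<open>A connecting path is cut at its first visit to \<open>s\<close>, so that appending it to
  an excursion from \<open>s\<close> gives a first-return word. For \<open>t = s\<close> the result
  is empty.\<close>

lemma first_passage:
 assumes "s \<in> S" "t \<in> S"
 obtains \<gamma> where "\<gamma> \<in> Ph t s" "s ~: set \<gamma>"
proof -
 obtain w where w: "w \<in> Ph t s" "w ~= []" using Pth_ne[OF assms(2,1)] .
 define \<gamma> where "\<gamma> = takeWhile (%x. x ~= s) w"
 have "\<gamma> \<in> Ph t s"
  unfolding \<gamma>_def
  by (rule Pth_split(1)[of _ "dropWhile (%x. x ~= s) w" _ s]) (use w assms hd_dropWhile[of "%x. x ~= s" w] in "auto simp: hd_conv_nth simp del: dropWhile_eq_Nil_conv")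
 moreover have "s ~: set \<gamma>" unfolding \<gamma>_def by (auto dest: set_takeWhileD)
 ultimately show thesis by (rule that)
qed

end

context pot
begin

lemma Exc_sum_remove:
 assumes "b ~: F" "b \<in> S" "s \<in> F" "t \<in> F" "t \<in> S"
  and fin: "!!s t. s \<in> insert b F ==> t \<in> insert b F ==> rsum (Ec (insert b F) s t) (%w. wq f q w (pt t)) < \<infinity>"
  and H: "Hs f (Ec (insert b F) b b) q (pt b) < \<infinity>"
 shows "rsum (Ec F s t) (%w. wq f q w (pt t)) < \<infinity>"
proof -
 let ?X = "Ec (insert b F)" and ?k = "%(\<alpha>, u, \<beta>). \<alpha>@u@(\<beta> :: nat list)"
 let ?T = "?X s b \<times> Star (?X b b) \<times> ?X b t"
 let ?g = "%s w. ennreal (exp kap)*ennreal (wq f q w (pt s))"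
 have "rsum (?k ` ?T) (%w. wq f q w (pt t)) <= rsum ?T (%z. wq f q (?k z) (pt t))" by (rule nsum_image_le)
 also have "... <= nsum ?T (%(\<alpha>, u, \<beta>). ?g b \<alpha>*(?g b u*ennreal (wq f q \<beta> (pt t))))"
 proof (rule nsum_mono, clarify)
  fix \<alpha> u \<beta> assume m: "\<alpha> \<in> ?X s b" "u \<in> Star (?X b b)" "\<beta> \<in> ?X b t"
  have u: "u \<in> Ph b b" using Star_FR_Pth[OF Exc_FR[OF insertI1] m(2)] .
  have al: "\<alpha> \<in> Ph s b" and be: "\<beta> \<in> Ph b t" using m by (auto simp: Exc_def)
  have c: "cat \<beta> (pt t) \<in> Cy [b]" by (rule PthD[OF be pt[OF assms(5)]])
  have c2: "cat u (cat \<beta> (pt t)) \<in> Cy [b]" by (rule PthD[OF u c])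
  have "wq f q (\<alpha>@u@\<beta>) (pt t) = wq f q \<alpha> (cat u (cat \<beta> (pt t)))*(wq f q u (cat \<beta> (pt t)) * wq f q \<beta> (pt t))"
   by (simp add: wq_append cat_append mult.assoc)
  also have "... <= (exp kap * wq f q \<alpha> (pt b))*((exp kap * wq f q u (pt b)) * wq f q \<beta> (pt t))"
   by (intro mult_mono wq_dist[OF al c2 pt[OF assms(2)]] wq_dist[OF u c pt[OF assms(2)]]) auto
  finally have "ennreal (wq f q (\<alpha>@u@\<beta>) (pt t)) <= ennreal ((exp kap * wq f q \<alpha> (pt b))*((exp kap * wq f q u (pt b)) * wq f q \<beta> (pt t)))" by (rule ennreal_leI)
  then show "ennreal (wq f q (\<alpha>@u@\<beta>) (pt t)) <= ?g b \<alpha>*(?g b u*ennreal (wq f q \<beta> (pt t)))" by (simp add: ennreal_mult)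
 qed
 also have "... = nsum (?X s b) (?g b)*(nsum (Star (?X b b)) (?g b) * rsum (?X b t) (%\<beta>. wq f q \<beta> (pt t)))"
  by (simp add: nsum_Times nsum_cmult nsum_multc)
 also have "... < \<infinity>" using fin[of s b] fin[of b t] H assms unfolding nsum_cmult Hs_def by (simp add: ennreal_mult_less_top)
 finally have I: "rsum (?k ` ?T) (%w. wq f q w (pt t)) < \<infinity>" .
 have "rsum (Ec F s t) (%w. wq f q w (pt t)) <= rsum (?X s t Un ?k ` ?T) (%w. wq f q w (pt t))"
  by (rule nsum_subset[OF Exc_remove[OF assms(1-5)]])
 also have "... <= rsum (?X s t) (%w. wq f q w (pt t))+rsum (?k ` ?T) (%w. wq f q w (pt t))" by (rule nsum_Un_le)
 also have "... < \<infinity>" using I fin[of s t] assms by simp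
 finally show ?thesis .
qed

text \<open>In h = 1 + L h, distortion gives L h >= exp (- kap) times the sum times h. The extra 1
  makes the inequality strict.\<close>

lemma finite_Hs_sum_less:
 assumes a: "a \<in> S" and W: "W <= Fr a" and fin: "finite W" and H: "Hs f W q (pt a) < \<infinity>"
 shows "(SUM w:W. wq f q w (pt a)) < exp kap"
proof -
 obtain h where h: "Hs f W q (pt a) = ennreal h" "0 <= h" using H by (cases "Hs f W q (pt a)") auto
 have h1: "1 <= h" using Hs_ge_1[of f W q "pt a"] h by simp
 let ?Z = "SUM w:W. wq f q w (pt a)"
 have Z: "0 <= ?Z" by (simp add: sum_nonneg)
 have "ennreal (?Z * h) = nsum W (%w. ennreal (wq f q w (pt a)) * Hs f W q (pt a))"
  using h fin by (simp add: nsum_finite sum_distrib_right ennreal_mult[symmetric] sum_ennreal)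
 also have "... <= nsum W (%w. ennreal (wq f q w (pt a))*(ennreal (exp kap) * Hs f W q (cat w (pt a))))"
  by (intro nsum_mono mult_left_mono Hs_dist[OF W pt[OF a] PthD[OF FR_Pth pt[OF a]]]) (use W in auto)
 also have "... = ennreal (exp kap) * Lop f W q (Hs f W q) (pt a)" by (simp add: Lop_def nsum_cmult[symmetric] mult.left_commute)
 finally have "ennreal (?Z * h)+ennreal (exp kap) <= ennreal (exp kap)*(1+Lop f W q (Hs f W q) (pt a))"
  by (simp add: distrib_left add_mono add.commute)
 also have "... = ennreal (exp kap * h)" unfolding Hs_eq[OF a W, symmetric] using h by (simp add: ennreal_mult)
 finally have "?Z * h+exp kap <= exp kap * h" using h Z by (simp add: ennreal_plus[symmetric] del: ennreal_plus)
 then have "?Z * h < exp kap * h" using exp_gt_zero[of kap] by linarith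
 then show ?thesis using h1 by (simp add: mult_less_cancel_right)
qed

end

context potz
begin

text \<open>Loops avoiding a second state form a proper subsystem. The function \<open>h\<close> of
  the full system is then a supersolution with a uniform relative deficit, contributed by one
  omitted word, so the gap lemma puts the exponent of the subsystem below
  \<open>crit\<close>.\<close>

lemma avoiding_Hs_below:
 assumes b: "b \<in> S" "b \<in> F" and c: "c \<in> S" "c \<in> F" "c ~= b"
  and q: "q < crit" "rsum (Ec F b b) (%w. wq f q w (pt b)) < \<infinity>"
 shows "EX q<crit. Hs f (Ec F b b) q (pt b) < \<infinity>"
proof -
 let ?W = "Ec F b b" and ?V = "Fr b"
 have W: "?W <= ?V" by (rule Exc_FR[OF b(2)])
 \<comment> \<open>If no first-return word were omitted, every loop at \<open>b\<close> would avoid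
   \<open>c\<close>, contradicting transitivity.\<close>
 obtain w1 where w1: "w1 \<in> ?V" "w1 ~: ?W"
 proof (rule ccontr)
  assume "\<not> thesis"
  then have VW: "?V <= ?W" using that by blast
  obtain \<alpha> where al: "\<alpha> \<in> Ph b c" using Pth_ne[OF b(1) c(1)] by blast
  obtain \<beta> where be: "\<beta> \<in> Ph c b" "\<beta> ~= []" using Pth_ne[OF c(1) b(1)] by blast
  have "\<alpha>@\<beta> \<in> Star ?W" using Pth_append[OF al be(1)] Star_FR[OF b(1)] Star_mono[OF VW] by blast
  moreover have "c ~: set u" if "u \<in> Star ?W" for u
   using that
  proof (induction rule: Star_induct)
   case (Cons w u)
   have "w ! i ~= c" if "i < length w" for i
    using Cons(1) that FR_hd[OF b(1), of w] W c unfolding Exc_def by (cases "i = 0") auto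
   then show ?case using Cons(3) by (auto simp: in_set_conv_nth)
  qed simp
  moreover have "c \<in> set \<beta>" using Pth_hd'[OF b(1) be] be(2) by (metis length_greater_0_conv nth_mem)
  ultimately show False by fastforce
 qed
 define h where "h q x = enn2real (Hs f ?V q x)" for q x
 have h: "Hs f ?V q x = ennreal (h q x)" if "x \<in> Cy [b]" "crit < q" for q x
  using Hs_finite_indep[OF order_refl that(1) pt[OF b(1)] Hs_gt[OF b(1) order_refl that(2)]] unfolding h_def by simp
 have h0: "0 <= h q x" for q x by (simp add: h_def)
 have h1: "1 <= h q x" if "x \<in> Cy [b]" "crit < q" for q x
  using Hs_ge_1[of f ?V q x] h0[of q x] unfolding h[OF that] by simp
 have hd: "h q x <= exp kap * h q y" if "x \<in> Cy [b]" "y \<in> Cy [b]" "crit < q" for q x y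
  using Hs_dist[OF order_refl that(1,2), of q] h0 that by (simp add: h ennreal_mult[symmetric])
 \<comment> \<open>One \<open>exp (- kap)\<close> is for the weight of \<open>w1\<close>, the other
   for \<open>h\<close> at the image; the exponent \<open>crit + 1\<close> makes the bound uniform
   in \<open>q\<close>.\<close>
 define c' where "c' = exp (- kap)*(exp (- kap) * wq f (crit+1) w1 (pt b))"
 show ?thesis
 proof (rule gap_imp_Hs_below[OF b(1) W, where eps="crit - q" and c=c' and k=kap])
  show "crit - q > 0" "c' > 0" using q by (simp_all add: c'_def)
  show "rsum ?W (%w. wq f (crit - (crit - q)) w (pt b)) < \<infinity>" using q by simp
  fix q assume q: "crit < q" "q < crit+1"
  show "EX h. (ALL x:Cy [b]. 0 < h x & Lop f ?W q (%x. ennreal (h x)) x+ennreal (c' * h x) <= ennreal (h x)) &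
    (ALL x:Cy [b]. ALL y:Cy [b]. h x <= exp kap * h y)"
  proof (intro exI[of _ "h q"] conjI ballI)
   fix x assume x: "x \<in> Cy [b]"
   show "0 < h q x" using h1[OF x, of q] q by simp
   have cx: "cat w x \<in> Cy [b]" if "w \<in> ?V" for w using PthD[OF FR_Pth[OF that] x] .
   have "c' * h q x = (exp (- kap) * wq f (crit+1) w1 (pt b))*(exp (- kap) * h q x)" by (simp add: c'_def)
   also have "... <= wq f q w1 x * h q (cat w1 x)"
   proof (rule mult_mono)
    have "wq f (crit+1) w1 (pt b) <= wq f q w1 (pt b)" by (rule wq_antimono) (use q in simp)
    also have "... <= exp kap * wq f q w1 x" by (rule wq_dist[OF FR_Pth[OF w1(1)] pt[OF b(1)] x])
    finally show "exp (- kap) * wq f (crit+1) w1 (pt b) <= wq f q w1 x" by (simp add: exp_minus field_simps)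
    show "exp (- kap) * h q x <= h q (cat w1 x)" using hd[OF x cx[OF w1(1)] q(1)] by (simp add: exp_minus field_simps)
   qed (use h0 in auto)
   finally have c: "c' * h q x <= wq f q w1 x * h q (cat w1 x)" .
   let ?g = "%w. ennreal (wq f q w x)*ennreal (h q (cat w x))"
   have "Lop f ?W q (%x. ennreal (h q x)) x+ennreal (c' * h q x) <= nsum ?W ?g+nsum {w1} ?g"
    unfolding Lop_def using c h0 by (intro add_left_mono) (simp add: nsum_finite ennreal_mult[symmetric] ennreal_leI)
   also have "... = nsum (?W Un {w1}) ?g" by (rule nsum_Un_disj[symmetric]) (use w1 in auto)
   also have "... <= nsum ?V ?g" by (rule nsum_subset) (use W w1 in auto)
   also have "... = Lop f ?V q (Hs f ?V q) x" unfolding Lop_def by (rule nsum_cong) (use h cx q in auto)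
   also have "... <= Hs f ?V q x" unfolding Hs_eq[OF b(1) order_refl, of f q x] by (simp add: add_increasing)
   also have "... = ennreal (h q x)" by (rule h[OF x q(1)])
   finally show "Lop f ?W q (%x. ennreal (h q x)) x+ennreal (c' * h q x) <= ennreal (h q x)" .
  next
   fix x y assume "x \<in> Cy [b]" "y \<in> Cy [b]"
   then show "h q x <= exp kap * h q y" using hd q by simp
  qed
 qed
qed

lemma nsum_wq_antimono: "q <= q' ==> rsum V (%w. wq f q w x) < \<infinity> ==> rsum V (%w. wq f q' w x) < \<infinity>"
 using nsum_mono[of V "%w. ennreal (wq f q' w x)" "%w. ennreal (wq f q w x)"] wq_antimono[of q q' f _ x]
 by (meson ennreal_leI le_less_trans)

text \<open>States are eliminated one by one. Each elimination replaces \<open>q\<close> by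
  \<open>max q q'\<close>, still below \<open>crit\<close>. For a single state the excursions are
  exactly the first-return words.\<close>

lemma Exc_finite_imp_SPR:
 assumes "finite F" "F ~= {}" "F <= S" "q < crit"
  "!!s t. s \<in> F ==> t \<in> F ==> rsum (Ec F s t) (%w. wq f q w (pt t)) < \<infinity>"
 shows "SPR S E f"
 using assms
proof (induction F arbitrary: q rule: finite_ne_induct)
 case (singleton a)
 have "Ec {a} a a = Fr a" unfolding Exc_def FR_def by auto
 then show ?case using singleton SPR_iff[OF gr_ex] by (metis insertI1 subsetD)
next
 case (insert b F)
 obtain c where c: "c \<in> F" using insert(2) by blast
 obtain q' where q': "q' < crit" "Hs f (Ec (insert b F) b b) q' (pt b) < \<infinity>"
 proof -
  have "c \<in> S" "c ~= b" "b \<in> S" using c insert.hyps insert.prems by auto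
  then show thesis using avoiding_Hs_below[of b "insert b F" c q] insert.prems(2,3) c that by blast
 qed
 let ?q = "max q q'"
 show ?case
 proof (rule insert.IH[of ?q])
  show "F <= S" "?q < crit" using insert.prems q' by auto
  fix s t assume st: "s \<in> F" "t \<in> F"
  show "rsum (Ec F s t) (%w. wq f ?q w (pt t)) < \<infinity>"
  proof (rule Exc_sum_remove[of b F s t ?q])
   show "b ~: F" "b \<in> S" "s \<in> F" "t \<in> F" "t \<in> S" using insert st by auto
   show "Hs f (Ec (insert b F) b b) ?q (pt b) < \<infinity>" using Hs_antimono[of q' ?q f _ "pt b"] q'(2) by (auto intro: le_less_trans)
   show "rsum (Ec (insert b F) u v) (%w. wq f ?q w (pt v)) < \<infinity>" if "u \<in> insert b F" "v \<in> insert b F" for u v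
    by (rule nsum_wq_antimono[OF _ insert.prems(3)[OF that]]) simp
  qed
 qed
qed

text \<open>There are finitely many pairs: if each had its own convergence exponent below
  \<open>crit\<close>, the maximum would serve all of them. Hence one pair diverges at every
  exponent below \<open>crit\<close>.\<close>

lemma not_SPR_excursions:
 assumes "\<not> SPR S E f" "finite F" "F ~= {}" "F <= S"
 obtains s t where "s \<in> F" "t \<in> F" "!!q. q < crit ==> rsum (Ec F s t) (%w. wq f q w (pt t)) = \<infinity>"
proof (rule ccontr)
 assume "\<not> thesis"
 then have "ALL z:F \<times> F. EX q<crit. rsum (Ec F (fst z) (snd z)) (%w. wq f q w (pt (snd z))) < \<infinity>"
  using that by (force simp: less_top)
 then obtain Q where Q: "!!z. z \<in> F \<times> F ==> Q z < crit & rsum (Ec F (fst z) (snd z)) (%w. wq f (Q z) w (pt (snd z))) < \<infinity>"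
  by metis
 have ne: "finite (Q ` (F \<times> F))" "Q ` (F \<times> F) ~= {}" using assms by auto
 define q where "q = Max (Q ` (F \<times> F))"
 have "q < crit" using Max_in[OF ne] Q unfolding q_def by auto
 moreover have "rsum (Ec F s t) (%w. wq f q w (pt t)) < \<infinity>" if "s \<in> F" "t \<in> F" for s t
  using nsum_wq_antimono[of "Q (s, t)" q] Q[of "(s, t)"] Max_ge[OF ne(1), of "Q (s, t)"] that unfolding q_def by auto
 ultimately show False using Exc_finite_imp_SPR[OF assms(2-4)] assms(1) by blast
qed

text \<open>If all levels from \<open>N\<close> on were small, the series at
  \<open>crit - eps\<close> would be dominated by a geometric one. The levels before
  \<open>N\<close> are finite by \<open>path_growth\<close>.\<close>

lemma large_levels:
 assumes s: "s \<in> S" and t: "t \<in> S" and V: "V <= Ph s t" and eps: "eps > 0"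
  and inf: "rsum V (%w. wq f (crit - eps) w (pt t)) = \<infinity>"
 shows "EX n>=N. ennreal (exp ((crit - 2*eps) * real n)) < rsum {w\<in>V. length w = n} (%w. wt f w (pt t))"
proof (rule ccontr)
 assume "\<not> ?thesis"
 then have le: "rsum {w\<in>V. length w = n} (%w. wt f w (pt t)) <= ennreal (exp ((crit - 2*eps) * real n))" if "n >= N" for n
  using that by (force simp: not_less)
 obtain C where C: "!!n. rsum {w\<in>Ph s t. length w = n} (%w. wt f w (pt t)) <= ennreal (C*exp ((crit+1) * real n))"
  using path_growth[OF s _ s t] gr_gt[of "crit+1"] gr_iff[OF s] by fastforce
 define d where "d = 1+2*eps"
 define K where "K = max 1 (\<bar>C\<bar>*exp (d * real N))"
 have all: "rsum {w\<in>V. length w = n} (%w. wt f w (pt t)) <= ennreal (K*exp ((crit - 2*eps) * real n))" for n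
 proof (cases "n >= N")
  case True
  have "1*exp ((crit - 2*eps) * real n) <= K*exp ((crit - 2*eps) * real n)" by (rule mult_right_mono) (auto simp: K_def)
  then show ?thesis using le[OF True] by (simp add: order_trans[OF _ ennreal_leI])
 next
  case False
  have "rsum {w\<in>V. length w = n} (%w. wt f w (pt t)) <= rsum {w\<in>Ph s t. length w = n} (%w. wt f w (pt t))"
   by (rule nsum_subset) (use V in auto)
  also have "... <= ennreal (C*exp ((crit+1) * real n))" by (rule C)
  also have "... <= ennreal (K*exp ((crit - 2*eps) * real n))"
  proof (rule ennreal_leI)
   have "C*exp ((crit+1) * real n) <= \<bar>C\<bar>*exp (d * real n)*exp ((crit - 2*eps) * real n)"
    by (simp add: d_def exp_add[symmetric] mult.assoc algebra_simps mult_right_mono)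
   also have "... <= K*exp ((crit - 2*eps) * real n)"
   proof (rule mult_right_mono)
    have "\<bar>C\<bar>*exp (d * real n) <= \<bar>C\<bar>*exp (d * real N)" using False eps by (intro mult_left_mono) (auto simp: d_def)
    then show "\<bar>C\<bar>*exp (d * real n) <= K" by (simp add: K_def)
   qed simp
   finally show "C*exp ((crit+1) * real n) <= K*exp ((crit - 2*eps) * real n)" .
  qed
  finally show ?thesis .
 qed
 have "rsum {w\<in>V. length w = n} (%w. wq f (crit - eps) w (pt t)) <= ennreal (K*exp (- eps * real n))" for n
 proof -
  have "rsum {w\<in>V. length w = n} (%w. wq f (crit - eps) w (pt t))
   = rsum {w\<in>V. length w = n} (%w. wt f w (pt t))*ennreal (exp (- (crit - eps) * real n))"
   unfolding nsum_multc[symmetric] by (rule nsum_cong) (auto simp: wq_def ennreal_mult)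
  also have "... <= ennreal (K*exp ((crit - 2*eps) * real n))*ennreal (exp (- (crit - eps) * real n))" by (rule mult_right_mono[OF all]) simp
  also have "... = ennreal (K*exp (- eps * real n))"
   by (subst ennreal_mult''[symmetric]) (auto simp: mult.assoc exp_add[symmetric] algebra_simps)
  finally show ?thesis .
 qed
 then have "rsum V (%w. wq f (crit - eps) w (pt t)) < \<infinity>"
  by (subst nsum_levels[of _ _ length]) (rule exp_levels_finite[OF _ eps])
 with inf show False by simp
qed

text \<open>Excursions of one large length \<open>n\<close> from \<open>s\<close> to
  \<open>t\<close>, closed by a fixed path avoiding \<open>s\<close>, are first-return words of
  equal length. Their system keeps nearly the full exponent, and each word meets \<open>F\<close>
  only at its start and in the closing path.\<close>

lemma escape:
 assumes ns: "\<not> SPR S E f" and F: "finite F" "F ~= {}" "F <= S" and e: "e > 0"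
 shows "EX \<mu>:IM. ereal (crit - e) <= mpress \<mu> f & (SUM s:F. measure \<mu> (Cy [s])) <= e"
proof -
 define eps where "eps = e/3"
 have eps: "eps > 0" using e by (simp add: eps_def)
 obtain s t where st: "s \<in> F" "t \<in> F" and inf: "!!q. q < crit ==> rsum (Ec F s t) (%w. wq f q w (pt t)) = \<infinity>"
  using not_SPR_excursions[OF ns F] by blast
 have sS: "s \<in> S" and tS: "t \<in> S" using st F by auto
 obtain \<gamma> where g: "\<gamma> \<in> Ph t s" "s ~: set \<gamma>" by (rule first_passage[OF sS tS])
 define G where "G = real (length \<gamma>)"
 define K where "K = 2 * kap - ln (wt f \<gamma> (pt s))"
 \<comment> \<open>Large enough that distortion and the closing path change the exponent by at most
   \<open>eps\<close>, and that the at most \<open>1 + G\<close> visits to \<open>F\<close> have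
   frequency at most \<open>e\<close>.\<close>
 obtain N :: nat where N: "(\<bar>K\<bar>+\<bar>crit - 3*eps\<bar> * G)/eps+(1+G)/e+1 <= real N" using real_arch_simple by blast
 obtain n where n: "n >= N" and big: "ennreal (exp ((crit - 2*eps) * real n)) < rsum {w\<in>Ec F s t. length w = n} (%w. wt f w (pt t))"
  using large_levels[OF sS tS _ eps inf, of N] eps by (auto simp: Exc_def)
 have nb: "(\<bar>K\<bar>+\<bar>crit - 3*eps\<bar> * G) <= eps * real n" "1+G <= e * real n"
 proof -
  have p: "0 <= (\<bar>K\<bar>+\<bar>crit - 3*eps\<bar> * G)/eps" "0 <= (1+G)/e" using eps e by (simp_all add: G_def)
  have "real N <= real n" using n by simp
  then have "(\<bar>K\<bar>+\<bar>crit - 3*eps\<bar> * G)/eps <= real n" "(1+G)/e <= real n" using N p by linarith+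
  then show "(\<bar>K\<bar>+\<bar>crit - 3*eps\<bar> * G) <= eps * real n" "1+G <= e * real n" using eps e by (simp_all add: field_simps)
 qed
 obtain W0 where W0: "finite W0" "W0 <= {w\<in>Ec F s t. length w = n}" "ennreal (exp ((crit - 2*eps) * real n)) < (SUM w:W0. ennreal (wt f w (pt t)))"
  by (rule nsum_approx[OF big])
 have W0D: "w \<in> Ph s t" "w ~= []" "!!i. 0 < i ==> i < length w ==> w ! i ~: F" "length w = n" if "w \<in> W0" for w
  using that W0(2) by (auto simp: Exc_def)
 have W0s: "exp ((crit - 2*eps) * real n) < (SUM w:W0. wt f w (pt t))" using W0(3) by (simp add: sum_ennreal sum_nonneg ennreal_less_iff)
 define W where "W = (%w. w@\<gamma>) ` W0"
 have Wfin: "finite W" using W0 by (simp add: W_def)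
 have Wne: "W ~= {}" using W0(3) by (auto simp: W_def)
 have wg: "(w@\<gamma>) ! i ~= s" if w: "w \<in> W0" and i: "0 < i" "i < length (w@\<gamma>)" for w i
  using W0D(3)[OF w i(1)] st(1) i g(2) nth_mem[of "i - length w" \<gamma>] by (cases "i < length w") (auto simp: nth_append)
 have WFR: "W <= Fr s"
  unfolding W_def FR_def using Pth_append[OF W0D(1) g(1)] W0D(2) wg by blast
 define m where "m = n+length \<gamma>"
 have Wlen: "length w = m" if "w \<in> W" for w using that W0D(4) by (auto simp: W_def m_def)
 have m: "real m = real n+G" by (simp add: m_def G_def)
 have n0: "0 < real n"
 proof -
  have "0 < 1+G" by (simp add: G_def)
  then have "0 < e * real n" using nb(2) by linarith
  then show ?thesis using e by (simp add: zero_less_mult_iff)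
 qed
 have m0: "0 < real m" using n0 m by (simp add: G_def)
 have Zlow: "(crit - 2*eps) * real n - kap+ln (wt f \<gamma> (pt s)) <= ln (SUM w:W. wt f w (pt s))"
 proof -
  have inj: "inj_on (%w. w@\<gamma>) W0" by (auto simp: inj_on_def)
  have c: "cat \<gamma> (pt s) \<in> Cy [t]" by (rule PthD[OF g(1) pt[OF sS]])
  have "exp (- kap) * wt f \<gamma> (pt s)*exp ((crit - 2*eps) * real n) <= exp (- kap) * wt f \<gamma> (pt s)*(SUM w:W0. wt f w (pt t))"
   by (rule mult_left_mono) (use W0s in auto)
  also have "... = (SUM w:W0. (exp (- kap) * wt f w (pt t)) * wt f \<gamma> (pt s))" by (simp add: sum_distrib_left mult.commute mult.left_commute)
  also have "... <= (SUM w:W0. wt f w (cat \<gamma> (pt s)) * wt f \<gamma> (pt s))"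
  proof (intro sum_mono mult_right_mono)
   fix w assume "w \<in> W0"
   from wt_dist[OF W0D(1)[OF this] pt[OF tS] c] show "exp (- kap) * wt f w (pt t) <= wt f w (cat \<gamma> (pt s))" by (simp add: exp_minus field_simps)
  qed simp
  also have "... = (SUM w:W. wt f w (pt s))" unfolding W_def sum.reindex[OF inj] by (simp add: wt_append)
  finally have le: "exp (- kap) * wt f \<gamma> (pt s)*exp ((crit - 2*eps) * real n) <= (SUM w:W. wt f w (pt s))" .
  have "ln (exp (- kap) * wt f \<gamma> (pt s)*exp ((crit - 2*eps) * real n)) <= ln (SUM w:W. wt f w (pt s))"
   by (rule ln_mono[OF le]) simp
  then show ?thesis by (simp add: ln_mult less_imp_neq[THEN not_sym] wt_pos)
 qed
 \<comment> \<open>As all words have length \<open>m\<close>, the bound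
   \<open>finite_Hs_sum_less\<close> fixes the exponent up to \<open>kap/m\<close>.\<close>
 have low: "crit - 3*eps <= q" if q: "Hs f W q (pt s) < \<infinity>" for q
 proof -
  have Zp: "0 < (SUM w:W. wt f w (pt s))" by (rule sum_pos[OF Wfin Wne]) simp
  have "(SUM w:W. wt f w (pt s))*exp (- q * real m) = (SUM w:W. wq f q w (pt s))" unfolding sum_distrib_right by (rule sum.cong) (auto simp: wq_def Wlen)
  also have "... < exp kap" by (rule finite_Hs_sum_less[OF sS WFR Wfin q])
  finally have "ln ((SUM w:W. wt f w (pt s))*exp (- q * real m)) <= ln (exp kap)" using Zp by (intro ln_mono) auto
  then have "ln (SUM w:W. wt f w (pt s)) <= kap+q * real m" using Zp by (simp add: ln_mult)
  then have 1: "(crit - 2*eps) * real n - K <= q * real m" using Zlow by (simp add: K_def)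
  have "(crit - 3*eps) * G <= \<bar>crit - 3*eps\<bar> * G" by (rule mult_right_mono) (auto simp: G_def)
  then have "(crit - 3*eps) * real m <= (crit - 2*eps) * real n - K" using nb(1) unfolding m by (simp add: algebra_simps)
  with 1 have "(crit - 3*eps) * real m <= q * real m" by linarith
  then show ?thesis using m0 by (simp add: mult_le_cancel_right)
 qed
 define Q where "Q = {q. Hs f W q (pt s) < \<infinity>}"
 define P where "P = Inf Q"
 have Qne: "crit+1 \<in> Q" using Hs_gt[OF sS WFR] by (simp add: Q_def)
 have Qb: "bdd_below Q" unfolding bdd_below_def Q_def using low by blast
 have PQ: "P <= q" if "q \<in> Q" for q unfolding P_def by (rule cInf_lower[OF that Qb])
 have Pge: "crit - 3*eps <= P" unfolding P_def by (rule cInf_greatest) (use Qne low in "auto simp: Q_def")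
 have tail: "rsum W (%w. wq f (P - 1) w (pt s)) < \<infinity>" using Wfin by (simp add: nsum_finite)
 have "gibbs S E f A \<theta> B s W P 1"
 proof unfold_locales
  fix q assume "P < q"
  then obtain q' where "q' \<in> Q" "q' < q" using cInf_lessD[of Q q] Qne unfolding P_def by blast
  then show "Hs f W q (pt s) < \<infinity>" using Hs_antimono[of q' q f W "pt s"] by (auto simp: Q_def intro: le_less_trans)
 next
  show "Hs f W P (pt s) = \<infinity>"
  proof (rule ccontr)
   assume "Hs f W P (pt s) ~= \<infinity>"
   then have "Hs f W P (pt s) < \<infinity>" by (simp add: less_top)
   from Hs_finite_imp_below[OF sS WFR _ tail this] obtain q where "q < P" "Hs f W q (pt s) < \<infinity>" by auto
   then show False using PQ[of q] by (simp add: Q_def)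
  qed
 qed (use sS WFR Wne tail in auto)
 from gibbs_pressure[OF this] obtain \<mu> where mu: "\<mu> \<in> IM" "ereal P <= mpress \<mu> f" and
  G4: "ALL F r. finite F --> 0 <= r --> (ALL b:W. real (card {j. j < length b & b ! j \<in> F}) <= r * real (length b)) -->
   (SUM s:F. measure \<mu> (Cy [s])) <= r" by (elim bexE conjE)
 have "real (card {j. j < length b & b ! j \<in> F}) <= e * real (length b)" if b: "b \<in> W" for b
 proof -
  obtain w where w: "w \<in> W0" "b = w@\<gamma>" using b by (auto simp: W_def)
  have "{j. j < length b & b ! j \<in> F} <= insert 0 {length w..<length w+length \<gamma>}"
  proof
   fix j assume "j \<in> {j. j < length b & b ! j \<in> F}"
   then have j: "j < length w+length \<gamma>" "b ! j \<in> F" using w by auto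
   show "j \<in> insert 0 {length w..<length w+length \<gamma>}"
   proof (cases "j = 0 | length w <= j")
    case False
    then have "b ! j ~: F" using W0D(3)[OF w(1), of j] w(2) by (simp add: nth_append)
    with j show ?thesis by simp
   qed (use j in auto)
  qed
  then have "card {j. j < length b & b ! j \<in> F} <= card (insert 0 {length w..<length w+length \<gamma>})" by (intro card_mono) auto
  also have "... <= Suc (length \<gamma>)" using card_insert_le_m1[of "Suc (length \<gamma>)" "{length w..<length w+length \<gamma>}" 0] by simp
  finally have "real (card {j. j < length b & b ! j \<in> F}) <= 1+G" by (simp add: G_def)
  also have "... <= e * real n" by (rule nb(2))
  also have "... <= e * real (length b)" using e Wlen[OF b] by (intro mult_left_mono) (auto simp: m_def)
  finally show ?thesis .
 qed
 then have "(SUM s:F. measure \<mu> (Cy [s])) <= e" using G4 F(1) e by simp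
 moreover have "ereal (crit - e) <= mpress \<mu> f" by (rule order_trans[OF _ mu(2)]) (use Pge in "simp add: eps_def")
 ultimately show ?thesis using mu(1) by blast
qed

lemma not_SPR_P_inf:
 assumes "\<not> SPR S E f" shows "ereal crit <= P_inf S E f"
proof -
 obtain s0 where s0: "s0 \<in> S" using S_ne by blast
 \<comment> \<open>An exhaustion of the states; \<open>s0\<close> keeps every set nonempty.\<close>
 let ?F = "%k::nat. insert s0 (S Int {..k})"
 have "ALL k. EX \<mu>. \<mu> \<in> IM & ereal (crit - 1/real (Suc k)) <= mpress \<mu> f & (SUM s:?F k. measure \<mu> (Cy [s])) <= 1/real (Suc k)"
 proof
  fix k show "EX \<mu>. \<mu> \<in> IM & ereal (crit - 1/real (Suc k)) <= mpress \<mu> f & (SUM s:?F k. measure \<mu> (Cy [s])) <= 1/real (Suc k)"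
   using escape[OF assms, of "?F k" "1/real (Suc k)"] s0 by auto
 qed
 then obtain \<mu>s where ms: "!!k. \<mu>s k \<in> IM" "!!k. ereal (crit - 1/real (Suc k)) <= mpress (\<mu>s k) f"
  "!!k. (SUM s:?F k. measure (\<mu>s k) (Cy [s])) <= 1/real (Suc k)" by metis
 have inv0: "(%k. 1/real (Suc k)) \<longlonglongrightarrow> 0" using LIMSEQ_inverse_real_of_nat by (simp add: inverse_eq_divide)
 have cyl0: "(%n. measure (\<mu>s n) (Cy w)) \<longlonglongrightarrow> 0" if w: "length w >= 1" for w
 proof (rule tendsto_sandwich[OF _ _ tendsto_const inv0])
  show "eventually (%n. measure (\<mu>s n) (Cy w) <= 1/real (Suc n)) sequentially"
   unfolding eventually_sequentially
  proof (intro exI[of _ "w ! 0"] allI impI)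
   fix n assume n: "w ! 0 <= n"
   interpret inv_meas S E "\<mu>s n" by (intro inv_meas.intro inv_meas_axioms.intro tms_axioms ms)
   show "measure (\<mu>s n) (Cy w) <= 1/real (Suc n)"
   proof (cases "w ! 0 \<in> S")
    case True
    have "0 < length w" using w by linarith
    then have "Cy w <= Cy [w ! 0]" unfolding cyl_def by auto
    then have "measure (\<mu>s n) (Cy w) <= measure (\<mu>s n) (Cy [w ! 0])" by (intro finite_measure_mono) auto
    also have "... <= (SUM s:?F n. measure (\<mu>s n) (Cy [s]))" by (rule member_le_sum) (use True n in auto)
    also have "... <= 1/real (Suc n)" by (rule ms)
    finally show ?thesis .
   next
    case False
    have "Cy w = {}"
    proof (rule equals0I)
     fix x assume "x \<in> Cy w"
     moreover have "0 < length w" using w by linarith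
     ultimately have "x 0 = w ! 0" "x 0 \<in> S" unfolding cyl_def Sigma_plus_def by blast+
     with False show False by simp
    qed
    then show ?thesis by simp
   qed
  qed
 qed simp
 have "(%k. ereal (crit - 1/real (Suc k))) \<longlonglongrightarrow> ereal (crit - 0)" unfolding lim_ereal by (intro tendsto_diff tendsto_const inv0)
 then have "limsup (%k. ereal (crit - 1/real (Suc k))) = ereal crit" by (intro lim_imp_Limsup) auto
 then have "ereal crit <= limsup (%k. mpress (\<mu>s k) f)" using Limsup_mono[of "%k. ereal (crit - 1/real (Suc k))" "%k. mpress (\<mu>s k) f" sequentially] ms(2) by simp
 also have "... <= P_inf S E f" unfolding P_inf_def by (rule SUP_upper) (use ms(1) cyl0 pressure_defined_inv in auto)
 finally show ?thesis .
qed

lemma equivalences: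
 shows "SPR S E f \<longleftrightarrow> EKP S E \<theta> f" "SPR S E f \<longleftrightarrow> P_inf S E f < gur_pressure S E f"
 using SPR_imp_EKP EKP_imp_P_inf not_SPR_P_inf unfolding gur_pressure_eq[OF gr_ex] by (meson not_le)+

end

theorem theorem8p4:
  fixes S :: "nat set" and E :: "nat \<Rightarrow> nat \<Rightarrow> bool" and \<theta> :: real
    and \<phi> :: "(nat \<Rightarrow> nat) \<Rightarrow> real"
  assumes "S \<noteq> {}"
    and "top_transitive S E"
    and "gur_pressure S E (\<lambda>_. 0) < \<infinity>"
    and "0 < \<theta>" and "\<theta> < 1"
    and "weakly_holder S E \<theta> \<phi>"
    and "\<exists>B. \<forall>x\<in>Sigma_plus S E. \<phi> x \<le> B"
  shows "(SPR S E \<phi> \<longleftrightarrow> EKP S E \<theta> \<phi>) \<and> (SPR S E \<phi> \<longleftrightarrow> P_inf S E \<phi> < gur_pressure S E \<phi>)"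
proof -
 obtain A where A: "!!n x y. n >= 2 ==> x \<in> Sigma_plus S E ==> y \<in> Sigma_plus S E ==> ALL i<n. x i = y i ==> \<bar>\<phi> x - \<phi> y\<bar> <= A*\<theta>^n"
  using assms(6) unfolding weakly_holder_def by blast
 obtain B where B: "!!x. x \<in> Sigma_plus S E ==> \<phi> x <= B" using assms(7) by blast
 interpret Z: pot S E "%_. 0" 0 \<theta> 0 by unfold_locales (use assms in auto)
 obtain q0 where q0: "Z.gr q0" using Z.gur_pressure_finite_imp[OF assms(3)] by blast
 \<comment> \<open>The constant in \<open>weakly_holder\<close> may be negative when no two distinct
   points share two coordinates; its absolute value is an admissible choice.\<close>
 interpret potz S E \<phi> "\<bar>A\<bar>" \<theta> B q0
 proof unfold_locales
  fix n :: nat and x y assume "2 <= n" "x \<in> Sigma_plus S E" "y \<in> Sigma_plus S E" "ALL i<n. x i = y i"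
  then have "\<bar>\<phi> x - \<phi> y\<bar> <= A*\<theta>^n" by (rule A)
  also have "... <= \<bar>A\<bar>*\<theta>^n" using assms(4) by (intro mult_right_mono) auto
  finally show "\<bar>\<phi> x - \<phi> y\<bar> <= \<bar>A\<bar>*\<theta>^n" .
 qed (use B q0 assms in auto)
 show ?thesis using equivalences by blast
qed

end
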